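(* Let $k$ be a field, let $B$ be a Hopf algebra over $k$ with an invertible antipode and let $X$ be a stable anti-Yetter-Drinfeld (SaYD) module over $B$. Let $C$ be a counital left $B$-module coalgebra and let $0\to K\to C\to C/K\to 0$ be a short exact sequence of H-counital $B$-module coalgebras. Assume that both $C$ and $C/K$ are projective as $B$-modules and that $X$ has finite projective dimension as a $B$-module. Then $$\mathbb{CM}^c_*(K,B,X)\to\mathbb{CM}^c_*(C,B,X)\to\mathbb{CM}^c_*(C/K,B,X)$$ is a homotopy cofibration sequence; that is, there are connecting morphisms $\delta_n$ which together with the induced maps give a long exact sequence $$\cdots\to H_{n-1}(\mathbb{CM}^c_*(C/K,B,X))\xrightarrow{\delta_{n-1}}H_n(\mathbb{CM}^c_*(K,B,X))\to H_n(\mathbb{CM}^c_*(C,B,X))\to H_n(\mathbb{CM}^c_*(C/K,B,X))\xrightarrow{\delta_n}\cdots$$ where $H_n$ denotes the cyclic homology of the indicated cocyclic modules.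
   Context: $\otimes=\otimes_k$. Coalgebras are coassociative but not necessarily counital; Sweedler notation $\Delta(c)=c_{(1)}\otimes c_{(2)}$, and $x\mapsto x_{(-1)}\otimes x_{(0)}$ for left comodules. A left $B$-module coalgebra is a coalgebra $C$ which is a left $B$-module with $\Delta(bc)=b_{(1)}c_{(1)}\otimes b_{(2)}c_{(2)}$. A short exact sequence $0\to K\to C\to C/K\to 0$ of $B$-module coalgebras means $K\subseteq C$ is a $B$-submodule with $\Delta(K)\subseteq K\otimes K$, and $C/K$ is the quotient $B$-module coalgebra. H-counital: for a coalgebra $C$ the bar complex has $\mathrm{CB}_n(C)=C^{\otimes n+1}$, $n\ge0$, with differential $\mathrm{CB}_n(C)\to\mathrm{CB}_{n+1}(C)$ given by $\sum_{j=0}^{n}(-1)^j\,id^{\otimes j}\otimes\Delta\otimes id^{\otimes n-j}$. $C$ is H-counital if this complex is acyclic (homology zero in every degree $n\ge 0$). SaYD module: $X$ is a left $B$-module and left $B$-comodule with $(bx)_{(-1)}\otimes(bx)_{(0)}=b_{(1)}x_{(-1)}S^{-1}(b_{(3)})\otimes b_{(2)}x_{(0)}$ (anti-Yetter-Drinfeld) and $x_{(-1)}x_{(0)}=x$ (stable) for all $b\in B,x\in X$. The cocyclic module: let $B$ act on $X\otimes C^{\otimes n+1}$ by $L_b(x\otimes c^0\otimes\cdots\otimes c^n)=b_{(n+2)}x\otimes b_{(1)}c^0\otimes\cdots\otimes b_{(n+1)}c^n$, and put $\mathbb{CM}^c_n(C,B,X)=k\otimes_B(X\otimes C^{\otimes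 n+1})$, with $k$ the trivial right $B$-module (via $\varepsilon$). The cofaces $\partial_j$, $0\le j\le n+1$, are induced by $\partial_j(x\otimes c^0\otimes\cdots\otimes c^n)=x\otimes c^0\otimes\cdots\otimes c^j_{(1)}\otimes c^j_{(2)}\otimes\cdots\otimes c^n$ for $0\le j\le n$ and $\partial_{n+1}(x\otimes c^0\otimes\cdots\otimes c^n)=x_{(0)}\otimes c^0_{(2)}\otimes c^1\otimes\cdots\otimes c^n\otimes x_{(-1)}c^0_{(1)}$; the cyclic operator is induced by $\tau_n(x\otimes c^0\otimes\cdots\otimes c^n)=x_{(0)}\otimes c^1\otimes\cdots\otimes c^n\otimes x_{(-1)}c^0$. These are well defined on $\mathbb{CM}^c_*$ because $X$ is SaYD. (If $C$ is not counital, there are no codegeneracies, and only cofaces and cyclic operators are used.) The cyclic homology $H_n$ of such an object is the degree-$n$ cohomology of the total complex of the bicomplex with columns $p\ge0$: even columns are the Hochschild complex with differential $d=\sum_{j=0}^{n+1}(-1)^j\partial_j$, odd columns are the bar complex with differential $-d'$, $d'=\sum_{j=0}^{n}(-1)^j\partial_j$, and the horizontal maps from even to odd columns are $1-(-1)^n\tau_n$ and from odd to even columns are $\sum_{i=0}^{n}((-1)^n\tau_n)^i$. *)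

theory Defs
  imports Complex_Main "HOL-Library.Poly_Mapping" "HOL-Library.Function_Algebras"
begin

section \<open>Free modules and tensor products\<close>

text \<open>
  The type \<open>'i \<Rightarrow>\<^sub>0 'r\<close> is the free \<open>'r\<close>-module on \<open>'i\<close>; all vector spaces are types of class
  \<open>ab_group_add\<close> with an explicit scalar multiplication by the field \<open>'k\<close>.
  A tensor product is the quotient of the free vector space on tuples (or lists) by the subspace
  spanned by the multilinearity relations.  An element of a tensor product is represented by a
  formal sum of tuples, and equality in the tensor product is congruence modulo that subspace.
  In particular a comultiplication is given by choosing, for each \<open>c\<close>, a formal sum
  representing \<open>c\<^sub>(\<^sub>1\<^sub>) \<otimes> c\<^sub>(\<^sub>2\<^sub>)\<close>.
\<close>

definition fscale :: "'r::ring_1 \<Rightarrow> ('i \<Rightarrow>\<^sub>0 'r) \<Rightarrow> ('i \<Rightarrow>\<^sub>0 'r)"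
  where "fscale a u = Poly_Mapping.map ((*) a) u"

abbreviation gen :: "'i \<Rightarrow> ('i \<Rightarrow>\<^sub>0 'k::field)"
  where "gen i \<equiv> Poly_Mapping.single i 1"

abbreviation fspan :: "('i \<Rightarrow>\<^sub>0 'k::field) set \<Rightarrow> ('i \<Rightarrow>\<^sub>0 'k) set"
  where "fspan \<equiv> module.span fscale"

lemma lookup_fscale: "Poly_Mapping.lookup (fscale a u) i = a * Poly_Mapping.lookup u i"
  by (simp add: fscale_def Poly_Mapping.map.rep_eq when_def)

lemma vector_space_fscale: "vector_space (fscale :: 'k::field \<Rightarrow> ('i \<Rightarrow>\<^sub>0 'k) \<Rightarrow> _)"
  by unfold_locales (auto intro!: poly_mapping_eqI simp: lookup_fscale lookup_add algebra_simps)

text \<open>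
  Linear extension of \<open>f\<close>.  With \<open>u\<close> representing \<open>c\<^sub>(\<^sub>1\<^sub>) \<otimes> c\<^sub>(\<^sub>2\<^sub>)\<close>, the term
  \<open>u \<bind> (\<lambda>(c1, c2). f c1 c2)\<close> is the Sweedler sum usually written \<open>f c\<^sub>(\<^sub>1\<^sub>) c\<^sub>(\<^sub>2\<^sub>)\<close>.
\<close>

definition lin_ext :: "('k::field \<Rightarrow> 'v::ab_group_add \<Rightarrow> 'v) \<Rightarrow> ('i \<Rightarrow>\<^sub>0 'k) \<Rightarrow> ('i \<Rightarrow> 'v) \<Rightarrow> 'v"
  where "lin_ext s u f = (\<Sum>i\<in>Poly_Mapping.keys u. s (Poly_Mapping.lookup u i) (f i))"

definition fbind :: "('i \<Rightarrow>\<^sub>0 'k::field) \<Rightarrow> ('i \<Rightarrow> ('j \<Rightarrow>\<^sub>0 'k)) \<Rightarrow> ('j \<Rightarrow>\<^sub>0 'k)" (infixl "\<bind>" 54)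
  where "u \<bind> f = lin_ext fscale u f"

abbreviation cong_modulo :: "'v::ab_group_add \<Rightarrow> 'v set \<Rightarrow> 'v \<Rightarrow> bool" ("(_ \<approx>\<^bsub>_\<^esub> _)" [51, 0, 51] 50)
  where "u \<approx>\<^bsub>W\<^esub> v \<equiv> u - v \<in> W"

text \<open>
  An element of \<open>G\<close> is a function placing a vector into one slot of a tuple whose other
  entries are fixed; the relations say that the tensor is linear in that slot.
\<close>

definition slot_rels :: "('k::field \<Rightarrow> 'v::ab_group_add \<Rightarrow> 'v) \<Rightarrow> ('v \<Rightarrow> 'i) set \<Rightarrow> ('i \<Rightarrow>\<^sub>0 'k) set"
  where "slot_rels s G =
    {gen (g (u + v)) - (gen (g u) + gen (g v)) | g u v. g \<in> G} \<union>
    {gen (g (s a v)) - fscale a (gen (g v)) | g a v. g \<in> G}"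

definition tensor2 where
  "tensor2 s1 s2 = fspan
     (slot_rels s1 {\<lambda>u. (u, v) | v. True} \<union> slot_rels s2 {\<lambda>v. (u, v) | u. True})"

definition tensor3 where
  "tensor3 s1 s2 s3 = fspan
     (slot_rels s1 {\<lambda>u. (u, v, w) | v w. True} \<union> slot_rels s2 {\<lambda>v. (u, v, w) | u w. True} \<union>
      slot_rels s3 {\<lambda>w. (u, v, w) | u v. True})"

text \<open>
  \<open>C\<^sup>\<otimes>\<^sup>n\<^sup>+\<^sup>1\<close> is presented by lists of length \<open>n + 1\<close>, and \<open>X \<otimes> C\<^sup>\<otimes>\<^sup>n\<^sup>+\<^sup>1\<close> by pairs \<open>(x, cs)\<close> with
  \<open>length cs = n + 1\<close>.
\<close>

definition power_rels :: "('k::field \<Rightarrow> 'c::ab_group_add \<Rightarrow> 'c) \<Rightarrow> nat \<Rightarrow> ('c list \<Rightarrow>\<^sub>0 'k) set"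
  where "power_rels sC n = slot_rels sC {\<lambda>c. cs @ c # ds | cs ds. length cs + length ds = n}"

definition coeff_power_rels ::
  "('k::field \<Rightarrow> 'x::ab_group_add \<Rightarrow> 'x) \<Rightarrow> ('k \<Rightarrow> 'c::ab_group_add \<Rightarrow> 'c) \<Rightarrow> nat \<Rightarrow> ('x \<times> 'c list \<Rightarrow>\<^sub>0 'k) set"
  where "coeff_power_rels sX sC n =
    slot_rels sX {\<lambda>x. (x, cs) | cs. length cs = Suc n} \<union>
    slot_rels sC {\<lambda>c. (x, cs @ c # ds) | x cs ds. length cs + length ds = n}"


section \<open>Coalgebras, Hopf algebras, modules and comodules\<close>

locale coalgebra = vector_space scale
  for scale :: "'k::field \<Rightarrow> 'c::ab_group_add \<Rightarrow> 'c" +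
  fixes \<Delta> :: "'c \<Rightarrow> ('c \<times> 'c \<Rightarrow>\<^sub>0 'k)"
  assumes comult_add: "\<Delta> (c + d) \<approx>\<^bsub>tensor2 scale scale\<^esub> \<Delta> c + \<Delta> d"
    and comult_scale: "\<Delta> (scale a c) \<approx>\<^bsub>tensor2 scale scale\<^esub> fscale a (\<Delta> c)"
    and coassoc: "(\<Delta> c \<bind> (\<lambda>(c1, c2). \<Delta> c1 \<bind> (\<lambda>(c11, c12). gen (c11, c12, c2))))
        \<approx>\<^bsub>tensor3 scale scale scale\<^esub> (\<Delta> c \<bind> (\<lambda>(c1, c2). \<Delta> c2 \<bind> (\<lambda>(c21, c22). gen (c1, c21, c22))))"

definition is_counit ::
  "('k::field \<Rightarrow> 'c::ab_group_add \<Rightarrow> 'c) \<Rightarrow> ('c \<Rightarrow> ('c \<times> 'c \<Rightarrow>\<^sub>0 'k)) \<Rightarrow> ('c \<Rightarrow> 'k) \<Rightarrow> bool"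
  where "is_counit sC \<Delta> \<epsilon> \<longleftrightarrow> Vector_Spaces.linear sC (*) \<epsilon> \<and>
    (\<forall>c. lin_ext sC (\<Delta> c) (\<lambda>(c1, c2). sC (\<epsilon> c1) c2) = c \<and>
         lin_ext sC (\<Delta> c) (\<lambda>(c1, c2). sC (\<epsilon> c2) c1) = c)"

definition counital :: "('k::field \<Rightarrow> 'c::ab_group_add \<Rightarrow> 'c) \<Rightarrow> ('c \<Rightarrow> ('c \<times> 'c \<Rightarrow>\<^sub>0 'k)) \<Rightarrow> bool"
  where "counital sC \<Delta> \<longleftrightarrow> (\<exists>\<epsilon>. is_counit sC \<Delta> \<epsilon>)"

locale hopf_algebra = coalgebra scale \<Delta>
  for scale :: "'k::field \<Rightarrow> 'b::ring_1 \<Rightarrow> 'b" and \<Delta> :: "'b \<Rightarrow> ('b \<times> 'b \<Rightarrow>\<^sub>0 'k)" +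
  fixes \<epsilon> :: "'b \<Rightarrow> 'k" and S :: "'b \<Rightarrow> 'b"
  assumes scale_mult_left: "scale a x * y = scale a (x * y)"
    and scale_mult_right: "x * scale a y = scale a (x * y)"
    and counit: "is_counit scale \<Delta> \<epsilon>"
    and comult_one: "\<Delta> 1 \<approx>\<^bsub>tensor2 scale scale\<^esub> gen (1, 1)"
    and comult_mult: "\<Delta> (x * y) \<approx>\<^bsub>tensor2 scale scale\<^esub>
          (\<Delta> x \<bind> (\<lambda>(x1, x2). \<Delta> y \<bind> (\<lambda>(y1, y2). gen (x1 * y1, x2 * y2))))"
    and counit_one: "\<epsilon> 1 = 1"
    and counit_mult: "\<epsilon> (x * y) = \<epsilon> x * \<epsilon> y"
    and antipode_linear: "Vector_Spaces.linear scale scale S"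
    and antipode_left: "lin_ext scale (\<Delta> x) (\<lambda>(x1, x2). S x1 * x2) = scale (\<epsilon> x) 1"
    and antipode_right: "lin_ext scale (\<Delta> x) (\<lambda>(x1, x2). x1 * S x2) = scale (\<epsilon> x) 1"

locale alg_module = vector_space sM
  for sB :: "'k::field \<Rightarrow> 'b::ring_1 \<Rightarrow> 'b" and sM :: "'k \<Rightarrow> 'm::ab_group_add \<Rightarrow> 'm" +
  fixes act :: "'b \<Rightarrow> 'm \<Rightarrow> 'm"
  assumes act_add_right: "act b (m + n) = act b m + act b n"
    and act_add_left: "act (b + c) m = act b m + act c m"
    and act_scale_right: "act b (sM a m) = sM a (act b m)"
    and act_scale_left: "act (sB a b) m = sM a (act b m)"
    and act_one: "act 1 m = m"
    and act_mult: "act (b * c) m = act b (act c m)"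

text \<open>
  If \<open>C\<close> has a counit, it is automatically \<open>B\<close>-linear because \<open>B\<close> has an antipode, so no
  compatibility of the action with a counit of \<open>C\<close> is imposed.
\<close>

locale module_coalgebra =
  B: hopf_algebra sB \<Delta>B \<epsilon> S + alg_module sB sC act + coalgebra sC \<Delta>
  for sB :: "'k::field \<Rightarrow> 'b::ring_1 \<Rightarrow> 'b" and \<Delta>B \<epsilon> S
    and sC :: "'k \<Rightarrow> 'c::ab_group_add \<Rightarrow> 'c" and act :: "'b \<Rightarrow> 'c \<Rightarrow> 'c" and \<Delta> +
  assumes comult_act: "\<Delta> (act b c) \<approx>\<^bsub>tensor2 sC sC\<^esub>
    (\<Delta>B b \<bind> (\<lambda>(b1, b2). \<Delta> c \<bind> (\<lambda>(c1, c2). gen (act b1 c1, act b2 c2))))"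

definition module_coalgebra_hom where
  "module_coalgebra_hom sC actC \<Delta>C sD actD \<Delta>D f \<longleftrightarrow>
     Vector_Spaces.linear sC sD f \<and> (\<forall>b c. f (actC b c) = actD b (f c)) \<and>
     (\<forall>c. (\<Delta>C c \<bind> (\<lambda>(c1, c2). gen (f c1, f c2))) \<approx>\<^bsub>tensor2 sD sD\<^esub> \<Delta>D (f c))"

locale sayd_module =
  B: hopf_algebra sB \<Delta>B \<epsilon> S + alg_module sB sX act
  for sB :: "'k::field \<Rightarrow> 'b::ring_1 \<Rightarrow> 'b" and \<Delta>B \<epsilon> S
    and sX :: "'k \<Rightarrow> 'x::ab_group_add \<Rightarrow> 'x" and act :: "'b \<Rightarrow> 'x \<Rightarrow> 'x" +
  fixes \<rho> :: "'x \<Rightarrow> ('b \<times> 'x \<Rightarrow>\<^sub>0 'k)"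
  assumes coact_add: "\<rho> (x + y) \<approx>\<^bsub>tensor2 sB sX\<^esub> \<rho> x + \<rho> y"
    and coact_scale: "\<rho> (sX a x) \<approx>\<^bsub>tensor2 sB sX\<^esub> fscale a (\<rho> x)"
    and coact_coassoc: "(\<rho> x \<bind> (\<lambda>(h, x0). \<Delta>B h \<bind> (\<lambda>(h1, h2). gen (h1, h2, x0))))
          \<approx>\<^bsub>tensor3 sB sB sX\<^esub> (\<rho> x \<bind> (\<lambda>(h, x0). \<rho> x0 \<bind> (\<lambda>(h', x00). gen (h, h', x00))))"
    and coact_counit: "lin_ext sX (\<rho> x) (\<lambda>(h, x0). sX (\<epsilon> h) x0) = x"
    and anti_yetter_drinfeld: "\<rho> (act b x) \<approx>\<^bsub>tensor2 sB sX\<^esub>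
          (\<Delta>B b \<bind> (\<lambda>(b1, b'). \<Delta>B b' \<bind> (\<lambda>(b2, b3).
             \<rho> x \<bind> (\<lambda>(h, x0). gen (b1 * h * inv S b3, act b2 x0)))))"
    and stable: "lin_ext sX (\<rho> x) (\<lambda>(h, x0). act h x0) = x"


section \<open>Projective modules and projective dimension\<close>

definition ring_module_on :: "'p::ab_group_add set \<Rightarrow> ('b::ring_1 \<Rightarrow> 'p \<Rightarrow> 'p) \<Rightarrow> bool" where
  "ring_module_on P act \<longleftrightarrow>
     0 \<in> P \<and> (\<forall>p\<in>P. \<forall>q\<in>P. p + q \<in> P) \<and> (\<forall>p\<in>P. - p \<in> P) \<and> (\<forall>b. \<forall>p\<in>P. act b p \<in> P) \<and>
     (\<forall>b. \<forall>p\<in>P. \<forall>q\<in>P. act b (p + q) = act b p + act b q) \<and>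
     (\<forall>b c. \<forall>p\<in>P. act (b + c) p = act b p + act c p) \<and>
     (\<forall>b c. \<forall>p\<in>P. act (b * c) p = act b (act c p)) \<and> (\<forall>p\<in>P. act 1 p = p)"

definition module_hom_on where
  "module_hom_on P actP Q actQ f \<longleftrightarrow>
     f ` P \<subseteq> Q \<and> (\<forall>p\<in>P. \<forall>q\<in>P. f (p + q) = f p + f q) \<and> (\<forall>b. \<forall>p\<in>P. f (actP b p) = actQ b (f p))"

text \<open>
  Projective means: direct summand of a free module.  A projective \<open>P\<close> is always a direct summand
  of the free module on its own elements, so a free module with basis the type of \<open>P\<close> is enough.
\<close>

definition projective_on :: "'p::ab_group_add set \<Rightarrow> ('b::ring_1 \<Rightarrow> 'p \<Rightarrow> 'p) \<Rightarrow> bool" where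
  "projective_on P act \<longleftrightarrow> ring_module_on P act \<and>
     (\<exists>(i :: 'p \<Rightarrow> ('p \<Rightarrow>\<^sub>0 'b)) (r :: ('p \<Rightarrow>\<^sub>0 'b) \<Rightarrow> 'p).
        module_hom_on P act UNIV fscale i \<and> module_hom_on UNIV fscale P act r \<and> (\<forall>p\<in>P. r (i p) = p))"

text \<open>
  The module \<open>X\<close>, a whole type, has a finite projective resolution
  \<open>0 \<rightarrow> P\<^sub>m \<rightarrow> \<dots> \<rightarrow> P\<^sub>0 \<rightarrow> X \<rightarrow> 0\<close> whose terms have carriers in the type \<open>'p\<close>.
  HOL cannot quantify over types inside a formula; the type is an argument, and a theorem assuming this
  predicate for a type variable \<open>'p\<close> covers resolutions in every type.  Each term has its own action.
\<close>

definition finite_projective_dimension ::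
  "'p::ab_group_add itself \<Rightarrow> ('b::ring_1 \<Rightarrow> 'x::ab_group_add \<Rightarrow> 'x) \<Rightarrow> bool" where
  "finite_projective_dimension T actX \<longleftrightarrow>
     (\<exists>m (P :: nat \<Rightarrow> 'p set) act (d :: nat \<Rightarrow> 'p \<Rightarrow> 'p) e.
        (\<forall>i. projective_on (P i) (act i)) \<and> (\<forall>i>m. P i = {0}) \<and>
        module_hom_on (P 0) (act 0) UNIV actX e \<and> e ` P 0 = UNIV \<and>
        (\<forall>i. module_hom_on (P (Suc i)) (act (Suc i)) (P i) (act i) (d i)) \<and>
        d 0 ` P 1 = {p \<in> P 0. e p = 0} \<and>
        (\<forall>i. d (Suc i) ` P (Suc (Suc i)) = {p \<in> P (Suc i). d i p = 0}))"


section \<open>Quotient spaces and cohomology\<close>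

text \<open>
  A cochain complex is presented by subspaces \<open>W n \<subseteq> V n\<close> and a differential \<open>d n\<close> mapping \<open>V n\<close> to
  \<open>V (n + 1)\<close> and \<open>W n\<close> to \<open>W (n + 1)\<close>; it stands for the complex \<open>V n / W n\<close>.  Its cohomology is
  written as a subquotient of \<open>V n\<close>.
\<close>

definition coset :: "'v::ab_group_add set \<Rightarrow> 'v \<Rightarrow> 'v set"
  where "coset W v = {v + w | w. w \<in> W}"

definition cocycles :: "(nat \<Rightarrow> 'v::ab_group_add set) \<Rightarrow> (nat \<Rightarrow> 'v set) \<Rightarrow> (nat \<Rightarrow> 'v \<Rightarrow> 'v) \<Rightarrow> nat \<Rightarrow> 'v set"
  where "cocycles V W d n = {u \<in> V n. d n u \<in> W (Suc n)}"

definition coboundaries :: "(nat \<Rightarrow> 'v::ab_group_add set) \<Rightarrow> (nat \<Rightarrow> 'v set) \<Rightarrow> (nat \<Rightarrow> 'v \<Rightarrow> 'v) \<Rightarrow> nat \<Rightarrow> 'v set"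
  where "coboundaries V W d n =
    (case n of 0 \<Rightarrow> W 0 | Suc m \<Rightarrow> {d m v + w | v w. v \<in> V m \<and> w \<in> W (Suc m)})"

definition cohomology :: "(nat \<Rightarrow> 'v::ab_group_add set) \<Rightarrow> (nat \<Rightarrow> 'v set) \<Rightarrow> (nat \<Rightarrow> 'v \<Rightarrow> 'v) \<Rightarrow> nat \<Rightarrow> 'v set set"
  where "cohomology V W d n = coset (coboundaries V W d n) ` cocycles V W d n"

definition acyclic_complex :: "(nat \<Rightarrow> 'v::ab_group_add set) \<Rightarrow> (nat \<Rightarrow> 'v set) \<Rightarrow> (nat \<Rightarrow> 'v \<Rightarrow> 'v) \<Rightarrow> bool"
  where "acyclic_complex V W d \<longleftrightarrow> (\<forall>n. cohomology V W d n = {coboundaries V W d n})"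

text \<open>
  Linearity of a map \<open>f\<close> from \<open>V / W\<close> to \<open>V' / W'\<close>, both given as sets of cosets.
\<close>

definition quotient_linear ::
  "('k \<Rightarrow> 'v::ab_group_add \<Rightarrow> 'v) \<Rightarrow> 'v set \<Rightarrow> 'v set \<Rightarrow> ('k \<Rightarrow> 'w::ab_group_add \<Rightarrow> 'w) \<Rightarrow> 'w set \<Rightarrow> 'w set
   \<Rightarrow> ('v set \<Rightarrow> 'w set) \<Rightarrow> bool"
  where "quotient_linear s V W s' V' W' f \<longleftrightarrow>
    (\<forall>u\<in>V. f (coset W u) \<in> coset W' ` V') \<and>
    (\<forall>u\<in>V. \<forall>v\<in>V. \<forall>u'\<in>V'. \<forall>v'\<in>V'. f (coset W u) = coset W' u' \<longrightarrow> f (coset W v) = coset W' v' \<longrightarrow>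
        f (coset W (u + v)) = coset W' (u' + v')) \<and>
    (\<forall>a. \<forall>u\<in>V. \<forall>u'\<in>V'. f (coset W u) = coset W' u' \<longrightarrow> f (coset W (s a u)) = coset W' (s' a u'))"

text \<open>
  If \<open>f\<close> is linear and respects the relations, this is the map of quotients induced by \<open>f\<close>, as the
  image of a coset under \<open>f\<close> then lies in a single coset of \<open>W'\<close>.
\<close>

definition induced :: "'w::ab_group_add set \<Rightarrow> ('v \<Rightarrow> 'w) \<Rightarrow> 'v set \<Rightarrow> 'w set"
  where "induced W' f A = {f a + w | a w. a \<in> A \<and> w \<in> W'}"

definition alt :: "nat \<Rightarrow> 'v::ab_group_add \<Rightarrow> 'v"
  where "alt j u = (if even j then u else - u)"

definition comult_at :: "('c \<Rightarrow> ('c \<times> 'c \<Rightarrow>\<^sub>0 'k::field)) \<Rightarrow> nat \<Rightarrow> 'c list \<Rightarrow> ('c list \<Rightarrow>\<^sub>0 'k)"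
  where "comult_at \<Delta> j cs = (\<Delta> (cs ! j) \<bind> (\<lambda>(c1, c2). gen (take j cs @ [c1, c2] @ drop (Suc j) cs)))"

definition H_counital :: "('k::field \<Rightarrow> 'c::ab_group_add \<Rightarrow> 'c) \<Rightarrow> ('c \<Rightarrow> ('c \<times> 'c \<Rightarrow>\<^sub>0 'k)) \<Rightarrow> bool"
  where "H_counital sC \<Delta> \<longleftrightarrow> acyclic_complex
    (\<lambda>n. {u. \<forall>cs\<in>Poly_Mapping.keys u. length cs = Suc n})
    (\<lambda>n. fspan (power_rels sC n))
    (\<lambda>n u. u \<bind> (\<lambda>cs. \<Sum>j\<le>n. alt j (comult_at \<Delta> j cs)))"


section \<open>Cyclic homology of cocyclic modules without codegeneracies\<close>

text \<open>
  Again presented: the degree \<open>n\<close> space is \<open>chains n / rels n\<close>, and cofaces and cyclic operators are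
  linear maps on \<open>chains\<close> inducing the operators of the cocyclic module.
\<close>

record 'v cocyclic =
  chains :: "nat \<Rightarrow> 'v set"
  rels :: "nat \<Rightarrow> 'v set"
  coface :: "nat \<Rightarrow> nat \<Rightarrow> 'v \<Rightarrow> 'v"
  cyc :: "nat \<Rightarrow> 'v \<Rightarrow> 'v"

definition hoch_diff :: "('i \<Rightarrow>\<^sub>0 'k::field) cocyclic \<Rightarrow> nat \<Rightarrow> ('i \<Rightarrow>\<^sub>0 'k) \<Rightarrow> ('i \<Rightarrow>\<^sub>0 'k)"
  where "hoch_diff M n u = (\<Sum>j\<le>Suc n. alt j (coface M n j u))"

definition bar_diff :: "('i \<Rightarrow>\<^sub>0 'k::field) cocyclic \<Rightarrow> nat \<Rightarrow> ('i \<Rightarrow>\<^sub>0 'k) \<Rightarrow> ('i \<Rightarrow>\<^sub>0 'k)"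
  where "bar_diff M n u = (\<Sum>j\<le>n. alt j (coface M n j u))"

definition signed_cyc :: "('i \<Rightarrow>\<^sub>0 'k::field) cocyclic \<Rightarrow> nat \<Rightarrow> ('i \<Rightarrow>\<^sub>0 'k) \<Rightarrow> ('i \<Rightarrow>\<^sub>0 'k)"
  where "signed_cyc M n u = alt n (cyc M n u)"

text \<open>In the bicomplex, \<open>p\<close> is the column and \<open>q\<close> the cosimplicial degree.\<close>

definition vert :: "('i \<Rightarrow>\<^sub>0 'k::field) cocyclic \<Rightarrow> nat \<Rightarrow> nat \<Rightarrow> ('i \<Rightarrow>\<^sub>0 'k) \<Rightarrow> ('i \<Rightarrow>\<^sub>0 'k)"
  where "vert M p q u = (if even p then hoch_diff M q u else - bar_diff M q u)"

definition horiz :: "('i \<Rightarrow>\<^sub>0 'k::field) cocyclic \<Rightarrow> nat \<Rightarrow> nat \<Rightarrow> ('i \<Rightarrow>\<^sub>0 'k) \<Rightarrow> ('i \<Rightarrow>\<^sub>0 'k)"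
  where "horiz M p q u =
    (if even p then u - signed_cyc M q u else (\<Sum>i\<le>q. (signed_cyc M q ^^ i) u))"

text \<open>
  A total cochain of degree \<open>n\<close> is a family \<open>w\<close> whose component \<open>w p\<close> has bidegree \<open>(p, n - p)\<close> for
  \<open>p \<le> n\<close> and vanishes for \<open>p > n\<close>.
\<close>

definition tot_space :: "(nat \<Rightarrow> ('i \<Rightarrow>\<^sub>0 'k::field) set) \<Rightarrow> nat \<Rightarrow> (nat \<Rightarrow> ('i \<Rightarrow>\<^sub>0 'k)) set"
  where "tot_space V n = {w. (\<forall>p\<le>n. w p \<in> V (n - p)) \<and> (\<forall>p>n. w p = 0)}"

definition tot_diff :: "('i \<Rightarrow>\<^sub>0 'k::field) cocyclic \<Rightarrow> nat \<Rightarrow> (nat \<Rightarrow> ('i \<Rightarrow>\<^sub>0 'k)) \<Rightarrow> (nat \<Rightarrow> ('i \<Rightarrow>\<^sub>0 'k))"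
  where "tot_diff M n w p =
    (if p \<le> n then vert M p (n - p) (w p) else 0) +
    (if 1 \<le> p \<and> p \<le> Suc n then horiz M (p - 1) (n - (p - 1)) (w (p - 1)) else 0)"

definition tot_scale :: "'k::field \<Rightarrow> (nat \<Rightarrow> ('i \<Rightarrow>\<^sub>0 'k)) \<Rightarrow> (nat \<Rightarrow> ('i \<Rightarrow>\<^sub>0 'k))"
  where "tot_scale a w = (\<lambda>p. fscale a (w p))"

definition cyclic_cocycles :: "('i \<Rightarrow>\<^sub>0 'k::field) cocyclic \<Rightarrow> nat \<Rightarrow> (nat \<Rightarrow> ('i \<Rightarrow>\<^sub>0 'k)) set"
  where "cyclic_cocycles M = cocycles (tot_space (chains M)) (tot_space (rels M)) (tot_diff M)"

text \<open>The zero class in the cyclic homology of degree \<open>n\<close> is \<open>cyclic_coboundaries M n\<close> itself.\<close>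

definition cyclic_coboundaries :: "('i \<Rightarrow>\<^sub>0 'k::field) cocyclic \<Rightarrow> nat \<Rightarrow> (nat \<Rightarrow> ('i \<Rightarrow>\<^sub>0 'k)) set"
  where "cyclic_coboundaries M = coboundaries (tot_space (chains M)) (tot_space (rels M)) (tot_diff M)"

definition cyclic_homology :: "('i \<Rightarrow>\<^sub>0 'k::field) cocyclic \<Rightarrow> nat \<Rightarrow> (nat \<Rightarrow> ('i \<Rightarrow>\<^sub>0 'k)) set set"
  where "cyclic_homology M = cohomology (tot_space (chains M)) (tot_space (rels M)) (tot_diff M)"

definition cyclic_map ::
  "('j \<Rightarrow>\<^sub>0 'k::field) cocyclic \<Rightarrow> (('i \<Rightarrow>\<^sub>0 'k) \<Rightarrow> ('j \<Rightarrow>\<^sub>0 'k)) \<Rightarrow> nat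
   \<Rightarrow> (nat \<Rightarrow> ('i \<Rightarrow>\<^sub>0 'k)) set \<Rightarrow> (nat \<Rightarrow> ('j \<Rightarrow>\<^sub>0 'k)) set"
  where "cyclic_map N f n = induced (cyclic_coboundaries N n) (\<lambda>w p. f (w p))"

text \<open>
  The long exact sequence of cyclic homology starts in degree 0; the injectivity clause is exactness
  there, since cyclic homology vanishes in negative degrees.
\<close>

definition homotopy_cofibration ::
  "('i \<Rightarrow>\<^sub>0 'k::field) cocyclic \<Rightarrow> ('j \<Rightarrow>\<^sub>0 'k) cocyclic \<Rightarrow> ('l \<Rightarrow>\<^sub>0 'k) cocyclic
   \<Rightarrow> (('i \<Rightarrow>\<^sub>0 'k) \<Rightarrow> ('j \<Rightarrow>\<^sub>0 'k)) \<Rightarrow> (('j \<Rightarrow>\<^sub>0 'k) \<Rightarrow> ('l \<Rightarrow>\<^sub>0 'k)) \<Rightarrow> bool"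
  where "homotopy_cofibration L M N f g \<longleftrightarrow>
    (\<exists>\<delta> :: nat \<Rightarrow> (nat \<Rightarrow> ('l \<Rightarrow>\<^sub>0 'k)) set \<Rightarrow> (nat \<Rightarrow> ('i \<Rightarrow>\<^sub>0 'k)) set.
      {A \<in> cyclic_homology L 0. cyclic_map M f 0 A = cyclic_coboundaries M 0} = {cyclic_coboundaries L 0} \<and>
      (\<forall>n. quotient_linear tot_scale (cyclic_cocycles N n) (cyclic_coboundaries N n)
              tot_scale (cyclic_cocycles L (Suc n)) (cyclic_coboundaries L (Suc n)) (\<delta> n) \<and>
           cyclic_map M f n ` cyclic_homology L n =
             {A \<in> cyclic_homology M n. cyclic_map N g n A = cyclic_coboundaries N n} \<and>
           cyclic_map N g n ` cyclic_homology M n =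
             {A \<in> cyclic_homology N n. \<delta> n A = cyclic_coboundaries L (Suc n)} \<and>
           \<delta> n ` cyclic_homology N n =
             {A \<in> cyclic_homology L (Suc n). cyclic_map M f (Suc n) A = cyclic_coboundaries M (Suc n)}))"


section \<open>The cocyclic module of a module coalgebra with SaYD coefficients\<close>

text \<open>
  The action \<open>b (x \<otimes> c\<^sup>0 \<otimes> \<dots> \<otimes> c\<^sup>n) = b\<^sub>(\<^sub>n\<^sub>+\<^sub>2\<^sub>) x \<otimes> b\<^sub>(\<^sub>1\<^sub>) c\<^sup>0 \<otimes> \<dots> \<otimes> b\<^sub>(\<^sub>n\<^sub>+\<^sub>1\<^sub>) c\<^sup>n\<close> on generators.
\<close>

fun diag_act ::
  "('b \<Rightarrow> ('b \<times> 'b \<Rightarrow>\<^sub>0 'k::field)) \<Rightarrow> ('b \<Rightarrow> 'x \<Rightarrow> 'x) \<Rightarrow> ('b \<Rightarrow> 'c \<Rightarrow> 'c) \<Rightarrow> 'b \<Rightarrow> 'x \<Rightarrow> 'c list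
   \<Rightarrow> ('x \<times> 'c list \<Rightarrow>\<^sub>0 'k)"
  where
    "diag_act \<Delta>B actX actC b x [] = gen (actX b x, [])"
  | "diag_act \<Delta>B actX actC b x (c # cs) = (\<Delta>B b \<bind> (\<lambda>(b1, b2).
        diag_act \<Delta>B actX actC b2 x cs \<bind> (\<lambda>(y, ds). gen (y, actC b1 c # ds))))"

text \<open>
  \<open>k \<otimes>\<^sub>B V\<close> is the quotient of \<open>V\<close> by the span of all \<open>b v - \<epsilon>(b) v\<close>; it suffices to take \<open>v\<close> in a
  spanning set.
\<close>

definition CM ::
  "('b::ring_1 \<Rightarrow> ('b \<times> 'b \<Rightarrow>\<^sub>0 'k::field)) \<Rightarrow> ('b \<Rightarrow> 'k)
   \<Rightarrow> ('k \<Rightarrow> 'c::ab_group_add \<Rightarrow> 'c) \<Rightarrow> ('b \<Rightarrow> 'c \<Rightarrow> 'c) \<Rightarrow> ('c \<Rightarrow> ('c \<times> 'c \<Rightarrow>\<^sub>0 'k))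
   \<Rightarrow> ('k \<Rightarrow> 'x::ab_group_add \<Rightarrow> 'x) \<Rightarrow> ('b \<Rightarrow> 'x \<Rightarrow> 'x) \<Rightarrow> ('x \<Rightarrow> ('b \<times> 'x \<Rightarrow>\<^sub>0 'k))
   \<Rightarrow> ('x \<times> 'c list \<Rightarrow>\<^sub>0 'k) cocyclic"
  where "CM \<Delta>B \<epsilon> sC actC \<Delta>C sX actX \<rho> =
    \<lparr> chains = (\<lambda>n. {u. \<forall>(x, cs)\<in>Poly_Mapping.keys u. length cs = Suc n}),
      rels = (\<lambda>n. fspan (coeff_power_rels sX sC n \<union>
        {diag_act \<Delta>B actX actC b x cs - fscale (\<epsilon> b) (gen (x, cs)) | b x cs. length cs = Suc n})),
      coface = (\<lambda>n j u. u \<bind> (\<lambda>(x, cs).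
        if j \<le> n then comult_at \<Delta>C j cs \<bind> (\<lambda>ds. gen (x, ds))
        else \<rho> x \<bind> (\<lambda>(h, x0). \<Delta>C (hd cs) \<bind> (\<lambda>(c1, c2). gen (x0, c2 # tl cs @ [actC h c1]))))),
      cyc = (\<lambda>n u. u \<bind> (\<lambda>(x, cs). \<rho> x \<bind> (\<lambda>(h, x0). gen (x0, tl cs @ [actC h (hd cs)])))) \<rparr>"

definition CM_map :: "('c \<Rightarrow> 'd) \<Rightarrow> ('x \<times> 'c list \<Rightarrow>\<^sub>0 'k::field) \<Rightarrow> ('x \<times> 'd list \<Rightarrow>\<^sub>0 'k)"
  where "CM_map f u = (u \<bind> (\<lambda>(x, cs). gen (x, map f cs)))"

text \<open>
  A short exact sequence \<open>0 \<rightarrow> K \<rightarrow> C \<rightarrow> D \<rightarrow> 0\<close> of module coalgebras, with \<open>K\<close> identified with its image in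
  \<open>C\<close> and \<open>D\<close> with the quotient of \<open>C\<close> by that image.
\<close>

definition short_exact_module_coalgebras where
  "short_exact_module_coalgebras sK actK \<Delta>K sC actC \<Delta>C sD actD \<Delta>D \<iota> \<pi> \<longleftrightarrow>
     module_coalgebra_hom sK actK \<Delta>K sC actC \<Delta>C \<iota> \<and>
     module_coalgebra_hom sC actC \<Delta>C sD actD \<Delta>D \<pi> \<and>
     inj \<iota> \<and> range \<iota> = {c. \<pi> c = 0} \<and> surj \<pi>"

end

theory Submission
  imports Defs
begin

text \<open>
  A subspace of formal sums is determined by the functionals annihilating it, so that everything is done with
  functionals \<open>\<phi> x [c\<^sub>0, \<dots>, c\<^sub>n]\<close>; those that descend to the cocyclic module are multilinear and \<open>B\<close>-invariant.

  For the long exact sequence it is enough that in each column an element of the complex of \<open>C\<close> that dies in the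
  complex of \<open>D\<close>, and whose differential comes from \<open>K\<close>, itself comes from \<open>K\<close> up to the differential of an element
  that dies in the complex of \<open>D\<close>.  Dually, a functional that vanishes on words in \<open>K\<close> and is a cocycle on words with
  at least one letter in \<open>K\<close> has to be a coboundary on the latter.  As in Wodzicki's excision theorem, this is shown
  for one class of words after the other: if the letters before a zone lie in \<open>K\<close> and the functional depends on those
  in the zone only modulo \<open>K\<close>, the differential reduces to the bar differential of \<open>D\<close> on the zone, which is
  acyclic.  Equivariance and the coefficients \<open>X\<close> are taken care of by the exactness of \<open>Hom\<^sub>B(X, -)\<close> on the functionals
  on words: as \<open>C\<close> is projective, they are injective relative to resolutions of \<open>X\<close>, and \<open>X\<close> has a finite one.
\<close>

section \<open>Functionals on formal sums\<close>

text \<open>The sequence of cocyclic modules is not exact in the middle: up to relations, the kernel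
  of the map to D is spanned by words with at least one letter in K, the image of K by words with
  all letters in K. What has to be shown is that their quotient is acyclic in every column. The two
  ends are cheap: as D is projective, \<pi> has a B-linear section \<sigma>, hence \<iota> has a
  B-linear retraction, and both pass to coinvariants although they need not respect the
  comultiplication. Projectivity of C serves to extend equivariant functionals from a submodule K of
  P to P: on words, the action can be untwisted until it moves the last letter only. A lift over X
  costs a lift over its first syzygy one degree higher, a descent that ends because the resolution
  is finite. Duality over a field is convenient because elements are formal sums modulo relations:
  identities between Sweedler sums become equalities of scalars \<open>ev u F\<close>, and
  membership in a span becomes the vanishing of all functionals that annihilate the
  generators.\<close>

definition lfun :: "('k::field \<Rightarrow> 'v::ab_group_add \<Rightarrow> 'v) \<Rightarrow> ('v \<Rightarrow> 'k) \<Rightarrow> bool"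
  where "lfun s L \<longleftrightarrow> (\<forall>x y. L (x + y) = L x + L y) \<and> (\<forall>a x. L (s a x) = a * L x)"

text \<open>The pairing of a formal sum with a function on its indices. Sweedler sums with values in
  the field are nested uses of it.\<close>

abbreviation ev :: "('i \<Rightarrow>\<^sub>0 'k::field) \<Rightarrow> ('i \<Rightarrow> 'k) \<Rightarrow> 'k"
  where "ev u F \<equiv> lin_ext (*) u F"

lemma lfunI: "(\<And>x y. L (x + y) = L x + L y) \<Longrightarrow> (\<And>a x. L (s a x) = a * L x) \<Longrightarrow> lfun s L"
  by (auto simp: lfun_def)

lemma lfun_add: "lfun s L \<Longrightarrow> L (x + y) = L x + L y"
  and lfun_scale: "lfun s L \<Longrightarrow> L (s a x) = a * L x"
  by (auto simp: lfun_def)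

lemma lfun_0: "lfun s L \<Longrightarrow> L 0 = 0"
  by (metis add.right_neutral add_left_cancel lfun_add)

lemma lfun_minus: "lfun s L \<Longrightarrow> L (- x) = - L x"
  using lfun_add[of s L x "- x"] by (simp add: lfun_0 eq_neg_iff_add_eq_0 add.commute)

lemma lfun_diff: "lfun s L \<Longrightarrow> L (x - y) = L x - L y"
  using lfun_add[of s L x "- y"] by (simp add: lfun_minus)

lemma lfun_sum: "lfun s L \<Longrightarrow> L (\<Sum>i\<in>A. f i) = (\<Sum>i\<in>A. L (f i))"
  by (induction A rule: infinite_finite_induct) (auto simp: lfun_0 lfun_add)

lemma lfun_lin_ext: "lfun s L \<Longrightarrow> L (lin_ext s u f) = ev u (\<lambda>i. L (f i))"
  by (simp add: lin_ext_def lfun_sum lfun_scale)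

lemma lfun_comp:
  "lfun s' L \<Longrightarrow> (\<And>x y. g (x + y) = g x + g y) \<Longrightarrow> (\<And>a x. g (s a x) = s' a (g x)) \<Longrightarrow> lfun s (\<lambda>x. L (g x))"
  by (simp add: lfun_def)

lemma ev_superset:
  assumes "finite A" "Poly_Mapping.keys u \<subseteq> A"
  shows "ev u F = (\<Sum>i\<in>A. Poly_Mapping.lookup u i * F i)"
  unfolding lin_ext_def by (rule sum.mono_neutral_left) (use assms in \<open>auto simp: in_keys_iff\<close>)

lemma ev_add: "ev (u + v) F = ev u F + ev v F"
proof -
  let ?A = "Poly_Mapping.keys u \<union> Poly_Mapping.keys v"
  have "ev (u + v) F = (\<Sum>i\<in>?A. Poly_Mapping.lookup (u + v) i * F i)"
    by (rule ev_superset) (auto dest: subsetD[OF keys_add])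
  also have "\<dots> = ev u F + ev v F"
    by (simp add: ev_superset[of ?A] lookup_add distrib_right sum.distrib)
  finally show ?thesis .
qed

lemma ev_scale: "ev (fscale a u) F = a * ev u F"
proof -
  have "ev (fscale a u) F = (\<Sum>i\<in>Poly_Mapping.keys u. Poly_Mapping.lookup (fscale a u) i * F i)"
    by (rule ev_superset) (auto simp: in_keys_iff lookup_fscale)
  then show ?thesis
    by (simp add: lin_ext_def lookup_fscale sum_distrib_left mult.assoc)
qed

lemma lfun_ev: "lfun fscale (\<lambda>u. ev u F)"
  by (simp add: lfun_def ev_add ev_scale)

lemma ev_0 [simp]: "ev 0 F = 0"
  by (simp add: lin_ext_def)

lemma ev_minus: "ev (- u) F = - ev u F"
  by (rule lfun_minus[OF lfun_ev])

lemma ev_diff: "ev (u - v) F = ev u F - ev v F"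
  by (rule lfun_diff[OF lfun_ev])

lemma ev_sum: "ev (\<Sum>i\<in>A. u i) F = (\<Sum>i\<in>A. ev (u i) F)"
  by (rule lfun_sum[OF lfun_ev])

lemma ev_gen [simp]: "ev (gen i) F = F i"
  by (simp add: lin_ext_def)

lemma ev_alt: "ev (alt j u) F = alt j (ev u F)"
  by (simp add: alt_def ev_minus)

lemma ev_bind: "ev (u \<bind> f) F = ev u (\<lambda>i. ev (f i) F)"
  unfolding fbind_def by (rule lfun_lin_ext[OF lfun_ev])

lemma ev_cong: "(\<And>i. i \<in> Poly_Mapping.keys u \<Longrightarrow> F i = G i) \<Longrightarrow> ev u F = ev u G"
  by (simp add: lin_ext_def)

lemma ev_fun_0 [simp]: "ev u (\<lambda>_. 0) = 0"
  by (simp add: lin_ext_def)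

lemma ev_eq_0: "(\<And>i. i \<in> Poly_Mapping.keys u \<Longrightarrow> F i = 0) \<Longrightarrow> ev u F = 0"
  by (simp add: lin_ext_def)

lemma ev_fun_add: "ev u (\<lambda>i. F i + G i) = ev u F + ev u G"
  by (simp add: lin_ext_def distrib_left sum.distrib)

lemma ev_fun_scale: "ev u (\<lambda>i. a * F i) = a * ev u F"
  by (simp add: lin_ext_def sum_distrib_left mult.left_commute)

lemma ev_fun_minus: "ev u (\<lambda>i. - F i) = - ev u F"
  by (simp add: lin_ext_def sum_negf)

lemma ev_fun_diff: "ev u (\<lambda>i. F i - G i) = ev u F - ev u G"
  by (simp add: lin_ext_def right_diff_distrib sum_subtractf)

lemma ev_fun_alt: "ev u (\<lambda>i. alt j (F i)) = alt j (ev u F)"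
  by (simp add: alt_def ev_fun_minus)

lemma ev_fun_sum: "ev u (\<lambda>i. \<Sum>j\<in>A. F i j) = (\<Sum>j\<in>A. ev u (\<lambda>i. F i j))"
  by (simp add: lin_ext_def sum_distrib_left) (rule sum.swap)

lemma ev_swap: "ev u (\<lambda>i. ev v (\<lambda>j. F i j)) = ev v (\<lambda>j. ev u (\<lambda>i. F i j))"
  by (simp add: lin_ext_def sum_distrib_left mult.left_commute) (rule sum.swap)

lemma lfun_ev_fun: "(\<And>i. lfun s (F i)) \<Longrightarrow> lfun s (\<lambda>x. ev u (\<lambda>i. F i x))"
  by (auto simp: lfun_def ev_fun_add ev_fun_scale)

lemma lfun_scale_fun: "lfun s F \<Longrightarrow> lfun s (\<lambda>x. a * F x)"
  by (auto simp: lfun_def distrib_left mult.left_commute)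

lemma lfun_zero: "lfun s (\<lambda>_. 0)"
  by (simp add: lfun_def)

lemma lfun_add_fun: "lfun s F \<Longrightarrow> lfun s G \<Longrightarrow> lfun s (\<lambda>x. F x + G x)"
  by (auto simp: lfun_def distrib_left)

lemma lfun_alt_fun: "lfun s F \<Longrightarrow> lfun s (\<lambda>x. alt j (F x))"
  by (auto simp: lfun_def alt_def)

lemma lfun_sum_fun: "(\<And>j. j \<in> A \<Longrightarrow> lfun s (F j)) \<Longrightarrow> lfun s (\<lambda>x. \<Sum>j\<in>A. F j x)"
  by (induction A rule: infinite_finite_induct) (auto intro: lfun_zero lfun_add_fun)

interpretation fs: vector_space "fscale :: 'k::field \<Rightarrow> ('i \<Rightarrow>\<^sub>0 'k) \<Rightarrow> _"
  by (rule vector_space_fscale)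

lemma ev_span:
  assumes "w \<in> fspan R" "\<And>r. r \<in> R \<Longrightarrow> ev r F = 0"
  shows "ev w F = 0"
  using assms(1)
  by (rule fs.span_induct_alt) (use assms(2) in \<open>simp_all add: ev_add ev_scale\<close>)

lemma gen_decomp: "u = (\<Sum>i\<in>Poly_Mapping.keys u. fscale (Poly_Mapping.lookup u i) (gen i))"
proof (rule poly_mapping_eqI)
  fix k
  have "(\<Sum>i\<in>Poly_Mapping.keys u. Poly_Mapping.lookup u i * (1 when i = k)) =
      (\<Sum>i\<in>Poly_Mapping.keys u. if i = k then Poly_Mapping.lookup u k else 0)"
    by (rule sum.cong) auto
  also have "\<dots> = Poly_Mapping.lookup u k"
    by (simp add: sum.delta in_keys_iff)
  finally have "(\<Sum>i\<in>Poly_Mapping.keys u. Poly_Mapping.lookup u i * (1 when i = k)) = Poly_Mapping.lookup u k" .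
  then show "Poly_Mapping.lookup u k =
      Poly_Mapping.lookup (\<Sum>i\<in>Poly_Mapping.keys u. fscale (Poly_Mapping.lookup u i) (gen i)) k"
    by (simp add: lookup_sum lookup_fscale lookup_single)
qed

text \<open>A linear functional on a free space is fixed by its values on generators. This brings
  the functionals produced by linear algebra into the form of a pairing with some
  \<open>F\<close>.\<close>

lemma lfun_eq_ev:
  assumes "lfun fscale L"
  shows "L u = ev u (\<lambda>i. L (gen i))"
proof -
  have "L u = L (\<Sum>i\<in>Poly_Mapping.keys u. fscale (Poly_Mapping.lookup u i) (gen i))"
    by (subst gen_decomp) rule
  then show ?thesis
    by (simp add: lfun_sum[OF assms] lfun_scale[OF assms] lin_ext_def)
qed

text \<open>A basis of the span stays independent when a vector outside the span is added, so some
  linear functional vanishes on the basis and is 1 at that vector.\<close>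

lemma span_separation:
  assumes "u \<notin> fspan R"
  obtains F where "\<And>w. w \<in> fspan R \<Longrightarrow> ev w F = 0" "ev u F \<noteq> 0"
proof -
  interpret vp: vector_space_pair fscale "(*) :: 'b \<Rightarrow> 'b \<Rightarrow> 'b"
    by (intro vector_space_pair.intro vector_space_fscale) (unfold_locales, simp_all add: algebra_simps)
  obtain B where B: "B \<subseteq> fspan R" "fs.independent B" "fspan R \<subseteq> fspan B"
    using fs.basis_exists[of "fspan R"] by metis
  have sp: "fspan B = fspan R"
    by (metis B(1,3) fs.span_minimal fs.subspace_span subset_antisym)
  have uB: "u \<notin> B" "fs.independent (insert u B)"
    using assms B(1,2) sp fs.independent_insertI[of u B] by auto
  obtain g where g: "Vector_Spaces.linear fscale (*) g" "\<forall>x\<in>insert u B. g x = (if x = u then 1 else 0)"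
    using vp.linear_independent_extend[OF uB(2), of "\<lambda>x. if x = u then 1 else 0"] by blast
  have L: "lfun fscale g"
    using g(1) by (simp add: lfun_def Vector_Spaces.linear_iff)
  have *: "ev w (\<lambda>i. g (gen i)) = g w" for w
    by (simp add: lfun_eq_ev[OF L, symmetric])
  show thesis
  proof (rule that[of "\<lambda>i. g (gen i)"])
    fix w assume "w \<in> fspan R"
    then have "w \<in> fspan B" by (simp add: sp)
    then have "ev w (\<lambda>i. g (gen i)) = 0"
      by (rule ev_span) (use uB g(2) * in auto)
    then show "ev w (\<lambda>i. g (gen i)) = 0" .
  next
    show "ev u (\<lambda>i. g (gen i)) \<noteq> 0"
      using g(2) by (simp add: *)
  qed
qed

text \<open>The double annihilator of a subspace is the subspace itself. Membership in a space of
  relations is reduced to functionals in this form throughout.\<close>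

lemma in_fspanI:
  assumes "\<And>F. (\<And>r. r \<in> R \<Longrightarrow> ev r F = 0) \<Longrightarrow> ev u F = 0"
  shows "u \<in> fspan R"
proof (rule ccontr)
  assume "u \<notin> fspan R"
  then obtain F where "\<And>w. w \<in> fspan R \<Longrightarrow> ev w F = 0" "ev u F \<noteq> 0"
    using span_separation by blast
  with assms[of F] show False
    using fs.span_base by metis
qed

lemma slot_rels_annihilator:
  "(\<forall>r\<in>slot_rels s G. ev r F = 0) \<longleftrightarrow> (\<forall>g\<in>G. lfun s (\<lambda>v. F (g v)))"
proof -
  have "ev (gen (g (u + v)) - (gen (g u) + gen (g v))) F = F (g (u + v)) - (F (g u) + F (g v))"
    "ev (gen (g (s a v)) - fscale a (gen (g v))) F = F (g (s a v)) - a * F (g v)" for g u v a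
    by (simp_all add: ev_diff ev_add ev_scale)
  note ev_rel = this
  show ?thesis
  proof (intro iffI ballI lfunI)
    fix g u v a assume *: "\<forall>r\<in>slot_rels s G. ev r F = 0" and g: "g \<in> G"
    have "gen (g (u + v)) - (gen (g u) + gen (g v)) \<in> slot_rels s G"
      "gen (g (s a v)) - fscale a (gen (g v)) \<in> slot_rels s G"
      unfolding slot_rels_def using g by blast+
    with * ev_rel show "F (g (u + v)) = F (g u) + F (g v)" "F (g (s a v)) = a * F (g v)"
      by (metis eq_iff_diff_eq_0)+
  next
    fix r assume *: "\<forall>g\<in>G. lfun s (\<lambda>v. F (g v))" and "r \<in> slot_rels s G"
    then consider g u v where "g \<in> G" "r = gen (g (u + v)) - (gen (g u) + gen (g v))"
      | g a v where "g \<in> G" "r = gen (g (s a v)) - fscale a (gen (g v))"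
      unfolding slot_rels_def by blast
    then show "ev r F = 0"
      by cases (use * in \<open>simp_all add: ev_rel lfun_def\<close>)
  qed
qed

section \<open>Multilinear functionals and the tensor relations\<close>

definition bilin where
  "bilin s1 s2 F \<longleftrightarrow> (\<forall>v. lfun s1 (\<lambda>u. F u v)) \<and> (\<forall>u. lfun s2 (F u))"

definition trilin where
  "trilin s1 s2 s3 F \<longleftrightarrow> (\<forall>v w. lfun s1 (\<lambda>u. F u v w)) \<and> (\<forall>u w. lfun s2 (\<lambda>v. F u v w)) \<and> (\<forall>u v. lfun s3 (F u v))"

lemma bilinI: "(\<And>v. lfun s1 (\<lambda>u. F u v)) \<Longrightarrow> (\<And>u. lfun s2 (\<lambda>v. F u v)) \<Longrightarrow> bilin s1 s2 F"
  by (simp add: bilin_def)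

lemma trilinI:
  "(\<And>v w. lfun s1 (\<lambda>u. F u v w)) \<Longrightarrow> (\<And>u w. lfun s2 (\<lambda>v. F u v w)) \<Longrightarrow> (\<And>u v. lfun s3 (\<lambda>w. F u v w)) \<Longrightarrow> trilin s1 s2 s3 F"
  by (simp add: trilin_def)

text \<open>The axioms of coalgebras and comodules hold only modulo tensor relations. A bilinear
  \<open>F\<close> annihilates these, so each axiom becomes an equality of scalars that can be used
  for rewriting.\<close>

lemma tensor2_ev:
  assumes "u \<approx>\<^bsub>tensor2 s1 s2\<^esub> v" "bilin s1 s2 F"
  shows "ev u (\<lambda>(a, b). F a b) = ev v (\<lambda>(a, b). F a b)"
proof -
  have "ev (u - v) (\<lambda>(a, b). F a b) = 0"
  proof (rule ev_span[OF assms(1)[unfolded tensor2_def]])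
    fix r assume r: "r \<in> slot_rels s1 {\<lambda>u. (u, v) | v. True} \<union> slot_rels s2 {\<lambda>v. (u, v) | u. True}"
    have "\<forall>r\<in>slot_rels s1 {\<lambda>u. (u, v) | v. True}. ev r (\<lambda>(a, b). F a b) = 0"
      "\<forall>r\<in>slot_rels s2 {\<lambda>v. (u, v) | u. True}. ev r (\<lambda>(a, b). F a b) = 0"
      unfolding slot_rels_annihilator using assms(2) by (auto simp: bilin_def)
    with r show "ev r (\<lambda>(a, b). F a b) = 0" by blast
  qed
  then show ?thesis by (simp add: ev_diff)
qed

lemma tensor3_ev:
  assumes "u \<approx>\<^bsub>tensor3 s1 s2 s3\<^esub> v" "trilin s1 s2 s3 F"
  shows "ev u (\<lambda>(a, b, c). F a b c) = ev v (\<lambda>(a, b, c). F a b c)"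
proof -
  have "ev (u - v) (\<lambda>(a, b, c). F a b c) = 0"
  proof (rule ev_span[OF assms(1)[unfolded tensor3_def]])
    fix r assume r: "r \<in> slot_rels s1 {\<lambda>u. (u, v, w) | v w. True} \<union> slot_rels s2 {\<lambda>v. (u, v, w) | u w. True} \<union>
      slot_rels s3 {\<lambda>w. (u, v, w) | u v. True}"
    have "\<forall>r\<in>slot_rels s1 {\<lambda>u. (u, v, w) | v w. True}. ev r (\<lambda>(a, b, c). F a b c) = 0"
      "\<forall>r\<in>slot_rels s2 {\<lambda>v. (u, v, w) | u w. True}. ev r (\<lambda>(a, b, c). F a b c) = 0"
      "\<forall>r\<in>slot_rels s3 {\<lambda>w. (u, v, w) | u v. True}. ev r (\<lambda>(a, b, c). F a b c) = 0"
      unfolding slot_rels_annihilator using assms(2) by (auto simp: trilin_def)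
    with r show "ev r (\<lambda>(a, b, c). F a b c) = 0" by blast
  qed
  then show ?thesis by (simp add: ev_diff)
qed

text \<open>Only words of length \<open>N\<close> are constrained; on all others \<open>f\<close>
  may be changed at will, see \<open>mlin_cong\<close>.\<close>

definition mlin :: "('k::field \<Rightarrow> 'c::ab_group_add \<Rightarrow> 'c) \<Rightarrow> nat \<Rightarrow> ('c list \<Rightarrow> 'k) \<Rightarrow> bool"
  where "mlin s N f \<longleftrightarrow> (\<forall>xs ys. Suc (length xs + length ys) = N \<longrightarrow> lfun s (\<lambda>c. f (xs @ c # ys)))"

lemma mlinD: "mlin s N f \<Longrightarrow> Suc (length xs + length ys) = N \<Longrightarrow> lfun s (\<lambda>c. f (xs @ c # ys))"
  by (simp add: mlin_def)

lemma mlin_hd: "mlin s (Suc N) f \<Longrightarrow> length ys = N \<Longrightarrow> lfun s (\<lambda>c. f (c # ys))"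
  using mlinD[of s "Suc N" f "[]"] by simp

lemma mlin_append1:
  fixes s :: "'k::field \<Rightarrow> 'c::ab_group_add \<Rightarrow> 'c"
  assumes "mlin s N f" "N = length us + M"
  shows "mlin s M (\<lambda>ys. f (us @ ys))"
  unfolding mlin_def
proof (intro allI impI)
  fix xs ys :: "'c list" assume "Suc (length xs + length ys) = M"
  then have "lfun s (\<lambda>c. f ((us @ xs) @ c # ys))"
    by (intro mlinD[OF assms(1)]) (simp add: assms(2))
  then show "lfun s (\<lambda>c. f (us @ xs @ c # ys))" by simp
qed

lemma mlin_tl:
  assumes "mlin s (Suc N) f"
  shows "mlin s N (\<lambda>ys. f (c # ys))"
proof -
  have "mlin s N (\<lambda>ys. f ([c] @ ys))"
    by (rule mlin_append1[OF assms]) simp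
  then show ?thesis by simp
qed

lemma mlin_append2:
  fixes s :: "'k::field \<Rightarrow> 'c::ab_group_add \<Rightarrow> 'c"
  assumes "mlin s N f" "N = M + length us"
  shows "mlin s M (\<lambda>xs. f (xs @ us))"
  unfolding mlin_def
proof (intro allI impI)
  fix xs ys :: "'c list" assume "Suc (length xs + length ys) = M"
  then have "lfun s (\<lambda>c. f (xs @ c # (ys @ us)))"
    by (intro mlinD[OF assms(1)]) (simp add: assms(2))
  then show "lfun s (\<lambda>c. f ((xs @ c # ys) @ us))" by simp
qed

lemma mlin_Suc:
  fixes s :: "'k::field \<Rightarrow> 'c::ab_group_add \<Rightarrow> 'c"
  assumes "\<And>ys. length ys = N \<Longrightarrow> lfun s (\<lambda>c. f (c # ys))" "\<And>c. mlin s N (\<lambda>ys. f (c # ys))"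
  shows "mlin s (Suc N) f"
  unfolding mlin_def
proof (intro allI impI)
  fix xs ys :: "'c list" assume l: "Suc (length xs + length ys) = Suc N"
  show "lfun s (\<lambda>c. f (xs @ c # ys))"
  proof (cases xs)
    case Nil
    with l assms(1)[of ys] show ?thesis by simp
  next
    case (Cons a us)
    have "lfun s (\<lambda>c. f (a # (us @ c # ys)))"
      by (rule mlinD[OF assms(2)]) (use l Cons in simp)
    then show ?thesis by (simp add: Cons)
  qed
qed

lemma mlin_0 [simp]: "mlin s 0 f"
  by (simp add: mlin_def)

lemma mlin_cong:
  fixes s :: "'k::field \<Rightarrow> 'c::ab_group_add \<Rightarrow> 'c"
  assumes "mlin s N f" "\<And>xs. length xs = N \<Longrightarrow> f xs = g xs"
  shows "mlin s N g"
  unfolding mlin_def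
proof (intro allI impI)
  fix xs ys :: "'c list" assume l: "Suc (length xs + length ys) = N"
  have "lfun s (\<lambda>c. f (xs @ c # ys))" by (rule mlinD[OF assms(1) l])
  moreover have "f (xs @ c # ys) = g (xs @ c # ys)" for c by (rule assms(2)) (use l in simp)
  ultimately show "lfun s (\<lambda>c. g (xs @ c # ys))" by simp
qed

lemma mlin_ev: "(\<And>i. mlin s N (F i)) \<Longrightarrow> mlin s N (\<lambda>xs. ev u (\<lambda>i. F i xs))"
  unfolding mlin_def by (auto intro: lfun_ev_fun)

lemma mlin_zero: "mlin s N (\<lambda>_. 0)"
  by (simp add: mlin_def lfun_zero)

lemma mlin_scale: "mlin s N f \<Longrightarrow> mlin s N (\<lambda>x. a * f x)"
  by (simp add: mlin_def lfun_scale_fun)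

lemma mlin_add: "mlin s N f \<Longrightarrow> mlin s N g \<Longrightarrow> mlin s N (\<lambda>x. f x + g x)"
  by (simp add: mlin_def lfun_add_fun)

lemma mlin_alt: "mlin s N f \<Longrightarrow> mlin s N (\<lambda>x. alt j (f x))"
  by (simp add: mlin_def lfun_alt_fun)

lemma mlin_sum: "(\<And>j. j \<in> A \<Longrightarrow> mlin s N (F j)) \<Longrightarrow> mlin s N (\<lambda>x. \<Sum>j\<in>A. F j x)"
  by (simp add: mlin_def lfun_sum_fun)

lemma mlin_eq_0:
  assumes "mlin s N f" "length xs = N" "j < N" "xs ! j = 0"
  shows "f xs = 0"
proof -
  have "lfun s (\<lambda>c. f (take j xs @ c # drop (Suc j) xs))"
    by (rule mlinD[OF assms(1)]) (use assms in auto)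
  from lfun_0[OF this] show ?thesis
    using assms id_take_nth_drop[of j xs] by simp
qed

lemma power_rels_annihilator: "(\<forall>r\<in>power_rels s n. ev r F = 0) \<longleftrightarrow> mlin s (Suc n) F"
  unfolding power_rels_def slot_rels_annihilator mlin_def by auto

section \<open>Hopf algebras and diagonal actions\<close>

text \<open>Lets an identity between vectors, such as multiplicativity of the antipode, be checked
  after applying an arbitrary functional, where Sweedler sums can be manipulated.\<close>

lemma lfun_separates:
  assumes "vector_space s" "\<And>L. lfun s L \<Longrightarrow> L x = L y"
  shows "x = y"
proof (rule ccontr)
  assume "x \<noteq> y"
  interpret vs: vector_space s by fact
  interpret vp: vector_space_pair s "(*) :: 'a \<Rightarrow> 'a \<Rightarrow> 'a"
    by (intro vector_space_pair.intro assms(1)) (unfold_locales, simp_all add: algebra_simps)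
  have "vs.independent {x - y}" using \<open>x \<noteq> y\<close> by simp
  then obtain g where g: "Vector_Spaces.linear s (*) g" "\<forall>v\<in>{x - y}. g v = 1"
    using vp.linear_independent_extend[of "{x - y}" "\<lambda>_. 1"] by blast
  then have "lfun s g" by (simp add: lfun_def Vector_Spaces.linear_iff)
  from assms(2)[OF this] lfun_diff[OF this, of x y] g(2) show False by simp
qed

lemma lfun_ev_pair: "(\<And>a b. lfun s (\<lambda>x. G a b x)) \<Longrightarrow> lfun s (\<lambda>x. ev u (\<lambda>(a, b). G a b x))"
  by (rule lfun_ev_fun) (simp add: case_prod_unfold)

lemma ev_pair_cong: "(\<And>a b. F a b = G a b) \<Longrightarrow> ev u (\<lambda>(a, b). F a b) = ev u (\<lambda>(a, b). G a b)"
  by simp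

lemma ev_swap_pair: "ev u (\<lambda>(a, b). ev v (\<lambda>(c, d). F a b c d)) = ev v (\<lambda>(c, d). ev u (\<lambda>(a, b). F a b c d))"
  unfolding case_prod_unfold by (rule ev_swap)

lemma ev_pair_scale: "ev u (\<lambda>(a, b). k * F a b) = k * ev u (\<lambda>(a, b). F a b)"
  unfolding case_prod_unfold by (rule ev_fun_scale)

section \<open>Sweedler calculus in coalgebras and Hopf algebras\<close>

context coalgebra
begin

lemma lfun_comult:
  assumes "bilin scale scale F"
  shows "lfun scale (\<lambda>c. ev (\<Delta> c) (\<lambda>(a, b). F a b))"
proof (rule lfunI)
  show "ev (\<Delta> (x + y)) (\<lambda>(a, b). F a b) = ev (\<Delta> x) (\<lambda>(a, b). F a b) + ev (\<Delta> y) (\<lambda>(a, b). F a b)" for x y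
    unfolding tensor2_ev[OF comult_add assms] ev_add ..
  show "ev (\<Delta> (scale a x)) (\<lambda>(a, b). F a b) = a * ev (\<Delta> x) (\<lambda>(a, b). F a b)" for a x
    unfolding tensor2_ev[OF comult_scale assms] ev_scale ..
qed

lemma coassoc_ev:
  assumes "trilin scale scale scale F"
  shows "ev (\<Delta> c) (\<lambda>(c1, c2). ev (\<Delta> c1) (\<lambda>(x, y). F x y c2)) =
    ev (\<Delta> c) (\<lambda>(c1, c2). ev (\<Delta> c2) (\<lambda>(x, y). F c1 x y))"
  using tensor3_ev[OF coassoc[of c] assms] by (simp add: ev_bind case_prod_unfold)

end

context hopf_algebra
begin

lemma lfun_counit: "lfun scale \<epsilon>"
  using counit by (simp add: is_counit_def lfun_def Vector_Spaces.linear_iff)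

lemma counit_left: "lfun scale G \<Longrightarrow> ev (\<Delta> b) (\<lambda>(b1, b2). \<epsilon> b1 * G b2) = G b"
  using counit lfun_lin_ext[of scale G "\<Delta> b" "\<lambda>(b1, b2). scale (\<epsilon> b1) b2"]
  by (simp add: is_counit_def case_prod_unfold lfun_scale)

lemma counit_right: "lfun scale G \<Longrightarrow> ev (\<Delta> b) (\<lambda>(b1, b2). \<epsilon> b2 * G b1) = G b"
  using counit lfun_lin_ext[of scale G "\<Delta> b" "\<lambda>(b1, b2). scale (\<epsilon> b2) b1"]
  by (simp add: is_counit_def case_prod_unfold lfun_scale)

lemma antipode_left_ev: "lfun scale G \<Longrightarrow> ev (\<Delta> b) (\<lambda>(b1, b2). G (S b1 * b2)) = \<epsilon> b * G 1"
  using antipode_left[of b] lfun_lin_ext[of scale G "\<Delta> b" "\<lambda>(b1, b2). S b1 * b2"]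
  by (simp add: case_prod_unfold lfun_scale)

lemma antipode_right_ev: "lfun scale G \<Longrightarrow> ev (\<Delta> b) (\<lambda>(b1, b2). G (b1 * S b2)) = \<epsilon> b * G 1"
  using antipode_right[of b] lfun_lin_ext[of scale G "\<Delta> b" "\<lambda>(b1, b2). b1 * S b2"]
  by (simp add: case_prod_unfold lfun_scale)

lemma antipode_add: "S (x + y) = S x + S y"
  and antipode_scale: "S (scale a x) = scale a (S x)"
  using antipode_linear by (simp_all add: Vector_Spaces.linear_iff)

lemma lfun_antipode: "lfun scale G \<Longrightarrow> lfun scale (\<lambda>x. G (S x))"
  by (erule lfun_comp) (simp_all add: antipode_add antipode_scale)

lemma lfun_mult_left: "lfun scale G \<Longrightarrow> lfun scale (\<lambda>x. G (a * x))"
  by (erule lfun_comp) (simp_all add: distrib_left scale_mult_right)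

lemma lfun_mult_right: "lfun scale G \<Longrightarrow> lfun scale (\<lambda>x. G (x * a))"
  by (erule lfun_comp) (simp_all add: distrib_right scale_mult_left)

lemma comult_mult_ev:
  assumes "bilin scale scale F"
  shows "ev (\<Delta> (x * y)) (\<lambda>(a, b). F a b) =
    ev (\<Delta> x) (\<lambda>(x1, x2). ev (\<Delta> y) (\<lambda>(y1, y2). F (x1 * y1) (x2 * y2)))"
  using tensor2_ev[OF comult_mult assms, of x y] by (simp add: ev_bind case_prod_unfold)

lemma comult_one_ev:
  assumes "bilin scale scale F"
  shows "ev (\<Delta> 1) (\<lambda>(a, b). F a b) = F 1 1"
  using tensor2_ev[OF comult_one assms] by simp

lemma antipode_one: "S 1 = 1"
proof (rule lfun_separates[OF vector_space_axioms])
  fix G :: "'b \<Rightarrow> 'k" assume G: "lfun scale G"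
  have "bilin scale scale (\<lambda>a b. G (S a * b))"
    by (intro bilinI lfun_mult_left G lfun_antipode[where G = "\<lambda>x. G (x * _)"] lfun_mult_right)
  from comult_one_ev[OF this] antipode_left_ev[OF G, of 1]
  show "G (S 1) = G 1" by (simp add: counit_one)
qed

lemmas lfun_alg = lfun_mult_left lfun_mult_right lfun_ev_pair lfun_scale_fun

text \<open>Both sides are convolution inverses of the multiplication, \<open>S (x * y)\<close> from
  the left and \<open>S y * S x\<close> from the right. The threefold product of left inverse,
  multiplication and right inverse is contracted in two ways.\<close>

lemma antipode_mult: "S (x * y) = S y * S x"
proof (rule lfun_separates[OF vector_space_axioms])
  fix G :: "'b \<Rightarrow> 'k" assume G: "lfun scale G"
  have G2: "lfun scale (\<lambda>z. G (u * z * v))" for u v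
    using lfun_mult_left[OF lfun_mult_right[OF G, of v], of u] .
  have GS: "lfun scale (\<lambda>z. G (u * S z * v))" for u v
    by (rule lfun_antipode[OF G2])
  have GSL: "lfun scale (\<lambda>z. G (S (z * w) * v))" "lfun scale (\<lambda>z. G (S (w * z) * v))" for w v
    by (rule lfun_mult_right[OF lfun_antipode[OF lfun_mult_right[OF G]]]
        lfun_mult_left[OF lfun_antipode[OF lfun_mult_right[OF G]]])+
  \<comment> \<open>The legs 1 and 2 contract by the left antipode axiom and leave
    \<open>S y * S x\<close>. The legs 2 and 3 contract by the right one, first for \<open>y\<close>
    and then for \<open>x\<close>, and leave \<open>S (x * y)\<close>.\<close>
  define F where "F x1 x2 x3 y1 y2 y3 = G (S (x1 * y1) * (x2 * (y2 * S y3) * S x3))" for x1 x2 x3 y1 y2 y3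
  have F_lin: "lfun scale (\<lambda>x1. F x1 x2 x3 y1 y2 y3)" "lfun scale (\<lambda>x2. F x1 x2 x3 y1 y2 y3)"
     "lfun scale (\<lambda>x3. F x1 x2 x3 y1 y2 y3)" "lfun scale (\<lambda>y1. F x1 x2 x3 y1 y2 y3)"
     "lfun scale (\<lambda>y2. F x1 x2 x3 y1 y2 y3)" "lfun scale (\<lambda>y3. F x1 x2 x3 y1 y2 y3)" for x1 x2 x3 y1 y2 y3
    unfolding F_def
    subgoal by (rule GSL)
    subgoal using G2[of "S (x1 * y1)" "y2 * S y3 * S x3"] by (simp add: mult.assoc)
    subgoal using GS[of "S (x1 * y1) * (x2 * (y2 * S y3))" 1] by (simp add: mult.assoc)
    subgoal by (rule GSL)
    subgoal using G2[of "S (x1 * y1) * x2" "S y3 * S x3"] by (simp add: mult.assoc)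
    subgoal using GS[of "S (x1 * y1) * x2 * y2" "S x3"] by (simp add: mult.assoc)
    done
  have "G (S y * S x) = ev (\<Delta> x) (\<lambda>(x1, x2). \<epsilon> x1 * G (S y * S x2))"
    by (rule counit_left[symmetric]) (rule lfun_antipode[OF lfun_mult_left[OF G]])
  also have "\<dots> = ev (\<Delta> x) (\<lambda>(x1, x2). ev (\<Delta> y) (\<lambda>(y1, y2). \<epsilon> (x1 * y1) * G (S y2 * S x2)))"
  proof (rule ev_pair_cong)
    fix x1 x2
    have "ev (\<Delta> y) (\<lambda>(y1, y2). \<epsilon> y1 * G (S y2 * S x2)) = G (S y * S x2)"
      by (rule counit_left) (rule lfun_antipode[OF lfun_mult_right[OF G]])
    then show "\<epsilon> x1 * G (S y * S x2) = ev (\<Delta> y) (\<lambda>(y1, y2). \<epsilon> (x1 * y1) * G (S y2 * S x2))"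
      by (simp add: counit_mult mult.assoc ev_pair_scale)
  qed
  also have "\<dots> = ev (\<Delta> x) (\<lambda>(x1, x2). ev (\<Delta> y) (\<lambda>(y1, y2).
      ev (\<Delta> x1) (\<lambda>(x11, x12). ev (\<Delta> y1) (\<lambda>(y11, y12). F x11 x12 x2 y11 y12 y2))))"
  proof (intro ev_pair_cong)
    fix x1 x2 y1 y2
    have "\<epsilon> (x1 * y1) * G (S y2 * S x2) = ev (\<Delta> (x1 * y1)) (\<lambda>(p, q). G (S p * q * (S y2 * S x2)))"
      using antipode_left_ev[OF lfun_mult_right[OF G, of "S y2 * S x2"], of "x1 * y1"] by simp
    also have "\<dots> = ev (\<Delta> x1) (\<lambda>(x11, x12). ev (\<Delta> y1) (\<lambda>(y11, y12). F x11 x12 x2 y11 y12 y2))"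
    proof (subst comult_mult_ev)
      show "bilin scale scale (\<lambda>p q. G (S p * q * (S y2 * S x2)))"
        using GS[of 1] G2 by (auto intro!: bilinI simp: mult.assoc)
    qed (simp add: F_def mult.assoc)
    finally show "\<epsilon> (x1 * y1) * G (S y2 * S x2) = \<dots>" .
  qed
  also have "\<dots> = ev (\<Delta> x) (\<lambda>(x1, x2). ev (\<Delta> x1) (\<lambda>(x11, x12).
      ev (\<Delta> y) (\<lambda>(y1, y2). ev (\<Delta> y1) (\<lambda>(y11, y12). F x11 x12 x2 y11 y12 y2))))"
    by (intro ev_pair_cong ev_swap_pair)
  also have "\<dots> = ev (\<Delta> x) (\<lambda>(x1, x2). ev (\<Delta> x2) (\<lambda>(x21, x22).
      ev (\<Delta> y) (\<lambda>(y1, y2). ev (\<Delta> y1) (\<lambda>(y11, y12). F x1 x21 x22 y11 y12 y2))))"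
    by (rule coassoc_ev) (intro trilinI lfun_ev_pair F_lin)
  also have "\<dots> = ev (\<Delta> x) (\<lambda>(x1, x2). ev (\<Delta> x2) (\<lambda>(x21, x22).
      ev (\<Delta> y) (\<lambda>(y1, y2). ev (\<Delta> y2) (\<lambda>(y21, y22). F x1 x21 x22 y1 y21 y22))))"
    by (intro ev_pair_cong coassoc_ev trilinI F_lin)
  also have "\<dots> = ev (\<Delta> x) (\<lambda>(x1, x2). ev (\<Delta> x2) (\<lambda>(x21, x22). G (S (x1 * y) * (x21 * S x22))))"
  proof (intro ev_pair_cong)
    fix x1 x2 x21 x22
    have "ev (\<Delta> y2) (\<lambda>(y21, y22). F x1 x21 x22 y1 y21 y22) = \<epsilon> y2 * G (S (x1 * y1) * (x21 * S x22))" for y1 y2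
      using antipode_right_ev[OF G2[of "S (x1 * y1) * x21" "S x22"], of y2] by (simp add: F_def mult.assoc)
    moreover have "ev (\<Delta> y) (\<lambda>(y1, y2). \<epsilon> y2 * G (S (x1 * y1) * (x21 * S x22))) = G (S (x1 * y) * (x21 * S x22))"
      by (rule counit_right) (rule GSL)
    ultimately show "ev (\<Delta> y) (\<lambda>(y1, y2). ev (\<Delta> y2) (\<lambda>(y21, y22). F x1 x21 x22 y1 y21 y22)) =
        G (S (x1 * y) * (x21 * S x22))" by simp
  qed
  also have "\<dots> = ev (\<Delta> x) (\<lambda>(x1, x2). \<epsilon> x2 * G (S (x1 * y)))"
  proof (intro ev_pair_cong)
    fix x1 x2
    show "ev (\<Delta> x2) (\<lambda>(x21, x22). G (S (x1 * y) * (x21 * S x22))) = \<epsilon> x2 * G (S (x1 * y))"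
      using antipode_right_ev[OF lfun_mult_left[OF G, of "S (x1 * y)"], of x2] by simp
  qed
  also have "\<dots> = G (S (x * y))"
    by (rule counit_right) (use GSL(1)[of y 1] in simp)
  finally show "G (S (x * y)) = G (S y * S x)" ..
qed

end

text \<open>The transpose of the diagonal action: the value of \<open>f\<close> at the word obtained
  by letting the successive legs of \<open>b\<close> act on the letters. The empty word spans the
  trivial module, hence the counit.\<close>

fun lact :: "('b \<Rightarrow> ('b \<times> 'b \<Rightarrow>\<^sub>0 'k::field)) \<Rightarrow> ('b \<Rightarrow> 'k) \<Rightarrow> ('b \<Rightarrow> 'c \<Rightarrow> 'c) \<Rightarrow> 'b \<Rightarrow> 'c list
    \<Rightarrow> ('c list \<Rightarrow> 'k) \<Rightarrow> 'k" where
  "lact \<Delta> \<epsilon> act b [] f = \<epsilon> b * f []"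
| "lact \<Delta> \<epsilon> act b (c # cs) f = ev (\<Delta> b) (\<lambda>(b1, b2). lact \<Delta> \<epsilon> act b2 cs (\<lambda>ds. f (act b1 c # ds)))"

lemma lact_cong:
  "(\<And>ds. length ds = length cs \<Longrightarrow> f ds = g ds) \<Longrightarrow> lact \<Delta> \<epsilon> act b cs f = lact \<Delta> \<epsilon> act b cs g"
proof (induction cs arbitrary: b f g)
  case (Cons c cs)
  have "lact \<Delta> \<epsilon> act b2 cs (\<lambda>ds. f (act b1 c # ds)) = lact \<Delta> \<epsilon> act b2 cs (\<lambda>ds. g (act b1 c # ds))" for b1 b2
    by (rule Cons.IH) (simp add: Cons.prems)
  then show ?case by simp
qed simp

lemma lact_ev: "lact \<Delta> \<epsilon> act b cs (\<lambda>ds. ev u (\<lambda>i. F i ds)) = ev u (\<lambda>i. lact \<Delta> \<epsilon> act b cs (F i))"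
proof (induction cs arbitrary: b F)
  case (Cons c cs)
  show ?case unfolding lact.simps Cons.IH case_prod_unfold by (rule ev_swap)
qed (simp add: ev_fun_scale)

lemma lact_ev_pair:
  "lact \<Delta> \<epsilon> act b cs (\<lambda>ds. ev u (\<lambda>(i, j). F i j ds)) = ev u (\<lambda>(i, j). lact \<Delta> \<epsilon> act b cs (F i j))"
  unfolding case_prod_unfold by (rule lact_ev)

lemma lact_add: "lact \<Delta> \<epsilon> act b cs (\<lambda>ds. f ds + g ds) = lact \<Delta> \<epsilon> act b cs f + lact \<Delta> \<epsilon> act b cs g"
proof (induction cs arbitrary: b f g)
  case (Cons c cs)
  show ?case unfolding lact.simps Cons.IH case_prod_unfold by (rule ev_fun_add)
qed (simp add: distrib_left)

lemma lact_scale: "lact \<Delta> \<epsilon> act b cs (\<lambda>ds. a * f ds) = a * lact \<Delta> \<epsilon> act b cs f"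
proof (induction cs arbitrary: b f)
  case (Cons c cs)
  show ?case unfolding lact.simps Cons.IH case_prod_unfold by (rule ev_fun_scale)
qed (simp add: mult.left_commute)

lemma lact_zero: "lact \<Delta> \<epsilon> act b cs (\<lambda>ds. 0) = 0"
  using lact_scale[of \<Delta> \<epsilon> act b cs 0] by simp

lemma lact_minus: "lact \<Delta> \<epsilon> act b cs (\<lambda>ds. - f ds) = - lact \<Delta> \<epsilon> act b cs f"
  using lact_scale[of \<Delta> \<epsilon> act b cs "-1" f] by simp

lemma lact_alt: "lact \<Delta> \<epsilon> act b cs (\<lambda>ds. alt j (f ds)) = alt j (lact \<Delta> \<epsilon> act b cs f)"
  by (simp add: alt_def lact_minus)

lemma lact_sum: "lact \<Delta> \<epsilon> act b cs (\<lambda>ds. \<Sum>i\<in>A. f i ds) = (\<Sum>i\<in>A. lact \<Delta> \<epsilon> act b cs (f i))"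
  by (induction A rule: infinite_finite_induct) (simp_all add: lact_zero lact_add)

lemma lfun_lact_fun:
  "(\<And>ds. length ds = length cs \<Longrightarrow> lfun s (\<lambda>x. F x ds)) \<Longrightarrow> lfun s (\<lambda>x. lact \<Delta> \<epsilon> act b cs (F x))"
proof (induction cs arbitrary: b F)
  case Nil
  then show ?case by (simp add: lfun_scale_fun)
next
  case (Cons c cs)
  show ?case by (simp, intro lfun_ev_pair Cons.IH) (simp add: Cons.prems)
qed

locale hopf_module =
  B: hopf_algebra sB \<Delta>B \<epsilon> S + alg_module sB sC act
  for sB :: "'k::field \<Rightarrow> 'b::ring_1 \<Rightarrow> 'b" and \<Delta>B \<epsilon> S
    and sC :: "'k \<Rightarrow> 'c::ab_group_add \<Rightarrow> 'c" and act :: "'b \<Rightarrow> 'c \<Rightarrow> 'c"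
begin

abbreviation la where "la \<equiv> lact \<Delta>B \<epsilon> act"

lemma lfun_act_left: "lfun sC L \<Longrightarrow> lfun sB (\<lambda>b. L (act b c))"
  by (erule lfun_comp) (simp_all add: act_add_left act_scale_left)

lemma lfun_act_right: "lfun sC L \<Longrightarrow> lfun sC (\<lambda>c. L (act b c))"
  by (erule lfun_comp) (simp_all add: act_add_right act_scale_right)

lemma lfun_la: "mlin sC (length cs) f \<Longrightarrow> lfun sB (\<lambda>b. la b cs f)"
proof (induction cs arbitrary: f)
  case Nil
  show ?case by (auto simp: lfun_def lfun_add[OF B.lfun_counit] lfun_scale[OF B.lfun_counit] algebra_simps)
next
  case (Cons c cs)
  show ?case
    unfolding lact.simps
  proof (rule B.lfun_comult, rule bilinI)
    show "lfun sB (\<lambda>b1. la b2 cs (\<lambda>ds. f (act b1 c # ds)))" for b2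
      by (intro lfun_lact_fun lfun_act_left[where L = "\<lambda>c. f (c # _)"] mlin_hd[of _ "length cs"]) (use Cons.prems in auto)
    show "lfun sB (\<lambda>b2. la b2 cs (\<lambda>ds. f (act b1 c # ds)))" for b1
      by (rule Cons.IH) (use Cons.prems mlin_tl in auto)
  qed
qed

lemma mlin_la: "mlin sC N f \<Longrightarrow> mlin sC N (\<lambda>cs. la b cs f)"
proof (induction N arbitrary: b f)
  case (Suc N)
  show ?case
  proof (rule mlin_Suc)
    fix ys :: "'c list" assume "length ys = N"
    then show "lfun sC (\<lambda>c. la b (c # ys) f)"
      by (simp, intro lfun_ev_pair lfun_lact_fun lfun_act_right[where L = "\<lambda>c. f (c # _)"])
        (use Suc.prems mlin_hd in auto)
  next
    fix c
    show "mlin sC N (\<lambda>ys. la b (c # ys) f)"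
      by (simp add: case_prod_unfold, intro mlin_ev Suc.IH mlin_tl Suc.prems)
  qed
qed simp

text \<open>By coassociativity the legs of \<open>b\<close> used for the two parts of the word can
  be grouped into \<open>b1\<close> and \<open>b2\<close>.\<close>

lemma la_append:
  "mlin sC (length cs + length ds) f \<Longrightarrow>
   la b (cs @ ds) f = ev (\<Delta>B b) (\<lambda>(b1, b2). la b1 cs (\<lambda>xs. la b2 ds (\<lambda>ys. f (xs @ ys))))"
proof (induction cs arbitrary: b f)
  case Nil
  then show ?case by (simp add: B.counit_left lfun_la)
next
  case (Cons c cs)
  have "la b ((c # cs) @ ds) f = ev (\<Delta>B b) (\<lambda>(b1, b2). ev (\<Delta>B b2) (\<lambda>(x, y).
      la x cs (\<lambda>xs. la y ds (\<lambda>ys. f (act b1 c # xs @ ys)))))"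
    using Cons.prems by (simp add: Cons.IH mlin_tl)
  also have "\<dots> = ev (\<Delta>B b) (\<lambda>(b1, b2). ev (\<Delta>B b1) (\<lambda>(x, y).
      la y cs (\<lambda>xs. la b2 ds (\<lambda>ys. f (act x c # xs @ ys)))))"
  proof (rule B.coassoc_ev[symmetric], rule trilinI)
    show "lfun sB (\<lambda>u. la v cs (\<lambda>xs. la w ds (\<lambda>ys. f (act u c # xs @ ys))))" for v w
      by (intro lfun_lact_fun lfun_act_left[where L = "\<lambda>c. f (c # _)"] mlin_hd) (use Cons.prems in auto)
    show "lfun sB (\<lambda>v. la v cs (\<lambda>xs. la w ds (\<lambda>ys. f (act u c # xs @ ys))))" for u w
    proof (rule lfun_la)
      have "mlin sC (length cs) (\<lambda>xs. f (act u c # xs @ ys))" if "length ys = length ds" for ys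
        using mlin_append2[OF mlin_tl, of sC "length cs + length ds" f _ ys] Cons.prems that by simp
      then show "mlin sC (length cs) (\<lambda>xs. la w ds (\<lambda>ys. f (act u c # xs @ ys)))"
        unfolding mlin_def by (auto intro!: lfun_lact_fun)
    qed
    show "lfun sB (\<lambda>w. la v cs (\<lambda>xs. la w ds (\<lambda>ys. f (act u c # xs @ ys))))" for u v
    proof (intro lfun_lact_fun lfun_la)
      fix xs :: "'c list" assume "length xs = length cs"
      then show "mlin sC (length ds) (\<lambda>ys. f (act u c # xs @ ys))"
        using mlin_append1[OF mlin_tl, of sC "length cs + length ds" f xs] Cons.prems by simp
    qed
  qed
  also have "\<dots> = ev (\<Delta>B b) (\<lambda>(b1, b2). la b1 (c # cs) (\<lambda>xs. la b2 ds (\<lambda>ys. f (xs @ ys))))"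
    by simp
  finally show ?case .
qed

lemma la_single: "lfun sC (\<lambda>c. f [c]) \<Longrightarrow> la b [c] f = f [act b c]"
  by (simp add: B.counit_right lfun_act_left[of "\<lambda>c. f [c]"])

text \<open>Transposition reverses products. This is why the action \<open>star\<close> on
  functionals is twisted by the inverse of the antipode.\<close>

lemma la_mult: "mlin sC (length cs) f \<Longrightarrow> la (a * b) cs f = la b cs (\<lambda>ds. la a ds f)"
proof (induction cs arbitrary: a b f)
  case Nil
  then show ?case by (simp add: B.counit_mult)
next
  case (Cons c cs)
  have "la (a * b) (c # cs) f = ev (\<Delta>B a) (\<lambda>(a1, a2). ev (\<Delta>B b) (\<lambda>(b1, b2).
      la (a2 * b2) cs (\<lambda>ds. f (act (a1 * b1) c # ds))))"
    unfolding lact.simps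
  proof (rule B.comult_mult_ev, rule bilinI)
    show "lfun sB (\<lambda>b1. la b2 cs (\<lambda>ds. f (act b1 c # ds)))" for b2
      by (intro lfun_lact_fun lfun_act_left[where L = "\<lambda>c. f (c # _)"] mlin_hd[of _ "length cs"]) (use Cons.prems in auto)
    show "lfun sB (\<lambda>b2. la b2 cs (\<lambda>ds. f (act b1 c # ds)))" for b1
      by (rule lfun_la) (use Cons.prems mlin_tl in auto)
  qed
  also have "\<dots> = ev (\<Delta>B a) (\<lambda>(a1, a2). ev (\<Delta>B b) (\<lambda>(b1, b2).
      la b2 cs (\<lambda>ds. la a2 ds (\<lambda>ds. f (act a1 (act b1 c) # ds)))))"
    using Cons.prems by (simp add: Cons.IH act_mult mlin_tl)
  also have "\<dots> = la b (c # cs) (\<lambda>ds. la a ds f)"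
    by (simp add: lact_ev_pair) (rule ev_swap_pair)
  finally show ?case .
qed

lemma la_one: "mlin sC (length cs) f \<Longrightarrow> la 1 cs f = f cs"
proof (induction cs arbitrary: f)
  case Nil
  then show ?case by (simp add: B.counit_one)
next
  case (Cons c cs)
  have "la 1 (c # cs) f = la 1 cs (\<lambda>ds. f (act 1 c # ds))"
    unfolding lact.simps
  proof (rule B.comult_one_ev, rule bilinI)
    show "lfun sB (\<lambda>b1. la b2 cs (\<lambda>ds. f (act b1 c # ds)))" for b2
      by (intro lfun_lact_fun lfun_act_left[where L = "\<lambda>c. f (c # _)"] mlin_hd[of _ "length cs"]) (use Cons.prems in auto)
    show "lfun sB (\<lambda>b2. la b2 cs (\<lambda>ds. f (act b1 c # ds)))" for b1
      by (rule lfun_la) (use Cons.prems mlin_tl in auto)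
  qed
  also have "\<dots> = f (c # cs)"
    using Cons.prems by (simp add: Cons.IH act_one mlin_tl)
  finally show ?case .
qed

end

locale bijective_antipode = hopf_algebra +
  assumes bij_S: "bij S"
begin

abbreviation T where "T \<equiv> inv S"

lemma S_T [simp]: "S (T x) = x" and T_S [simp]: "T (S x) = x"
  using bij_S by (simp_all add: bij_is_inj bij_is_surj surj_f_inv_f)

lemma T_eqI: "S y = x \<Longrightarrow> T x = y"
  by auto

lemma T_add: "T (x + y) = T x + T y"
  by (rule T_eqI) (simp add: antipode_add)

lemma T_scale: "T (scale a x) = scale a (T x)"
  by (rule T_eqI) (simp add: antipode_scale)

lemma T_mult: "T (x * y) = T y * T x"
  by (rule T_eqI) (simp add: antipode_mult)

lemma T_one: "T 1 = 1"
  by (rule T_eqI) (simp add: antipode_one)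

lemma lfun_T: "lfun scale G \<Longrightarrow> lfun scale (\<lambda>x. G (T x))"
  by (erule lfun_comp) (simp_all add: T_add T_scale)

text \<open>Apply the inverse of the antipode to \<open>S b1 * b2\<close>: as an antihomomorphism it
  exchanges the factors, so the legs occur in the opposite order.\<close>

lemma T_left_ev: "lfun scale G \<Longrightarrow> ev (\<Delta> b) (\<lambda>(b1, b2). G (T b2 * b1)) = \<epsilon> b * G 1"
  using antipode_left_ev[OF lfun_T, of G b] by (simp add: T_mult T_one)

lemma T_right_ev: "lfun scale G \<Longrightarrow> ev (\<Delta> b) (\<lambda>(b1, b2). G (b2 * T b1)) = \<epsilon> b * G 1"
  using antipode_right_ev[OF lfun_T, of G b] by (simp add: T_mult T_one)

end

section \<open>Comultiplying a single letter of a word\<close>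

lemma ev_comult_at:
  "ev (comult_at \<Delta> j cs) f = ev (\<Delta> (cs ! j)) (\<lambda>(c1, c2). f (take j cs @ [c1, c2] @ drop (Suc j) cs))"
  by (simp add: comult_at_def ev_bind case_prod_unfold)

lemma ev_comult_at_0: "ev (comult_at \<Delta> 0 (c # cs)) f = ev (\<Delta> c) (\<lambda>(c1, c2). f (c1 # c2 # cs))"
  by (simp add: ev_comult_at)

lemma ev_comult_at_Suc: "ev (comult_at \<Delta> (Suc j) (c # cs)) f = ev (comult_at \<Delta> j cs) (\<lambda>ds. f (c # ds))"
  by (simp add: ev_comult_at)

lemma ev_comult_at_cong:
  assumes "j < length cs" "\<And>ds. length ds = Suc (length cs) \<Longrightarrow> f ds = g ds"
  shows "ev (comult_at \<Delta> j cs) f = ev (comult_at \<Delta> j cs) g"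
  unfolding ev_comult_at case_prod_unfold by (intro ev_cong assms(2)) (use assms(1) in simp)

lemma lfun_comult_at_fun:
  assumes "j < length cs" "\<And>ds. length ds = Suc (length cs) \<Longrightarrow> lfun s (\<lambda>x. F x ds)"
  shows "lfun s (\<lambda>x. ev (comult_at \<Delta> j cs) (F x))"
  unfolding ev_comult_at by (intro lfun_ev_pair assms(2)) (use assms(1) in simp)

text \<open>The keys of a bind are not directly accessible. The coefficient of \<open>ds\<close> is
  read off with the indicator function of \<open>ds\<close>, which vanishes on all words of the
  expected length if \<open>ds\<close> does not have it.\<close>

lemma comult_at_length:
  assumes "j < length cs" "ds \<in> Poly_Mapping.keys (comult_at \<Delta> j cs)"
  shows "length ds = Suc (length cs)"
proof (rule ccontr)
  assume *: "length ds \<noteq> Suc (length cs)"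
  have "ev (comult_at \<Delta> j cs) (\<lambda>xs. if xs = ds then 1 else 0) = ev (comult_at \<Delta> j cs) (\<lambda>xs. 0)"
    using * by (intro ev_comult_at_cong[OF assms(1)]) auto
  moreover have "ev (comult_at \<Delta> j cs) (\<lambda>xs. if xs = ds then 1 else 0) = Poly_Mapping.lookup (comult_at \<Delta> j cs) ds"
    by (simp add: lin_ext_def if_distrib sum.delta assms(2) cong: if_cong)
  ultimately show False using assms(2) by (simp add: in_keys_iff)
qed

text \<open>The map may depend on the position: projections are later applied to some letters of a
  word and not to the others.\<close>

definition mapi :: "(nat \<Rightarrow> 'c \<Rightarrow> 'd) \<Rightarrow> 'c list \<Rightarrow> 'd list"
  where "mapi g cs = map (\<lambda>j. g j (cs ! j)) [0..<length cs]"

lemma length_mapi [simp]: "length (mapi g cs) = length cs"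
  by (simp add: mapi_def)

lemma nth_mapi [simp]: "j < length cs \<Longrightarrow> mapi g cs ! j = g j (cs ! j)"
  by (simp add: mapi_def)

lemma mapi_Nil [simp]: "mapi g [] = []"
  by (simp add: mapi_def)

lemma mapi_Cons [simp]: "mapi g (c # cs) = g 0 c # mapi (\<lambda>j. g (Suc j)) cs"
  by (rule nth_equalityI) (auto simp: nth_Cons split: nat.splits)

lemma mapi_append: "mapi g (xs @ ys) = mapi g xs @ mapi (\<lambda>j. g (length xs + j)) ys"
  by (rule nth_equalityI) (auto simp: nth_append)

lemma map_eq_mapi: "map g cs = mapi (\<lambda>_. g) cs"
  by (rule nth_equalityI) auto

lemma mlin_mapi:
  fixes s :: "'k::field \<Rightarrow> 'c::ab_group_add \<Rightarrow> 'c" and s' :: "'k \<Rightarrow> 'd::ab_group_add \<Rightarrow> 'd"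
  assumes "mlin s' N f" "\<And>j x y. g j (x + y) = g j x + g j y" "\<And>j a x. g j (s a x) = s' a (g j x)"
  shows "mlin s N (\<lambda>cs. f (mapi g cs))"
  unfolding mlin_def
proof (intro allI impI)
  fix xs ys :: "'c list" assume "Suc (length xs + length ys) = N"
  then have "lfun s' (\<lambda>c. f (mapi g xs @ c # mapi (\<lambda>j. g (Suc (length xs + j))) ys))"
    by (intro mlinD[OF assms(1)]) simp
  then show "lfun s (\<lambda>c. f (mapi g (xs @ c # ys)))"
    by (simp add: mapi_append) (erule lfun_comp[where g = "g (length xs)"], simp_all add: assms)
qed

lemma lact_mapi:
  assumes "\<And>j b c. g j (act b c) = act' b (g j c)"
  shows "lact \<Delta> \<epsilon> act b cs (\<lambda>ds. f (mapi g ds)) = lact \<Delta> \<epsilon> act' b (mapi g cs) f"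
  using assms
proof (induction cs arbitrary: b f g)
  case (Cons c cs)
  have "lact \<Delta> \<epsilon> act b2 cs (\<lambda>ds. f (g 0 (act b1 c) # mapi (\<lambda>j. g (Suc j)) ds)) =
      lact \<Delta> \<epsilon> act' b2 (mapi (\<lambda>j. g (Suc j)) cs) (\<lambda>ds. f (act' b1 (g 0 c) # ds))" for b1 b2
    using Cons.IH[of "\<lambda>j. g (Suc j)" b2 "\<lambda>ds. f (act' b1 (g 0 c) # ds)"] Cons.prems by simp
  then show ?case by simp
qed simp

lemma mapi_cong: "(\<And>j. j < length cs \<Longrightarrow> g j (cs ! j) = h j (cs ! j)) \<Longrightarrow> mapi g cs = mapi h cs"
  by (rule nth_equalityI) auto

text \<open>Splitting letter \<open>j\<close> moves the positions behind it up by one. Therefore the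
  map on the shorter word skips the index \<open>Suc j\<close>.\<close>

lemma comult_at_mapi:
  assumes "j < length cs" "g j = id" "g (Suc j) = id"
  shows "ev (comult_at \<Delta> j cs) (\<lambda>ds. f (mapi g ds)) =
    ev (comult_at \<Delta> j (mapi (\<lambda>p. if p \<le> j then g p else g (Suc p)) cs)) f"
proof -
  obtain xs c ys where cs: "cs = xs @ c # ys" "length xs = j"
    using assms(1) id_take_nth_drop[of j cs] by (metis length_take min.absorb4)
  have "mapi (\<lambda>p. if p \<le> j then g p else g (Suc p)) xs = mapi g xs"
    using cs(2) by (intro mapi_cong) simp
  with cs(2) assms(2,3) show ?thesis
    by (simp add: ev_comult_at cs(1) mapi_append nth_append)
qed

text \<open>The letters are replaced one at a time. By multilinearity each replacement changes the
  value by that of a word containing the difference of new and old letter, all other letters being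
  either old or already replaced.\<close>

lemma mapi_mod:
  assumes f: "mlin s N f" and l: "length cs = N"
    and v: "\<And>j ds. j < N \<Longrightarrow> length ds = N \<Longrightarrow> ds ! j = g j (cs ! j) - cs ! j \<Longrightarrow>
      (\<And>p. p < N \<Longrightarrow> p \<noteq> j \<Longrightarrow> ds ! p = cs ! p \<or> ds ! p = g p (cs ! p)) \<Longrightarrow> f ds = 0"
  shows "f (mapi g cs) = f cs"
proof -
  have "f (take k (mapi g cs) @ drop k cs) = f cs" if "k \<le> N" for k
    using that
  proof (induction k)
    case (Suc k)
    let ?u = "take k (mapi g cs)" and ?v = "drop (Suc k) cs"
    have k: "k < length cs" using Suc.prems l by simp
    have lf: "lfun s (\<lambda>c. f (?u @ c # ?v))"
      by (rule mlinD[OF f]) (use k l in simp)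
    have "f (?u @ (g k (cs ! k) - cs ! k) # ?v) = 0"
    proof (rule v[of k])
      fix p assume "p < N" "p \<noteq> k"
      then consider "p < k" | q where "p = Suc (k + q)"
        by (metis less_imp_Suc_add nat_neq_iff)
      then show "(?u @ (g k (cs ! k) - cs ! k) # ?v) ! p = cs ! p \<or> (?u @ (g k (cs ! k) - cs ! k) # ?v) ! p = g p (cs ! p)"
        using k l \<open>p < N\<close> by cases (auto simp: nth_append)
    qed (use k l in \<open>auto simp: nth_append\<close>)
    then have "f (?u @ g k (cs ! k) # ?v) = f (?u @ cs ! k # ?v)"
      using lfun_diff[OF lf] by simp
    moreover have "take (Suc k) (mapi g cs) @ drop (Suc k) cs = ?u @ g k (cs ! k) # ?v"
      using k by (simp add: take_Suc_conv_app_nth)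
    moreover have "?u @ cs ! k # ?v = ?u @ drop k cs"
      using k by (simp add: Cons_nth_drop_Suc)
    ultimately show ?case using Suc by simp
  qed simp
  from this[of N] show ?thesis by (simp add: l)
qed

context coalgebra
begin

lemma mlin_comult_at:
  "mlin scale (Suc N) f \<Longrightarrow> j < N \<Longrightarrow> mlin scale N (\<lambda>cs. ev (comult_at \<Delta> j cs) f)"
proof (induction j arbitrary: N f)
  case 0
  then obtain M where N: "N = Suc M" by (cases N) auto
  show ?case unfolding N
  proof (rule mlin_Suc)
    fix ys :: "'c list" assume l: "length ys = M"
    show "lfun scale (\<lambda>c. ev (comult_at \<Delta> 0 (c # ys)) f)"
      unfolding ev_comult_at_0
    proof (rule lfun_comult, rule bilinI)
      show "lfun scale (\<lambda>u. f (u # v # ys))" for v by (rule mlin_hd) (use 0 N l in auto)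
      show "lfun scale (\<lambda>v. f (u # v # ys))" for u
        by (rule mlin_hd[OF mlin_tl]) (use 0 N l in auto)
    qed
  next
    fix c show "mlin scale M (\<lambda>ys. ev (comult_at \<Delta> 0 (c # ys)) f)"
      unfolding ev_comult_at_0 case_prod_unfold by (intro mlin_ev mlin_tl) (use 0 N in simp)
  qed
next
  case (Suc j)
  then obtain M where N: "N = Suc M" by (cases N) auto
  show ?case unfolding N
  proof (rule mlin_Suc)
    fix ys :: "'c list" assume l: "length ys = M"
    show "lfun scale (\<lambda>c. ev (comult_at \<Delta> (Suc j) (c # ys)) f)"
      unfolding ev_comult_at_Suc
      by (rule lfun_comult_at_fun) (use Suc.prems N l mlin_hd in auto)
  next
    fix c show "mlin scale M (\<lambda>ys. ev (comult_at \<Delta> (Suc j) (c # ys)) f)"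
      unfolding ev_comult_at_Suc by (intro Suc.IH mlin_tl) (use Suc.prems N in auto)
  qed
qed

text \<open>The dual of the cosimplicial identity between inner cofaces. For \<open>i = j\<close> it
  is coassociativity at that letter; otherwise different letters are split, and the two sums
  commute.\<close>

lemma comult_at_comult_at:
  "mlin scale (Suc (Suc (length cs))) f \<Longrightarrow> i \<le> j \<Longrightarrow> j < length cs \<Longrightarrow>
   ev (comult_at \<Delta> i cs) (\<lambda>ds. ev (comult_at \<Delta> (Suc j) ds) f) =
   ev (comult_at \<Delta> j cs) (\<lambda>ds. ev (comult_at \<Delta> i ds) f)"
proof (induction i arbitrary: j cs f)
  case 0
  then obtain c t where cs: "cs = c # t" by (cases cs) auto
  show ?case
  proof (cases j)
    case j: 0
    have "trilin scale scale scale (\<lambda>u v w. f (u # v # w # t))"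
      by (intro trilinI mlin_hd mlin_hd[OF mlin_tl] mlin_hd[OF mlin_tl[OF mlin_tl]]) (use 0 cs in auto)
    from coassoc_ev[OF this, of c] show ?thesis
      by (simp add: cs j ev_comult_at_0 ev_comult_at_Suc)
  next
    case (Suc k)
    show ?thesis
      unfolding cs Suc ev_comult_at_0 ev_comult_at_Suc case_prod_unfold by (rule ev_swap)
  qed
next
  case (Suc i)
  then obtain c t k where "cs = c # t" "j = Suc k" by (cases cs; cases j) auto
  then show ?case
    using Suc.IH[of t "\<lambda>ds. f (c # ds)" k] Suc.prems by (simp add: ev_comult_at_Suc mlin_tl)
qed

end

context module_coalgebra
begin

sublocale hopf_module sB \<Delta>B \<epsilon> S sC act
  by unfold_locales

lemma comult_act_ev:
  assumes "bilin sC sC F"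
  shows "ev (\<Delta> (act b c)) (\<lambda>(x, y). F x y) =
    ev (\<Delta>B b) (\<lambda>(b1, b2). ev (\<Delta> c) (\<lambda>(c1, c2). F (act b1 c1) (act b2 c2)))"
  using tensor2_ev[OF comult_act assms, of b c] by (simp add: ev_bind case_prod_unfold)

text \<open>In a module coalgebra the leg of \<open>b\<close> acting on a letter is split together
  with the letter; coassociativity turns the two halves into two of the legs needed for the longer
  word.\<close>

lemma la_comult_at:
  "mlin sC (Suc (length cs)) f \<Longrightarrow> j < length cs \<Longrightarrow>
   la b cs (\<lambda>ds. ev (comult_at \<Delta> j ds) f) = ev (comult_at \<Delta> j cs) (\<lambda>es. la b es f)"
proof (induction j arbitrary: b cs f)
  case 0
  then obtain c t where cs: "cs = c # t" by (cases cs) auto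
  have f1: "lfun sC (\<lambda>u. f (u # v # ys))" "lfun sC (\<lambda>u. f (v # u # ys))" if "length ys = length t" for v ys
    by (intro mlin_hd mlin_hd[OF mlin_tl]; use 0 cs that in simp)+
  have f2: "mlin sC (length t) (\<lambda>ys. f (u # v # ys))" for u v
    by (intro mlin_tl) (use 0 cs in simp)
  have "la b cs (\<lambda>ds. ev (comult_at \<Delta> 0 ds) f) =
      ev (\<Delta>B b) (\<lambda>(b1, b2). ev (\<Delta> (act b1 c)) (\<lambda>(c1, c2). la b2 t (\<lambda>ds. f (c1 # c2 # ds))))"
    by (simp add: cs ev_comult_at_0 lact_ev_pair)
  also have "\<dots> = ev (\<Delta>B b) (\<lambda>(b1, b2). ev (\<Delta>B b1) (\<lambda>(b11, b12). ev (\<Delta> c) (\<lambda>(c1, c2).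
      la b2 t (\<lambda>ds. f (act b11 c1 # act b12 c2 # ds)))))"
    by (intro ev_pair_cong comult_act_ev bilinI lfun_lact_fun f1)
  also have "\<dots> = ev (\<Delta>B b) (\<lambda>(b1, b2). ev (\<Delta>B b2) (\<lambda>(b21, b22). ev (\<Delta> c) (\<lambda>(c1, c2).
      la b22 t (\<lambda>ds. f (act b1 c1 # act b21 c2 # ds)))))"
  proof (rule B.coassoc_ev, rule trilinI)
    fix u v w
    show "lfun sB (\<lambda>u. ev (\<Delta> c) (\<lambda>(c1, c2). la w t (\<lambda>ds. f (act u c1 # act v c2 # ds))))"
      by (intro lfun_ev_pair lfun_lact_fun) (rule lfun_act_left, erule f1)
    show "lfun sB (\<lambda>v. ev (\<Delta> c) (\<lambda>(c1, c2). la w t (\<lambda>ds. f (act u c1 # act v c2 # ds))))"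
      by (intro lfun_ev_pair lfun_lact_fun) (rule lfun_act_left, erule f1)
    show "lfun sB (\<lambda>w. ev (\<Delta> c) (\<lambda>(c1, c2). la w t (\<lambda>ds. f (act u c1 # act v c2 # ds))))"
      by (intro lfun_ev_pair lfun_la f2)
  qed
  also have "\<dots> = ev (\<Delta> c) (\<lambda>(c1, c2). ev (\<Delta>B b) (\<lambda>(b1, b2). ev (\<Delta>B b2) (\<lambda>(b21, b22).
      la b22 t (\<lambda>ds. f (act b1 c1 # act b21 c2 # ds)))))"
    by (subst ev_swap_pair[of "\<Delta> c"]) (intro ev_pair_cong ev_swap_pair)
  also have "\<dots> = ev (comult_at \<Delta> 0 cs) (\<lambda>es. la b es f)"
    by (simp add: cs ev_comult_at_0)
  finally show ?case .
next
  case (Suc j)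
  then obtain c t where cs: "cs = c # t" by (cases cs) auto
  have "la b cs (\<lambda>ds. ev (comult_at \<Delta> (Suc j) ds) f) =
    ev (\<Delta>B b) (\<lambda>(b1, b2). ev (comult_at \<Delta> j t) (\<lambda>es. la b2 es (\<lambda>ds. f (act b1 c # ds))))"
    using Suc.prems by (simp add: cs ev_comult_at_Suc Suc.IH mlin_tl)
  also have "\<dots> = ev (comult_at \<Delta> (Suc j) cs) (\<lambda>es. la b es f)"
    unfolding cs ev_comult_at_Suc lact.simps case_prod_unfold by (rule ev_swap)
  finally show ?case .
qed

end

section \<open>Invariant functionals and the cocyclic structure\<close>

lemma ev_comult_at_append:
  "k < length t \<Longrightarrow> ev (comult_at \<Delta> k (t @ s)) f = ev (comult_at \<Delta> k t) (\<lambda>ds. f (ds @ s))"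
  by (simp add: ev_comult_at nth_append)

context sayd_module
begin

lemma lfun_coact:
  assumes "bilin sB sX F"
  shows "lfun sX (\<lambda>x. ev (\<rho> x) (\<lambda>(h, y). F h y))"
proof (rule lfunI)
  show "ev (\<rho> (x + y)) (\<lambda>(h, y). F h y) = ev (\<rho> x) (\<lambda>(h, y). F h y) + ev (\<rho> y) (\<lambda>(h, y). F h y)" for x y
    unfolding tensor2_ev[OF coact_add assms] ev_add ..
  show "ev (\<rho> (sX a x)) (\<lambda>(h, y). F h y) = a * ev (\<rho> x) (\<lambda>(h, y). F h y)" for a x
    unfolding tensor2_ev[OF coact_scale assms] ev_scale ..
qed

lemma coact_coassoc_ev:
  assumes "trilin sB sB sX F"
  shows "ev (\<rho> x) (\<lambda>(h, y). ev (\<Delta>B h) (\<lambda>(h1, h2). F h1 h2 y)) =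
    ev (\<rho> x) (\<lambda>(h, y). ev (\<rho> y) (\<lambda>(h', z). F h h' z))"
  using tensor3_ev[OF coact_coassoc[of x] assms] by (simp add: ev_bind case_prod_unfold)

lemma coact_counit_ev: "lfun sX G \<Longrightarrow> ev (\<rho> x) (\<lambda>(h, y). \<epsilon> h * G y) = G x"
  using coact_counit[of x] lfun_lin_ext[of sX G "\<rho> x" "\<lambda>(h, y). sX (\<epsilon> h) y"]
  by (simp add: case_prod_unfold lfun_scale)

lemma stable_ev: "lfun sX G \<Longrightarrow> ev (\<rho> x) (\<lambda>(h, y). G (act h y)) = G x"
  using stable[of x] lfun_lin_ext[of sX G "\<rho> x" "\<lambda>(h, y). act h y"]
  by (simp add: case_prod_unfold)

lemma anti_yetter_drinfeld_ev:
  assumes "bilin sB sX F"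
  shows "ev (\<rho> (act b x)) (\<lambda>(h, y). F h y) = ev (\<Delta>B b) (\<lambda>(b1, b'). ev (\<Delta>B b') (\<lambda>(b2, b3).
      ev (\<rho> x) (\<lambda>(h, y). F (b1 * h * inv S b3) (act b2 y))))"
  using tensor2_ev[OF anti_yetter_drinfeld assms, of b x] by (simp add: ev_bind case_prod_unfold)

end

locale cyclic_coefficients =
  bijective_antipode sB \<Delta>B \<epsilon> S + X: sayd_module sB \<Delta>B \<epsilon> S sX actX \<rho> +
  C: module_coalgebra sB \<Delta>B \<epsilon> S sC actC \<Delta>C
  for sB :: "'k::field \<Rightarrow> 'b::ring_1 \<Rightarrow> 'b" and \<Delta>B \<epsilon> S
    and sX :: "'k \<Rightarrow> 'x::ab_group_add \<Rightarrow> 'x" and actX \<rho>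
    and sC :: "'k \<Rightarrow> 'c::ab_group_add \<Rightarrow> 'c" and actC \<Delta>C
begin

definition multilinear :: "nat \<Rightarrow> ('x \<Rightarrow> 'c list \<Rightarrow> 'k) \<Rightarrow> bool" where
  "multilinear N \<phi> \<longleftrightarrow> (\<forall>cs. length cs = N \<longrightarrow> lfun sX (\<lambda>x. \<phi> x cs)) \<and> (\<forall>x. mlin sC N (\<phi> x))"

text \<open>By \<open>CM_rels_annihilator\<close>, these are the functionals on the cocyclic module: \<open>B\<close>-invariance is rephrased by moving
  the action on \<open>X\<close> to the other side with the antipode.\<close>

definition balanced :: "nat \<Rightarrow> ('x \<Rightarrow> 'c list \<Rightarrow> 'k) \<Rightarrow> bool" where
  "balanced N \<phi> \<longleftrightarrow> multilinear N \<phi> \<and>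
     (\<forall>b x cs. length cs = N \<longrightarrow> C.la b cs (\<phi> x) = \<phi> (actX (S b) x) cs)"

lemma multilinearD: "multilinear N \<phi> \<Longrightarrow> length cs = N \<Longrightarrow> lfun sX (\<lambda>x. \<phi> x cs)"
  "multilinear N \<phi> \<Longrightarrow> mlin sC N (\<phi> x)"
  by (simp_all add: multilinear_def)

lemma lfun_actX_left: "lfun sX L \<Longrightarrow> lfun sB (\<lambda>b. L (actX b x))"
  by (erule lfun_comp) (simp_all add: X.act_add_left X.act_scale_left)

lemma lfun_actX_right: "lfun sX L \<Longrightarrow> lfun sX (\<lambda>x. L (actX b x))"
  by (erule lfun_comp) (simp_all add: X.act_add_right X.act_scale_right)

text \<open>Moving \<open>b1\<close> from the word to X produces the factor
  \<open>S b1 * b2\<close>, which contracts to the counit.\<close>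

lemma balanced_invariant:
  assumes "balanced N \<phi>" "length cs = N"
  shows "ev (\<Delta>B b) (\<lambda>(b1, b2). C.la b1 cs (\<phi> (actX b2 x))) = \<epsilon> b * \<phi> x cs"
proof -
  have lx: "lfun sX (\<lambda>x. \<phi> x cs)" using assms by (simp add: balanced_def multilinear_def)
  have "ev (\<Delta>B b) (\<lambda>(b1, b2). C.la b1 cs (\<phi> (actX b2 x))) =
      ev (\<Delta>B b) (\<lambda>(b1, b2). \<phi> (actX (S b1 * b2) x) cs)"
    using assms by (simp add: balanced_def X.act_mult)
  also have "\<dots> = \<epsilon> b * \<phi> (actX 1 x) cs"
    by (rule antipode_left_ev) (rule lfun_actX_left[OF lx])
  finally show ?thesis by (simp add: X.act_one)
qed

text \<open>Insert a counit of the first leg of \<open>b\<close>, replace it by means of the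
  invariance, and contract the two legs that now act on X, the second of which is under
  \<open>S\<close>.\<close>

lemma balancedI:
  assumes m: "multilinear N \<phi>"
    and inv: "\<And>b x cs. length cs = N \<Longrightarrow> ev (\<Delta>B b) (\<lambda>(b1, b2). C.la b1 cs (\<phi> (actX b2 x))) = \<epsilon> b * \<phi> x cs"
  shows "balanced N \<phi>"
  unfolding balanced_def
proof (intro conjI allI impI)
  fix b x and cs :: "'c list" assume l: "length cs = N"
  have lx: "lfun sX (\<lambda>x. \<phi> x ds)" if "length ds = length cs" for ds
    using m that l by (simp add: multilinear_def)
  have lc: "mlin sC (length cs) (\<phi> x)" for x using m l by (simp add: multilinear_def)
  have "\<phi> (actX (S b) x) cs = ev (\<Delta>B b) (\<lambda>(b1, b2). \<epsilon> b1 * \<phi> (actX (S b2) x) cs)"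
    by (rule counit_left[symmetric]) (intro lfun_antipode lfun_actX_left[OF lx] refl)
  also have "\<dots> = ev (\<Delta>B b) (\<lambda>(b1, b2). ev (\<Delta>B b1) (\<lambda>(p, q). C.la p cs (\<phi> (actX (q * S b2) x))))"
    using l by (simp add: inv X.act_mult)
  also have "\<dots> = ev (\<Delta>B b) (\<lambda>(b1, b2). ev (\<Delta>B b2) (\<lambda>(p, q). C.la b1 cs (\<phi> (actX (p * S q) x))))"
    by (rule coassoc_ev) (intro trilinI lfun_lact_fun C.lfun_la lc
        lfun_mult_right[where G = "\<lambda>b. \<phi> (actX b x) _"]
        lfun_antipode[where G = "\<lambda>b. \<phi> (actX (_ * b) x) _"] lfun_mult_left[where G = "\<lambda>b. \<phi> (actX b x) _"]
        lfun_actX_left[OF lx])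
  also have "\<dots> = ev (\<Delta>B b) (\<lambda>(b1, b2). \<epsilon> b2 * C.la b1 cs (\<phi> x))"
  proof (intro ev_pair_cong)
    fix b1 b2
    have "ev (\<Delta>B b2) (\<lambda>(p, q). C.la b1 cs (\<phi> (actX (p * S q) x))) = \<epsilon> b2 * C.la b1 cs (\<phi> (actX 1 x))"
      by (rule antipode_right_ev) (intro lfun_lact_fun lfun_actX_left lx)
    then show "ev (\<Delta>B b2) (\<lambda>(p, q). C.la b1 cs (\<phi> (actX (p * S q) x))) = \<epsilon> b2 * C.la b1 cs (\<phi> x)"
      by (simp add: X.act_one)
  qed
  also have "\<dots> = C.la b cs (\<phi> x)"
    by (rule counit_right) (rule C.lfun_la[OF lc])
  finally show "C.la b cs (\<phi> x) = \<phi> (actX (S b) x) cs" ..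
qed (rule m)

text \<open>\<open>diag_act\<close> peels the legs off one by one and leaves the last one to X,
  whereas on the right one leg is handed to the whole word and one to X. Coassociativity reconciles
  the two.\<close>

lemma ev_diag_act:
  "multilinear (length cs) \<phi> \<Longrightarrow> ev (diag_act \<Delta>B actX actC b x cs) (\<lambda>(y, ds). \<phi> y ds) =
    ev (\<Delta>B b) (\<lambda>(b1, b2). C.la b1 cs (\<phi> (actX b2 x)))"
proof (induction cs arbitrary: b \<phi>)
  case Nil
  have "lfun sB (\<lambda>b. \<phi> (actX b x) [])"
    using Nil by (intro lfun_actX_left) (simp add: multilinear_def)
  from counit_left[OF this] show ?case by simp
next
  case (Cons c cs)
  have lx: "lfun sX (\<lambda>x. \<phi> x (d # ds))" if "length ds = length cs" for d ds
    using Cons.prems that by (simp add: multilinear_def)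
  have lc: "mlin sC (Suc (length cs)) (\<phi> x)" for x using Cons.prems by (simp add: multilinear_def)
  have m: "multilinear (length cs) (\<lambda>y ds. \<phi> y (d # ds))" for d
    using lx mlin_tl[OF lc] by (simp add: multilinear_def)
  have "ev (diag_act \<Delta>B actX actC b x (c # cs)) (\<lambda>(y, ds). \<phi> y ds) =
    ev (\<Delta>B b) (\<lambda>(b1, b2). ev (diag_act \<Delta>B actX actC b2 x cs) (\<lambda>(y, ds). \<phi> y (actC b1 c # ds)))"
    by (simp add: ev_bind case_prod_unfold)
  also have "\<dots> = ev (\<Delta>B b) (\<lambda>(b1, b2). ev (\<Delta>B b2) (\<lambda>(p, q). C.la p cs (\<lambda>ds. \<phi> (actX q x) (actC b1 c # ds))))"
    by (intro ev_pair_cong Cons.IH[OF m])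
  also have "\<dots> = ev (\<Delta>B b) (\<lambda>(b1, b2). ev (\<Delta>B b1) (\<lambda>(p, q). C.la q cs (\<lambda>ds. \<phi> (actX b2 x) (actC p c # ds))))"
    by (rule coassoc_ev[symmetric]) (intro trilinI lfun_lact_fun C.lfun_la mlin_tl lc lfun_actX_left lx
       C.lfun_act_left[where L = "\<lambda>d. \<phi> _ (d # _)"] mlin_hd[OF lc])
  finally show ?case by simp
qed

lemma CM_rels_annihilator:
  "(\<forall>r\<in>coeff_power_rels sX sC n \<union>
      {diag_act \<Delta>B actX actC b x cs - fscale (\<epsilon> b) (gen (x, cs)) | b x cs. length cs = Suc n}.
      ev r (\<lambda>(x, cs). \<phi> x cs) = 0) \<longleftrightarrow> balanced (Suc n) \<phi>" (is "?L \<longleftrightarrow> _")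
proof -
  have ann: "(\<forall>r\<in>coeff_power_rels sX sC n. ev r (\<lambda>(x, cs). \<phi> x cs) = 0) \<longleftrightarrow> multilinear (Suc n) \<phi>"
    unfolding coeff_power_rels_def ball_Un slot_rels_annihilator multilinear_def mlin_def
    by (auto simp: imp_ex)
  have diag: "ev (diag_act \<Delta>B actX actC b x cs - fscale (\<epsilon> b) (gen (x, cs))) (\<lambda>(x, cs). \<phi> x cs) =
      ev (\<Delta>B b) (\<lambda>(b1, b2). C.la b1 cs (\<phi> (actX b2 x))) - \<epsilon> b * \<phi> x cs"
    if "multilinear (Suc n) \<phi>" "length cs = Suc n" for b x cs
    using that by (simp add: ev_diff ev_scale ev_diag_act)
  show ?thesis
  proof
    assume L: ?L
    with ann have m: "multilinear (Suc n) \<phi>" by blast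
    show "balanced (Suc n) \<phi>"
    proof (rule balancedI[OF m])
      fix b x and cs :: "'c list" assume l: "length cs = Suc n"
      have "ev (diag_act \<Delta>B actX actC b x cs - fscale (\<epsilon> b) (gen (x, cs))) (\<lambda>(x, cs). \<phi> x cs) = 0"
        using L l by blast
      then show "ev (\<Delta>B b) (\<lambda>(b1, b2). C.la b1 cs (\<phi> (actX b2 x))) = \<epsilon> b * \<phi> x cs"
        unfolding diag[OF m l] by simp
    qed
  next
    assume b: "balanced (Suc n) \<phi>"
    then have m: "multilinear (Suc n) \<phi>" by (simp add: balanced_def)
    show ?L
    proof
      fix r assume "r \<in> coeff_power_rels sX sC n \<union>
        {diag_act \<Delta>B actX actC b x cs - fscale (\<epsilon> b) (gen (x, cs)) | b x cs. length cs = Suc n}"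
      then consider "r \<in> coeff_power_rels sX sC n" | b x cs where "length cs = Suc n"
        "r = diag_act \<Delta>B actX actC b x cs - fscale (\<epsilon> b) (gen (x, cs))" by blast
      then show "ev r (\<lambda>(x, cs). \<phi> x cs) = 0"
      proof cases
        case 1
        with ann m
        show ?thesis by blast
      next
        case (2 b x cs)
        then show ?thesis
          using diag[OF m 2(1), of b x] balanced_invariant[OF b 2(1), of b x] by simp
      qed
    qed
  qed
qed

text \<open>This and \<open>cshift\<close> are the transposes of an inner coface and of the cyclic
  operator; composites therefore appear in reversed order.\<close>

definition split_at :: "nat \<Rightarrow> ('x \<Rightarrow> 'c list \<Rightarrow> 'k) \<Rightarrow> 'x \<Rightarrow> 'c list \<Rightarrow> 'k"
  where "split_at j \<phi> x cs = ev (comult_at \<Delta>C j cs) (\<phi> x)"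

definition cshift :: "('x \<Rightarrow> 'c list \<Rightarrow> 'k) \<Rightarrow> 'x \<Rightarrow> 'c list \<Rightarrow> 'k"
  where "cshift \<phi> x cs = ev (\<rho> x) (\<lambda>(h, y). \<phi> y (tl cs @ [actC h (hd cs)]))"

lemma balanced_split_at:
  assumes b: "balanced (Suc N) \<phi>" and j: "j < N"
  shows "balanced N (split_at j \<phi>)"
proof -
  have m: "multilinear (Suc N) \<phi>" using b by (simp add: balanced_def)
  have "multilinear N (split_at j \<phi>)"
    unfolding multilinear_def
  proof (intro conjI allI impI)
    show "lfun sX (\<lambda>x. split_at j \<phi> x cs)" if "length cs = N" for cs
      unfolding split_at_def using that j m by (intro lfun_comult_at_fun) (auto intro: multilinearD)
    show "mlin sC N (split_at j \<phi> x)" for x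
      unfolding split_at_def by (rule C.mlin_comult_at[OF multilinearD(2)[OF m] j])
  qed
  moreover have "C.la b cs (split_at j \<phi> x) = split_at j \<phi> (actX (S b) x) cs" if l: "length cs = N" for b x cs
  proof -
    have "C.la b cs (split_at j \<phi> x) = ev (comult_at \<Delta>C j cs) (\<lambda>es. C.la b es (\<phi> x))"
      unfolding split_at_def using multilinearD(2)[OF m] l j by (intro C.la_comult_at) auto
    also have "\<dots> = split_at j \<phi> (actX (S b) x) cs"
      unfolding split_at_def using b l j by (intro ev_comult_at_cong) (auto simp: balanced_def)
    finally show ?thesis .
  qed
  ultimately show ?thesis by (simp add: balanced_def)
qed

text \<open>This is where the anti-Yetter-Drinfeld condition makes the cyclic operator compatible
  with coinvariants. The coaction of the leg acting on X puts a leg and the inverse antipode of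
  another one in front of the rotated letter. Three consecutive legs then form a diagonal action,
  which invariance removes, and the remaining two contract.\<close>

lemma balanced_cshift:
  assumes b: "balanced N \<phi>" and "0 < N"
  shows "balanced N (cshift \<phi>)"
proof -
  obtain n where Suc: "N = Suc n" using \<open>0 < N\<close> by (cases N) auto
  have m: "multilinear (Suc n) \<phi>" using b Suc by (simp add: balanced_def)
  have lx: "lfun sX (\<lambda>x. \<phi> x cs)" if "length cs = Suc n" for cs by (rule multilinearD(1)[OF m that])
  have ll: "lfun sC (\<lambda>d. \<phi> x (t @ [d]))" if "length t = n" for x t
    using mlinD[OF multilinearD(2)[OF m], of t "[]"] that by simp
  have lb: "lfun sB (\<lambda>z. \<phi> x (t @ [actC z c]))" if "length t = n" for x t c
    by (rule C.lfun_act_left[OF ll[OF that]])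
  have lt: "mlin sC n (\<lambda>t. \<phi> x (t @ [d]))" for x d
    by (rule mlin_append2[OF multilinearD(2)[OF m]]) simp
  have bl: "bilin sB sX (\<lambda>h y. \<phi> y (t @ [actC h c]))" if "length t = n" for t c
    using that by (intro bilinI lb lx) auto
  have "multilinear N (cshift \<phi>)"
    unfolding multilinear_def Suc
  proof (intro conjI allI impI)
    show "lfun sX (\<lambda>x. cshift \<phi> x cs)" if "length cs = Suc n" for cs
      unfolding cshift_def using that by (intro X.lfun_coact bl) simp
    show "mlin sC (Suc n) (cshift \<phi> x)" for x
    proof (rule mlin_Suc)
      show "lfun sC (\<lambda>c. cshift \<phi> x (c # ys))" if "length ys = n" for ys
        unfolding cshift_def using that by (auto intro!: lfun_ev_pair C.lfun_act_right ll)
      show "mlin sC n (\<lambda>ys. cshift \<phi> x (c # ys))" for c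
        unfolding cshift_def case_prod_unfold by (auto intro!: mlin_ev lt)
    qed
  qed
  moreover have "ev (\<Delta>B b) (\<lambda>(b1, b2). C.la b1 cs (cshift \<phi> (actX b2 x))) = \<epsilon> b * cshift \<phi> x cs"
    if "length cs = N" for b x cs
  proof -
    obtain c t where cs: "cs = c # t" and t: "length t = n"
      using \<open>length cs = N\<close> Suc by (cases cs) auto
    \<comment> \<open>The legs of \<open>b\<close> in order: \<open>b1\<close> acts on the first
      letter, \<open>u\<close> on the other ones, and \<open>p\<close>, \<open>q\<close>,
      \<open>r\<close> come from the anti-Yetter-Drinfeld expansion. The consecutive legs
      \<open>u\<close>, \<open>p\<close>, \<open>q\<close> act diagonally on the rotated word and on
      \<open>y\<close>; what remains is \<open>T r * b1\<close>.\<close>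
    define H where "H b1 u p q r h y = C.la u t (\<lambda>t'. \<phi> (actX q y) (t' @ [actC (p * (h * (T r * b1))) c]))"
      for b1 u p q r h y
    have H1: "lfun sB (\<lambda>b1. H b1 u p q r h y)" for u p q r h y
      unfolding H_def by (intro lfun_lact_fun lfun_mult_left[where G = "\<lambda>z. \<phi> (actX q y) (_ @ [actC z c])"]
        lfun_mult_left[where G = "\<lambda>z. \<phi> (actX q y) (_ @ [actC (_ * z) c])"]
        lfun_mult_left[where G = "\<lambda>z. \<phi> (actX q y) (_ @ [actC (_ * (_ * z)) c])"] lb) (simp add: t)
    have H2: "lfun sB (\<lambda>u. H b1 u p q r h y)" for b1 p q r h y
      unfolding H_def using lt t by (intro C.lfun_la) simp
    have H3: "lfun sB (\<lambda>p. H b1 u p q r h y)" for b1 u q r h y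
      unfolding H_def by (intro lfun_lact_fun lfun_mult_right[where G = "\<lambda>z. \<phi> (actX q y) (_ @ [actC z c])"] lb) (simp add: t)
    have H4: "lfun sB (\<lambda>q. H b1 u p q r h y)" for b1 u p r h y
      unfolding H_def by (intro lfun_lact_fun lfun_actX_left lx) (simp add: t)
    have H5: "lfun sB (\<lambda>r. H b1 u p q r h y)" for b1 u p q h y
      unfolding H_def by (intro lfun_lact_fun
        lfun_T[where G = "\<lambda>z. \<phi> (actX q y) (_ @ [actC (p * (h * (z * b1))) c])"]
        lfun_mult_right[where G = "\<lambda>z. \<phi> (actX q y) (_ @ [actC (p * (h * z)) c])"]
        lfun_mult_left[where G = "\<lambda>z. \<phi> (actX q y) (_ @ [actC (p * z) c])"]
        lfun_mult_left[where G = "\<lambda>z. \<phi> (actX q y) (_ @ [actC z c])"] lb) (simp add: t)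
    have rot: "cshift \<phi> (actX v x) (actC b1 c # t') = ev (\<Delta>B v) (\<lambda>(p, b'). ev (\<Delta>B b') (\<lambda>(q, r).
        ev (\<rho> x) (\<lambda>(h, y). \<phi> (actX q y) (t' @ [actC (p * (h * (T r * b1))) c]))))"
      if "length t' = n" for v b1 t'
      unfolding cshift_def list.sel X.anti_yetter_drinfeld_ev[OF bl[OF that]]
      by (simp add: C.act_mult mult.assoc)
    have larot: "C.la u t (\<lambda>t'. cshift \<phi> (actX v x) (actC b1 c # t')) =
        ev (\<Delta>B v) (\<lambda>(p, b'). ev (\<Delta>B b') (\<lambda>(q, r). ev (\<rho> x) (\<lambda>(h, y). H b1 u p q r h y)))" for u v b1
    proof -
      have "C.la u t (\<lambda>t'. cshift \<phi> (actX v x) (actC b1 c # t')) = C.la u t (\<lambda>t'. 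
        ev (\<Delta>B v) (\<lambda>(p, b'). ev (\<Delta>B b') (\<lambda>(q, r).
        ev (\<rho> x) (\<lambda>(h, y). \<phi> (actX q y) (t' @ [actC (p * (h * (T r * b1))) c])))))"
        by (rule lact_cong) (simp add: rot t)
      then show ?thesis by (simp add: H_def lact_ev_pair)
    qed
    have "ev (\<Delta>B b) (\<lambda>(b1, b2). C.la b1 cs (cshift \<phi> (actX b2 x))) =
       ev (\<Delta>B b) (\<lambda>(b1, b2). ev (\<Delta>B b1) (\<lambda>(b11, b12). C.la b12 t (\<lambda>t'. cshift \<phi> (actX b2 x) (actC b11 c # t'))))"
      by (simp add: cs)
    also have "\<dots> = ev (\<Delta>B b) (\<lambda>(b1, b2). ev (\<Delta>B b2) (\<lambda>(b21, b22). C.la b21 t (\<lambda>t'. cshift \<phi> (actX b22 x) (actC b1 c # t'))))"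
    proof (rule coassoc_ev, rule trilinI)
      show "lfun sB (\<lambda>w. C.la v t (\<lambda>t'. cshift \<phi> (actX w x) (actC u c # t')))" for u v
        using \<open>multilinear N (cshift \<phi>)\<close>
        by (intro lfun_lact_fun lfun_actX_left) (simp add: multilinear_def Suc t)
    qed (unfold larot, (intro lfun_ev_pair H1 H2)+)
    also have "\<dots> = ev (\<Delta>B b) (\<lambda>(b1, b2). ev (\<Delta>B b2) (\<lambda>(u, v). 
        ev (\<Delta>B v) (\<lambda>(p, b'). ev (\<Delta>B b') (\<lambda>(q, r). ev (\<rho> x) (\<lambda>(h, y). H b1 u p q r h y)))))"
      by (simp add: larot)
    also have "\<dots> = ev (\<Delta>B b) (\<lambda>(b1, b2). ev (\<Delta>B b2) (\<lambda>(u, v). 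
        ev (\<Delta>B v) (\<lambda>(m, r). ev (\<Delta>B m) (\<lambda>(p, q). ev (\<rho> x) (\<lambda>(h, y). H b1 u p q r h y)))))"
      by (rule ev_pair_cong, rule ev_pair_cong, rule coassoc_ev[symmetric]) (intro trilinI lfun_ev_pair H3 H4 H5)
    also have "\<dots> = ev (\<Delta>B b) (\<lambda>(b1, b2). ev (\<Delta>B b2) (\<lambda>(w, r). 
        ev (\<Delta>B w) (\<lambda>(u, m). ev (\<Delta>B m) (\<lambda>(p, q). ev (\<rho> x) (\<lambda>(h, y). H b1 u p q r h y)))))"
    proof (rule ev_pair_cong, rule coassoc_ev[symmetric], rule trilinI)
      show "lfun sB (\<lambda>m. ev (\<Delta>B m) (\<lambda>(p, q). ev (\<rho> x) (\<lambda>(h, y). H b1 u p q r h y)))" for b1 u r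
        by (rule lfun_comult) (intro bilinI lfun_ev_pair H3 H4)
    qed (intro lfun_ev_pair H2 H5)+
    also have "\<dots> = ev (\<Delta>B b) (\<lambda>(b1, b2). ev (\<Delta>B b2) (\<lambda>(w, r). 
        \<epsilon> w * ev (\<rho> x) (\<lambda>(h, y). \<phi> y (t @ [actC (h * (T r * b1)) c]))))"
    proof (intro ev_pair_cong)
      fix b1 w r
      have *: "ev (\<Delta>B w) (\<lambda>(u, m). ev (\<Delta>B m) (\<lambda>(p, q). H b1 u p q r h y)) = \<epsilon> w * \<phi> y (t @ [actC (h * (T r * b1)) c])" for h y
      proof -
        let ?d = "actC (h * (T r * b1)) c"
        have "ev (\<Delta>B w) (\<lambda>(u, m). ev (\<Delta>B m) (\<lambda>(p, q). H b1 u p q r h y)) =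
            ev (\<Delta>B w) (\<lambda>(m, q). ev (\<Delta>B m) (\<lambda>(u, p). H b1 u p q r h y))"
          by (intro coassoc_ev[symmetric] trilinI H2 H3 H4)
        also have "\<dots> = ev (\<Delta>B w) (\<lambda>(m, q). C.la m (t @ [?d]) (\<phi> (actX q y)))"
        proof (intro ev_pair_cong)
          fix m q
          have "C.la m (t @ [?d]) (\<phi> (actX q y)) =
              ev (\<Delta>B m) (\<lambda>(u, p). C.la u t (\<lambda>t'. C.la p [?d] (\<lambda>ys. \<phi> (actX q y) (t' @ ys))))"
            using multilinearD(2)[OF m] t by (intro C.la_append) simp
          also have "\<dots> = ev (\<Delta>B m) (\<lambda>(u, p). H b1 u p q r h y)"
            unfolding H_def by (intro ev_pair_cong lact_cong)
              (subst C.la_single, auto simp: t C.act_mult intro: ll)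
          finally show "ev (\<Delta>B m) (\<lambda>(u, p). H b1 u p q r h y) = C.la m (t @ [?d]) (\<phi> (actX q y))" ..
        qed
        also have "\<dots> = \<epsilon> w * \<phi> y (t @ [?d])"
          by (rule balanced_invariant[OF b]) (simp add: t Suc)
        finally show ?thesis .
      qed
      have "ev (\<Delta>B w) (\<lambda>(u, m). ev (\<Delta>B m) (\<lambda>(p, q). ev (\<rho> x) (\<lambda>(h, y). H b1 u p q r h y))) =
          ev (\<rho> x) (\<lambda>(h, y). ev (\<Delta>B w) (\<lambda>(u, m). ev (\<Delta>B m) (\<lambda>(p, q). H b1 u p q r h y)))"
        by (subst ev_swap_pair[of "\<rho> x"]) (intro ev_pair_cong ev_swap_pair)
      then show "ev (\<Delta>B w) (\<lambda>(u, m). ev (\<Delta>B m) (\<lambda>(p, q). ev (\<rho> x) (\<lambda>(h, y). H b1 u p q r h y))) =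
          \<epsilon> w * ev (\<rho> x) (\<lambda>(h, y). \<phi> y (t @ [actC (h * (T r * b1)) c]))"
        by (simp add: * ev_pair_scale)
    qed
    also have "\<dots> = ev (\<Delta>B b) (\<lambda>(b1, b2). ev (\<rho> x) (\<lambda>(h, y). \<phi> y (t @ [actC (h * (T b2 * b1)) c])))"
      by (intro ev_pair_cong counit_left lfun_ev_pair
        lfun_T[where G = "\<lambda>z. \<phi> _ (_ @ [actC (_ * (z * _)) c])"]
        lfun_mult_right[where G = "\<lambda>z. \<phi> _ (_ @ [actC (_ * z) c])"]
        lfun_mult_left[where G = "\<lambda>z. \<phi> _ (_ @ [actC z c])"] lb t)
    also have "\<dots> = \<epsilon> b * ev (\<rho> x) (\<lambda>(h, y). \<phi> y (t @ [actC (h * 1) c]))"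
      by (rule T_left_ev) (intro lfun_ev_pair lfun_mult_left[where G = "\<lambda>z. \<phi> _ (_ @ [actC z c])"] lb t)
    also have "\<dots> = \<epsilon> b * cshift \<phi> x cs"
      by (simp add: cshift_def cs)
    finally show ?thesis .
  qed
  ultimately show ?thesis by (rule balancedI)
qed

lemma split_at_cshift:
  assumes "Suc k < length cs"
  shows "split_at (Suc k) (cshift \<phi>) x cs = cshift (split_at k \<phi>) x cs"
proof -
  obtain c t where cs: "cs = c # t" using assms by (cases cs) auto
  have k: "k < length t" using assms cs by simp
  show ?thesis
    unfolding split_at_def cshift_def cs ev_comult_at_Suc list.sel case_prod_unfold ev_comult_at_append[OF k]
    by (rule ev_swap)
qed

text \<open>Splitting a rotated letter \<open>actC h c\<close> splits \<open>h\<close> as well.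
  Coassociativity of the coaction turns the two legs of \<open>h\<close> into two successive
  coactions, that is, into two rotations.\<close>

lemma split_at_cshift_cshift:
  assumes m: "multilinear (Suc (Suc n)) \<phi>" and l: "length cs = Suc n"
  shows "split_at 0 (cshift (cshift \<phi>)) x cs = cshift (split_at n \<phi>) x cs"
proof -
  obtain c t where cs: "cs = c # t" and t: "length t = n" using l by (cases cs) auto
  have l1: "lfun sC (\<lambda>d. \<phi> y (t @ [d, e]))" for y e
    using mlinD[OF multilinearD(2)[OF m], of t "[e]"] t by simp
  have l2: "lfun sC (\<lambda>d. \<phi> y (t @ [e, d]))" for y e
    using mlinD[OF multilinearD(2)[OF m], of "t @ [e]" "[]"] t by simp
  have l3: "lfun sX (\<lambda>x. \<phi> x (t @ [d, e]))" for d e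
    by (rule multilinearD(1)[OF m]) (simp add: t)
  have "cshift (split_at n \<phi>) x cs = ev (\<rho> x) (\<lambda>(h, y). ev (\<Delta>C (actC h c)) (\<lambda>(d, e). \<phi> y (t @ [d, e])))"
    by (simp add: cshift_def split_at_def cs ev_comult_at t[symmetric])
  also have "\<dots> = ev (\<rho> x) (\<lambda>(h, y). ev (\<Delta>B h) (\<lambda>(h1, h2). ev (\<Delta>C c) (\<lambda>(d, e). \<phi> y (t @ [actC h1 d, actC h2 e]))))"
    by (intro ev_pair_cong C.comult_act_ev bilinI l1 l2)
  also have "\<dots> = ev (\<rho> x) (\<lambda>(h, y). ev (\<rho> y) (\<lambda>(h', z). ev (\<Delta>C c) (\<lambda>(d, e). \<phi> z (t @ [actC h d, actC h' e]))))"
    by (rule X.coact_coassoc_ev) (intro trilinI lfun_ev_pair l3 C.lfun_act_left[OF l1] C.lfun_act_left[OF l2])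
  also have "\<dots> = ev (\<Delta>C c) (\<lambda>(d, e). ev (\<rho> x) (\<lambda>(h, y). ev (\<rho> y) (\<lambda>(h', z). \<phi> z (t @ [actC h d, actC h' e]))))"
    by (subst ev_swap_pair[of "\<Delta>C c"]) (intro ev_pair_cong ev_swap_pair)
  also have "\<dots> = split_at 0 (cshift (cshift \<phi>)) x cs"
    by (simp add: cshift_def split_at_def cs ev_comult_at_0)
  finally show ?thesis ..
qed

text \<open>Each rotation applies the coaction once more. By coassociativity the iterated coactions
  merge into a single one, whose coefficient acts diagonally on all rotated letters.\<close>

lemma cshift_funpow:
  assumes "multilinear N \<phi>" "length cs + length ds = N"
  shows "(cshift ^^ length cs) \<phi> x (cs @ ds) = ev (\<rho> x) (\<lambda>(h, y). C.la h cs (\<lambda>es. \<phi> y (ds @ es)))"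
  using assms(2)
proof (induction cs arbitrary: x ds)
  case Nil
  then have "lfun sX (\<lambda>x. \<phi> x ds)" by (intro multilinearD(1)[OF assms(1)]) simp
  from X.coact_counit_ev[OF this] show ?case by simp
next
  case (Cons c cs)
  have lx: "lfun sX (\<lambda>x. \<phi> x (ds @ d # es))" if "length es = length cs" for d es
    using Cons.prems that by (intro multilinearD(1)[OF assms(1)]) simp
  have lc: "lfun sC (\<lambda>d. \<phi> x (ds @ d # es))" if "length es = length cs" for x es
    using Cons.prems that by (intro mlinD[OF multilinearD(2)[OF assms(1)]]) simp
  have lm: "mlin sC (length cs) (\<lambda>es. \<phi> y (ds @ d # es))" for y d
    using mlin_append1[OF multilinearD(2)[OF assms(1)], of "ds @ [d]" "length cs" y] Cons.prems by simp
  have "(cshift ^^ length (c # cs)) \<phi> x ((c # cs) @ ds) =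
      ev (\<rho> x) (\<lambda>(h, y). (cshift ^^ length cs) \<phi> y (cs @ (ds @ [actC h c])))"
    by (simp add: cshift_def[of _ x])
  also have "\<dots> = ev (\<rho> x) (\<lambda>(h, y). ev (\<rho> y) (\<lambda>(h', z). C.la h' cs (\<lambda>es. \<phi> z (ds @ actC h c # es))))"
    using Cons.prems by (subst Cons.IH) auto
  also have "\<dots> = ev (\<rho> x) (\<lambda>(h, y). ev (\<Delta>B h) (\<lambda>(h1, h2). C.la h2 cs (\<lambda>es. \<phi> y (ds @ actC h1 c # es))))"
    by (rule X.coact_coassoc_ev[symmetric]) (intro trilinI lfun_lact_fun C.lfun_la lx lm C.lfun_act_left[OF lc])
  finally show ?case by simp
qed

text \<open>After a full turn the coefficient \<open>h\<close> of the coaction acts on the whole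
  word. Stability writes \<open>y\<close> as \<open>actX h' z\<close> with another coaction, so that
  \<open>h\<close> and \<open>h'\<close> become the two legs of one element, and invariance replaces
  this element by its counit.\<close>

lemma cshift_funpow_full:
  assumes b: "balanced N \<phi>" and l: "length cs = N"
  shows "(cshift ^^ N) \<phi> x cs = \<phi> x cs"
proof -
  have m: "multilinear N \<phi>" using b by (simp add: balanced_def)
  have lx: "lfun sX (\<lambda>x. \<phi> x es)" if "length es = length cs" for es
    using multilinearD(1)[OF m] that l by simp
  have lm: "mlin sC (length cs) (\<phi> y)" for y using multilinearD(2)[OF m] l by simp
  have "(cshift ^^ N) \<phi> x cs = ev (\<rho> x) (\<lambda>(h, y). C.la h cs (\<phi> y))"
    using cshift_funpow[OF m, of cs "[]" x] l by simp
  also have "\<dots> = ev (\<rho> x) (\<lambda>(h, y). ev (\<rho> y) (\<lambda>(h', z). C.la h cs (\<phi> (actX h' z))))"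
    by (intro ev_pair_cong X.stable_ev[symmetric] lfun_lact_fun lx)
  also have "\<dots> = ev (\<rho> x) (\<lambda>(h, y). ev (\<Delta>B h) (\<lambda>(h1, h2). C.la h1 cs (\<phi> (actX h2 y))))"
    by (rule X.coact_coassoc_ev[symmetric])
      (intro trilinI lfun_lact_fun C.lfun_la lm lfun_actX_left lfun_actX_right lx)
  also have "\<dots> = ev (\<rho> x) (\<lambda>(h, y). \<epsilon> h * \<phi> y cs)"
    by (simp add: balanced_invariant[OF b l])
  also have "\<dots> = \<phi> x cs"
    by (rule X.coact_counit_ev) (rule lx, simp)
  finally show ?thesis .
qed

end

section \<open>Cocyclic objects and their bicomplex\<close>

definition additive_map :: "('a::ab_group_add \<Rightarrow> 'b::ab_group_add) \<Rightarrow> bool"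
  where "additive_map f \<longleftrightarrow> (\<forall>x y. f (x + y) = f x + f y)"

lemma additive_mapD: "additive_map f \<Longrightarrow> f (x + y) = f x + f y"
  by (simp add: additive_map_def)

lemma additive_map_0: "additive_map f \<Longrightarrow> f 0 = 0"
  by (metis add.right_neutral add_left_cancel additive_mapD)

lemma additive_map_minus: "additive_map f \<Longrightarrow> f (- x) = - f x"
  using additive_mapD[of f x "- x"] by (simp add: additive_map_0 eq_neg_iff_add_eq_0 add.commute)

lemma additive_map_diff: "additive_map f \<Longrightarrow> f (x - y) = f x - f y"
  using additive_mapD[of f x "- y"] by (simp add: additive_map_minus)

lemma additive_map_sum: "additive_map f \<Longrightarrow> f (\<Sum>i\<in>A. g i) = (\<Sum>i\<in>A. f (g i))"
  by (induction A rule: infinite_finite_induct) (simp_all add: additive_map_0 additive_mapD)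

lemma additive_map_alt: "additive_map f \<Longrightarrow> f (alt j x) = alt j (f x)"
  by (simp add: alt_def additive_map_minus)

lemma alt_0 [simp]: "alt j 0 = 0"
  by (simp add: alt_def)

lemma alt_alt [simp]: "alt j (alt j x) = x"
  by (simp add: alt_def)

lemma alt_swap: "alt i (alt j x) = alt j (alt i x)"
  by (simp add: alt_def)

lemma alt_Suc: "alt (Suc j) x = - alt j x"
  by (simp add: alt_def)

lemma alt_minus: "alt j (- x) = - alt j x"
  by (simp add: alt_def)

lemma alt_diff: "alt j (x - y) = alt j x - alt j y"
  by (simp add: alt_def)

lemma alt_add: "alt j (x + y) = alt j x + alt j y"
  by (simp add: alt_def)

text \<open>The pairs \<open>(Suc j, i)\<close> with \<open>i \<le> j\<close> correspond to the
  pairs \<open>(i, j)\<close>, and both kinds together exhaust the range. This is the combinatorics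
  behind the vanishing of squared differentials.\<close>

lemma alternating_double_sum:
  fixes a :: "nat \<Rightarrow> nat \<Rightarrow> 'v::ab_group_add"
  assumes "\<And>i j. i \<le> j \<Longrightarrow> j \<le> m \<Longrightarrow> a (Suc j) i = - a i j"
  shows "(\<Sum>j\<le>Suc m. \<Sum>i\<le>m. a j i) = 0"
proof -
  have "(\<Sum>j\<le>Suc m. \<Sum>i\<le>m. a j i) = (\<Sum>i\<le>m. \<Sum>j\<le>Suc m. a j i)"
    by (rule sum.swap)
  also have "\<dots> = (\<Sum>i\<le>m. (\<Sum>j\<le>i. a j i) + (\<Sum>j\<in>{i..m}. a (Suc j) i))"
  proof (rule sum.cong)
    fix i assume "i \<in> {..m}"
    then have "{..Suc m} = {..i} \<union> Suc ` {i..m}"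
      by (auto simp: image_Suc_atLeastAtMost)
    then have "(\<Sum>j\<le>Suc m. a j i) = (\<Sum>j\<le>i. a j i) + (\<Sum>j\<in>Suc ` {i..m}. a j i)"
      by (simp only:) (rule sum.union_disjoint, auto)
    also have "(\<Sum>j\<in>Suc ` {i..m}. a j i) = (\<Sum>j\<in>{i..m}. a (Suc j) i)"
      by (simp only: sum.reindex[OF inj_on_subset[OF inj_Suc subset_UNIV]] o_def)
    finally show "(\<Sum>j\<le>Suc m. a j i) = (\<Sum>j\<le>i. a j i) + (\<Sum>j\<in>{i..m}. a (Suc j) i)" .
  qed simp
  also have "\<dots> = (\<Sum>i\<le>m. \<Sum>j\<le>i. a j i) - (\<Sum>i\<le>m. \<Sum>j\<in>{i..m}. a i j)"
    by (simp add: sum.distrib assms sum_negf sum_subtractf)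
  also have "(\<Sum>i\<le>m. \<Sum>j\<in>{i..m}. a i j) = (\<Sum>j\<le>m. \<Sum>i\<le>j. a i j)"
    by (simp add: sum.Sigma) (rule sum.reindex_bij_witness[of _ "\<lambda>(j, i). (i, j)" "\<lambda>(i, j). (j, i)"], auto)
  finally show ?thesis by simp
qed

text \<open>\<open>S n j\<close> and \<open>L n\<close> are the signed operators \<open>(-1)\<^sup>j \<partial>\<^sub>j\<close> and \<open>(-1)\<^sup>n \<tau>\<^sub>n\<close>.\<close>

locale strict_cocyclic =
  fixes V :: "nat \<Rightarrow> 'v::ab_group_add set" and S :: "nat \<Rightarrow> nat \<Rightarrow> 'v \<Rightarrow> 'v" and L :: "nat \<Rightarrow> 'v \<Rightarrow> 'v"
  assumes S_add: "additive_map (S n j)" and L_add: "additive_map (L n)"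
    and V_sum: "(\<And>i. i \<in> A \<Longrightarrow> f i \<in> V n) \<Longrightarrow> finite (A :: nat set) \<Longrightarrow> (\<Sum>i\<in>A. f i) \<in> V n"
    and S_V: "u \<in> V n \<Longrightarrow> j \<le> n \<Longrightarrow> S n j u \<in> V (Suc n)" and L_V: "u \<in> V n \<Longrightarrow> L n u \<in> V n"
    and S_S: "u \<in> V n \<Longrightarrow> i \<le> j \<Longrightarrow> j \<le> n \<Longrightarrow> S (Suc n) (Suc j) (S n i u) = - S (Suc n) i (S n j u)"
    and L_S: "u \<in> V n \<Longrightarrow> j < n \<Longrightarrow> L (Suc n) (S n (Suc j) u) = S n j (L n u)"
    and L_L_S: "u \<in> V n \<Longrightarrow> L (Suc n) (L (Suc n) (S n 0 u)) = S n n (L n u)"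
    and L_pow: "u \<in> V n \<Longrightarrow> (L n ^^ Suc n) u = u"
begin

definition D' where "D' n u = (\<Sum>j\<le>n. S n j u)"

text \<open>The Hochschild differential: the last coface is the cyclic operator after coface 0, and
  its sign is the one contained in \<open>L (Suc n)\<close>.\<close>

definition D where "D n u = D' n u + L (Suc n) (S n 0 u)"

definition N where "N n u = (\<Sum>i\<le>n. (L n ^^ i) u)"

lemma D'_D': "u \<in> V n \<Longrightarrow> D' (Suc n) (D' n u) = 0"
  unfolding D'_def additive_map_sum[OF S_add] by (rule alternating_double_sum) (rule S_S)

lemma D_D: assumes u: "u \<in> V n" shows "D (Suc n) (D n u) = 0"
proof -
  \<comment> \<open>With the last coface included, the missing cosimplicial relations follow from
    the cyclic ones. In the three cases below, the left-hand side contains no, one or two last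
    cofaces.\<close>
  define S' where "S' n j u = (if j \<le> n then S n j u else L (Suc n) (S n 0 u))" for n j u
  have add: "additive_map (S' n j)" for n j
    unfolding S'_def additive_map_def by (simp add: additive_mapD[OF S_add] additive_mapD[OF L_add])
  have D: "D n u = (\<Sum>j\<le>Suc n. S' n j u)" for n u
    by (simp add: D_def D'_def S'_def)
  have "S' (Suc n) (Suc j) (S' n i u) = - S' (Suc n) i (S' n j u)" if ij: "i \<le> j" "j \<le> Suc n" for i j
  proof -
    consider "j \<le> n" | "j = Suc n" "i \<le> n" | "j = Suc n" "i = Suc n" using ij le_Suc_eq by (metis le_trans)
    then show ?thesis
    proof cases
      case 1
      then show ?thesis using ij u by (simp add: S'_def S_S)
    next
      case 2
      have "S (Suc n) 0 (S n i u) = - S (Suc n) (Suc i) (S n 0 u)"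
        using S_S[OF u, of 0 i] 2 by simp
      then have "L (Suc (Suc n)) (S (Suc n) 0 (S n i u)) = - S (Suc n) i (L (Suc n) (S n 0 u))"
        using 2 u by (simp add: additive_map_minus[OF L_add] L_S S_V)
      then show ?thesis using 2 by (simp add: S'_def)
    next
      case 3
      have eq: "S (Suc n) 0 (S n 0 u) = - S (Suc n) (Suc 0) (S n 0 u)"
        using S_S[OF u, of 0 0] by simp
      have "L (Suc (Suc n)) (L (Suc (Suc n)) (S (Suc n) 0 (S n 0 u))) =
        - L (Suc (Suc n)) (S (Suc n) 0 (L (Suc n) (S n 0 u)))"
        unfolding eq using u by (simp add: additive_map_minus[OF L_add] L_S S_V)
      moreover have "L (Suc (Suc n)) (L (Suc (Suc n)) (S (Suc n) 0 (S n 0 u))) =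
        S (Suc n) (Suc n) (L (Suc n) (S n 0 u))"
        using u by (simp add: L_L_S S_V)
      ultimately show ?thesis using 3 by (simp add: S'_def)
    qed
  qed
  then show ?thesis
    unfolding D additive_map_sum[OF add] by (rule alternating_double_sum)
qed

text \<open>\<open>L\<close> takes coface \<open>Suc j\<close> of \<open>u\<close> to coface
  \<open>j\<close> of \<open>L n u\<close>, and applied twice to coface 0 it yields the top coface
  of \<open>L n u\<close>. So \<open>L (Suc n) (D n u)\<close> consists of all inner cofaces of
  \<open>L n u\<close> and of \<open>L (Suc n) (S n 0 u)\<close>, which cancels against the last
  coface in \<open>D n u\<close>.\<close>

lemma D_L:
  assumes u: "u \<in> V n"
  shows "D n u - L (Suc n) (D n u) = D' n u - D' n (L n u)"
proof -
  have 1: "L (Suc n) (D' n u) = L (Suc n) (S n 0 u) + (\<Sum>j<n. S n j (L n u))"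
    using u by (simp add: D'_def sum.atMost_shift additive_mapD[OF L_add] additive_map_sum[OF L_add] L_S)
  have 2: "D' n (L n u) = (\<Sum>j<n. S n j (L n u)) + S n n (L n u)"
    by (simp add: D'_def lessThan_Suc_atMost[symmetric])
  show ?thesis
    unfolding D_def additive_mapD[OF L_add] 1 2 L_L_S[OF u] by simp
qed

lemma L_funpow_V: "u \<in> V n \<Longrightarrow> (L n ^^ i) u \<in> V n"
  by (induction i) (auto intro: L_V)

lemma L_funpow_S: "u \<in> V n \<Longrightarrow> i \<le> j \<Longrightarrow> j \<le> n \<Longrightarrow> (L (Suc n) ^^ i) (S n j u) = S n (j - i) ((L n ^^ i) u)"
proof (induction i)
  case (Suc i)
  then have "(L (Suc n) ^^ Suc i) (S n j u) = L (Suc n) (S n (Suc (j - Suc i)) ((L n ^^ i) u))"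
    by (simp add: Suc_diff_Suc)
  also have "\<dots> = S n (j - Suc i) ((L n ^^ Suc i) u)"
    using Suc.prems by (subst L_S) (auto intro: L_funpow_V)
  finally show ?case .
qed simp

text \<open>Iterating \<open>L\<close> moves coface \<open>j\<close> around a circle: it descends to
  index 0 in \<open>j\<close> steps, is the last coface once, and reenters at the top. Collecting
  the double sum by the power of \<open>L\<close> that has reached \<open>u\<close> gives all
  cofaces of all these powers.\<close>

lemma N_D':
  assumes u: "u \<in> V n"
  shows "N (Suc n) (D' n u) = D n (N n u)"
proof -
  define t where "t k m = S n k ((L n ^^ m) u)" for k m
  \<comment> \<open>The coface of \<open>(L n ^^ m) u\<close> that occurs in row \<open>j\<close>.
    It occurs at exponent \<open>m\<close> as long as \<open>m \<le> j\<close>, and at exponent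
    \<open>Suc m\<close> later, as the exponent \<open>Suc j\<close> belongs to the last
    coface.\<close>
  define g where "g j m = t (if m \<le> j then j - m else Suc n + j - m) m" for j m
  have add: "additive_map (L (Suc n) ^^ i)" for i
    by (induction i) (simp_all add: additive_map_def additive_mapD[OF L_add])
  have up: "(L (Suc n) ^^ i) (S n j u) = t (j - i) i" if "i \<le> j" "j \<le> n" for i j
    using that u by (simp add: t_def L_funpow_S)
  have mid: "(L (Suc n) ^^ Suc j) (S n j u) = L (Suc n) (S n 0 ((L n ^^ j) u))" if "j \<le> n" for j
    using that u by (simp add: L_funpow_S)
  have down: "(L (Suc n) ^^ Suc m) (S n j u) = t (Suc n + j - m) m" if "j < m" "m \<le> n" for j m
  proof -
    obtain d where m: "m = Suc (j + d)" using \<open>j < m\<close> less_imp_Suc_add by blast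
    have "(L (Suc n) ^^ Suc m) (S n j u) = (L (Suc n) ^^ d) ((L (Suc n) ^^ Suc (Suc j)) (S n j u))"
    proof -
      have "Suc m = d + Suc (Suc j)" by (simp add: m)
      then show ?thesis by (simp only: funpow_add o_apply)
    qed
    also have "(L (Suc n) ^^ Suc (Suc j)) (S n j u) = S n n ((L n ^^ Suc j) u)"
      using L_funpow_V[OF u, of j] mid[of j] m that by (simp add: L_L_S)
    also have "(L (Suc n) ^^ d) (S n n ((L n ^^ Suc j) u)) = S n (n - d) ((L n ^^ d) ((L n ^^ Suc j) u))"
      using m that L_funpow_V[OF u, of "Suc j"] by (intro L_funpow_S) auto
    also have "(L n ^^ d) ((L n ^^ Suc j) u) = (L n ^^ m) u"
    proof -
      have "m = d + Suc j" by (simp add: m)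
      then show ?thesis by (simp only: funpow_add o_apply)
    qed
    also have "n - d = Suc n + j - m" using m by simp
    finally show ?thesis by (simp add: t_def)
  qed
  have row: "(\<Sum>i\<le>Suc n. (L (Suc n) ^^ i) (S n j u)) = L (Suc n) (S n 0 ((L n ^^ j) u)) + (\<Sum>m\<le>n. g j m)"
    if j: "j \<le> n" for j
  proof -
    let ?f = "\<lambda>i. (L (Suc n) ^^ i) (S n j u)"
    let ?k = "\<lambda>m. if m \<le> j then m else Suc m"
    have img: "{..Suc n} = insert (Suc j) (?k ` {..n})"
    proof (intro set_eqI iffI)
      fix x assume x: "x \<in> {..Suc n}"
      consider "x \<le> j" | "x = Suc j" | "x > Suc j" by linarith
      then show "x \<in> insert (Suc j) (?k ` {..n})"
      proof cases
        case 3
        then have "x = ?k (x - 1)" "x - 1 \<in> {..n}" using x by auto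
        then show ?thesis by blast
      qed (use j in \<open>auto simp: image_iff\<close>)
    qed (use j in \<open>auto split: if_splits\<close>)
    have inj: "inj_on ?k {..n}" by (auto simp: inj_on_def split: if_splits)
    have "(\<Sum>i\<le>Suc n. ?f i) = ?f (Suc j) + (\<Sum>m\<in>?k ` {..n}. ?f m)"
      unfolding img by (rule sum.insert) (auto split: if_splits)
    also have "(\<Sum>m\<in>?k ` {..n}. ?f m) = (\<Sum>m\<le>n. ?f (?k m))"
      unfolding sum.reindex[OF inj] o_def ..
    finally have "(\<Sum>i\<le>Suc n. ?f i) = ?f (Suc j) + (\<Sum>m\<le>n. ?f (?k m))" .
    also have "(\<Sum>m\<le>n. ?f (?k m)) = (\<Sum>m\<le>n. g j m)"
    proof (rule sum.cong)
      fix m assume "m \<in> {..n}"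
      then show "?f (?k m) = g j m"
        using up[of m j] down[of j m] j unfolding g_def by (auto simp del: funpow.simps)
    qed simp
    finally show ?thesis unfolding mid[OF j] .
  qed
  have col: "(\<Sum>j\<le>n. g j m) = (\<Sum>k\<le>n. t k m)" if m: "m \<le> n" for m
  proof -
    \<comment> \<open>For fixed \<open>m\<close> the index of the coface is a rotation of
      \<open>{..n}\<close>.\<close>
    have "bij_betw (\<lambda>j. if m \<le> j then j - m else Suc n + j - m) {..n} {..n}"
      by (rule bij_betw_byWitness[where f' = "\<lambda>k. if k + m \<le> n then k + m else k + m - Suc n"])
        (use m in \<open>auto split: if_splits\<close>)
    from sum.reindex_bij_betw[OF this, of "\<lambda>k. t k m"] show ?thesis
      by (simp add: g_def)
  qed
  have "N (Suc n) (D' n u) = (\<Sum>i\<le>Suc n. \<Sum>j\<le>n. (L (Suc n) ^^ i) (S n j u))"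
    by (simp only: N_def D'_def additive_map_sum[OF add])
  also have "\<dots> = (\<Sum>j\<le>n. \<Sum>i\<le>Suc n. (L (Suc n) ^^ i) (S n j u))"
    by (rule sum.swap)
  also have "\<dots> = (\<Sum>j\<le>n. L (Suc n) (S n 0 ((L n ^^ j) u))) + (\<Sum>j\<le>n. \<Sum>m\<le>n. g j m)"
    unfolding sum.distrib[symmetric] by (rule sum.cong) (simp_all only: row atMost_iff)
  also have "(\<Sum>j\<le>n. \<Sum>m\<le>n. g j m) = (\<Sum>m\<le>n. \<Sum>k\<le>n. t k m)"
    by (subst sum.swap) (simp add: col)
  also have "\<dots> = D' n (N n u)"
    by (subst sum.swap) (simp add: D'_def N_def t_def additive_map_sum[OF S_add])
  also have "(\<Sum>j\<le>n. L (Suc n) (S n 0 ((L n ^^ j) u))) = L (Suc n) (S n 0 (N n u))"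
    by (simp add: N_def additive_map_sum[OF S_add] additive_map_sum[OF L_add])
  finally show ?thesis by (simp add: D_def add.commute)
qed

lemma L_N:
  assumes u: "u \<in> V n"
  shows "L n (N n u) = N n u" "N n (L n u) = N n u"
proof -
  have "(\<Sum>i\<le>n. (L n ^^ Suc i) u) + u = (\<Sum>i\<le>Suc n. (L n ^^ i) u)"
    by (subst (2) sum.atMost_shift) (simp add: lessThan_Suc_atMost add.commute)
  also have "\<dots> = N n u + u"
    unfolding sum.atMost_Suc L_pow[OF u] N_def ..
  finally have *: "(\<Sum>i\<le>n. (L n ^^ Suc i) u) = N n u" by simp
  show "L n (N n u) = N n u"
    unfolding N_def additive_map_sum[OF L_add] using * by (simp add: N_def)
  show "N n (L n u) = N n u"
    unfolding *[symmetric] by (simp add: N_def funpow_swap1)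
qed

end

section \<open>Presented cocyclic objects and their total complex\<close>

locale cocyclic_object =
  fixes M :: "('i \<Rightarrow>\<^sub>0 'k::field) cocyclic"
  assumes subspace_chains: "fs.subspace (chains M n)"
    and subspace_rels: "fs.subspace (rels M n)"
    and rels_chains: "rels M n \<subseteq> chains M n"
    and coface_add: "coface M n j (u + v) = coface M n j u + coface M n j v"
    and coface_scale: "coface M n j (fscale a u) = fscale a (coface M n j u)"
    and cyc_add: "cyc M n (u + v) = cyc M n u + cyc M n v"
    and cyc_scale: "cyc M n (fscale a u) = fscale a (cyc M n u)"
    and coface_chains: "u \<in> chains M n \<Longrightarrow> j \<le> Suc n \<Longrightarrow> coface M n j u \<in> chains M (Suc n)"
    and coface_rels: "u \<in> rels M n \<Longrightarrow> j \<le> Suc n \<Longrightarrow> coface M n j u \<in> rels M (Suc n)"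
    and cyc_chains: "u \<in> chains M n \<Longrightarrow> cyc M n u \<in> chains M n"
    and cyc_rels: "u \<in> rels M n \<Longrightarrow> cyc M n u \<in> rels M n"
    and coface_last: "u \<in> chains M n \<Longrightarrow>
      coface M n (Suc n) u \<approx>\<^bsub>rels M (Suc n)\<^esub> cyc M (Suc n) (coface M n 0 u)"
    and coface_coface: "u \<in> chains M n \<Longrightarrow> i \<le> j \<Longrightarrow> j \<le> n \<Longrightarrow>
      coface M (Suc n) (Suc j) (coface M n i u) \<approx>\<^bsub>rels M (Suc (Suc n))\<^esub> coface M (Suc n) i (coface M n j u)"
    and cyc_coface: "u \<in> chains M n \<Longrightarrow> j < n \<Longrightarrow>
      cyc M (Suc n) (coface M n (Suc j) u) \<approx>\<^bsub>rels M (Suc n)\<^esub> coface M n j (cyc M n u)"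
    and cyc_cyc_coface: "u \<in> chains M n \<Longrightarrow>
      cyc M (Suc n) (cyc M (Suc n) (coface M n 0 u)) \<approx>\<^bsub>rels M (Suc n)\<^esub> coface M n n (cyc M n u)"
    and cyc_pow: "u \<in> chains M n \<Longrightarrow> (cyc M n ^^ Suc n) u \<approx>\<^bsub>rels M n\<^esub> u"
begin

lemma additive_coface: "additive_map (coface M n j)" and additive_cyc: "additive_map (cyc M n)"
  by (simp_all add: additive_map_def coface_add cyc_add)

lemma
  shows rels_0: "0 \<in> rels M n"
    and rels_add: "u \<in> rels M n \<Longrightarrow> v \<in> rels M n \<Longrightarrow> u + v \<in> rels M n"
    and rels_diff: "u \<in> rels M n \<Longrightarrow> v \<in> rels M n \<Longrightarrow> u - v \<in> rels M n"
    and rels_minus: "u \<in> rels M n \<Longrightarrow> - u \<in> rels M n"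
    and rels_scale: "u \<in> rels M n \<Longrightarrow> fscale a u \<in> rels M n"
    and rels_alt: "u \<in> rels M n \<Longrightarrow> alt j u \<in> rels M n"
    and rels_sum: "(\<And>i. i \<in> A \<Longrightarrow> g i \<in> rels M n) \<Longrightarrow> (\<Sum>i\<in>A. g i) \<in> rels M n"
  using subspace_rels[of n]
  by (auto simp: fs.subspace_0 fs.subspace_add fs.subspace_diff fs.subspace_neg fs.subspace_scale fs.subspace_sum alt_def)

lemma
  shows chains_0: "0 \<in> chains M n"
    and chains_add: "u \<in> chains M n \<Longrightarrow> v \<in> chains M n \<Longrightarrow> u + v \<in> chains M n"
    and chains_diff: "u \<in> chains M n \<Longrightarrow> v \<in> chains M n \<Longrightarrow> u - v \<in> chains M n"
    and chains_minus: "u \<in> chains M n \<Longrightarrow> - u \<in> chains M n"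
    and chains_scale: "u \<in> chains M n \<Longrightarrow> fscale a u \<in> chains M n"
    and chains_alt: "u \<in> chains M n \<Longrightarrow> alt j u \<in> chains M n"
    and chains_sum: "(\<And>i. i \<in> A \<Longrightarrow> g i \<in> chains M n) \<Longrightarrow> (\<Sum>i\<in>A. g i) \<in> chains M n"
  using subspace_chains[of n]
  by (auto simp: fs.subspace_0 fs.subspace_add fs.subspace_diff fs.subspace_neg fs.subspace_scale fs.subspace_sum alt_def)

lemma projection_ex: "\<exists>p. Vector_Spaces.linear fscale fscale p \<and> (\<forall>u\<in>rels M n. p u = 0) \<and> (\<forall>u. u - p u \<in> rels M n)"
proof -
  interpret vp: vector_space_pair "fscale :: 'k \<Rightarrow> ('i \<Rightarrow>\<^sub>0 'k) \<Rightarrow> _" "fscale :: 'k \<Rightarrow> ('i \<Rightarrow>\<^sub>0 'k) \<Rightarrow> _"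
    by unfold_locales
  have id: "Vector_Spaces.linear fscale fscale (\<lambda>u. u :: 'i \<Rightarrow>\<^sub>0 'k)"
    using fs.linear_ident .
  obtain g where g: "range g \<subseteq> rels M n" "Vector_Spaces.linear fscale fscale g" "\<forall>v\<in>rels M n. g v = v"
    using vp.linear_exists_left_inverse_on[OF id subspace_rels, of n] by auto
  have "Vector_Spaces.linear fscale fscale (\<lambda>u. u - g u)"
    using vp.linear_compose_sub[OF id g(2)] .
  then show ?thesis using g by (intro exI[of _ "\<lambda>u. u - g u"]) auto
qed

text \<open>A linear choice of normal forms modulo the relations makes the identities of the presented operators strict.\<close>

definition nf where
  "nf n = (SOME p. Vector_Spaces.linear fscale fscale p \<and> (\<forall>u\<in>rels M n. p u = 0) \<and> (\<forall>u. u - p u \<in> rels M n))"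

lemma nf: "Vector_Spaces.linear fscale fscale (nf n)" "u \<in> rels M n \<Longrightarrow> nf n u = 0" "u - nf n u \<in> rels M n"
  using someI_ex[OF projection_ex[of n]] unfolding nf_def by auto

lemma additive_nf: "additive_map (nf n)"
  using nf(1)[of n] by (simp add: additive_map_def Vector_Spaces.linear_iff)

lemma nf_eq_iff: "nf n u = nf n v \<longleftrightarrow> u - v \<in> rels M n"
proof
  assume "nf n u = nf n v"
  then have "(u - nf n u) - (v - nf n v) = u - v" by simp
  then show "u - v \<in> rels M n" using rels_diff[OF nf(3)[of u n] nf(3)[of v n]] by simp
next
  assume "u - v \<in> rels M n"
  from nf(2)[OF this] show "nf n u = nf n v" by (simp add: additive_map_diff[OF additive_nf])
qed

lemma nf_eq_0_iff: "nf n u = 0 \<longleftrightarrow> u \<in> rels M n"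
  using nf_eq_iff[of n u 0] by (simp add: additive_map_0[OF additive_nf])

lemma nf_chains: "u \<in> chains M n \<Longrightarrow> nf n u \<in> chains M n"
  using chains_diff[of u n "u - nf n u"] subsetD[OF rels_chains nf(3)] by simp

lemma nf_coface: "j \<le> Suc n \<Longrightarrow> nf (Suc n) (coface M n j (nf n u)) = nf (Suc n) (coface M n j u)"
  using coface_rels[OF rels_minus[OF nf(3)[of u n]], of j]
  by (simp add: nf_eq_iff additive_map_diff[OF additive_coface, symmetric])

lemma nf_cyc: "nf n (cyc M n (nf n u)) = nf n (cyc M n u)"
  using cyc_rels[OF rels_minus[OF nf(3)[of u n]]]
  by (simp add: nf_eq_iff additive_map_diff[OF additive_cyc, symmetric])

lemma nf_nf: "nf n (nf n u) = nf n u"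
  using rels_minus[OF nf(3)[of u n]] by (simp add: nf_eq_iff)

lemma nf_alt: "nf n (alt j u) = alt j (nf n u)"
  by (rule additive_map_alt[OF additive_nf])

lemma nf_signed_cyc: "nf n (signed_cyc M n (nf n u)) = nf n (signed_cyc M n u)"
  by (simp add: signed_cyc_def nf_alt nf_cyc)

lemma nf_funpow: "nf n (((\<lambda>u. nf n (signed_cyc M n u)) ^^ i) u) = nf n ((signed_cyc M n ^^ i) u)"
proof (induction i)
  case (Suc i)
  have "nf n (signed_cyc M n (((\<lambda>u. nf n (signed_cyc M n u)) ^^ i) u)) = nf n (signed_cyc M n ((signed_cyc M n ^^ i) u))"
    by (metis Suc nf_signed_cyc)
  then show ?case by (simp add: nf_nf)
qed simp

lemma additive_signed_cyc: "additive_map (signed_cyc M n)"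
  by (simp add: signed_cyc_def additive_map_def cyc_add alt_add)

text \<open>The accumulated sign has exponent \<open>n * Suc n\<close>, which is even.\<close>

lemma signed_cyc_funpow:
  "(signed_cyc M n ^^ Suc n) u = (cyc M n ^^ Suc n) u"
proof -
  have "(signed_cyc M n ^^ i) u = alt (n * i) ((cyc M n ^^ i) u)" for i
  proof (induction i)
    case (Suc i)
    then show ?case by (simp add: signed_cyc_def additive_map_alt[OF additive_cyc]) (simp add: alt_def)
  qed (simp add: alt_def)
  moreover have "alt (n * Suc n) v = v" for v :: "'i \<Rightarrow>\<^sub>0 'k" by (simp add: alt_def)
  ultimately show ?thesis by metis
qed

sublocale nf: strict_cocyclic "\<lambda>n. {u \<in> chains M n. nf n u = u}" "\<lambda>n j u. nf (Suc n) (alt j (coface M n j u))"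
  "\<lambda>n u. nf n (signed_cyc M n u)"
proof
  fix n j
  show "additive_map (\<lambda>u. nf (Suc n) (alt j (coface M n j u)))"
    by (simp add: additive_map_def coface_add alt_add additive_mapD[OF additive_nf])
  show "additive_map (\<lambda>u. nf n (signed_cyc M n u))"
    by (simp add: additive_map_def additive_mapD[OF additive_signed_cyc] additive_mapD[OF additive_nf])
  fix u assume "u \<in> {u \<in> chains M n. nf n u = u}"
  then have u: "u \<in> chains M n" and nfu: "nf n u = u" by auto
  show "j \<le> n \<Longrightarrow> nf (Suc n) (alt j (coface M n j u)) \<in> {u \<in> chains M (Suc n). nf (Suc n) u = u}"
    using u by (auto intro!: nf_chains chains_alt coface_chains simp: nf_nf)
  show "nf n (signed_cyc M n u) \<in> {u \<in> chains M n. nf n u = u}"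
    using u unfolding signed_cyc_def by (auto intro!: nf_chains chains_alt cyc_chains simp: nf_nf)
  show "nf (Suc (Suc n)) (alt (Suc j) (coface M (Suc n) (Suc j) (nf (Suc n) (alt i (coface M n i u))))) =
      - nf (Suc (Suc n)) (alt i (coface M (Suc n) i (nf (Suc n) (alt j (coface M n j u)))))"
    if "i \<le> j" "j \<le> n" for i
    using that coface_coface[OF u that]
    by (simp add: nf_alt nf_coface additive_map_alt[OF additive_coface] alt_Suc alt_swap[of i] nf_eq_iff[symmetric]
      additive_map_minus[OF additive_nf] alt_minus)
  show "nf (Suc n) (signed_cyc M (Suc n) (nf (Suc n) (alt (Suc j) (coface M n (Suc j) u)))) =
      nf (Suc n) (alt j (coface M n j (nf n (signed_cyc M n u))))" if "j < n"
    using that cyc_coface[OF u that]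
    by (simp add: signed_cyc_def nf_alt nf_coface nf_cyc additive_map_alt[OF additive_coface]
       additive_map_alt[OF additive_cyc] alt_Suc alt_minus alt_swap[of n] nf_eq_iff[symmetric]
       additive_map_minus[OF additive_cyc] additive_map_minus[OF additive_nf])
  show "nf (Suc n) (signed_cyc M (Suc n) (nf (Suc n) (signed_cyc M (Suc n) (nf (Suc n) (alt 0 (coface M n 0 u)))))) =
      nf (Suc n) (alt n (coface M n n (nf n (signed_cyc M n u))))"
  proof -
    have "nf (Suc n) (signed_cyc M (Suc n) (nf (Suc n) (signed_cyc M (Suc n) (nf (Suc n) (alt 0 (coface M n 0 u)))))) =
       nf (Suc n) (cyc M (Suc n) (cyc M (Suc n) (coface M n 0 u)))"
      by (simp add: signed_cyc_def nf_alt nf_cyc additive_map_alt[OF additive_cyc]) (simp add: alt_def)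
    also have "\<dots> = nf (Suc n) (coface M n n (cyc M n u))"
      using cyc_cyc_coface[OF u] by (simp add: nf_eq_iff)
    also have "\<dots> = nf (Suc n) (alt n (coface M n n (nf n (signed_cyc M n u))))"
      by (simp add: signed_cyc_def nf_alt nf_coface additive_map_alt[OF additive_coface])
    finally show ?thesis .
  qed
  show "((\<lambda>u. nf n (signed_cyc M n u)) ^^ Suc n) u = u"
  proof -
    have "((\<lambda>u. nf n (signed_cyc M n u)) ^^ Suc n) u = nf n (((\<lambda>u. nf n (signed_cyc M n u)) ^^ Suc n) u)"
      by (simp add: nf_nf)
    also have "\<dots> = nf n u"
      unfolding nf_funpow signed_cyc_funpow nf_eq_iff by (rule cyc_pow[OF u])
    finally show ?thesis by (simp add: nfu)
  qed
qed (auto intro: chains_sum simp: additive_map_sum[OF additive_nf])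

lemma bar_diff_chains: "u \<in> chains M n \<Longrightarrow> bar_diff M n u \<in> chains M (Suc n)"
  and hoch_diff_chains: "u \<in> chains M n \<Longrightarrow> hoch_diff M n u \<in> chains M (Suc n)"
  and bar_diff_rels: "u \<in> rels M n \<Longrightarrow> bar_diff M n u \<in> rels M (Suc n)"
  and hoch_diff_rels: "u \<in> rels M n \<Longrightarrow> hoch_diff M n u \<in> rels M (Suc n)"
  unfolding bar_diff_def hoch_diff_def
  by (intro chains_sum chains_alt coface_chains rels_sum rels_alt coface_rels; simp)+

lemma signed_cyc_chains: "u \<in> chains M n \<Longrightarrow> signed_cyc M n u \<in> chains M n"
  and signed_cyc_rels: "u \<in> rels M n \<Longrightarrow> signed_cyc M n u \<in> rels M n"
  unfolding signed_cyc_def by (intro chains_alt cyc_chains rels_alt cyc_rels; simp)+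

lemma additive_bar_diff: "additive_map (bar_diff M n)" and additive_hoch_diff: "additive_map (hoch_diff M n)"
  by (simp_all add: bar_diff_def hoch_diff_def additive_map_def coface_add alt_add sum.distrib)

lemma nf_bar_diff: "nf (Suc n) (bar_diff M n u) = nf.D' n (nf n u)"
  unfolding nf.D'_def bar_diff_def by (simp add: additive_map_sum[OF additive_nf] nf_alt nf_coface)

lemma nf_hoch_diff:
  assumes u: "u \<in> chains M n"
  shows "nf (Suc n) (hoch_diff M n u) = nf.D n (nf n u)"
proof -
  have "nf (Suc n) (alt (Suc n) (coface M n (Suc n) u)) =
      nf (Suc n) (alt (Suc n) (cyc M (Suc n) (coface M n 0 u)))"
    using coface_last[OF u] unfolding nf_alt nf_eq_iff[symmetric] by simp
  also have "\<dots> = nf (Suc n) (signed_cyc M (Suc n) (nf (Suc n) (alt 0 (coface M n 0 (nf n u)))))"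
    by (simp add: signed_cyc_def nf_alt nf_cyc nf_coface additive_map_alt[OF additive_cyc]) (simp add: alt_def)
  finally show ?thesis
    unfolding nf.D_def hoch_diff_def
    by (simp add: additive_mapD[OF additive_nf] bar_diff_def[symmetric] nf_bar_diff)
qed

lemma nf_nf_chains: "u \<in> chains M n \<Longrightarrow> nf n u \<in> {u \<in> chains M n. nf n u = u}"
  by (simp add: nf_nf nf_chains)

lemma bar_diff_bar_diff: "u \<in> chains M n \<Longrightarrow> bar_diff M (Suc n) (bar_diff M n u) \<in> rels M (Suc (Suc n))"
  unfolding nf_eq_0_iff[symmetric] by (simp add: nf_bar_diff nf.D'_D'[OF nf_nf_chains])

lemma hoch_diff_hoch_diff: "u \<in> chains M n \<Longrightarrow> hoch_diff M (Suc n) (hoch_diff M n u) \<in> rels M (Suc (Suc n))"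
  unfolding nf_eq_0_iff[symmetric] by (simp add: nf_hoch_diff hoch_diff_chains nf.D_D[OF nf_nf_chains])

lemma horiz_chains: "u \<in> chains M q \<Longrightarrow> horiz M p q u \<in> chains M q"
proof -
  assume u: "u \<in> chains M q"
  have "(signed_cyc M q ^^ i) u \<in> chains M q" for i
    by (induction i) (auto simp: u signed_cyc_chains)
  then show ?thesis unfolding horiz_def using u by (auto intro!: chains_sum chains_diff signed_cyc_chains)
qed

lemma horiz_rels: "u \<in> rels M q \<Longrightarrow> horiz M p q u \<in> rels M q"
proof -
  assume u: "u \<in> rels M q"
  have "(signed_cyc M q ^^ i) u \<in> rels M q" for i
    by (induction i) (auto simp: u signed_cyc_rels)
  then show ?thesis unfolding horiz_def using u by (auto intro!: rels_sum rels_diff signed_cyc_rels)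
qed

lemma vert_chains: "u \<in> chains M q \<Longrightarrow> vert M p q u \<in> chains M (Suc q)"
  by (simp add: vert_def hoch_diff_chains bar_diff_chains chains_minus)

lemma vert_rels: "u \<in> rels M q \<Longrightarrow> vert M p q u \<in> rels M (Suc q)"
  by (simp add: vert_def hoch_diff_rels bar_diff_rels rels_minus)

lemma additive_funpow_signed_cyc: "additive_map (signed_cyc M q ^^ i)"
  by (induction i) (simp_all add: additive_map_def additive_mapD[OF additive_signed_cyc])

lemma additive_horiz: "additive_map (horiz M p q)"
  by (simp add: additive_map_def horiz_def additive_mapD[OF additive_signed_cyc] sum.distrib
    additive_mapD[OF additive_funpow_signed_cyc])

lemma additive_vert: "additive_map (vert M p q)"
  by (simp add: additive_map_def vert_def additive_mapD[OF additive_hoch_diff] additive_mapD[OF additive_bar_diff])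

lemma vert_vert: "u \<in> chains M q \<Longrightarrow> vert M p (Suc q) (vert M p q u) \<in> rels M (Suc (Suc q))"
  by (simp add: vert_def hoch_diff_hoch_diff bar_diff_bar_diff additive_map_minus[OF additive_bar_diff])

lemma nf_horiz:
  "nf q (horiz M p q u) = (if even p then nf q u - nf q (signed_cyc M q (nf q u)) else nf.N q (nf q u))"
proof -
  have "nf q (((\<lambda>u. nf q (signed_cyc M q u)) ^^ i) (nf q u)) = nf q ((signed_cyc M q ^^ i) u)" for i
  proof -
    have "nf q ((signed_cyc M q ^^ i) (nf q u)) = nf q ((signed_cyc M q ^^ i) u)"
    proof (induction i)
      case (Suc i)
      then show ?case by simp (metis nf_signed_cyc)
    qed (simp add: nf_nf)
    then show ?thesis by (simp add: nf_funpow)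
  qed
  moreover have "((\<lambda>u. nf q (signed_cyc M q u)) ^^ i) (nf q u) = nf q (((\<lambda>u. nf q (signed_cyc M q u)) ^^ i) (nf q u))" for i
    by (cases i) (simp_all add: nf_nf)
  ultimately have "((\<lambda>u. nf q (signed_cyc M q u)) ^^ i) (nf q u) = nf q ((signed_cyc M q ^^ i) u)" for i
    by simp
  then show ?thesis
    by (simp add: horiz_def nf.N_def additive_map_sum[OF additive_nf] additive_map_diff[OF additive_nf] nf_signed_cyc)
qed

lemma nf_vert:
  "u \<in> chains M q \<Longrightarrow> nf (Suc q) (vert M p q u) = (if even p then nf.D q (nf q u) else - nf.D' q (nf q u))"
  by (simp add: vert_def nf_hoch_diff nf_bar_diff additive_map_minus[OF additive_nf])

lemma horiz_horiz:
  assumes u: "u \<in> chains M q"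
  shows "horiz M (Suc p) q (horiz M p q u) \<in> rels M q"
proof -
  note v = nf_nf_chains[OF u]
  have add: "additive_map (nf.N q)"
    unfolding additive_map_def nf.N_def
  proof (intro allI)
    fix x y
    have "additive_map ((\<lambda>u. nf q (signed_cyc M q u)) ^^ i)" for i
      by (induction i) (simp_all add: additive_map_def additive_mapD[OF nf.L_add])
    then show "(\<Sum>i\<le>q. ((\<lambda>u. nf q (signed_cyc M q u)) ^^ i) (x + y)) =
      (\<Sum>i\<le>q. ((\<lambda>u. nf q (signed_cyc M q u)) ^^ i) x) + (\<Sum>i\<le>q. ((\<lambda>u. nf q (signed_cyc M q u)) ^^ i) y)"
      by (simp add: additive_mapD sum.distrib)
  qed
  show ?thesis
    unfolding nf_eq_0_iff[symmetric] nf_horiz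
    using nf.L_N[OF v] by (simp add: additive_map_diff[OF add])
qed

text \<open>The squares anticommute because the odd columns carry the negative bar differential. On
  normal forms the claim is \<open>D_L\<close> for even and \<open>N_D'\<close> for odd
  columns.\<close>

lemma vert_horiz:
  assumes u: "u \<in> chains M q"
  shows "vert M (Suc p) q (horiz M p q u) + horiz M p (Suc q) (vert M p q u) \<in> rels M (Suc q)"
proof -
  note v = nf_nf_chains[OF u]
  have add': "additive_map (nf.D' q)" for q
    by (simp add: additive_map_def nf.D'_def additive_mapD[OF nf.S_add] sum.distrib)
  have N: "nf.N q (- w) = - nf.N q w" for q w
  proof -
    have "additive_map ((\<lambda>u. nf q (signed_cyc M q u)) ^^ i)" for i
      by (induction i) (simp_all add: additive_map_def additive_mapD[OF nf.L_add])
    then show ?thesis by (simp add: nf.N_def additive_map_minus sum_negf)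
  qed
  show ?thesis
    unfolding nf_eq_0_iff[symmetric] additive_mapD[OF additive_nf] nf_horiz nf_vert[OF horiz_chains[OF u]] nf_vert[OF u]
    using nf.D_L[OF v] nf.N_D'[OF v] by (simp add: additive_map_diff[OF add'] N)
qed

lemma tot_diff_chains:
  assumes "w \<in> tot_space (chains M) n"
  shows "tot_diff M n w \<in> tot_space (chains M) (Suc n)"
  unfolding tot_space_def mem_Collect_eq
proof (intro conjI allI impI)
  fix p assume p: "p \<le> Suc n"
  have w: "w q \<in> chains M (n - q)" if "q \<le> n" for q using assms that by (simp add: tot_space_def)
  have 1: "vert M p (n - p) (w p) \<in> chains M (Suc n - p)" if "p \<le> n"
    using vert_chains[OF w[OF that]] that by (simp add: Suc_diff_le)
  have 2: "horiz M (p - 1) (n - (p - 1)) (w (p - 1)) \<in> chains M (Suc n - p)" if "1 \<le> p"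
    using horiz_chains[OF w[of "p - 1"]] that p by (cases p) auto
  show "tot_diff M n w p \<in> chains M (Suc n - p)"
    unfolding tot_diff_def using 1 2 by (auto intro!: chains_add simp: chains_0)
qed (simp add: tot_diff_def)

lemma tot_diff_rels:
  assumes "w \<in> tot_space (rels M) n"
  shows "tot_diff M n w \<in> tot_space (rels M) (Suc n)"
  unfolding tot_space_def mem_Collect_eq
proof (intro conjI allI impI)
  fix p assume p: "p \<le> Suc n"
  have w: "w q \<in> rels M (n - q)" if "q \<le> n" for q using assms that by (simp add: tot_space_def)
  have 1: "vert M p (n - p) (w p) \<in> rels M (Suc n - p)" if "p \<le> n"
    using vert_rels[OF w[OF that]] that by (simp add: Suc_diff_le)
  have 2: "horiz M (p - 1) (n - (p - 1)) (w (p - 1)) \<in> rels M (Suc n - p)" if "1 \<le> p"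
    using horiz_rels[OF w[of "p - 1"]] that p by (cases p) auto
  show "tot_diff M n w p \<in> rels M (Suc n - p)"
    unfolding tot_diff_def using 1 2 by (auto intro!: rels_add simp: rels_0)
qed (simp add: tot_diff_def)

lemma tot_diff_tot_diff:
  assumes w: "w \<in> tot_space (chains M) n"
  shows "tot_diff M (Suc n) (tot_diff M n w) \<in> tot_space (rels M) (Suc (Suc n))"
  unfolding tot_space_def mem_Collect_eq
proof (intro conjI allI impI)
  fix p assume p: "p \<le> Suc (Suc n)"
  have w: "w q \<in> chains M (n - q)" if "q \<le> n" for q using assms that by (simp add: tot_space_def)
  \<comment> \<open>The contributions to component \<open>p\<close> that start in the columns
    \<open>p\<close>, \<open>p - 1\<close> and \<open>p - 2\<close>.\<close>
  define vv where "vv = (if p \<le> n then vert M p (Suc n - p) (vert M p (n - p) (w p)) else 0)"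
  define vh where "vh = (if 1 \<le> p \<and> p \<le> Suc n then vert M p (Suc n - p) (horiz M (p - 1) (n - (p - 1)) (w (p - 1)))
      + horiz M (p - 1) (Suc n - (p - 1)) (vert M (p - 1) (n - (p - 1)) (w (p - 1))) else 0)"
  define hh where "hh = (if 2 \<le> p then horiz M (p - 1) (Suc n - (p - 1)) (horiz M (p - 2) (n - (p - 2)) (w (p - 2))) else 0)"
  have "tot_diff M (Suc n) (tot_diff M n w) p = vv + vh + hh"
  proof -
    consider "p = 0" | "p = 1" | q where "p = Suc (Suc q)" by (cases p; cases "p - 1") auto
    then show ?thesis
      using p by cases (auto simp: tot_diff_def vv_def vh_def hh_def additive_mapD[OF additive_vert]
        additive_mapD[OF additive_horiz] additive_map_0[OF additive_vert] additive_map_0[OF additive_horiz] numeral_2_eq_2)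
  qed
  moreover have "vv \<in> rels M (Suc (Suc n) - p)"
    using vert_vert[OF w[of p], of p] by (auto simp: vv_def rels_0 Suc_diff_le)
  moreover have "vh \<in> rels M (Suc (Suc n) - p)"
  proof (cases "1 \<le> p \<and> p \<le> Suc n")
    case True
    then obtain q where q: "p = Suc q" "q \<le> n" by (cases p) auto
    then show ?thesis using vert_horiz[OF w[of q], of q] by (simp add: vh_def Suc_diff_le)
  qed (auto simp: vh_def rels_0)
  moreover have "hh \<in> rels M (Suc (Suc n) - p)"
  proof (cases "2 \<le> p")
    case True
    then obtain q where q: "p = Suc (Suc q)" "q \<le> n" using p by (cases p; cases "p - 1") auto
    then show ?thesis using horiz_horiz[OF w[of q], of q] by (simp add: hh_def numeral_2_eq_2)
  qed (auto simp: hh_def rels_0)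
  ultimately show "tot_diff M (Suc n) (tot_diff M n w) p \<in> rels M (Suc (Suc n) - p)"
    by (simp add: rels_add)
qed (simp add: tot_diff_def)

lemma additive_tot_diff: "additive_map (tot_diff M n)"
  by (auto simp: additive_map_def tot_diff_def additive_mapD[OF additive_vert] additive_mapD[OF additive_horiz])

lemma tot_diff_scale: "tot_diff M n (tot_scale a w) = tot_scale a (tot_diff M n w)"
proof -
  have sc: "fscale a (alt j u) = alt j (fscale a u)" for j and u :: "'i \<Rightarrow>\<^sub>0 'k"
    by (simp add: alt_def)
  have l: "signed_cyc M q (fscale a u) = fscale a (signed_cyc M q u)" for q u
    by (simp add: signed_cyc_def cyc_scale sc)
  have lp: "(signed_cyc M q ^^ i) (fscale a u) = fscale a ((signed_cyc M q ^^ i) u)" for q i u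
    by (induction i) (simp_all add: l)
  have "vert M p q (fscale a u) = fscale a (vert M p q u)" for p q u
    by (simp add: vert_def hoch_diff_def bar_diff_def coface_scale sc fs.scale_sum_right fs.scale_right_distrib)
  moreover have "horiz M p q (fscale a u) = fscale a (horiz M p q u)" for p q u
    by (simp add: horiz_def l lp fs.scale_sum_right fs.scale_right_diff_distrib)
  ultimately show ?thesis
    by (simp add: tot_diff_def tot_scale_def fun_eq_iff fs.scale_right_distrib)
qed

end

section \<open>Long exact sequences of presented complexes\<close>

locale presented_complex =
  fixes s :: "'k \<Rightarrow> 'v::ab_group_add \<Rightarrow> 'v" and V W :: "nat \<Rightarrow> 'v set" and d :: "nat \<Rightarrow> 'v \<Rightarrow> 'v"
  assumes d_add: "additive_map (d n)" and d_s: "d n (s a u) = s a (d n u)"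
    and s_add: "additive_map (s a)"
    and V_add: "u \<in> V n \<Longrightarrow> v \<in> V n \<Longrightarrow> u + v \<in> V n"
    and V_minus: "u \<in> V n \<Longrightarrow> - u \<in> V n" and V_s: "u \<in> V n \<Longrightarrow> s a u \<in> V n"
    and W_0: "0 \<in> W n" and W_add: "u \<in> W n \<Longrightarrow> v \<in> W n \<Longrightarrow> u + v \<in> W n"
    and W_minus: "u \<in> W n \<Longrightarrow> - u \<in> W n" and W_s: "u \<in> W n \<Longrightarrow> s a u \<in> W n"
    and W_V: "u \<in> W n \<Longrightarrow> u \<in> V n"
    and d_V: "u \<in> V n \<Longrightarrow> d n u \<in> V (Suc n)" and d_W: "u \<in> W n \<Longrightarrow> d n u \<in> W (Suc n)"
    and d_d: "u \<in> V n \<Longrightarrow> d (Suc n) (d n u) \<in> W (Suc (Suc n))"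
begin

abbreviation Z where "Z \<equiv> cocycles V W d"
abbreviation B where "B \<equiv> coboundaries V W d"

lemma V_0: "0 \<in> V n" by (rule W_V[OF W_0])
lemma V_diff: "u \<in> V n \<Longrightarrow> v \<in> V n \<Longrightarrow> u - v \<in> V n" using V_add[of u n "- v"] V_minus by simp
lemma W_diff: "u \<in> W n \<Longrightarrow> v \<in> W n \<Longrightarrow> u - v \<in> W n" using W_add[of u n "- v"] W_minus by simp

lemma B_0_iff: "u \<in> B 0 \<longleftrightarrow> u \<in> W 0"
  by (simp add: coboundaries_def)

lemma B_Suc_iff: "u \<in> B (Suc n) \<longleftrightarrow> (\<exists>v\<in>V n. u - d n v \<in> W (Suc n))"
  unfolding coboundaries_def by (force simp: algebra_simps)

lemma W_B: "u \<in> W n \<Longrightarrow> u \<in> B n"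
  by (cases n) (auto simp: B_0_iff B_Suc_iff additive_map_0[OF d_add] intro: bexI[OF _ V_0])

lemma B_0: "0 \<in> B n" by (rule W_B[OF W_0])

lemma B_add: assumes "u \<in> B n" "v \<in> B n" shows "u + v \<in> B n"
proof (cases n)
  case (Suc m)
  with assms obtain x y where "x \<in> V m" "u - d m x \<in> W n" "y \<in> V m" "v - d m y \<in> W n" by (auto simp: B_Suc_iff)
  then have "x + y \<in> V m" "(u + v) - d m (x + y) \<in> W n"
    using W_add[of "u - d m x" n "v - d m y"] by (auto simp: V_add additive_mapD[OF d_add] algebra_simps)
  then show ?thesis by (auto simp: B_Suc_iff Suc)
qed (use assms in \<open>simp add: B_0_iff W_add\<close>)

lemma B_s: assumes "u \<in> B n" shows "s a u \<in> B n"
proof (cases n)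
  case (Suc m)
  with assms obtain x where x: "x \<in> V m" "u - d m x \<in> W n" by (auto simp: B_Suc_iff)
  have "s a u - d m (s a x) = s a (u - d m x)" by (simp add: d_s additive_map_diff[OF s_add])
  then show ?thesis using x V_s W_s by (auto simp: B_Suc_iff Suc intro!: bexI[of _ "s a x"])
qed (use assms in \<open>simp add: B_0_iff W_s\<close>)

lemma B_minus: assumes "u \<in> B n" shows "- u \<in> B n"
proof (cases n)
  case (Suc m)
  with assms obtain x where x: "x \<in> V m" "u - d m x \<in> W n" by (auto simp: B_Suc_iff)
  have "- u - d m (- x) = - (u - d m x)" by (simp add: additive_map_minus[OF d_add])
  then have "- u - d m (- x) \<in> W n" using W_minus[OF x(2)] by (simp only:)
  then show ?thesis using V_minus[OF x(1)] unfolding Suc B_Suc_iff by blast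
qed (use assms in \<open>simp add: B_0_iff W_minus\<close>)

lemma coset_eq_iff: "coset (B n) u = coset (B n) v \<longleftrightarrow> u - v \<in> B n"
proof
  assume "coset (B n) u = coset (B n) v"
  moreover have "u \<in> coset (B n) u" using B_0 by (force simp: coset_def)
  ultimately show "u - v \<in> B n" by (auto simp: coset_def)
next
  have "coset (B n) u \<subseteq> coset (B n) v" if "u - v \<in> B n" for u v
  proof
    fix x assume "x \<in> coset (B n) u"
    then obtain b where b: "b \<in> B n" "x = u + b" by (auto simp: coset_def)
    then have "x = v + (u - v + b)" "u - v + b \<in> B n" using B_add that by auto
    then show "x \<in> coset (B n) v" unfolding coset_def by blast
  qed
  moreover assume "u - v \<in> B n"
  moreover have "v - u \<in> B n" using B_minus[OF \<open>u - v \<in> B n\<close>] by simp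
  ultimately show "coset (B n) u = coset (B n) v" by blast
qed

lemma coset_eq_B_iff: "coset (B n) u = B n \<longleftrightarrow> u \<in> B n"
proof -
  have "coset (B n) 0 = B n" by (auto simp: coset_def)
  then show ?thesis using coset_eq_iff[of n u 0] by simp
qed

lemma mem_coset_iff: "v \<in> coset (B n) u \<longleftrightarrow> v - u \<in> B n"
  by (force simp: coset_def algebra_simps)

lemma Z_iff: "u \<in> Z n \<longleftrightarrow> u \<in> V n \<and> d n u \<in> W (Suc n)"
  by (simp add: cocycles_def)

lemma B_V: "u \<in> B n \<Longrightarrow> u \<in> V n"
proof (cases n)
  case (Suc m)
  assume "u \<in> B n"
  then obtain v where "v \<in> V m" "u - d m v \<in> W (Suc m)" by (auto simp: Suc B_Suc_iff)
  then have "d m v + (u - d m v) \<in> V (Suc m)" by (metis V_add d_V W_V)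
  then show ?thesis by (simp add: Suc)
qed (simp add: B_0_iff W_V)

lemma B_Z: "u \<in> B n \<Longrightarrow> u \<in> Z n"
proof (cases n)
  case (Suc m)
  assume u: "u \<in> B n"
  then obtain v where v: "v \<in> V m" "u - d m v \<in> W n" by (auto simp: Suc B_Suc_iff)
  have "d n u = d n (d m v) + d n (u - d m v)" by (simp flip: additive_mapD[OF d_add])
  then show ?thesis using v d_d[of v m] d_W[of "u - d m v" n] B_V[OF u] by (simp add: Z_iff Suc W_add)
qed (simp add: Z_iff B_0_iff W_V d_W)

lemma Z_diff: "u \<in> Z n \<Longrightarrow> v \<in> Z n \<Longrightarrow> u - v \<in> Z n"
  by (simp add: Z_iff V_diff W_diff additive_map_diff[OF d_add])

lemma cohomology_cases: assumes "A \<in> cohomology V W d n" obtains u where "u \<in> Z n" "A = coset (B n) u"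
  using assms by (auto simp: cohomology_def)

lemma cohomologyI: "u \<in> Z n \<Longrightarrow> coset (B n) u \<in> cohomology V W d n"
  by (auto simp: cohomology_def)

end

text \<open>\<open>middle\<close> replaces exactness in the middle. It says that the quotient of the
  kernel of \<open>g\<close> by the image of \<open>f\<close> is acyclic, so that this kernel has
  the cohomology of the left complex; with exactness it would hold with \<open>y = 0\<close>. In
  degree 0 there are no coboundaries, hence \<open>y = 0\<close> there.\<close>

locale complex_sequence =
  L: presented_complex sL VL WL dL + M: presented_complex sM VM WM dM + N: presented_complex sN VN WN dN
  for sL :: "'k \<Rightarrow> 'u::ab_group_add \<Rightarrow> 'u" and VL WL dL
    and sM :: "'k \<Rightarrow> 'v::ab_group_add \<Rightarrow> 'v" and VM WM dM
    and sN :: "'k \<Rightarrow> 'w::ab_group_add \<Rightarrow> 'w" and VN WN dN +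
  fixes f :: "'u \<Rightarrow> 'v" and g :: "'v \<Rightarrow> 'w"
  assumes f_add: "additive_map f" and g_add: "additive_map g"
    and f_s: "f (sL a u) = sM a (f u)" and g_s: "g (sM a v) = sN a (g v)"
    and f_V: "u \<in> VL n \<Longrightarrow> f u \<in> VM n" and f_W: "u \<in> WL n \<Longrightarrow> f u \<in> WM n"
    and g_V: "v \<in> VM n \<Longrightarrow> g v \<in> VN n" and g_W: "v \<in> WM n \<Longrightarrow> g v \<in> WN n"
    and f_d: "u \<in> VL n \<Longrightarrow> f (dL n u) - dM n (f u) \<in> WM (Suc n)"
    and g_d: "v \<in> VM n \<Longrightarrow> g (dM n v) - dN n (g v) \<in> WN (Suc n)"
    and f_inj: "u \<in> VL n \<Longrightarrow> f u \<in> WM n \<Longrightarrow> u \<in> WL n"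
    and g_surj: "w \<in> VN n \<Longrightarrow> \<exists>v\<in>VM n. g v - w \<in> WN n"
    and g_f: "u \<in> VL n \<Longrightarrow> g (f u) \<in> WN n"
    and middle: "v \<in> VM n \<Longrightarrow> g v \<in> WN n \<Longrightarrow> u \<in> VL (Suc n) \<Longrightarrow> dM n v - f u \<in> WM (Suc n) \<Longrightarrow>
      \<exists>l\<in>VL n. \<exists>y. v - f l - y \<in> WM n \<and> (case n of 0 \<Rightarrow> y = 0 | Suc m \<Rightarrow> \<exists>v'\<in>VM m. g v' \<in> WN m \<and> y = dM m v')"
begin

lemma f_Z: assumes "u \<in> L.Z n" shows "f u \<in> M.Z n"
proof -
  have "f (dL n u) - (f (dL n u) - dM n (f u)) \<in> WM (Suc n)"
    by (rule M.W_diff) (use assms f_W f_d in \<open>auto simp: L.Z_iff\<close>)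
  then show ?thesis using assms f_V by (simp add: L.Z_iff M.Z_iff)
qed

lemma g_Z: assumes "u \<in> M.Z n" shows "g u \<in> N.Z n"
proof -
  have "g (dM n u) - (g (dM n u) - dN n (g u)) \<in> WN (Suc n)"
    by (rule N.W_diff) (use assms g_W g_d in \<open>auto simp: M.Z_iff\<close>)
  then show ?thesis using assms g_V by (simp add: M.Z_iff N.Z_iff)
qed

lemma f_B: assumes "u \<in> L.B n" shows "f u \<in> M.B n"
proof (cases n)
  case (Suc m)
  with assms obtain v where v: "v \<in> VL m" "u - dL m v \<in> WL n" by (auto simp: L.B_Suc_iff)
  have "f u - dM m (f v) = f (u - dL m v) + (f (dL m v) - dM m (f v))"
    by (simp add: additive_map_diff[OF f_add])
  also have "\<dots> \<in> WM n" using v f_W f_d[OF v(1)] Suc by (intro M.W_add) auto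
  finally show ?thesis unfolding Suc M.B_Suc_iff using v f_V by blast
qed (use assms f_W in \<open>simp add: L.B_0_iff M.B_0_iff\<close>)

lemma g_B: assumes "u \<in> M.B n" shows "g u \<in> N.B n"
proof (cases n)
  case (Suc m)
  with assms obtain v where v: "v \<in> VM m" "u - dM m v \<in> WM n" by (auto simp: M.B_Suc_iff)
  have "g u - dN m (g v) = g (u - dM m v) + (g (dM m v) - dN m (g v))"
    by (simp add: additive_map_diff[OF g_add])
  also have "\<dots> \<in> WN n" using v g_W g_d[OF v(1)] Suc by (intro N.W_add) auto
  finally show ?thesis unfolding Suc N.B_Suc_iff using v g_V by blast
qed (use assms g_W in \<open>simp add: M.B_0_iff N.B_0_iff\<close>)

lemma induced_f: "induced (M.B n) f (coset (L.B n) u) = coset (M.B n) (f u)"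
proof (rule set_eqI)
  fix x
  show "x \<in> induced (M.B n) f (coset (L.B n) u) \<longleftrightarrow> x \<in> coset (M.B n) (f u)"
  proof
    assume "x \<in> induced (M.B n) f (coset (L.B n) u)"
    then obtain b w where b: "b \<in> L.B n" "w \<in> M.B n" "x = f (u + b) + w" by (auto simp: induced_def coset_def)
    then have "x = f u + (f b + w)" "f b + w \<in> M.B n" using f_B M.B_add by (auto simp: additive_mapD[OF f_add] add.assoc)
    then show "x \<in> coset (M.B n) (f u)" by (auto simp: coset_def)
  next
    assume "x \<in> coset (M.B n) (f u)"
    then obtain w where "w \<in> M.B n" "x = f u + w" by (auto simp: coset_def)
    moreover have "u \<in> coset (L.B n) u" using L.B_0 by (simp add: L.mem_coset_iff)
    ultimately show "x \<in> induced (M.B n) f (coset (L.B n) u)" by (auto simp: induced_def)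
  qed
qed

lemma induced_g: "induced (N.B n) g (coset (M.B n) u) = coset (N.B n) (g u)"
proof (rule set_eqI)
  fix x
  show "x \<in> induced (N.B n) g (coset (M.B n) u) \<longleftrightarrow> x \<in> coset (N.B n) (g u)"
  proof
    assume "x \<in> induced (N.B n) g (coset (M.B n) u)"
    then obtain b w where b: "b \<in> M.B n" "w \<in> N.B n" "x = g (u + b) + w" by (auto simp: induced_def coset_def)
    then have "x = g u + (g b + w)" "g b + w \<in> N.B n" using g_B N.B_add by (auto simp: additive_mapD[OF g_add] add.assoc)
    then show "x \<in> coset (N.B n) (g u)" by (auto simp: coset_def)
  next
    assume "x \<in> coset (N.B n) (g u)"
    then obtain w where "w \<in> N.B n" "x = g u + w" by (auto simp: coset_def)
    moreover have "u \<in> coset (M.B n) u" using M.B_0 by (simp add: M.mem_coset_iff)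
    ultimately show "x \<in> induced (N.B n) g (coset (M.B n) u)" by (auto simp: induced_def)
  qed
qed

text \<open>The zigzag of the snake lemma as a relation between cochains: lift, apply the
  differential, pull back. As the relation is compatible with sums and scalars, linearity and
  independence of choices both reduce to what it does to coboundaries.\<close>

definition conn_rel where
  "conn_rel n z l \<longleftrightarrow> l \<in> VL (Suc n) \<and> (\<exists>u\<in>VM n. g u - z \<in> WN n \<and> dM n u - f l \<in> WM (Suc n))"

lemma conn_rel_add:
  assumes "conn_rel n z l" "conn_rel n z' l'"
  shows "conn_rel n (z + z') (l + l')"
proof -
  from assms obtain u u' where u: "u \<in> VM n" "g u - z \<in> WN n" "dM n u - f l \<in> WM (Suc n)"
      "u' \<in> VM n" "g u' - z' \<in> WN n" "dM n u' - f l' \<in> WM (Suc n)" by (auto simp: conn_rel_def)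
  have "g (u + u') - (z + z') \<in> WN n"
    using N.W_add[OF u(2) u(5)] by (simp add: additive_mapD[OF g_add] algebra_simps)
  moreover have "dM n (u + u') - f (l + l') \<in> WM (Suc n)"
    using M.W_add[OF u(3) u(6)] by (simp add: additive_mapD[OF f_add] additive_mapD[OF M.d_add] algebra_simps)
  ultimately show ?thesis
    using assms M.V_add[OF u(1) u(4)] L.V_add unfolding conn_rel_def by blast
qed

lemma conn_rel_diff:
  assumes "conn_rel n z l" "conn_rel n z' l'"
  shows "conn_rel n (z - z') (l - l')"
proof -
  from assms obtain u u' where u: "u \<in> VM n" "g u - z \<in> WN n" "dM n u - f l \<in> WM (Suc n)"
      "u' \<in> VM n" "g u' - z' \<in> WN n" "dM n u' - f l' \<in> WM (Suc n)" by (auto simp: conn_rel_def)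
  have "g (u - u') - (z - z') \<in> WN n"
    using N.W_diff[OF u(2) u(5)] by (simp add: additive_map_diff[OF g_add] algebra_simps)
  moreover have "dM n (u - u') - f (l - l') \<in> WM (Suc n)"
    using M.W_diff[OF u(3) u(6)] by (simp add: additive_map_diff[OF f_add] additive_map_diff[OF M.d_add] algebra_simps)
  ultimately show ?thesis
    using assms M.V_diff[OF u(1) u(4)] L.V_diff unfolding conn_rel_def by blast
qed

lemma conn_rel_s:
  assumes "conn_rel n z l"
  shows "conn_rel n (sN a z) (sL a l)"
proof -
  from assms obtain u where u: "u \<in> VM n" "g u - z \<in> WN n" "dM n u - f l \<in> WM (Suc n)" by (auto simp: conn_rel_def)
  have "g (sM a u) - sN a z = sN a (g u - z)" by (simp add: g_s additive_map_diff[OF N.s_add])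
  moreover have "dM n (sM a u) - f (sL a l) = sM a (dM n u - f l)"
    by (simp add: f_s M.d_s additive_map_diff[OF M.s_add])
  ultimately show ?thesis
    using assms u by (auto simp: conn_rel_def L.V_s N.W_s M.W_s intro!: bexI[of _ "sM a u"] M.V_s)
qed

text \<open>The differential of a lift \<open>u\<close> dies on the right but need not come from the
  left. \<open>middle\<close>, one degree higher, writes it as \<open>f l\<close> plus the
  differential of some \<open>v\<close> that dies on the right, so that \<open>u - v\<close> is a
  better lift.\<close>

lemma conn_rel_ex:
  assumes z: "z \<in> N.Z n"
  shows "\<exists>l. conn_rel n z l"
proof -
  obtain u where u: "u \<in> VM n" "g u - z \<in> WN n" using g_surj z by (auto simp: N.Z_iff)
  have "g (dM n u) = (g (dM n u) - dN n (g u)) + dN n (g u - z) + dN n z"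
    by (simp add: additive_map_diff[OF N.d_add])
  also have "\<dots> \<in> WN (Suc n)" using z u g_d[OF u(1)] N.d_W by (intro N.W_add) (auto simp: N.Z_iff)
  finally have "g (dM n u) \<in> WN (Suc n)" .
  moreover have "dM (Suc n) (dM n u) - f 0 \<in> WM (Suc (Suc n))"
    using M.d_d[OF u(1)] by (simp add: additive_map_0[OF f_add])
  ultimately obtain l v where l: "l \<in> VL (Suc n)" "dM n u - f l - dM n v \<in> WM (Suc n)" "v \<in> VM n" "g v \<in> WN n"
    using middle[OF M.d_V[OF u(1)] _ L.V_0] by fastforce
  have "g (u - v) - z \<in> WN n"
    using N.W_diff[OF u(2) l(4)] by (simp add: additive_map_diff[OF g_add] algebra_simps)
  moreover have "dM n (u - v) - f l \<in> WM (Suc n)"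
    using l(2) by (simp add: additive_map_diff[OF M.d_add] algebra_simps)
  ultimately show ?thesis using l u M.V_diff unfolding conn_rel_def by blast
qed

lemma conn_rel_Z:
  assumes "conn_rel n z l"
  shows "l \<in> L.Z (Suc n)"
proof -
  from assms obtain u where u: "u \<in> VM n" "dM n u - f l \<in> WM (Suc n)" and l: "l \<in> VL (Suc n)"
    by (auto simp: conn_rel_def)
  have "f (dL (Suc n) l) = (f (dL (Suc n) l) - dM (Suc n) (f l)) + (dM (Suc n) (dM n u) - dM (Suc n) (dM n u - f l))"
    by (simp add: additive_map_diff[OF M.d_add])
  also have "\<dots> \<in> WM (Suc (Suc n))"
    by (rule M.W_add[OF f_d[OF l] M.W_diff[OF M.d_d[OF u(1)] M.d_W[OF u(2)]]])
  finally show ?thesis using l f_inj L.d_V by (simp add: L.Z_iff)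
qed

text \<open>Used to correct lifts: subtracting a coboundary of the middle complex changes the
  differential of a lift only by relations.\<close>

lemma lift_boundary:
  assumes "z \<in> N.B n"
  obtains v where "v \<in> M.B n" "g v - z \<in> WN n"
proof (cases n)
  case 0
  then show ?thesis using that[of 0] assms M.B_0 N.W_minus by (simp add: N.B_0_iff additive_map_0[OF g_add])
next
  case (Suc m)
  with assms obtain z' where z': "z' \<in> VN m" "z - dN m z' \<in> WN n" by (auto simp: N.B_Suc_iff)
  obtain u where u: "u \<in> VM m" "g u - z' \<in> WN m" using g_surj[OF z'(1)] by blast
  have "g (dM m u) - z = (g (dM m u) - dN m (g u)) + dN m (g u - z') - (z - dN m z')"
    by (simp add: additive_map_diff[OF N.d_add])
  also have "\<dots> \<in> WN n" unfolding Suc by (rule N.W_diff[OF N.W_add[OF g_d[OF u(1)] N.d_W[OF u(2)]] z'(2)[unfolded Suc]])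
  finally show ?thesis
    using that[of "dM m u"] u(1) M.W_0 unfolding Suc M.B_Suc_iff by force
qed

text \<open>Once a coboundary is subtracted, the lift dies on the right, and \<open>middle\<close>
  presents it as \<open>f l'\<close> up to a coboundary. Injectivity of \<open>f\<close> modulo
  relations then identifies \<open>l\<close> with the differential of \<open>l'\<close>.\<close>

lemma conn_rel_B:
  assumes R: "conn_rel n z l" and z: "z \<in> N.B n"
  shows "l \<in> L.B (Suc n)"
proof -
  from R obtain u where u: "u \<in> VM n" "g u - z \<in> WN n" "dM n u - f l \<in> WM (Suc n)" and l: "l \<in> VL (Suc n)"
    by (auto simp: conn_rel_def)
  obtain b where b: "b \<in> M.B n" "g b - z \<in> WN n" using lift_boundary[OF z] .
  have bZ: "b \<in> VM n" "dM n b \<in> WM (Suc n)" using M.B_Z[OF b(1)] by (auto simp: M.Z_iff)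
  have 1: "u - b \<in> VM n" using u bZ by (intro M.V_diff)
  have 2: "g (u - b) \<in> WN n" using N.W_diff[OF u(2) b(2)] by (simp add: additive_map_diff[OF g_add])
  have 3: "dM n (u - b) - f l \<in> WM (Suc n)"
    using M.W_diff[OF u(3) bZ(2)] by (simp add: additive_map_diff[OF M.d_add] algebra_simps)
  obtain l' v where l': "l' \<in> VL n" "u - b - f l' - v \<in> WM n"
    and v: "case n of 0 \<Rightarrow> v = 0 | Suc m \<Rightarrow> \<exists>v'\<in>VM m. g v' \<in> WN m \<and> v = dM m v'"
    using middle[OF 1 2 l 3] by blast
  have dv: "dM n v \<in> WM (Suc n)"
    using v M.d_d M.W_0 by (auto simp: additive_map_0[OF M.d_add] split: nat.splits)
  have "f (l - dL n l') = dM n (u - b - f l' - v) + dM n v - (dM n (u - b) - f l) - (f (dL n l') - dM n (f l'))"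
    by (simp add: additive_map_diff[OF M.d_add] additive_map_diff[OF f_add])
  also have "\<dots> \<in> WM (Suc n)" by (rule M.W_diff[OF M.W_diff[OF M.W_add[OF M.d_W[OF l'(2)] dv] 3] f_d[OF l'(1)]])
  finally show ?thesis
    unfolding L.B_Suc_iff using l' l f_inj L.V_diff L.d_V by blast
qed

text \<open>The choice ranges over all representatives of the class \<open>A\<close>, so that the
  result depends on the coset alone.\<close>

definition conn where
  "conn n A = coset (L.B (Suc n)) (SOME l. \<exists>z\<in>A. conn_rel n z l)"

lemma conn_coset:
  assumes "conn_rel n z l"
  shows "conn n (coset (N.B n) z) = coset (L.B (Suc n)) l"
proof -
  have "z \<in> coset (N.B n) z" using N.B_0 by (simp add: N.mem_coset_iff)
  then have "\<exists>l. \<exists>z\<in>coset (N.B n) z. conn_rel n z l" using assms by blast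
  from someI_ex[OF this] obtain z' where z': "z' \<in> coset (N.B n) z"
    "conn_rel n z' (SOME l. \<exists>z\<in>coset (N.B n) z. conn_rel n z l)" by blast
  show ?thesis
    unfolding conn_def L.coset_eq_iff
    by (rule conn_rel_B[OF conn_rel_diff[OF z'(2) assms]]) (use z'(1) in \<open>simp add: N.mem_coset_iff\<close>)
qed

lemma quotient_linear_conn:
  "quotient_linear sN (N.Z n) (N.B n) sL (L.Z (Suc n)) (L.B (Suc n)) (conn n)"
  unfolding quotient_linear_def
proof (intro conjI ballI allI impI)
  fix u assume u: "u \<in> N.Z n"
  then obtain l where l: "conn_rel n u l" using conn_rel_ex by blast
  then show "conn n (coset (N.B n) u) \<in> coset (L.B (Suc n)) ` L.Z (Suc n)"
    using conn_coset conn_rel_Z by auto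
  fix u' assume u': "u' \<in> L.Z (Suc n)" "conn n (coset (N.B n) u) = coset (L.B (Suc n)) u'"
  then have lu': "l - u' \<in> L.B (Suc n)" by (simp add: conn_coset[OF l] L.coset_eq_iff)
  show "conn n (coset (N.B n) (sN a u)) = coset (L.B (Suc n)) (sL a u')" for a
    unfolding conn_coset[OF conn_rel_s[OF l]] L.coset_eq_iff
    using L.B_s[OF lu', of a] by (simp add: additive_map_diff[OF L.s_add])
next
  fix u v u' v'
  assume uv: "u \<in> N.Z n" "v \<in> N.Z n" "conn n (coset (N.B n) u) = coset (L.B (Suc n)) u'"
    "conn n (coset (N.B n) v) = coset (L.B (Suc n)) v'"
  obtain l l' where l: "conn_rel n u l" "conn_rel n v l'" using conn_rel_ex uv by blast
  then have "l - u' \<in> L.B (Suc n)" "l' - v' \<in> L.B (Suc n)" using uv by (simp_all add: conn_coset L.coset_eq_iff)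
  from L.B_add[OF this] show "conn n (coset (N.B n) (u + v)) = coset (L.B (Suc n)) (u' + v')"
    unfolding conn_coset[OF conn_rel_add[OF l]] L.coset_eq_iff by (simp add: algebra_simps)
qed

lemma exact_start:
  "{A \<in> cohomology VL WL dL 0. induced (M.B 0) f A = M.B 0} = {L.B 0}"
proof (intro set_eqI iffI)
  fix A assume A: "A \<in> {A \<in> cohomology VL WL dL 0. induced (M.B 0) f A = M.B 0}"
  then obtain u where u: "u \<in> L.Z 0" "A = coset (L.B 0) u" by (auto elim: L.cohomology_cases)
  then have "f u \<in> WM 0" using A by (simp add: induced_f M.coset_eq_B_iff M.B_0_iff)
  then show "A \<in> {L.B 0}" using u f_inj by (simp add: L.coset_eq_B_iff L.B_0_iff L.Z_iff)
next
  fix A assume "A \<in> {L.B 0}"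
  then have A: "A = coset (L.B 0) 0" using L.coset_eq_B_iff[of 0 0] L.B_0 by simp
  show "A \<in> {A \<in> cohomology VL WL dL 0. induced (M.B 0) f A = M.B 0}"
    unfolding A using L.cohomologyI[OF L.B_Z[OF L.B_0]] M.B_0
    by (simp add: induced_f M.coset_eq_B_iff additive_map_0[OF f_add])
qed

lemma exact_M:
  "induced (M.B n) f ` cohomology VL WL dL n = {A \<in> cohomology VM WM dM n. induced (N.B n) g A = N.B n}"
proof (intro set_eqI iffI)
  fix A assume "A \<in> induced (M.B n) f ` cohomology VL WL dL n"
  then obtain u where u: "u \<in> L.Z n" "A = coset (M.B n) (f u)" by (auto simp: induced_f elim!: L.cohomology_cases)
  moreover have "g (f u) \<in> N.B n" using u g_f by (auto simp: L.Z_iff intro: N.W_B)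
  ultimately show "A \<in> {A \<in> cohomology VM WM dM n. induced (N.B n) g A = N.B n}"
    using M.cohomologyI[OF f_Z[OF u(1)]] by (simp add: induced_g N.coset_eq_B_iff)
next
  fix A assume A: "A \<in> {A \<in> cohomology VM WM dM n. induced (N.B n) g A = N.B n}"
  then obtain u where u: "u \<in> M.Z n" "A = coset (M.B n) u" by (auto elim: M.cohomology_cases)
  then have "g u \<in> N.B n" using A by (simp add: induced_g N.coset_eq_B_iff)
  then obtain b where b: "b \<in> M.B n" "g b - g u \<in> WN n" by (rule lift_boundary)
  have bZ: "u - b \<in> M.Z n" by (intro M.Z_diff u M.B_Z b)
  have 1: "u - b \<in> VM n" using bZ by (simp add: M.Z_iff)
  have 2: "g (u - b) \<in> WN n" using N.W_minus[OF b(2)] by (simp add: additive_map_diff[OF g_add])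
  have 3: "dM n (u - b) - f 0 \<in> WM (Suc n)" using bZ by (simp add: additive_map_0[OF f_add] M.Z_iff)
  obtain l v where l: "l \<in> VL n" "u - b - f l - v \<in> WM n"
    and v: "case n of 0 \<Rightarrow> v = 0 | Suc m \<Rightarrow> \<exists>v'\<in>VM m. g v' \<in> WN m \<and> v = dM m v'"
    using middle[OF 1 2 L.V_0 3] by blast
  have vB: "v \<in> M.B n"
    using v M.W_0 by (auto simp: M.B_0 M.B_Suc_iff split: nat.splits) (metis cancel_comm_monoid_add_class.diff_cancel M.W_0)
  have uf: "u - f l = (u - b - f l - v) + b + v" by simp
  have ufB: "u - f l \<in> M.B n" unfolding uf by (rule M.B_add[OF M.B_add[OF M.W_B[OF l(2)] b(1)] vB])
  then have "f l \<in> M.Z n" using M.Z_diff[OF u(1) M.B_Z[OF ufB]] by simp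
  then have "f (dL n l) - dM n (f l) + dM n (f l) \<in> WM (Suc n)"
    using f_d[OF l(1)] by (intro M.W_add) (auto simp: M.Z_iff)
  then have "l \<in> L.Z n" using l f_inj L.d_V by (simp add: L.Z_iff)
  moreover have "A = induced (M.B n) f (coset (L.B n) l)"
    using ufB u by (simp add: induced_f M.coset_eq_iff)
  ultimately show "A \<in> induced (M.B n) f ` cohomology VL WL dL n" using L.cohomologyI by blast
qed

lemma exact_N:
  "induced (N.B n) g ` cohomology VM WM dM n = {A \<in> cohomology VN WN dN n. conn n A = L.B (Suc n)}"
proof (intro set_eqI iffI)
  fix A assume "A \<in> induced (N.B n) g ` cohomology VM WM dM n"
  then obtain u where u: "u \<in> M.Z n" "A = coset (N.B n) (g u)" by (auto simp: induced_g elim!: M.cohomology_cases)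
  then have "conn_rel n (g u) 0"
    using N.W_0 L.V_0 by (auto simp: conn_rel_def M.Z_iff additive_map_0[OF f_add] intro!: bexI[of _ u])
  then have "conn n A = L.B (Suc n)" using u L.B_0 by (simp add: conn_coset L.coset_eq_B_iff)
  then show "A \<in> {A \<in> cohomology VN WN dN n. conn n A = L.B (Suc n)}"
    using u N.cohomologyI[OF g_Z] by simp
next
  fix A assume A: "A \<in> {A \<in> cohomology VN WN dN n. conn n A = L.B (Suc n)}"
  then obtain z where z: "z \<in> N.Z n" "A = coset (N.B n) z" by (auto elim: N.cohomology_cases)
  obtain l where l: "conn_rel n z l" using conn_rel_ex z by blast
  then have "l \<in> L.B (Suc n)" using A z by (simp add: conn_coset L.coset_eq_B_iff)
  then obtain l' where l': "l' \<in> VL n" "l - dL n l' \<in> WL (Suc n)" by (auto simp: L.B_Suc_iff)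
  obtain u where u: "u \<in> VM n" "g u - z \<in> WN n" "dM n u - f l \<in> WM (Suc n)" using l by (auto simp: conn_rel_def)
  have "dM n (u - f l') = (dM n u - f l) + f (l - dL n l') + (f (dL n l') - dM n (f l'))"
    by (simp add: additive_map_diff[OF M.d_add] additive_map_diff[OF f_add])
  also have "\<dots> \<in> WM (Suc n)" using u l' by (intro M.W_add f_W f_d)
  finally have Z: "u - f l' \<in> M.Z n" using u l' f_V by (simp add: M.Z_iff M.V_diff)
  have "g (u - f l') - z \<in> WN n"
    using N.W_diff[OF u(2) g_f[OF l'(1)]] by (simp add: additive_map_diff[OF g_add] algebra_simps)
  then have "induced (N.B n) g (coset (M.B n) (u - f l')) = A"
    using z N.W_B by (simp add: induced_g N.coset_eq_iff)
  then show "A \<in> induced (N.B n) g ` cohomology VM WM dM n" using M.cohomologyI[OF Z] by blast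
qed

lemma exact_L:
  "conn n ` cohomology VN WN dN n = {A \<in> cohomology VL WL dL (Suc n). induced (M.B (Suc n)) f A = M.B (Suc n)}"
proof (intro set_eqI iffI)
  fix A assume "A \<in> conn n ` cohomology VN WN dN n"
  then obtain z where z: "z \<in> N.Z n" "A = conn n (coset (N.B n) z)" by (auto elim: N.cohomology_cases)
  obtain l where l: "conn_rel n z l" using conn_rel_ex z by blast
  then obtain u where u: "u \<in> VM n" "dM n u - f l \<in> WM (Suc n)" by (auto simp: conn_rel_def)
  then have "f l \<in> M.B (Suc n)"
    using M.W_minus[OF u(2)] unfolding M.B_Suc_iff by auto
  then show "A \<in> {A \<in> cohomology VL WL dL (Suc n). induced (M.B (Suc n)) f A = M.B (Suc n)}"
    using z l L.cohomologyI[OF conn_rel_Z[OF l]] by (simp add: conn_coset induced_f M.coset_eq_B_iff)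
next
  fix A assume A: "A \<in> {A \<in> cohomology VL WL dL (Suc n). induced (M.B (Suc n)) f A = M.B (Suc n)}"
  then obtain l where l: "l \<in> L.Z (Suc n)" "A = coset (L.B (Suc n)) l" by (auto elim: L.cohomology_cases)
  then have "f l \<in> M.B (Suc n)" using A by (simp add: induced_f M.coset_eq_B_iff)
  then obtain u where u: "u \<in> VM n" "f l - dM n u \<in> WM (Suc n)" by (auto simp: M.B_Suc_iff)
  then have R: "conn_rel n (g u) l"
    using l M.W_minus[OF u(2)] N.W_0 by (auto simp: conn_rel_def L.Z_iff intro!: bexI[of _ u])
  have "dN n (g u) = g (f l) - g (f l - dM n u) - (g (dM n u) - dN n (g u))"
    by (simp add: additive_map_diff[OF g_add])
  also have "\<dots> \<in> WN (Suc n)" using l u by (intro N.W_diff g_f g_W g_d) (auto simp: L.Z_iff)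
  finally have "g u \<in> N.Z n" using u g_V by (simp add: N.Z_iff)
  then show "A \<in> conn n ` cohomology VN WN dN n"
    using N.cohomologyI conn_coset[OF R] l by (metis imageI)
qed

end

section \<open>From single columns to the total complex\<close>

lemma tot_space_iff: "w \<in> tot_space V n \<longleftrightarrow> (\<forall>p\<le>n. w p \<in> V (n - p)) \<and> (\<forall>p>n. w p = 0)"
  by (simp add: tot_space_def)

lemma presented_complex_tot:
  assumes "cocyclic_object M"
  shows "presented_complex tot_scale (tot_space (chains M)) (tot_space (rels M)) (tot_diff M)"
proof -
  interpret cocyclic_object M by fact
  show ?thesis
  proof
    fix n
    show "additive_map (tot_diff M n)" by (rule additive_tot_diff)
    show "tot_diff M n (tot_scale a u) = tot_scale a (tot_diff M n u)" for a u by (rule tot_diff_scale)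
    show "u \<in> tot_space (chains M) n \<Longrightarrow> tot_diff M n u \<in> tot_space (chains M) (Suc n)" for u by (rule tot_diff_chains)
    show "u \<in> tot_space (rels M) n \<Longrightarrow> tot_diff M n u \<in> tot_space (rels M) (Suc n)" for u by (rule tot_diff_rels)
    show "u \<in> tot_space (chains M) n \<Longrightarrow> tot_diff M (Suc n) (tot_diff M n u) \<in> tot_space (rels M) (Suc (Suc n))" for u
      by (rule tot_diff_tot_diff)
  qed (auto simp: additive_map_def tot_scale_def fs.scale_right_distrib tot_space_iff chains_add chains_minus
     chains_scale rels_0 rels_add rels_minus rels_scale subsetD[OF rels_chains])
qed

locale cocyclic_map = A: cocyclic_object A + B: cocyclic_object B
  for A :: "('i \<Rightarrow>\<^sub>0 'k::field) cocyclic" and B :: "('j \<Rightarrow>\<^sub>0 'k) cocyclic" +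
  fixes f :: "('i \<Rightarrow>\<^sub>0 'k) \<Rightarrow> ('j \<Rightarrow>\<^sub>0 'k)"
  assumes f_add: "f (u + v) = f u + f v" and f_scale: "f (fscale a u) = fscale a (f u)"
    and f_chains: "u \<in> chains A n \<Longrightarrow> f u \<in> chains B n" and f_rels: "u \<in> rels A n \<Longrightarrow> f u \<in> rels B n"
    and f_coface: "u \<in> chains A n \<Longrightarrow> j \<le> Suc n \<Longrightarrow> f (coface A n j u) \<approx>\<^bsub>rels B (Suc n)\<^esub> coface B n j (f u)"
    and f_cyc: "u \<in> chains A n \<Longrightarrow> f (cyc A n u) \<approx>\<^bsub>rels B n\<^esub> cyc B n (f u)"
begin

lemma additive_f: "additive_map f"
  by (simp add: additive_map_def f_add)

lemma f_hoch_diff: assumes "u \<in> chains A n" shows "f (hoch_diff A n u) \<approx>\<^bsub>rels B (Suc n)\<^esub> hoch_diff B n (f u)"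
proof -
  have "f (hoch_diff A n u) - hoch_diff B n (f u) = (\<Sum>j\<le>Suc n. alt j (f (coface A n j u) - coface B n j (f u)))"
    by (simp only: hoch_diff_def additive_map_sum[OF additive_f] additive_map_alt[OF additive_f] alt_diff sum_subtractf)
  also have "\<dots> \<in> rels B (Suc n)" using assms by (intro B.rels_sum B.rels_alt f_coface) auto
  finally show ?thesis .
qed

lemma f_bar_diff: assumes "u \<in> chains A n" shows "f (bar_diff A n u) \<approx>\<^bsub>rels B (Suc n)\<^esub> bar_diff B n (f u)"
proof -
  have "f (bar_diff A n u) - bar_diff B n (f u) = (\<Sum>j\<le>n. alt j (f (coface A n j u) - coface B n j (f u)))"
    by (simp only: bar_diff_def additive_map_sum[OF additive_f] additive_map_alt[OF additive_f] alt_diff sum_subtractf)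
  also have "\<dots> \<in> rels B (Suc n)" using assms by (intro B.rels_sum B.rels_alt f_coface) auto
  finally show ?thesis .
qed

lemma f_vert: "u \<in> chains A n \<Longrightarrow> f (vert A p n u) \<approx>\<^bsub>rels B (Suc n)\<^esub> vert B p n (f u)"
  using f_hoch_diff[of u n] B.rels_minus[OF f_bar_diff[of u n]]
  by (simp add: vert_def additive_map_minus[OF additive_f])

lemma f_signed_cyc: "u \<in> chains A n \<Longrightarrow> f (signed_cyc A n u) \<approx>\<^bsub>rels B n\<^esub> signed_cyc B n (f u)"
  using B.rels_alt[OF f_cyc, of u n n] by (simp add: signed_cyc_def additive_map_alt[OF additive_f] alt_diff)

lemma f_funpow: "u \<in> chains A n \<Longrightarrow> f ((signed_cyc A n ^^ i) u) \<approx>\<^bsub>rels B n\<^esub> (signed_cyc B n ^^ i) (f u)"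
proof (induction i)
  case (Suc i)
  let ?v = "(signed_cyc A n ^^ i) u"
  have v: "?v \<in> chains A n"
    using Suc.prems by (induction i) (auto intro: A.signed_cyc_chains)
  have "f ((signed_cyc A n ^^ Suc i) u) - (signed_cyc B n ^^ Suc i) (f u) =
    (f (signed_cyc A n ?v) - signed_cyc B n (f ?v)) + signed_cyc B n (f ?v - (signed_cyc B n ^^ i) (f u))"
    by (simp add: additive_map_diff[OF B.additive_signed_cyc])
  also have "\<dots> \<in> rels B n"
    by (rule B.rels_add[OF f_signed_cyc[OF v] B.signed_cyc_rels[OF Suc.IH[OF Suc.prems]]])
  finally show ?case .
qed (simp add: B.rels_0)

lemma f_horiz: assumes "u \<in> chains A n" shows "f (horiz A p n u) \<approx>\<^bsub>rels B n\<^esub> horiz B p n (f u)"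
proof (cases "even p")
  case True
  have "f (horiz A p n u) - horiz B p n (f u) = - (f (signed_cyc A n u) - signed_cyc B n (f u))"
    using True by (simp add: horiz_def additive_map_diff[OF additive_f])
  then show ?thesis using B.rels_minus[OF f_signed_cyc[OF assms]] by (simp only:)
next
  case False
  have "f (horiz A p n u) - horiz B p n (f u) = (\<Sum>i\<le>n. f ((signed_cyc A n ^^ i) u) - (signed_cyc B n ^^ i) (f u))"
    using False by (simp add: horiz_def additive_map_sum[OF additive_f] sum_subtractf)
  then show ?thesis using B.rels_sum[OF f_funpow[OF assms]] by (simp only:)
qed

lemma f_tot_diff:
  assumes w: "w \<in> tot_space (chains A) n"
  shows "(\<lambda>p. f (tot_diff A n w p)) \<approx>\<^bsub>tot_space (rels B) (Suc n)\<^esub> tot_diff B n (\<lambda>p. f (w p))"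
  unfolding tot_space_iff
proof (intro conjI allI impI)
  fix p assume p: "p \<le> Suc n"
  have wc: "w q \<in> chains A (n - q)" if "q \<le> n" for q using w that by (simp add: tot_space_iff)
  have 1: "(if p \<le> n then f (vert A p (n - p) (w p)) - vert B p (n - p) (f (w p)) else 0) \<in> rels B (Suc n - p)"
    using f_vert[OF wc, of p p] by (auto simp: B.rels_0 Suc_diff_le)
  have 2: "(if 1 \<le> p then f (horiz A (p - 1) (n - (p - 1)) (w (p - 1))) - horiz B (p - 1) (n - (p - 1)) (f (w (p - 1))) else 0)
      \<in> rels B (Suc n - p)"
    using f_horiz[OF wc[of "p - 1"], of "p - 1"] p by (cases p) (auto simp: B.rels_0)
  have "((\<lambda>p. f (tot_diff A n w p)) - tot_diff B n (\<lambda>p. f (w p))) p =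
    (if p \<le> n then f (vert A p (n - p) (w p)) - vert B p (n - p) (f (w p)) else 0) +
    (if 1 \<le> p then f (horiz A (p - 1) (n - (p - 1)) (w (p - 1))) - horiz B (p - 1) (n - (p - 1)) (f (w (p - 1))) else 0)"
    using p by (simp add: tot_diff_def f_add additive_map_0[OF additive_f])
  also have "\<dots> \<in> rels B (Suc n - p)" by (rule B.rels_add[OF 1 2])
  finally show "((\<lambda>p. f (tot_diff A n w p)) - tot_diff B n (\<lambda>p. f (w p))) p \<in> rels B (Suc n - p)" .
qed (auto simp: tot_diff_def additive_map_0[OF additive_f])

end

text \<open>\<open>column\<close> is the hypothesis \<open>middle\<close> of
  \<open>complex_sequence\<close> for one column, with the vertical differential only;
  \<open>staircase\<close> derives the version for the total complex.\<close>

locale cocyclic_sequence =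
  F: cocyclic_map L M f + G: cocyclic_map M N g
  for L :: "('i \<Rightarrow>\<^sub>0 'k::field) cocyclic" and M :: "('j \<Rightarrow>\<^sub>0 'k) cocyclic" and N :: "('l \<Rightarrow>\<^sub>0 'k) cocyclic"
    and f g +
  assumes f_inj: "u \<in> chains L n \<Longrightarrow> f u \<in> rels M n \<Longrightarrow> u \<in> rels L n"
    and g_surj: "w \<in> chains N n \<Longrightarrow> \<exists>v\<in>chains M n. g v \<approx>\<^bsub>rels N n\<^esub> w"
    and g_f: "u \<in> chains L n \<Longrightarrow> g (f u) \<in> rels N n"
    and column: "v \<in> chains M q \<Longrightarrow> g v \<in> rels N q \<Longrightarrow> u \<in> chains L (Suc q) \<Longrightarrow> vert M p q v \<approx>\<^bsub>rels M (Suc q)\<^esub> f u \<Longrightarrow>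
      \<exists>l\<in>chains L q. \<exists>y. v - f l - y \<in> rels M q \<and>
        (case q of 0 \<Rightarrow> y = 0 | Suc m \<Rightarrow> \<exists>v'\<in>chains M m. g v' \<in> rels N m \<and> y = vert M p m v')"
begin

definition single_column :: "nat \<Rightarrow> ('a \<Rightarrow>\<^sub>0 'k) \<Rightarrow> nat \<Rightarrow> ('a \<Rightarrow>\<^sub>0 'k)"
  where "single_column k a = (\<lambda>p. if p = k then a else 0)"

abbreviation "TL \<equiv> tot_space (chains L)"
abbreviation "TM \<equiv> tot_space (chains M)"
abbreviation "RM \<equiv> tot_space (rels M)"
abbreviation "RN \<equiv> tot_space (rels N)"

definition in_image where
  "in_image n v \<longleftrightarrow> (\<exists>l\<in>TL n. \<exists>y. v - (\<lambda>p. f (l p)) - y \<in> RM n \<and>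
     (case n of 0 \<Rightarrow> y = 0 | Suc m \<Rightarrow> \<exists>v'\<in>TM m. (\<lambda>p. g (v' p)) \<in> RN m \<and> y = tot_diff M m v'))"

interpretation tL: presented_complex tot_scale TL "tot_space (rels L)" "tot_diff L"
  by (rule presented_complex_tot) unfold_locales
interpretation tM: presented_complex tot_scale TM RM "tot_diff M"
  by (rule presented_complex_tot) unfold_locales
interpretation tN: presented_complex tot_scale "tot_space (chains N)" RN "tot_diff N"
  by (rule presented_complex_tot) unfold_locales

lemma f_TL: "u \<in> TL n \<Longrightarrow> (\<lambda>p. f (u p)) \<in> TM n"
  by (simp add: tot_space_iff F.f_chains additive_map_0[OF F.additive_f])

lemma g_TM: "u \<in> TM n \<Longrightarrow> (\<lambda>p. g (u p)) \<in> tot_space (chains N) n"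
  by (simp add: tot_space_iff G.f_chains additive_map_0[OF G.additive_f])

lemma g_RM: "u \<in> RM n \<Longrightarrow> (\<lambda>p. g (u p)) \<in> RN n"
  by (simp add: tot_space_iff G.f_rels additive_map_0[OF G.additive_f])

lemma single_column_tot: "k \<le> n \<Longrightarrow> a \<in> V (n - k) \<Longrightarrow> (\<And>m. 0 \<in> V m) \<Longrightarrow> single_column k a \<in> tot_space V n"
  by (auto simp: tot_space_iff single_column_def)

text \<open>The columns are cleared from left to right. Horizontal maps lead from a column to the
  next one, so if the columns before \<open>k\<close> consist of relations, component
  \<open>k\<close> of the total differential is vertical up to relations and \<open>column\<close>
  applies to it. A cochain of degree \<open>n\<close> has no component beyond column
  \<open>n\<close>, which starts the descending induction.\<close>

lemma staircase:
  assumes "k \<le> Suc n" "v \<in> TM n" "(\<lambda>p. g (v p)) \<in> RN n" "u \<in> TL (Suc n)"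
    "tot_diff M n v - (\<lambda>p. f (u p)) \<in> RM (Suc n)" "\<And>p. p < k \<Longrightarrow> v p \<in> rels M (n - p)"
  shows "in_image n v"
  using assms
proof (induction k arbitrary: v u rule: inc_induct)
  case base
  have "v - (\<lambda>p. f (0 p)) - 0 \<in> RM n"
    using base by (auto simp: tot_space_iff additive_map_0[OF F.additive_f])
  moreover have "tot_diff M m 0 = 0" for m by (rule additive_map_0[OF tM.d_add])
  moreover have "(\<lambda>p. g ((0 :: nat \<Rightarrow> ('j \<Rightarrow>\<^sub>0 'k)) p)) \<in> RN m" for m
    by (auto simp: tot_space_iff additive_map_0[OF G.additive_f] G.B.rels_0)
  ultimately show ?case
    unfolding in_image_def by (intro bexI[OF _ tL.V_0] exI[of _ 0]) (auto split: nat.splits intro!: bexI[OF _ tM.V_0])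
next
  case (step k)
  have k: "k \<le> n" using step.hyps by simp
  have vk: "v k \<in> chains M (n - k)" using step.prems k by (simp add: tot_space_iff)
  have gvk: "g (v k) \<in> rels N (n - k)" using step.prems k by (simp add: tot_space_iff)
  have "u k \<in> chains L (Suc n - k)" using step.prems(3) k by (simp add: tot_space_iff)
  then have uk: "u k \<in> chains L (Suc (n - k))" using k by (simp add: Suc_diff_le)
  \<comment> \<open>The entry in column \<open>k - 1\<close> is a relation, and so is its horizontal
    image, which can therefore be dropped from component \<open>k\<close>.\<close>
  have "vert M k (n - k) (v k) - f (u k) \<in> rels M (Suc (n - k))"
  proof -
    have h: "(if 1 \<le> k then horiz M (k - 1) (n - (k - 1)) (v (k - 1)) else 0) \<in> rels M (Suc (n - k))"
      using F.B.horiz_rels[OF step.prems(5)[of "k - 1"]] k by (cases k) (auto simp: F.B.rels_0 Suc_diff_Suc)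
    have "(tot_diff M n v - (\<lambda>p. f (u p))) k \<in> rels M (Suc n - k)"
      using step.prems(4) k unfolding tot_space_iff by (meson le_SucI)
    then have "(tot_diff M n v - (\<lambda>p. f (u p))) k \<in> rels M (Suc (n - k))"
      using k by (simp add: Suc_diff_le)
    from F.B.rels_diff[OF this h] show ?thesis
      using k by (simp add: tot_diff_def split: if_splits)
  qed
  from column[OF vk gvk uk this] obtain l y where l: "l \<in> chains L (n - k)" "v k - f l - y \<in> rels M (n - k)"
    and y: "case n - k of 0 \<Rightarrow> y = 0 | Suc m \<Rightarrow> \<exists>v'\<in>chains M m. g v' \<in> rels N m \<and> y = vert M k m v'"
    by blast
  define l' where "l' = single_column k l"
  have l'T: "l' \<in> TL n" unfolding l'_def by (rule single_column_tot[where V = "chains L", OF k l(1) F.A.chains_0])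
  \<comment> \<open>The vertical coboundary \<open>y\<close> is completed to a total one, the total
    differential of a cochain concentrated in column \<open>k\<close>. Its further component lies in
    column \<open>Suc k\<close> and is left to the later steps.\<close>
  obtain y' where y': "y' \<in> TM n" "tot_diff M n y' \<in> RM (Suc n)" "(\<lambda>p. g (y' p)) \<in> RN n" "y' k = y"
    "\<And>p. p < k \<Longrightarrow> y' p = 0"
    "case n of 0 \<Rightarrow> y' = 0 | Suc m \<Rightarrow> \<exists>v'\<in>TM m. (\<lambda>p. g (v' p)) \<in> RN m \<and> y' = tot_diff M m v'"
  proof (cases "n - k")
    case 0
    then have y0: "y = 0" using y by simp
    have d0: "tot_diff M m 0 = 0" for m by (rule additive_map_0[OF tM.d_add])
    have g0: "(\<lambda>p. g ((0 :: nat \<Rightarrow> ('j \<Rightarrow>\<^sub>0 'k)) p)) = 0"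
      by (simp add: additive_map_0[OF G.additive_f] fun_eq_iff)
    have w: "case n of 0 \<Rightarrow> (0 :: nat \<Rightarrow> ('j \<Rightarrow>\<^sub>0 'k)) = 0 | Suc m \<Rightarrow> \<exists>v'\<in>TM m. (\<lambda>p. g (v' p)) \<in> RN m \<and> 0 = tot_diff M m v'"
      using d0 g0 tM.V_0 tN.W_0 by (cases n) (auto intro!: bexI[of _ 0])
    show ?thesis
    proof (rule that[of 0])
      show "(\<lambda>p. g ((0 :: nat \<Rightarrow> ('j \<Rightarrow>\<^sub>0 'k)) p)) \<in> RN n" unfolding g0 by (rule tN.W_0)
    qed (use w in \<open>simp_all only: y0 d0 tM.V_0 tM.W_0 zero_fun_apply\<close>)
  next
    case (Suc m)
    then obtain v' where v': "v' \<in> chains M m" "g v' \<in> rels N m" "y = vert M k m v'" using y by auto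
    obtain n' where n: "n = Suc n'" "k \<le> n'" "m = n' - k" using Suc by (cases n) auto
    have v'': "v' \<in> chains M (n' - k)" "g v' \<in> rels N (n' - k)" using v' n by auto
    let ?w = "single_column k v'"
    have w: "?w \<in> TM n'"
      by (rule single_column_tot[where V = "chains M", OF n(2) v''(1) F.B.chains_0])
    have gw: "(\<lambda>p. g (?w p)) \<in> RN n'"
      using single_column_tot[where V = "rels N", OF n(2) v''(2) G.B.rels_0]
      by (simp add: single_column_def if_distrib[of g] additive_map_0[OF G.additive_f] cong: if_cong)
    have "(\<lambda>p. g (tot_diff M n' ?w p)) - tot_diff N n' (\<lambda>p. g (?w p)) \<in> RN (Suc n')"
      by (rule G.f_tot_diff[OF w])
    from tN.W_add[OF this tN.d_W[OF gw]] have g: "(\<lambda>p. g (tot_diff M n' ?w p)) \<in> RN (Suc n')" by simp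
    show ?thesis
    proof (rule that[of "tot_diff M n' ?w"])
      show "tot_diff M n' ?w k = y" "p < k \<Longrightarrow> tot_diff M n' ?w p = 0" for p
        using n v' by (auto simp: tot_diff_def single_column_def additive_map_0[OF F.B.additive_vert] additive_map_0[OF F.B.additive_horiz])
    qed (use w gw g n tM.d_V[OF w] tM.d_d[OF w] in auto)
  qed
  define x where "x = v - (\<lambda>p. f (l' p)) - y'"
  have gfl: "(\<lambda>p. g (f (l' p))) \<in> RN n"
    using l'T g_f by (simp add: tot_space_iff additive_map_0[OF F.additive_f] additive_map_0[OF G.additive_f])
  have "in_image n x"
  proof (rule step.IH)
    show "x \<in> TM n" unfolding x_def using step.prems(1) f_TL[OF l'T] y'(1) by (intro tM.V_diff)
    have "(\<lambda>p. g (x p)) = (\<lambda>p. g (v p)) - (\<lambda>p. g (f (l' p))) - (\<lambda>p. g (y' p))"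
      by (simp add: x_def fun_eq_iff additive_map_diff[OF G.additive_f])
    then show "(\<lambda>p. g (x p)) \<in> RN n" using tN.W_diff[OF tN.W_diff[OF step.prems(2) gfl] y'(3)] by (simp only:)
    show "u - tot_diff L n l' \<in> TL (Suc n)" by (rule tL.V_diff[OF step.prems(3) tL.d_V[OF l'T]])
    have "tot_diff M n x - (\<lambda>p. f ((u - tot_diff L n l') p)) =
      (tot_diff M n v - (\<lambda>p. f (u p))) + ((\<lambda>p. f (tot_diff L n l' p)) - tot_diff M n (\<lambda>p. f (l' p))) - tot_diff M n y'"
      by (simp add: x_def fun_eq_iff additive_map_diff[OF tM.d_add] additive_map_diff[OF F.additive_f])
    then show "tot_diff M n x - (\<lambda>p. f ((u - tot_diff L n l') p)) \<in> RM (Suc n)"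
      using tM.W_diff[OF tM.W_add[OF step.prems(4) F.f_tot_diff[OF l'T]] y'(2)] by (simp only:)
    fix p assume "p < Suc k"
    then show "x p \<in> rels M (n - p)"
      using step.prems(5)[of p] l(2) y'(4,5)
      by (cases "p = k") (auto simp: x_def l'_def single_column_def additive_map_0[OF F.additive_f])
  qed
  then obtain l2 y2 where l2: "l2 \<in> TL n" "x - (\<lambda>p. f (l2 p)) - y2 \<in> RM n"
    and y2: "case n of 0 \<Rightarrow> y2 = 0 | Suc m \<Rightarrow> \<exists>v'\<in>TM m. (\<lambda>p. g (v' p)) \<in> RN m \<and> y2 = tot_diff M m v'"
    unfolding in_image_def by blast
  have "v - (\<lambda>p. f ((l' + l2) p)) - (y' + y2) = x - (\<lambda>p. f (l2 p)) - y2"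
    by (simp add: x_def fun_eq_iff F.f_add)
  then have 1: "v - (\<lambda>p. f ((l' + l2) p)) - (y' + y2) \<in> RM n" using l2(2) by (simp only:)
  have 2: "case n of 0 \<Rightarrow> y' + y2 = 0 | Suc m \<Rightarrow> \<exists>v'\<in>TM m. (\<lambda>p. g (v' p)) \<in> RN m \<and> y' + y2 = tot_diff M m v'"
  proof (cases n)
    case 0
    then show ?thesis using y'(6) y2 by simp
  next
    case (Suc m)
    obtain v1 v2 where v: "v1 \<in> TM m" "(\<lambda>p. g (v1 p)) \<in> RN m" "y' = tot_diff M m v1"
      "v2 \<in> TM m" "(\<lambda>p. g (v2 p)) \<in> RN m" "y2 = tot_diff M m v2"
      using y'(6) y2 Suc by auto
    have "(\<lambda>p. g ((v1 + v2) p)) = (\<lambda>p. g (v1 p)) + (\<lambda>p. g (v2 p))" by (simp add: G.f_add fun_eq_iff)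
    then have "(\<lambda>p. g ((v1 + v2) p)) \<in> RN m" using tN.W_add[OF v(2,5)] by (simp only:)
    moreover have "y' + y2 = tot_diff M m (v1 + v2)" by (simp add: v additive_mapD[OF tM.d_add])
    ultimately show ?thesis
      unfolding Suc nat.case using tM.V_add[OF v(1,4)] by blast
  qed
  show ?case
    unfolding in_image_def using 1 2 tL.V_add[OF l'T l2(1)] by blast
qed

lemma complex_sequence_tot:
  "complex_sequence tot_scale TL (tot_space (rels L)) (tot_diff L) tot_scale TM RM (tot_diff M)
     tot_scale (tot_space (chains N)) RN (tot_diff N) (\<lambda>w p. f (w p)) (\<lambda>w p. g (w p))"
proof unfold_locales
  fix n
  show "additive_map (\<lambda>w p. f (w p))" "additive_map (\<lambda>w p. g (w p))"
    by (simp_all add: additive_map_def fun_eq_iff F.f_add G.f_add)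
  show "(\<lambda>p. f (tot_scale a u p)) = tot_scale a (\<lambda>p. f (u p))" "(\<lambda>p. g (tot_scale a v p)) = tot_scale a (\<lambda>p. g (v p))" for a u v
    by (simp_all add: tot_scale_def fun_eq_iff F.f_scale G.f_scale)
  show "u \<in> tot_space (rels L) n \<Longrightarrow> (\<lambda>p. f (u p)) \<in> RM n" for u
    by (simp add: tot_space_iff F.f_rels additive_map_0[OF F.additive_f])
  show "u \<in> TL n \<Longrightarrow> (\<lambda>p. f (u p)) \<in> RM n \<Longrightarrow> u \<in> tot_space (rels L) n" for u
    by (simp add: tot_space_iff f_inj)
  show "u \<in> TL n \<Longrightarrow> (\<lambda>p. g (f (u p))) \<in> RN n" for u
    by (simp add: tot_space_iff g_f additive_map_0[OF F.additive_f] additive_map_0[OF G.additive_f])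
  show "\<exists>v\<in>TM n. (\<lambda>p. g (v p)) - w \<in> RN n" if w: "w \<in> tot_space (chains N) n" for w
  proof -
    have "\<forall>p\<in>{..n}. \<exists>v. v \<in> chains M (n - p) \<and> g v - w p \<in> rels N (n - p)"
      using w g_surj by (fastforce simp: tot_space_iff)
    then obtain v where v: "\<And>p. p \<le> n \<Longrightarrow> v p \<in> chains M (n - p) \<and> g (v p) - w p \<in> rels N (n - p)"
      by (metis atMost_iff)
    then show ?thesis
      using w by (intro bexI[of _ "\<lambda>p. if p \<le> n then v p else 0"]) (auto simp: tot_space_iff additive_map_0[OF G.additive_f])
  qed
  show "\<exists>l\<in>TL n. \<exists>y. v - (\<lambda>p. f (l p)) - y \<in> RM n \<and>
     (case n of 0 \<Rightarrow> y = 0 | Suc m \<Rightarrow> \<exists>v'\<in>TM m. (\<lambda>p. g (v' p)) \<in> RN m \<and> y = tot_diff M m v')"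
    if "v \<in> TM n" "(\<lambda>p. g (v p)) \<in> RN n" "u \<in> TL (Suc n)" "tot_diff M n v - (\<lambda>p. f (u p)) \<in> RM (Suc n)" for u v
    using staircase[OF _ that, of 0] by (simp add: in_image_def)
qed (simp_all add: f_TL g_TM g_RM F.f_tot_diff G.f_tot_diff)

theorem homotopy_cofibration: "homotopy_cofibration L M N f g"
proof -
  interpret complex_sequence tot_scale TL "tot_space (rels L)" "tot_diff L" tot_scale TM RM "tot_diff M"
     tot_scale "tot_space (chains N)" RN "tot_diff N" "\<lambda>w p. f (w p)" "\<lambda>w p. g (w p)"
    by (rule complex_sequence_tot)
  show ?thesis
    unfolding homotopy_cofibration_def cyclic_map_def cyclic_homology_def cyclic_coboundaries_def cyclic_cocycles_def
    by (rule exI[of _ conn]) (intro conjI allI quotient_linear_conn exact_start exact_M exact_N exact_L)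
qed

end

section \<open>The presented object \<open>CM\<close> is cocyclic\<close>

lemma ev_eqI: assumes "\<And>F. ev u F = ev v F" shows "u = v"
proof (rule poly_mapping_eqI)
  fix k
  have "ev u (\<lambda>i. if i = k then 1 else 0) = Poly_Mapping.lookup u k" for u :: "'a \<Rightarrow>\<^sub>0 'b"
    by (simp add: lin_ext_def if_distrib sum.delta in_keys_iff cong: if_cong)
  then show "Poly_Mapping.lookup u k = Poly_Mapping.lookup v k" using assms by metis
qed

lemma fbind_add: "(u + v) \<bind> F = (u \<bind> F) + (v \<bind> F)"
  and fbind_scale: "fscale a u \<bind> F = fscale a (u \<bind> F)"
  by (rule ev_eqI, simp add: ev_bind ev_add ev_scale)+

context cyclic_coefficients
begin

abbreviation "CMX \<equiv> CM \<Delta>B \<epsilon> sC actC \<Delta>C sX actX \<rho>"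

lemma chains_CM_iff: "u \<in> chains CMX n \<longleftrightarrow> (\<forall>(x, cs)\<in>Poly_Mapping.keys u. length cs = Suc n)"
  by (simp add: CM_def)

text \<open>Makes the length condition accessible to transposition, in the same way as the
  relations: it is a vanishing condition for all functions that are zero on words of the right
  length.\<close>

lemma chains_CM_iff_ev:
  "u \<in> chains CMX n \<longleftrightarrow> (\<forall>F. (\<forall>x cs. length cs = Suc n \<longrightarrow> F (x, cs) = 0) \<longrightarrow> ev u F = 0)"
proof
  assume "u \<in> chains CMX n"
  then show "\<forall>F. (\<forall>x cs. length cs = Suc n \<longrightarrow> F (x, cs) = 0) \<longrightarrow> ev u F = 0"
    by (auto simp: chains_CM_iff intro!: ev_eq_0)
next
  assume *: "\<forall>F. (\<forall>x cs. length cs = Suc n \<longrightarrow> F (x, cs) = 0) \<longrightarrow> ev u F = 0"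
  have "length cs = Suc n" if "(x, cs) \<in> Poly_Mapping.keys u" for x cs
  proof (rule ccontr)
    assume l: "length cs \<noteq> Suc n"
    have "ev u (\<lambda>i. if i = (x, cs) then 1 else 0) = 0" using * l by auto
    moreover have "ev u (\<lambda>i. if i = (x, cs) then 1 else 0) = Poly_Mapping.lookup u (x, cs)"
      using that by (simp add: lin_ext_def if_distrib sum.delta cong: if_cong)
    ultimately show False using that by (simp add: in_keys_iff)
  qed
  then show "u \<in> chains CMX n" by (auto simp: chains_CM_iff)
qed

lemma chains_CM_ev_cong:
  assumes "u \<in> chains CMX n" "\<And>x cs. length cs = Suc n \<Longrightarrow> F (x, cs) = G (x, cs)"
  shows "ev u F = ev u G"
  by (rule ev_cong) (use assms in \<open>auto simp: chains_CM_iff\<close>)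

lemma rels_CM_ev:
  assumes "u \<in> rels CMX n" "balanced (Suc n) \<phi>"
  shows "ev u (\<lambda>(x, cs). \<phi> x cs) = 0"
  using assms(1) unfolding CM_def cocyclic.simps
  by (rule ev_span) (use CM_rels_annihilator[of n \<phi>] assms(2) in blast)

lemma rels_CM_I:
  assumes "\<And>\<phi>. balanced (Suc n) \<phi> \<Longrightarrow> ev u (\<lambda>(x, cs). \<phi> x cs) = 0"
  shows "u \<in> rels CMX n"
  unfolding CM_def cocyclic.simps
proof (rule in_fspanI)
  fix F assume F: "\<And>r. r \<in> coeff_power_rels sX sC n \<union>
      {diag_act \<Delta>B actX actC b x cs - fscale (\<epsilon> b) (gen (x, cs)) | b x cs. length cs = Suc n} \<Longrightarrow> ev r F = 0"
  have eq: "(\<lambda>(x, cs). F (x, cs)) = F" by auto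
  have "balanced (Suc n) (\<lambda>x cs. F (x, cs))"
    unfolding CM_rels_annihilator[symmetric] eq using F by blast
  from assms[OF this] show "ev u F = 0" by (simp add: eq)
qed

lemma ev_coface_CM:
  assumes "u \<in> chains CMX n" "j \<le> n"
  shows "ev (coface CMX n j u) (\<lambda>(x, cs). \<phi> x cs) = ev u (\<lambda>(x, cs). split_at j \<phi> x cs)"
  using assms(2) by (simp add: CM_def ev_bind case_prod_unfold split_at_def)

lemma ev_cyc_CM:
  "ev (cyc CMX n u) (\<lambda>(x, cs). \<phi> x cs) = ev u (\<lambda>(x, cs). cshift \<phi> x cs)"
  by (simp add: CM_def ev_bind case_prod_unfold cshift_def)

text \<open>The last coface is the cyclic operator after coface 0. This holds for every function
  \<open>\<phi>\<close>, since the coaction of \<open>x\<close> and the comultiplication of the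
  first letter are independent sums.\<close>

lemma ev_coface_last_CM:
  assumes "u \<in> chains CMX n"
  shows "ev (coface CMX n (Suc n) u) (\<lambda>(x, cs). \<phi> x cs) = ev u (\<lambda>(x, cs). split_at 0 (cshift \<phi>) x cs)"
proof -
  have "ev (coface CMX n (Suc n) u) (\<lambda>(x, cs). \<phi> x cs) =
    ev u (\<lambda>(x, cs). ev (\<rho> x) (\<lambda>(h, y). ev (\<Delta>C (hd cs)) (\<lambda>(c1, c2). \<phi> y (c2 # tl cs @ [actC h c1]))))"
    by (simp add: CM_def ev_bind case_prod_unfold)
  also have "\<dots> = ev u (\<lambda>(x, cs). split_at 0 (cshift \<phi>) x cs)"
  proof (rule chains_CM_ev_cong[OF assms])
    fix x and cs :: "'c list" assume "length cs = Suc n"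
    then obtain c t where cs: "cs = c # t" by (cases cs) auto
    show "(case (x, cs) of (x, cs) \<Rightarrow> ev (\<rho> x) (\<lambda>(h, y). ev (\<Delta>C (hd cs)) (\<lambda>(c1, c2). \<phi> y (c2 # tl cs @ [actC h c1]))))
      = (case (x, cs) of (x, cs) \<Rightarrow> split_at 0 (cshift \<phi>) x cs)"
      unfolding cs by (simp add: split_at_def cshift_def ev_comult_at_0) (rule ev_swap_pair)
  qed
  finally show ?thesis .
qed

lemma diag_act_chains:
  assumes "\<And>y ds. length ds = length cs \<Longrightarrow> F (y, ds) = 0"
  shows "ev (diag_act \<Delta>B actX actC b x cs) F = 0"
  using assms
proof (induction cs arbitrary: b F)
  case (Cons c cs)
  have "ev (diag_act \<Delta>B actX actC b2 x cs) (\<lambda>(y, ds). F (y, actC b1 c # ds)) = 0" for b1 b2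
    using Cons.prems by (intro Cons.IH) auto
  then show ?case by (simp add: ev_bind case_prod_unfold)
qed simp

lemma fs_subspace_chains_CM: "fs.subspace (chains CMX n)"
  by (rule fs.subspaceI) (auto simp: chains_CM_iff_ev ev_add ev_scale)

lemma rels_chains_CM: "rels CMX n \<subseteq> chains CMX n"
proof -
  have "r \<in> chains CMX n" if "r \<in> coeff_power_rels sX sC n \<union>
      {diag_act \<Delta>B actX actC b x cs - fscale (\<epsilon> b) (gen (x, cs)) | b x cs. length cs = Suc n}" for r
    unfolding chains_CM_iff_ev
  proof (intro allI impI)
    fix F :: "'x \<times> 'c list \<Rightarrow> 'k" assume F: "\<forall>x cs. length cs = Suc n \<longrightarrow> F (x, cs) = 0"
    show "ev r F = 0" using that
    proof
      assume "r \<in> coeff_power_rels sX sC n"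
      then show ?thesis
        unfolding coeff_power_rels_def slot_rels_def
        by (auto simp: ev_diff ev_add ev_scale F)
    next
      assume "r \<in> {diag_act \<Delta>B actX actC b x cs - fscale (\<epsilon> b) (gen (x, cs)) | b x cs. length cs = Suc n}"
      then show ?thesis by (auto simp: ev_diff ev_scale F diag_act_chains)
    qed
  qed
  then show ?thesis
    unfolding CM_def cocyclic.simps
    by (intro fs.span_minimal) (use fs_subspace_chains_CM[of n] in \<open>auto simp: CM_def\<close>)
qed

lemma coface_chains_CM:
  assumes u: "u \<in> chains CMX n" and j: "j \<le> Suc n"
  shows "coface CMX n j u \<in> chains CMX (Suc n)"
  unfolding chains_CM_iff_ev
proof (intro allI impI)
  fix F :: "'x \<times> 'c list \<Rightarrow> 'k" assume F: "\<forall>x cs. length cs = Suc (Suc n) \<longrightarrow> F (x, cs) = 0"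
  have sp: "split_at i \<phi> x cs = 0" if "length cs = Suc n" "i \<le> n" "\<And>x cs. length cs = Suc (Suc n) \<Longrightarrow> \<phi> x cs = 0" for i \<phi> x cs
    unfolding split_at_def using comult_at_length[of i cs _ \<Delta>C] that by (intro ev_eq_0) auto
  have cy: "cshift (\<lambda>x cs. F (x, cs)) x cs = 0" if "length cs = Suc (Suc n)" for x cs
    unfolding cshift_def using that F by (intro ev_eq_0) auto
  have eq: "(\<lambda>(x, cs). F (x, cs)) = F" by auto
  show "ev (coface CMX n j u) F = 0"
  proof (cases "j \<le> n")
    case True
    have "ev (coface CMX n j u) F = ev u (\<lambda>(x, cs). split_at j (\<lambda>x cs. F (x, cs)) x cs)"
      using ev_coface_CM[OF u True, of "\<lambda>x cs. F (x, cs)"] by (simp add: eq)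
    also have "\<dots> = ev u (\<lambda>_. 0)" using F True by (intro chains_CM_ev_cong[OF u]) (simp add: sp)
    finally show ?thesis by simp
  next
    case False
    then have "j = Suc n" using j by simp
    then have "ev (coface CMX n j u) F = ev u (\<lambda>(x, cs). split_at 0 (cshift (\<lambda>x cs. F (x, cs))) x cs)"
      using ev_coface_last_CM[OF u, of "\<lambda>x cs. F (x, cs)"] by (simp add: eq)
    also have "\<dots> = ev u (\<lambda>_. 0)" by (intro chains_CM_ev_cong[OF u]) (simp add: sp cy)
    finally show ?thesis by simp
  qed
qed

lemma cyc_chains_CM:
  assumes u: "u \<in> chains CMX n"
  shows "cyc CMX n u \<in> chains CMX n"
  unfolding chains_CM_iff_ev
proof (intro allI impI)
  fix F :: "'x \<times> 'c list \<Rightarrow> 'k" assume F: "\<forall>x cs. length cs = Suc n \<longrightarrow> F (x, cs) = 0"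
  have eq: "(\<lambda>(x, cs). F (x, cs)) = F" by auto
  have "ev (cyc CMX n u) F = ev u (\<lambda>(x, cs). cshift (\<lambda>x cs. F (x, cs)) x cs)"
    using ev_cyc_CM[of n u "\<lambda>x cs. F (x, cs)"] by (simp add: eq)
  also have "\<dots> = ev u (\<lambda>_. 0)"
    using F by (intro chains_CM_ev_cong[OF u]) (auto simp: cshift_def intro!: ev_eq_0)
  finally show "ev (cyc CMX n u) F = 0" by simp
qed

text \<open>Every identity modulo relations is tested on balanced functionals, where it turns into
  an identity between \<open>split_at\<close> and \<open>cshift\<close> in reversed order. That an
  operator preserves the relations means that its transpose preserves balanced functionals.\<close>

lemma cocyclic_object_CM: "cocyclic_object CMX"
proof
  fix n
  note lin = ev_diff ev_coface_CM ev_coface_last_CM ev_cyc_CM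
  show "fs.subspace (chains CMX n)" by (rule fs_subspace_chains_CM)
  show "fs.subspace (rels CMX n)" by (simp add: CM_def)
  show "rels CMX n \<subseteq> chains CMX n" by (rule rels_chains_CM)
  show "coface CMX n j (u + v) = coface CMX n j u + coface CMX n j v"
    "coface CMX n j (fscale a u) = fscale a (coface CMX n j u)"
    "cyc CMX n (u + v) = cyc CMX n u + cyc CMX n v" "cyc CMX n (fscale a u) = fscale a (cyc CMX n u)" for j u v a
    by (simp_all add: CM_def fbind_add fbind_scale)
  fix u
  show "cyc CMX n u \<in> rels CMX n" if u: "u \<in> rels CMX n"
    by (rule rels_CM_I) (simp add: ev_cyc_CM rels_CM_ev[OF u balanced_cshift])
  show "coface CMX n j u \<in> rels CMX (Suc n)" if u: "u \<in> rels CMX n" and j: "j \<le> Suc n" for j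
  proof (rule rels_CM_I)
    fix \<phi> assume b: "balanced (Suc (Suc n)) \<phi>"
    have uc: "u \<in> chains CMX n" using rels_chains_CM u by blast
    show "ev (coface CMX n j u) (\<lambda>(x, cs). \<phi> x cs) = 0"
    proof (cases "j \<le> n")
      case True
      then show ?thesis using b by (simp add: ev_coface_CM[OF uc] rels_CM_ev[OF u balanced_split_at])
    next
      case False
      then have "j = Suc n" using j by simp
      then show ?thesis using b
        by (simp add: ev_coface_last_CM[OF uc] rels_CM_ev[OF u balanced_split_at] balanced_cshift)
    qed
  qed
  assume u: "u \<in> chains CMX n"
  note cc = coface_chains_CM[OF u] cyc_chains_CM[OF u]
  show "coface CMX n j u \<in> chains CMX (Suc n)" if "j \<le> Suc n" for j by (rule coface_chains_CM[OF u that])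
  show "cyc CMX n u \<in> chains CMX n" by (rule cyc_chains_CM[OF u])
  show "coface CMX n (Suc n) u \<approx>\<^bsub>rels CMX (Suc n)\<^esub> cyc CMX (Suc n) (coface CMX n 0 u)"
    by (rule rels_CM_I) (simp add: ev_diff ev_coface_last_CM[OF u] ev_cyc_CM ev_coface_CM[OF u])
  show "coface CMX (Suc n) (Suc j) (coface CMX n i u) \<approx>\<^bsub>rels CMX (Suc (Suc n))\<^esub> coface CMX (Suc n) i (coface CMX n j u)"
    if ij: "i \<le> j" "j \<le> n" for i j
  proof (rule rels_CM_I)
    fix \<phi> assume b: "balanced (Suc (Suc (Suc n))) \<phi>"
    have "ev u (\<lambda>(x, cs). split_at i (split_at (Suc j) \<phi>) x cs) = ev u (\<lambda>(x, cs). split_at j (split_at i \<phi>) x cs)"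
    proof (rule chains_CM_ev_cong[OF u])
      fix x and cs :: "'c list" assume l: "length cs = Suc n"
      show "(case (x, cs) of (x, cs) \<Rightarrow> split_at i (split_at (Suc j) \<phi>) x cs) = (case (x, cs) of (x, cs) \<Rightarrow> split_at j (split_at i \<phi>) x cs)"
        unfolding split_at_def prod.case
        using b ij l by (intro C.comult_at_comult_at) (auto simp: balanced_def multilinear_def)
    qed
    then show "ev (coface CMX (Suc n) (Suc j) (coface CMX n i u) - coface CMX (Suc n) i (coface CMX n j u)) (\<lambda>(x, cs). \<phi> x cs) = 0"
      using ij by (simp add: ev_diff ev_coface_CM[OF cc(1)] ev_coface_CM[OF u])
  qed
  show "cyc CMX (Suc n) (coface CMX n (Suc j) u) \<approx>\<^bsub>rels CMX (Suc n)\<^esub> coface CMX n j (cyc CMX n u)" if j: "j < n" for j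
  proof (rule rels_CM_I)
    fix \<phi> :: "'x \<Rightarrow> 'c list \<Rightarrow> 'k"
    have "ev u (\<lambda>(x, cs). split_at (Suc j) (cshift \<phi>) x cs) = ev u (\<lambda>(x, cs). cshift (split_at j \<phi>) x cs)"
      using j by (intro chains_CM_ev_cong[OF u]) (simp add: split_at_cshift)
    then show "ev (cyc CMX (Suc n) (coface CMX n (Suc j) u) - coface CMX n j (cyc CMX n u)) (\<lambda>(x, cs). \<phi> x cs) = 0"
      using j by (simp add: ev_diff ev_cyc_CM ev_coface_CM[OF u] ev_coface_CM[OF cc(2)])
  qed
  show "cyc CMX (Suc n) (cyc CMX (Suc n) (coface CMX n 0 u)) \<approx>\<^bsub>rels CMX (Suc n)\<^esub> coface CMX n n (cyc CMX n u)"
  proof (rule rels_CM_I)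
    fix \<phi> assume b: "balanced (Suc (Suc n)) \<phi>"
    have "ev u (\<lambda>(x, cs). split_at 0 (cshift (cshift \<phi>)) x cs) = ev u (\<lambda>(x, cs). cshift (split_at n \<phi>) x cs)"
      using b by (intro chains_CM_ev_cong[OF u]) (simp add: split_at_cshift_cshift balanced_def)
    then show "ev (cyc CMX (Suc n) (cyc CMX (Suc n) (coface CMX n 0 u)) - coface CMX n n (cyc CMX n u)) (\<lambda>(x, cs). \<phi> x cs) = 0"
      by (simp add: ev_diff ev_cyc_CM ev_coface_CM[OF u] ev_coface_CM[OF cc(2)])
  qed
  show "(cyc CMX n ^^ Suc n) u \<approx>\<^bsub>rels CMX n\<^esub> u"
  proof (rule rels_CM_I)
    fix \<phi> assume b: "balanced (Suc n) \<phi>"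
    have it: "ev ((cyc CMX n ^^ i) u) (\<lambda>(x, cs). \<phi> x cs) = ev u (\<lambda>(x, cs). (cshift ^^ i) \<phi> x cs)" for i \<phi>
      by (induction i arbitrary: \<phi>) (simp, simp add: ev_cyc_CM, simp add: funpow_swap1)
    have "ev u (\<lambda>(x, cs). (cshift ^^ Suc n) \<phi> x cs) = ev u (\<lambda>(x, cs). \<phi> x cs)"
      using cshift_funpow_full[OF b] by (intro chains_CM_ev_cong[OF u]) (simp del: funpow.simps)
    then show "ev ((cyc CMX n ^^ Suc n) u - u) (\<lambda>(x, cs). \<phi> x cs) = 0"
      unfolding ev_diff it by simp
  qed
qed

end

section \<open>Lifting over modules of finite projective dimension\<close>

lemma ring_module_onD:
  assumes "ring_module_on P act"
  shows "0 \<in> P" "p \<in> P \<Longrightarrow> q \<in> P \<Longrightarrow> p + q \<in> P" "p \<in> P \<Longrightarrow> - p \<in> P" "p \<in> P \<Longrightarrow> act b p \<in> P"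
    "p \<in> P \<Longrightarrow> q \<in> P \<Longrightarrow> act b (p + q) = act b p + act b q"
    "p \<in> P \<Longrightarrow> act (b + c) p = act b p + act c p"
    "p \<in> P \<Longrightarrow> act (b * c) p = act b (act c p)" "p \<in> P \<Longrightarrow> act 1 p = p"
  using assms by (auto simp: ring_module_on_def)

lemma ring_module_on_diff: "ring_module_on P act \<Longrightarrow> p \<in> P \<Longrightarrow> q \<in> P \<Longrightarrow> p - q \<in> P"
  using ring_module_onD(2,3)[of P act] by (metis diff_conv_add_uminus)

lemma ring_module_on_sum: "ring_module_on P act \<Longrightarrow> (\<And>i. i \<in> A \<Longrightarrow> g i \<in> P) \<Longrightarrow> (\<Sum>i\<in>A. g i) \<in> P"
  by (induction A rule: infinite_finite_induct) (auto intro: ring_module_onD)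

lemma ring_module_on_act_0: "ring_module_on P act \<Longrightarrow> act b 0 = 0"
  using ring_module_onD(5)[of P act 0 0 b] ring_module_onD(1)[of P act] by simp

lemma ring_module_on_zero_act: "ring_module_on P act \<Longrightarrow> p \<in> P \<Longrightarrow> act 0 p = 0"
  using ring_module_onD(6)[of P act p 0 0] by simp

lemma ring_module_on_act_sum:
  "ring_module_on P act \<Longrightarrow> (\<And>i. i \<in> A \<Longrightarrow> g i \<in> P) \<Longrightarrow> act b (\<Sum>i\<in>A. g i) = (\<Sum>i\<in>A. act b (g i))"
  by (induction A rule: infinite_finite_induct)
    (auto simp: ring_module_on_act_0 ring_module_onD(5) ring_module_on_sum)

lemma module_hom_onD:
  assumes "module_hom_on P actP Q actQ f"
  shows "p \<in> P \<Longrightarrow> f p \<in> Q" "p \<in> P \<Longrightarrow> q \<in> P \<Longrightarrow> f (p + q) = f p + f q"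
    "p \<in> P \<Longrightarrow> f (actP b p) = actQ b (f p)"
  using assms by (auto simp: module_hom_on_def)

lemma module_hom_on_0:
  fixes f :: "'p::ab_group_add \<Rightarrow> 'q::ab_group_add"
  shows "module_hom_on P actP Q actQ f \<Longrightarrow> 0 \<in> P \<Longrightarrow> f 0 = 0"
  using module_hom_onD(2)[of P actP Q actQ f 0 0] by (metis add.right_neutral add_left_cancel)

lemma module_hom_on_diff:
  fixes f :: "'p::ab_group_add \<Rightarrow> 'q::ab_group_add"
  assumes "module_hom_on P actP Q actQ f" "ring_module_on P act" "p \<in> P" "q \<in> P"
  shows "f (p - q) = f p - f q"
  using module_hom_onD(2)[OF assms(1) ring_module_on_diff[OF assms(2-4)] assms(4)] by (simp add: eq_diff_eq)

lemma module_hom_on_sum: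
  fixes f :: "'p::ab_group_add \<Rightarrow> 'q::ab_group_add"
  assumes "module_hom_on P actP Q actQ f" "ring_module_on P act" "\<And>i. i \<in> A \<Longrightarrow> g i \<in> P"
  shows "f (\<Sum>i\<in>A. g i) = (\<Sum>i\<in>A. f (g i))"
  using assms(3)
  by (induction A rule: infinite_finite_induct)
    (auto simp: module_hom_on_0[OF assms(1)] ring_module_onD(1)[OF assms(2)] module_hom_onD(2)[OF assms(1)]
      ring_module_on_sum[OF assms(2)])

lemma lookup_sum_keys:
  "(\<And>e. U 0 e = 0) \<Longrightarrow> finite A \<Longrightarrow> Poly_Mapping.keys u \<subseteq> A \<Longrightarrow>
   (\<Sum>e\<in>Poly_Mapping.keys u. U (Poly_Mapping.lookup u e) e) = (\<Sum>e\<in>A. U (Poly_Mapping.lookup u e) e)"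
  by (rule sum.mono_neutral_left) (auto simp: in_keys_iff)

text \<open>Stated for a general additive \<open>U\<close> because it serves both for module-valued
  maps on a projective module and for scalar functionals of the coordinates of C.\<close>

lemma coord_sum_add:
  assumes "\<And>e b c. U (b + c) e = U b e + (U c e :: 'v::ab_group_add)"
  shows "(\<Sum>e\<in>Poly_Mapping.keys (u + v). U (Poly_Mapping.lookup (u + v) e) e) =
    (\<Sum>e\<in>Poly_Mapping.keys u. U (Poly_Mapping.lookup u e) e) + (\<Sum>e\<in>Poly_Mapping.keys v. U (Poly_Mapping.lookup v e) e)"
proof -
  let ?A = "Poly_Mapping.keys u \<union> Poly_Mapping.keys v"
  have U0: "U 0 e = 0" for e using assms[of 0 0 e] by simp
  have "(\<Sum>e\<in>Poly_Mapping.keys w. U (Poly_Mapping.lookup w e) e) = (\<Sum>e\<in>?A. U (Poly_Mapping.lookup w e) e)"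
    if "Poly_Mapping.keys w \<subseteq> ?A" for w
    by (rule lookup_sum_keys) (use that U0 in auto)
  from this[of u] this[of v] this[OF keys_add] show ?thesis
    by (simp add: lookup_add assms sum.distrib)
qed

lemma coord_sum_scale:
  fixes u :: "'i \<Rightarrow>\<^sub>0 'b::ring_1"
  assumes "\<And>e. U 0 e = 0"
  shows "(\<Sum>e\<in>Poly_Mapping.keys (fscale b u). U (Poly_Mapping.lookup (fscale b u) e) e) =
    (\<Sum>e\<in>Poly_Mapping.keys u. U (b * Poly_Mapping.lookup u e) e)"
proof -
  have "Poly_Mapping.keys (fscale b u) \<subseteq> Poly_Mapping.keys u"
    by (auto simp: in_keys_iff lookup_fscale)
  from lookup_sum_keys[of U, OF assms finite_keys this] show ?thesis by (simp add: lookup_fscale)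
qed

lemma fscale_ring_module: "ring_module_on UNIV (fscale :: 'b::ring_1 \<Rightarrow> ('i \<Rightarrow>\<^sub>0 'b) \<Rightarrow> _)"
  by (auto simp: ring_module_on_def intro!: poly_mapping_eqI simp: lookup_fscale lookup_add algebra_simps)

lemma free_decomp:
  fixes u :: "'i \<Rightarrow>\<^sub>0 'b::ring_1"
  shows "u = (\<Sum>e\<in>Poly_Mapping.keys u. fscale (Poly_Mapping.lookup u e) (Poly_Mapping.single e 1))"
proof (rule poly_mapping_eqI)
  fix k
  have "(\<Sum>i\<in>Poly_Mapping.keys u. Poly_Mapping.lookup u i * (1 when i = k)) =
      (\<Sum>i\<in>Poly_Mapping.keys u. if i = k then Poly_Mapping.lookup u k else 0)"
    by (rule sum.cong) auto
  also have "\<dots> = Poly_Mapping.lookup u k"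
    by (simp add: in_keys_iff)
  finally show "Poly_Mapping.lookup u k =
      Poly_Mapping.lookup (\<Sum>i\<in>Poly_Mapping.keys u. fscale (Poly_Mapping.lookup u i) (Poly_Mapping.single i 1)) k"
    by (simp add: lookup_sum lookup_fscale lookup_single)
qed

text \<open>The dual basis lemma: \<open>r e\<close> is the image of the free generator
  \<open>e\<close>, and the coordinates of \<open>p\<close> with respect to these elements are given
  by the embedding \<open>i\<close>.\<close>

lemma projective_onE:
  fixes act :: "'b::ring_1 \<Rightarrow> 'p::ab_group_add \<Rightarrow> 'p"
  assumes "projective_on P act"
  obtains i :: "'p \<Rightarrow> ('p \<Rightarrow>\<^sub>0 'b)" and r :: "'p \<Rightarrow> 'p" where "module_hom_on P act UNIV fscale i"
    "\<And>e. r e \<in> P"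
    "\<And>p. p \<in> P \<Longrightarrow> (\<Sum>e\<in>Poly_Mapping.keys (i p). act (Poly_Mapping.lookup (i p) e) (r e)) = p"
proof -
  from assms obtain i :: "'p \<Rightarrow> ('p \<Rightarrow>\<^sub>0 'b)" and r where i: "module_hom_on P act UNIV fscale i"
    and r: "module_hom_on UNIV fscale P act r"
    and ri: "\<And>p. p \<in> P \<Longrightarrow> r (i p) = p"
    by (auto simp: projective_on_def)
  show thesis
  proof (rule that[of i "\<lambda>e. r (Poly_Mapping.single e 1)"])
    fix p assume p: "p \<in> P"
    have "p = r (\<Sum>e\<in>Poly_Mapping.keys (i p). fscale (Poly_Mapping.lookup (i p) e) (Poly_Mapping.single e 1))"
      using ri[OF p] free_decomp[of "i p"] by simp
    also have "\<dots> = (\<Sum>e\<in>Poly_Mapping.keys (i p). act (Poly_Mapping.lookup (i p) e) (r (Poly_Mapping.single e 1)))"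
      by (subst module_hom_on_sum[OF r fscale_ring_module]) (simp_all add: module_hom_onD(3)[OF r])
    finally show "(\<Sum>e\<in>Poly_Mapping.keys (i p). act (Poly_Mapping.lookup (i p) e) (r (Poly_Mapping.single e 1))) = p" ..
  qed (use i module_hom_onD(1)[OF r] in auto)
qed

text \<open>The values \<open>t e\<close> are arbitrary: the map is the coordinate map
  \<open>i\<close> followed by the linear map from the free module that sends the generator
  \<open>e\<close> to \<open>t e\<close>.\<close>

lemma projective_extend:
  assumes "projective_on P act" "ring_module_on Q actQ"
    and i: "module_hom_on P act UNIV fscale (i :: 'p::ab_group_add \<Rightarrow> ('e \<Rightarrow>\<^sub>0 'b::ring_1))" and t: "\<And>e. t e \<in> Q"
  shows "module_hom_on P act Q actQ (\<lambda>p. \<Sum>e\<in>Poly_Mapping.keys (i p). actQ (Poly_Mapping.lookup (i p) e) (t e))"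
  unfolding module_hom_on_def
proof (intro conjI ballI allI)
  note Q = ring_module_onD[OF assms(2)]
  show "(\<lambda>p. \<Sum>e\<in>Poly_Mapping.keys (i p). actQ (Poly_Mapping.lookup (i p) e) (t e)) ` P \<subseteq> Q"
    by (auto intro!: ring_module_on_sum[OF assms(2)] Q(4) t)
  fix p assume p: "p \<in> P"
  show "(\<Sum>e\<in>Poly_Mapping.keys (i (p + q)). actQ (Poly_Mapping.lookup (i (p + q)) e) (t e)) =
      (\<Sum>e\<in>Poly_Mapping.keys (i p). actQ (Poly_Mapping.lookup (i p) e) (t e)) +
      (\<Sum>e\<in>Poly_Mapping.keys (i q). actQ (Poly_Mapping.lookup (i q) e) (t e))" if "q \<in> P" for q
    unfolding module_hom_onD(2)[OF i p that] by (rule coord_sum_add) (rule Q(6)[OF t])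
  show "(\<Sum>e\<in>Poly_Mapping.keys (i (act b p)). actQ (Poly_Mapping.lookup (i (act b p)) e) (t e)) =
     actQ b (\<Sum>e\<in>Poly_Mapping.keys (i p). actQ (Poly_Mapping.lookup (i p) e) (t e))" for b
  proof -
    have "(\<Sum>e\<in>Poly_Mapping.keys (i (act b p)). actQ (Poly_Mapping.lookup (i (act b p)) e) (t e)) =
      (\<Sum>e\<in>Poly_Mapping.keys (i p). actQ (b * Poly_Mapping.lookup (i p) e) (t e))"
      unfolding module_hom_onD(3)[OF i p]
      by (rule coord_sum_scale) (rule ring_module_on_zero_act[OF assms(2) t])
    also have "\<dots> = actQ b (\<Sum>e\<in>Poly_Mapping.keys (i p). actQ (Poly_Mapping.lookup (i p) e) (t e))"
      by (subst ring_module_on_act_sum[OF assms(2)]) (auto simp: Q(7)[OF t] intro!: Q(4) t)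
    finally show ?thesis .
  qed
qed

section \<open>Lifting equivariant maps along an exact complex\<close>

locale coresolution =
  fixes M :: "nat \<Rightarrow> 'f::ab_group_add set" and star :: "'b::ring_1 \<Rightarrow> 'f \<Rightarrow> 'f" and D :: "nat \<Rightarrow> 'f \<Rightarrow> 'f"
  assumes ring_module: "ring_module_on (M a) star"
    and D_hom: "module_hom_on (M (Suc a)) star (M a) star (D a)"
    and D_D: "f \<in> M (Suc (Suc a)) \<Longrightarrow> D a (D (Suc a) f) = 0"
    and D_exact: "f \<in> M (Suc a) \<Longrightarrow> D a f = 0 \<Longrightarrow> \<exists>g\<in>M (Suc (Suc a)). D (Suc a) g = f"
begin

text \<open>Exactness of the functor of module maps out of \<open>X\<close> on the complex, at the
  positive indices. The differentials lower the index because functionals are pulled back along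
  comultiplications.\<close>

definition lifts :: "'x::ab_group_add set \<Rightarrow> ('b \<Rightarrow> 'x \<Rightarrow> 'x) \<Rightarrow> bool" where
  "lifts X act \<longleftrightarrow> (\<forall>a \<phi>. module_hom_on X act (M (Suc a)) star \<phi> \<longrightarrow> (\<forall>x\<in>X. D a (\<phi> x) = 0) \<longrightarrow>
     (\<exists>\<psi>. module_hom_on X act (M (Suc (Suc a))) star \<psi> \<and> (\<forall>x\<in>X. D (Suc a) (\<psi> x) = \<phi> x)))"

lemma liftsE:
  assumes "lifts X act" "module_hom_on X act (M (Suc a)) star \<phi>" "\<And>x. x \<in> X \<Longrightarrow> D a (\<phi> x) = 0"
  obtains \<psi> where "module_hom_on X act (M (Suc (Suc a))) star \<psi>" "\<And>x. x \<in> X \<Longrightarrow> D (Suc a) (\<psi> x) = \<phi> x"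
  using assms unfolding lifts_def by blast

text \<open>By exactness the values at the elements of a dual basis have preimages, and the
  coordinates assemble these into a module map.\<close>

lemma lifts_projective:
  fixes P :: "'x::ab_group_add set"
  assumes P: "projective_on P act"
  shows "lifts P act"
  unfolding lifts_def
proof (intro allI impI)
  fix a \<phi> assume \<phi>: "module_hom_on P act (M (Suc a)) star \<phi>" "\<forall>x\<in>P. D a (\<phi> x) = 0"
  have Pm: "ring_module_on P act" using P by (simp add: projective_on_def)
  obtain i :: "'x \<Rightarrow> ('x \<Rightarrow>\<^sub>0 'b)" and r :: "'x \<Rightarrow> 'x"
    where i: "module_hom_on P act UNIV fscale i" and r: "\<And>e. r e \<in> P"
    and ir: "\<And>p. p \<in> P \<Longrightarrow> (\<Sum>e\<in>Poly_Mapping.keys (i p). act (Poly_Mapping.lookup (i p) e) (r e)) = p"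
    by (rule projective_onE[OF P], rule that) simp_all
  have "\<forall>e. \<exists>g. g \<in> M (Suc (Suc a)) \<and> D (Suc a) g = \<phi> (r e)"
    using D_exact module_hom_onD(1)[OF \<phi>(1) r] \<phi>(2) r by blast
  then obtain t where t: "\<And>e. t e \<in> M (Suc (Suc a))" "\<And>e. D (Suc a) (t e) = \<phi> (r e)" by metis
  let ?\<psi> = "\<lambda>p. \<Sum>e\<in>Poly_Mapping.keys (i p). star (Poly_Mapping.lookup (i p) e) (t e)"
  have "D (Suc a) (?\<psi> p) = \<phi> p" if p: "p \<in> P" for p
  proof -
    have "D (Suc a) (?\<psi> p) = (\<Sum>e\<in>Poly_Mapping.keys (i p). star (Poly_Mapping.lookup (i p) e) (\<phi> (r e)))"
      by (subst module_hom_on_sum[OF D_hom ring_module])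
        (auto simp: module_hom_onD(3)[OF D_hom] t intro!: ring_module_onD(4)[OF ring_module] t)
    also have "\<dots> = \<phi> (\<Sum>e\<in>Poly_Mapping.keys (i p). act (Poly_Mapping.lookup (i p) e) (r e))"
      by (subst module_hom_on_sum[OF \<phi>(1) Pm])
        (auto simp: module_hom_onD(3)[OF \<phi>(1)] r intro!: ring_module_onD(4)[OF Pm] r)
    finally show ?thesis by (simp add: ir[OF p])
  qed
  then show "\<exists>\<psi>. module_hom_on P act (M (Suc (Suc a))) star \<psi> \<and> (\<forall>x\<in>P. D (Suc a) (\<psi> x) = \<phi> x)"
    using projective_extend[where t = t, OF P ring_module i t(1)] by blast
qed

text \<open>For a projective \<open>P\<close> with submodule \<open>K\<close> this says that the
  first Ext group of \<open>P / K\<close> with values in \<open>M (Suc a)\<close> vanishes.\<close>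

definition extends_from :: "'x::ab_group_add set \<Rightarrow> 'x set \<Rightarrow> ('b \<Rightarrow> 'x \<Rightarrow> 'x) \<Rightarrow> bool" where
  "extends_from K P act \<longleftrightarrow> (\<forall>a \<phi>. module_hom_on K act (M (Suc a)) star \<phi> \<longrightarrow>
     (\<exists>\<psi>. module_hom_on P act (M (Suc a)) star \<psi> \<and> (\<forall>x\<in>K. \<psi> x = \<phi> x)))"

lemma extends_fromE:
  assumes "extends_from K P act" "module_hom_on K act (M (Suc a)) star \<phi>"
  obtains \<psi> where "module_hom_on P act (M (Suc a)) star \<psi>" "\<And>x. x \<in> K \<Longrightarrow> \<psi> x = \<phi> x"
  using assms unfolding extends_from_def by blast

text \<open>Dimension shifting. Over \<open>P\<close> the map lifts to \<open>\<psi>1\<close>, which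
  need not descend to \<open>X\<close>. On the kernel of \<open>e\<close> it is a cycle and is
  lifted one degree further to \<open>\<psi>2\<close>, and this is extended from the kernel to
  \<open>\<psi>3\<close> on all of \<open>P\<close>; subtracting its differential from
  \<open>\<psi>1\<close> makes the lift vanish on the kernel.\<close>

lemma lifts_quotient:
  assumes P: "projective_on P actP" and e: "module_hom_on P actP X actX e" "e ` P = X"
    and ext: "extends_from {p \<in> P. e p = 0} P actP" and K: "lifts {p \<in> P. e p = 0} actP"
  shows "lifts X actX"
  unfolding lifts_def
proof (intro allI impI)
  fix a \<phi> assume \<phi>: "module_hom_on X actX (M (Suc a)) star \<phi>" "\<forall>x\<in>X. D a (\<phi> x) = 0"
  let ?K = "{p \<in> P. e p = 0}"
  have Pm: "ring_module_on P actP" using P by (simp add: projective_on_def)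
  note eD = module_hom_onD[OF e(1)]
  have hom: "module_hom_on P actP (M (Suc a)) star (\<lambda>p. \<phi> (e p))"
    using module_hom_onD[OF \<phi>(1)] eD unfolding module_hom_on_def by auto
  have "D a (\<phi> (e p)) = 0" if "p \<in> P" for p using \<phi>(2) eD(1)[OF that] by simp
  from liftsE[OF lifts_projective[OF P] hom this]
  obtain \<psi>1 where \<psi>1: "module_hom_on P actP (M (Suc (Suc a))) star \<psi>1"
    "\<And>p. p \<in> P \<Longrightarrow> D (Suc a) (\<psi>1 p) = \<phi> (e p)" by blast
  have P0: "0 \<in> P" by (rule ring_module_onD(1)[OF Pm])
  have e0: "e 0 = 0" by (rule module_hom_on_0[OF e(1) P0])
  have "0 \<in> X" using eD(1)[OF P0] e0 by simp
  then have 0: "\<phi> 0 = 0" by (rule module_hom_on_0[OF \<phi>(1)])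
  have hom1: "module_hom_on ?K actP (M (Suc (Suc a))) star \<psi>1"
    using module_hom_onD[OF \<psi>1(1)] unfolding module_hom_on_def by auto
  have "D (Suc a) (\<psi>1 x) = 0" if "x \<in> ?K" for x using \<psi>1(2)[of x] 0 that by simp
  from liftsE[OF K hom1 this] obtain \<psi>2 where \<psi>2: "module_hom_on ?K actP (M (Suc (Suc (Suc a)))) star \<psi>2"
    "\<And>x. x \<in> ?K \<Longrightarrow> D (Suc (Suc a)) (\<psi>2 x) = \<psi>1 x" by blast
  from extends_fromE[OF ext \<psi>2(1)]
  obtain \<psi>3 where \<psi>3: "module_hom_on P actP (M (Suc (Suc (Suc a)))) star \<psi>3" "\<And>x. x \<in> ?K \<Longrightarrow> \<psi>3 x = \<psi>2 x" by blast
  \<comment> \<open>On the kernel of \<open>e\<close> the two terms agree, so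
    \<open>\<theta>\<close> descends to \<open>X\<close>. The subtracted term is a boundary and does
    not change the differential, which remains \<open>\<phi> (e p)\<close>.\<close>
  define \<theta> where "\<theta> p = \<psi>1 p - D (Suc (Suc a)) (\<psi>3 p)" for p
  note M3 = module_hom_onD[OF \<psi>3(1)] and M1 = module_hom_onD[OF \<psi>1(1)]
  have \<theta>M: "\<theta> p \<in> M (Suc (Suc a))" if "p \<in> P" for p
    unfolding \<theta>_def by (intro ring_module_on_diff[OF ring_module] M1(1) module_hom_onD(1)[OF D_hom] M3(1) that)
  have \<theta>_add: "\<theta> (p + q) = \<theta> p + \<theta> q" if "p \<in> P" "q \<in> P" for p q
    unfolding \<theta>_def using that by (simp add: M1(2) M3(1,2) module_hom_onD(2)[OF D_hom])
  have \<theta>_act: "\<theta> (actP b p) = star b (\<theta> p)" if "p \<in> P" for b p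
  proof -
    have m: "\<psi>1 p \<in> M (Suc (Suc a))" "D (Suc (Suc a)) (\<psi>3 p) \<in> M (Suc (Suc a))"
      using M1(1) M3(1) that module_hom_onD(1)[OF D_hom] by auto
    have "star b (\<psi>1 p) = star b (\<theta> p) + star b (D (Suc (Suc a)) (\<psi>3 p))"
      using ring_module_onD(5)[OF ring_module \<theta>M[OF that] m(2), of b] by (simp add: \<theta>_def)
    then show ?thesis using that by (simp add: \<theta>_def M1(3) M3(1,3) module_hom_onD(3)[OF D_hom])
  qed
  have \<theta>_K: "\<theta> p = 0" if "p \<in> ?K" for p using that by (simp add: \<theta>_def \<psi>3(2) \<psi>2(2))
  have \<theta>_eq: "\<theta> p = \<theta> q" if "p \<in> P" "q \<in> P" "e p = e q" for p q
  proof -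
    have "p - q \<in> ?K" using that by (simp add: ring_module_on_diff[OF Pm] module_hom_on_diff[OF e(1) Pm])
    then have "\<theta> (p - q) = 0" "p - q \<in> P" using \<theta>_K by auto
    with \<theta>_add[of "p - q" q] that show ?thesis by simp
  qed
  define s where "s x = (SOME p. p \<in> P \<and> e p = x)" for x
  have s: "s x \<in> P \<and> e (s x) = x" if "x \<in> X" for x
    unfolding s_def by (rule someI_ex) (use that e(2) in auto)
  define \<psi> where "\<psi> x = \<theta> (s x)" for x
  have \<psi>: "\<psi> (e p) = \<theta> p" if "p \<in> P" for p
    unfolding \<psi>_def using s[of "e p"] eD(1) that by (intro \<theta>_eq) auto
  have "module_hom_on X actX (M (Suc (Suc a))) star \<psi>"
    unfolding module_hom_on_def e(2)[symmetric]
    by (auto simp: \<psi> \<theta>M \<theta>_add[symmetric] \<theta>_act[symmetric] eD(2,3)[symmetric] ring_module_onD[OF Pm])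
  moreover have "D (Suc a) (\<psi> x) = \<phi> x" if xX: "x \<in> X" for x
  proof -
    obtain p where p: "p \<in> P" "x = e p" using xX e(2) by blast
    have "D (Suc a) (\<theta> p) = D (Suc a) (\<psi>1 p) - D (Suc a) (D (Suc (Suc a)) (\<psi>3 p))"
      unfolding \<theta>_def
      by (rule module_hom_on_diff[OF D_hom ring_module]) (auto intro: M1 M3 p module_hom_onD(1)[OF D_hom])
    then show ?thesis using p by (simp add: \<psi> \<psi>1(2) D_D M3(1))
  qed
  ultimately show "\<exists>\<psi>. module_hom_on X actX (M (Suc (Suc a))) star \<psi> \<and> (\<forall>x\<in>X. D (Suc a) (\<psi> x) = \<phi> x)"
    by blast
qed

text \<open>Descending induction over the syzygies of \<open>X\<close>, starting from the trivial
  module. Each step uses the preceding syzygy one degree higher, which is why \<open>lifts\<close>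
  is quantified over all degrees and the complex has to be unbounded.\<close>

lemma lifts_finite_projective_dimension:
  assumes fpd: "finite_projective_dimension TYPE('p::ab_group_add) actX"
    and ext: "\<And>K P (act :: 'b \<Rightarrow> 'p \<Rightarrow> 'p). projective_on P act \<Longrightarrow> K \<subseteq> P \<Longrightarrow> ring_module_on K act \<Longrightarrow> extends_from K P act"
  shows "lifts UNIV actX"
proof -
  obtain m and P :: "nat \<Rightarrow> 'p set" and act d e where H: "\<forall>i. projective_on (P i) (act i)" "\<forall>i>m. P i = {0}"
    "module_hom_on (P 0) (act 0) UNIV actX e" "e ` P 0 = UNIV"
    "\<forall>i. module_hom_on (P (Suc i)) (act (Suc i)) (P i) (act i) (d i)"
    "d 0 ` P 1 = {p \<in> P 0. e p = 0}" "\<forall>i. d (Suc i) ` P (Suc (Suc i)) = {p \<in> P (Suc i). d i p = 0}"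
    using fpd unfolding finite_projective_dimension_def by (elim exE conjE) (rule that)
  note e = H(3,4) and d0 = H(6)
  have proj: "projective_on (P i) (act i)" and triv: "i > m \<Longrightarrow> P i = {0}"
    and d: "module_hom_on (P (Suc i)) (act (Suc i)) (P i) (act i) (d i)"
    and dS: "d (Suc i) ` P (Suc (Suc i)) = {p \<in> P (Suc i). d i p = 0}" for i
    using H(1,2,5,7) by auto
  have Pm: "ring_module_on (P i) (act i)" for i using proj by (simp add: projective_on_def)
  \<comment> \<open>The kernels in the resolution, \<open>K 0\<close> being that of the
    augmentation. Beyond its length \<open>m\<close> they are zero.\<close>
  define K where "K i = (case i of 0 \<Rightarrow> {p \<in> P 0. e p = 0} | Suc j \<Rightarrow> {p \<in> P (Suc j). d j p = 0})" for i
  have kernel: "ring_module_on {p \<in> Q. f p = 0} a" if Q: "ring_module_on Q a" and f: "module_hom_on Q a R b f"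
    and b0: "\<And>c. b c 0 = 0" for Q :: "'p set" and a f b and R :: "'z::ab_group_add set"
    using ring_module_onD[OF Q] module_hom_onD[OF f] module_hom_on_0[OF f] module_hom_on_diff[OF f Q, of 0] b0
    unfolding ring_module_on_def by auto
  have "actX c 0 = 0" for c
    using module_hom_onD(3)[OF e(1) ring_module_onD(1)[OF Pm], of c] module_hom_on_0[OF e(1) ring_module_onD(1)[OF Pm]]
      ring_module_on_act_0[OF Pm] by simp
  then have Km: "ring_module_on (K i) (act i)" for i
    using kernel[OF Pm e(1)] kernel[OF Pm d ring_module_on_act_0[OF Pm]] by (cases i) (simp_all add: K_def)
  have KP: "K i \<subseteq> P i" for i by (auto simp: K_def split: nat.splits)
  have dK: "d i ` P (Suc i) = K i" "{p \<in> P (Suc i). d i p = 0} = K (Suc i)" for i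
    using d0 dS by (auto simp: K_def split: nat.splits)
  have dhom: "module_hom_on (P (Suc i)) (act (Suc i)) (K i) (act i) (d i)" for i
    using d[of i] dK(1)[of i] unfolding module_hom_on_def by auto
  have "lifts (K i) (act i)" if "i \<le> Suc m" for i
    using that
  proof (induction i rule: inc_induct)
    case base
    have "K (Suc m) = {0}" using KP[of "Suc m"] triv[of "Suc m"] ring_module_onD(1)[OF Km[of "Suc m"]] by auto
    moreover have "lifts {0 :: 'p} a" if a0: "\<And>b. a b 0 = 0" for a
      unfolding lifts_def
    proof (intro allI impI)
      fix n \<phi> assume \<phi>: "module_hom_on {0 :: 'p} a (M (Suc n)) star \<phi>"
      then have "\<phi> 0 = 0" by (rule module_hom_on_0) simp
      moreover have "module_hom_on {0 :: 'p} a (M (Suc (Suc n))) star (\<lambda>_. 0)"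
        using ring_module_onD(1)[OF ring_module] ring_module_on_act_0[OF ring_module] by (auto simp: module_hom_on_def)
      ultimately show "\<exists>\<psi>. module_hom_on {0 :: 'p} a (M (Suc (Suc n))) star \<psi> \<and> (\<forall>x\<in>{0}. D (Suc n) (\<psi> x) = \<phi> x)"
        using module_hom_on_0[OF D_hom ring_module_onD(1)[OF ring_module]] by (intro exI[of _ "\<lambda>_. 0"]) auto
    qed
    ultimately show ?case using ring_module_on_act_0[OF Pm] by simp
  next
    case (step i)
    show ?case
    proof (rule lifts_quotient[OF proj dhom dK(1)])
      show "extends_from {p \<in> P (Suc i). d i p = 0} (P (Suc i)) (act (Suc i))"
        unfolding dK(2) by (rule ext[OF proj KP Km])
      show "lifts {p \<in> P (Suc i). d i p = 0} (act (Suc i))" unfolding dK(2) by (rule step.IH)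
    qed
  qed
  then have "lifts (K 0) (act 0)" by simp
  moreover have "K 0 = {p \<in> P 0. e p = 0}" by (simp add: K_def)
  ultimately show ?thesis
    using lifts_quotient[OF proj e] ext[OF proj KP Km, of 0] by simp
qed

end

section \<open>Zones of words\<close>

text \<open>The dual bar differential on the letters \<open>lo, ..., lo + a - 1\<close>. Signs are
  counted from the beginning of the zone, so that the result can be compared with the bar complex of
  D.\<close>

definition zone_diff :: "('c \<Rightarrow> ('c \<times> 'c \<Rightarrow>\<^sub>0 'k::field)) \<Rightarrow> nat \<Rightarrow> nat \<Rightarrow> ('c list \<Rightarrow> 'k) \<Rightarrow> 'c list \<Rightarrow> 'k"
  where "zone_diff \<Delta> lo a f cs = (\<Sum>t<a. alt t (ev (comult_at \<Delta> (lo + t) cs) f))"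

lemma ev_comult_at_eq_0:
  "j < length cs \<Longrightarrow> (\<And>ds. length ds = Suc (length cs) \<Longrightarrow> f ds = 0) \<Longrightarrow> ev (comult_at \<Delta> j cs) f = 0"
  using ev_comult_at_cong[of j cs f "\<lambda>_. 0" \<Delta>] by simp

lemma alt_sum: "alt j (\<Sum>i\<in>A. g i) = (\<Sum>i\<in>A. alt j (g i))"
  by (simp add: alt_def sum_negf)

context coalgebra
begin

lemma mlin_zone_diff:
  "mlin scale (Suc N) f \<Longrightarrow> lo + a \<le> N \<Longrightarrow> mlin scale N (zone_diff \<Delta> lo a f)"
  unfolding zone_diff_def by (intro mlin_sum mlin_alt mlin_comult_at) auto

lemma zone_diff_zone_diff:
  assumes "mlin scale (Suc (Suc (length cs))) f" "lo + a \<le> length cs"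
  shows "zone_diff \<Delta> lo a (zone_diff \<Delta> lo (Suc a) f) cs = 0"
proof (cases a)
  case (Suc m)
  let ?a = "\<lambda>s t. alt t (alt s (ev (comult_at \<Delta> (lo + t) cs) (\<lambda>ds. ev (comult_at \<Delta> (lo + s) ds) f)))"
  have "zone_diff \<Delta> lo a (zone_diff \<Delta> lo (Suc a) f) cs = (\<Sum>t\<le>m. \<Sum>s\<le>Suc m. ?a s t)"
    by (simp only: zone_diff_def[abs_def] Suc lessThan_Suc_atMost ev_fun_sum ev_fun_alt alt_sum)
  also have "\<dots> = (\<Sum>s\<le>Suc m. \<Sum>t\<le>m. ?a s t)" by (rule sum.swap)
  also have "\<dots> = 0"
  proof (rule alternating_double_sum)
    fix i j assume "i \<le> j" "j \<le> m"
    then show "?a (Suc j) i = - ?a i j"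
      using comult_at_comult_at[OF assms(1), of "lo + i" "lo + j"] assms(2) Suc
      by (simp add: alt_Suc alt_minus alt_swap[of i])
  qed
  finally show ?thesis .
qed (simp add: zone_diff_def)

text \<open>A linear map \<open>h\<close> that inverts the bar differential of an acyclic bar complex modulo coboundaries; it acts on
  all functionals at once, so that further tensor factors can be carried along as parameters.\<close>

lemma H_counital_homotopy:
  assumes "H_counital scale \<Delta>"
  shows "\<exists>h :: 'c list \<Rightarrow> ('c list \<Rightarrow>\<^sub>0 'k). \<forall>F. mlin scale (Suc n) F \<longrightarrow>
    (\<forall>zs. length zs = n \<longrightarrow> zone_diff \<Delta> 0 n F zs = 0) \<longrightarrow>
    mlin scale (Suc (Suc n)) (\<lambda>zs. ev (h zs) F) \<and>
    (\<forall>zs. length zs = Suc n \<longrightarrow> zone_diff \<Delta> 0 (Suc n) (\<lambda>ws. ev (h ws) F) zs = F zs)"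
proof -
  define V :: "nat \<Rightarrow> ('c list \<Rightarrow>\<^sub>0 'k) set" where "V n = {u. \<forall>cs\<in>Poly_Mapping.keys u. length cs = Suc n}" for n
  define W where "W n = fspan (power_rels scale n)" for n
  define d where "d n u = (u \<bind> (\<lambda>cs. \<Sum>j\<le>n. alt j (comult_at \<Delta> j cs)))" for n and u :: "'c list \<Rightarrow>\<^sub>0 'k"
  define Y where "Y n = coboundaries V W d n" for n
  have acyc: "acyclic_complex V W d"
    using assms unfolding H_counital_def V_def[abs_def] W_def[abs_def] d_def[abs_def] .
  have ev_d: "ev (d n u) F = ev u (zone_diff \<Delta> 0 (Suc n) F)" for n u F
    by (simp add: d_def ev_bind ev_sum ev_alt zone_diff_def[abs_def] lessThan_Suc_atMost)
  have W_ev: "w \<in> W n \<Longrightarrow> mlin scale (Suc n) F \<Longrightarrow> ev w F = 0" for w n F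
    unfolding W_def by (rule ev_span) (use power_rels_annihilator[of scale n F] in auto)
  have W_I: "(\<And>F. mlin scale (Suc n) F \<Longrightarrow> ev w F = 0) \<Longrightarrow> w \<in> W n" for w n
    unfolding W_def by (rule in_fspanI) (use power_rels_annihilator[of scale n] in blast)
  have d_W: "w \<in> W n \<Longrightarrow> d n w \<in> W (Suc n)" for w n
    by (rule W_I) (simp add: ev_d W_ev mlin_zone_diff)
  have V_ev: "u \<in> V n \<Longrightarrow> (\<And>cs. length cs = Suc n \<Longrightarrow> F cs = 0) \<Longrightarrow> ev u F = 0" for u n F
    by (rule ev_eq_0) (auto simp: V_def)
  have d_d: "d (Suc n) (d n u) \<in> W (Suc (Suc n))" if "u \<in> V n" for u n
    by (rule W_I) (use that in \<open>auto simp: ev_d intro!: V_ev zone_diff_zone_diff\<close>)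
  have Y_cases: "y \<in> Y n \<longleftrightarrow> (case n of 0 \<Rightarrow> y \<in> W 0 | Suc m \<Rightarrow> \<exists>v\<in>V m. \<exists>w\<in>W (Suc m). y = d m v + w)" for y n
    by (auto simp: Y_def coboundaries_def split: nat.splits)
  have subW: "fs.subspace (W n)" for n by (simp add: W_def)
  have subV: "fs.subspace (V n)" for n
    unfolding V_def
  proof (rule fs.subspaceI)
    fix x y :: "'c list \<Rightarrow>\<^sub>0 'k" and a
    assume x: "x \<in> {u. \<forall>cs\<in>Poly_Mapping.keys u. length cs = Suc n}"
    have "Poly_Mapping.keys (fscale a x) \<subseteq> Poly_Mapping.keys x" by (auto simp: in_keys_iff lookup_fscale)
    then show "fscale a x \<in> {u. \<forall>cs\<in>Poly_Mapping.keys u. length cs = Suc n}" using x by auto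
    assume "y \<in> {u. \<forall>cs\<in>Poly_Mapping.keys u. length cs = Suc n}"
    then show "x + y \<in> {u. \<forall>cs\<in>Poly_Mapping.keys u. length cs = Suc n}"
      using x keys_add[of x y] by auto
  qed simp
  have d_add: "d n (u + v) = d n u + d n v" and d_scale: "d n (fscale a u) = fscale a (d n u)" for n a u v
    by (simp_all add: d_def fbind_add fbind_scale)
  have subY: "fs.subspace (Y n)"
  proof (cases n)
    case 0
    then have "Y n = W 0" using Y_cases[of _ n] by auto
    then show ?thesis by (simp add: subW)
  next
    case (Suc m)
    have Y: "y \<in> Y n \<longleftrightarrow> (\<exists>v\<in>V m. \<exists>w\<in>W (Suc m). y = d m v + w)" for y using Y_cases[of y n] Suc by simp
    show ?thesis
    proof (rule fs.subspaceI)
      have "d m 0 = 0" using d_scale[of m 0 0] by simp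
      then show "0 \<in> Y n" unfolding Y using fs.subspace_0[OF subV[of m]] fs.subspace_0[OF subW[of "Suc m"]] by force
      fix x y assume "x \<in> Y n" "y \<in> Y n"
      then obtain v w v' w' where "v \<in> V m" "w \<in> W (Suc m)" "x = d m v + w" "v' \<in> V m" "w' \<in> W (Suc m)" "y = d m v' + w'"
        unfolding Y by blast
      then show "x + y \<in> Y n"
        unfolding Y using fs.subspace_add[OF subV] fs.subspace_add[OF subW]
        by (intro bexI[of _ "v + v'"] bexI[of _ "w + w'"]) (auto simp: d_add)
    next
      fix a y assume "y \<in> Y n"
      then obtain v w where "v \<in> V m" "w \<in> W (Suc m)" "y = d m v + w" unfolding Y by blast
      then show "fscale a y \<in> Y n"
        unfolding Y using fs.subspace_scale[OF subV] fs.subspace_scale[OF subW]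
        by (intro bexI[of _ "fscale a v"] bexI[of _ "fscale a w"]) (auto simp: d_scale fs.scale_right_distrib)
    qed
  qed
  have exact: "u \<in> Y n" if "u \<in> V n" "d n u \<in> W (Suc n)" for u
  proof -
    have "coset (Y n) u \<in> cohomology V W d n" using that by (auto simp: cohomology_def cocycles_def Y_def)
    then have "coset (Y n) u = Y n" using acyc by (simp add: acyclic_complex_def Y_def)
    moreover have "u \<in> coset (Y n) u" using fs.subspace_0[OF subY] by (force simp: coset_def)
    ultimately show ?thesis by simp
  qed
  have dY: "d n y \<in> W (Suc n)" if yY: "y \<in> Y n" for y
  proof (cases n)
    case 0
    then show ?thesis using yY Y_cases[of y n] d_W by simp
  next
    case (Suc m)
    then obtain v w where "v \<in> V m" "w \<in> W (Suc m)" "y = d m v + w" using yY Y_cases[of y n] by auto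
    then show ?thesis
      using d_d[of v m] d_W[of w "Suc m"] Suc fs.subspace_add[OF subW] by (simp add: d_add)
  qed
  interpret vp: vector_space_pair "fscale :: 'k \<Rightarrow> ('c list \<Rightarrow>\<^sub>0 'k) \<Rightarrow> _" "fscale :: 'k \<Rightarrow> ('c list \<Rightarrow>\<^sub>0 'k) \<Rightarrow> _"
    by unfold_locales
  have id: "Vector_Spaces.linear fscale fscale (\<lambda>u. u :: 'c list \<Rightarrow>\<^sub>0 'k)" using fs.linear_ident .
  have lin_d: "Vector_Spaces.linear fscale fscale (d n)"
    by (simp add: Vector_Spaces.linear_iff vector_space_fscale d_add d_scale)
  \<comment> \<open>Over a field there are linear projections onto the relations and onto the
    coboundaries. The maps \<open>p\<close> and \<open>z\<close> below remove these parts.\<close>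
  obtain pW where pW: "range pW \<subseteq> W (Suc n)" "Vector_Spaces.linear fscale fscale pW" "\<forall>v\<in>W (Suc n). pW v = v"
    using vp.linear_exists_left_inverse_on[OF id subW[of "Suc n"]] by auto
  obtain pY where pY: "range pY \<subseteq> Y n" "Vector_Spaces.linear fscale fscale pY" "\<forall>v\<in>Y n. pY v = v"
    using vp.linear_exists_left_inverse_on[OF id subY] by auto
  define p where "p u = u - pW u" for u
  define z where "z u = u - pY u" for u
  have lin_p: "Vector_Spaces.linear fscale fscale p" unfolding p_def by (rule vp.linear_compose_sub[OF id pW(2)])
  have lin_z: "Vector_Spaces.linear fscale fscale z" unfolding z_def by (rule vp.linear_compose_sub[OF id pY(2)])
  have lin_pd: "Vector_Spaces.linear fscale fscale (\<lambda>u. p (d n u))"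
    using Vector_Spaces.linear_compose[OF lin_d lin_p] by (simp add: o_def)
  have p0: "p w = 0 \<longleftrightarrow> w \<in> W (Suc n)" for w
    unfolding p_def using pW(1,3) by (metis diff_self eq_iff_diff_eq_0 rangeI subsetD)
  have zY: "z y = 0" if "y \<in> Y n" for y using that pY(3) by (simp add: z_def)
  have zz: "z (z u) = z u" for u
    using zY[of "pY u"] pY(1) vp.linear_diff[OF lin_z, of u "pY u"] unfolding z_def by (auto simp: image_subset_iff)
  have Y_V: "y \<in> V n" if y: "y \<in> Y n" for y
  proof -
    have chain: "u \<in> V n" if vanish: "\<And>F. (\<And>cs. length cs = Suc n \<Longrightarrow> F cs = 0) \<Longrightarrow> ev u F = 0" for u n
    proof -
      have "length cs = Suc n" if cs: "cs \<in> Poly_Mapping.keys u" for cs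
      proof (rule ccontr)
        assume l: "length cs \<noteq> Suc n"
        have "ev u (\<lambda>i. if i = cs then 1 else 0) = 0" by (rule vanish) (use l in auto)
        moreover have "ev u (\<lambda>i. if i = cs then 1 else 0) = Poly_Mapping.lookup u cs"
          using cs by (simp add: lin_ext_def if_distrib sum.delta cong: if_cong)
        ultimately show False using cs by (simp add: in_keys_iff)
      qed
      then show ?thesis by (simp add: V_def)
    qed
    have W_V: "w \<in> V n" if "w \<in> W n" for w n
      by (rule chain, rule W_ev[OF that]) (auto intro!: mlin_cong[OF mlin_zero])
    have d_V: "d n u \<in> V (Suc n)" if "u \<in> V n" for u n
      by (rule chain, unfold ev_d zone_diff_def[abs_def], rule V_ev[OF that], rule sum.neutral)
        (simp add: ev_comult_at_eq_0)
    show ?thesis using y Y_cases[of y n] W_V d_V fs.subspace_add[OF subV] by (cases n) auto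
  qed
  have subZ: "fs.subspace (z ` V n)" by (rule vp.linear_subspace_image[OF lin_z subV])
  have zV: "z u \<in> V n" if "u \<in> V n" for u
    unfolding z_def using that pY(1) Y_V by (intro fs.subspace_diff[OF subV]) auto
  \<comment> \<open>The image of \<open>V n\<close> under \<open>z\<close> is a complement of the
    coboundaries. A cocycle in it is a coboundary by acyclicity, hence zero, so the differential
    modulo relations is injective there and has a linear left inverse \<open>g\<close>.\<close>
  have inj: "inj_on (\<lambda>u. p (d n u)) (z ` V n)"
    unfolding vp.linear_inj_on_iff_eq_0[OF lin_pd subZ]
  proof (intro ballI impI)
    fix x assume x: "x \<in> z ` V n" and "p (d n x) = 0"
    then have "x \<in> Y n" using exact[of x] zV p0 by auto
    then have "z x = 0" by (rule zY)
    then show "x = 0" using x zz by auto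
  qed
  obtain g where g: "Vector_Spaces.linear fscale fscale g" "\<And>v. v \<in> z ` V n \<Longrightarrow> g (p (d n v)) = v"
    using vp.linear_exists_left_inverse_on[OF lin_pd subZ inj] by auto
  define h0 where "h0 u = g (p u)" for u
  have lin_h0: "Vector_Spaces.linear fscale fscale h0"
    using Vector_Spaces.linear_compose[OF lin_p g(1)] by (simp add: o_def h0_def[abs_def])
  have h0W: "h0 w = 0" if "w \<in> W (Suc n)" for w
    using that p0[of w] vp.linear_0[OF g(1)] by (simp add: h0_def)
  \<comment> \<open>\<open>h0\<close> recovers \<open>u\<close> from its differential up to a
    coboundary, and coboundaries are annihilated by the functionals under consideration.\<close>
  have h0d: "h0 (d n u) - u \<in> Y n" if u: "u \<in> V n" for u
  proof -
    have "d n u = d n (z u) + d n (pY u)" by (simp add: z_def flip: d_add)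
    then have "p (d n u) = p (d n (z u))"
      using vp.linear_add[OF lin_p, of "d n (z u)" "d n (pY u)"] p0[of "d n (pY u)"] dY[of "pY u"] pY(1) by auto
    then have "h0 (d n u) = z u" using g(2) u by (simp add: h0_def)
    then show ?thesis using pY(1) fs.subspace_neg[OF subY, of "pY u"] by (auto simp: z_def)
  qed
  have ev_h0: "ev (h0 u) F = ev u (\<lambda>zs. ev (h0 (gen zs)) F)" for u F
    using lfun_eq_ev[of "\<lambda>u. ev (h0 u) F" u] lin_h0
    by (simp add: lfun_def ev_add ev_scale Vector_Spaces.linear_iff)
  have Y_ev: "ev y F = 0" if F: "mlin scale (Suc n) F" "\<And>zs. length zs = n \<Longrightarrow> zone_diff \<Delta> 0 n F zs = 0" and y: "y \<in> Y n" for y F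
  proof (cases n)
    case 0
    then show ?thesis using y Y_cases[of y n] W_ev F(1) by simp
  next
    case (Suc m)
    then obtain v w where vw: "v \<in> V m" "w \<in> W (Suc m)" "y = d m v + w" using y Y_cases[of y n] by auto
    have "ev v (zone_diff \<Delta> 0 (Suc m) F) = 0" by (rule V_ev[OF vw(1)]) (use F(2) Suc in auto)
    then show ?thesis using vw W_ev[OF vw(2), of F] F(1) Suc by (simp add: ev_add ev_d)
  qed
  show ?thesis
  proof (intro exI[of _ "\<lambda>zs. h0 (gen zs)"] allI impI conjI)
    fix F assume F0: "mlin scale (Suc n) F" "\<forall>zs. length zs = n \<longrightarrow> zone_diff \<Delta> 0 n F zs = 0"
    then have F: "mlin scale (Suc n) F" "\<And>zs. length zs = n \<Longrightarrow> zone_diff \<Delta> 0 n F zs = 0" by auto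
    show "mlin scale (Suc (Suc n)) (\<lambda>zs. ev (h0 (gen zs)) F)"
      unfolding power_rels_annihilator[symmetric] ev_h0[symmetric]
      by (simp add: h0W[unfolded W_def] fs.span_base)
    fix zs :: "'c list" assume l: "length zs = Suc n"
    have "zone_diff \<Delta> 0 (Suc n) (\<lambda>ws. ev (h0 (gen ws)) F) zs = ev (h0 (d n (gen zs))) F"
      by (simp add: ev_h0[of "d n (gen zs)"] ev_d)
    also have "\<dots> = F zs + ev (h0 (d n (gen zs)) - gen zs) F" by (simp add: ev_diff)
    also have "\<dots> = F zs" using l by (subst Y_ev[OF F h0d]) (auto simp: V_def)
    finally show "zone_diff \<Delta> 0 (Suc n) (\<lambda>ws. ev (h0 (gen ws)) F) zs = F zs" .
  qed
qed

end

section \<open>Functionals that factor through the quotient on a zone\<close>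

lemma lact_cong_act:
  "(\<And>ds. length ds = length cs \<Longrightarrow> (\<And>p. p < length cs \<Longrightarrow> \<exists>b. ds ! p = act b (cs ! p)) \<Longrightarrow> f ds = g ds) \<Longrightarrow>
   lact \<Delta> \<epsilon> act b cs f = lact \<Delta> \<epsilon> act b cs g"
proof (induction cs arbitrary: b f g)
  case (Cons c cs)
  have "lact \<Delta> \<epsilon> act b2 cs (\<lambda>ds. f (act b1 c # ds)) = lact \<Delta> \<epsilon> act b2 cs (\<lambda>ds. g (act b1 c # ds))" for b1 b2
  proof (rule Cons.IH)
    fix ds assume ds: "length ds = length cs" "\<And>p. p < length cs \<Longrightarrow> \<exists>b. ds ! p = act b (cs ! p)"
    show "f (act b1 c # ds) = g (act b1 c # ds)"
    proof (rule Cons.prems)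
      fix p assume "p < length (c # cs)"
      then show "\<exists>b. (act b1 c # ds) ! p = act b ((c # cs) ! p)" using ds(2) by (cases p) auto
    qed (simp add: ds(1))
  qed
  then show ?case by simp
qed simp

lemma ev_comult_at_prefix:
  "ev (comult_at \<Delta> (length ms + t) (ms @ us)) f = ev (comult_at \<Delta> t us) (\<lambda>vs. f (ms @ vs))"
  by (simp add: ev_comult_at nth_append)

lemma mlin_split:
  fixes s :: "'k::field \<Rightarrow> 'c::ab_group_add \<Rightarrow> 'c"
  assumes "\<And>ys. length ys = m \<Longrightarrow> mlin s n (\<lambda>xs. F xs ys)" "\<And>xs. length xs = n \<Longrightarrow> mlin s m (F xs)"
  shows "mlin s (n + m) (\<lambda>cs. F (take n cs) (drop n cs))"
  unfolding mlin_def
proof (intro allI impI)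
  fix xs ys :: "'c list" assume l: "Suc (length xs + length ys) = n + m"
  show "lfun s (\<lambda>c. F (take n (xs @ c # ys)) (drop n (xs @ c # ys)))"
  proof (cases "length xs < n")
    case True
    then obtain k where k: "n = Suc (length xs + k)" using less_imp_Suc_add by blast
    then have "lfun s (\<lambda>c. F (xs @ c # take k ys) (drop k ys))"
      by (intro mlinD[OF assms(1)]) (use l in auto)
    then show ?thesis by (simp add: k)
  next
    case False
    then have "lfun s (\<lambda>c. F (take n xs) (drop n xs @ c # ys))"
      by (intro mlinD[OF assms(2)]) (use l in auto)
    then show ?thesis using False by simp
  qed
qed

text \<open>K enters only as the kernel of \<open>\<pi>\<close>, and \<open>kernel_comult\<close>
  expresses by functionals that it is a subcoalgebra. The section \<open>\<sigma>\<close> is linear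
  over B but not assumed to respect the comultiplication.\<close>

locale excision =
  cyclic_coefficients sB \<Delta>B \<epsilon> S sX actX \<rho> sC actC \<Delta>C + D: module_coalgebra sB \<Delta>B \<epsilon> S sD actD \<Delta>D
  for sB :: "'k::field \<Rightarrow> 'b::ring_1 \<Rightarrow> 'b" and \<Delta>B \<epsilon> S
    and sX :: "'k \<Rightarrow> 'x::ab_group_add \<Rightarrow> 'x" and actX \<rho>
    and sC :: "'k \<Rightarrow> 'c::ab_group_add \<Rightarrow> 'c" and actC \<Delta>C
    and sD :: "'k \<Rightarrow> 'd::ab_group_add \<Rightarrow> 'd" and actD \<Delta>D +
  fixes \<pi> :: "'c \<Rightarrow> 'd" and \<sigma> :: "'d \<Rightarrow> 'c"
  assumes \<pi>_add: "\<pi> (c + c') = \<pi> c + \<pi> c'" and \<pi>_scale: "\<pi> (sC a c) = sD a (\<pi> c)" and \<pi>_act: "\<pi> (actC b c) = actD b (\<pi> c)"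
    and \<sigma>_add: "\<sigma> (d + d') = \<sigma> d + \<sigma> d'" and \<sigma>_scale: "\<sigma> (sD a d) = sC a (\<sigma> d)" and \<sigma>_act: "\<sigma> (actD b d) = actC b (\<sigma> d)"
    and \<pi>_\<sigma> [simp]: "\<pi> (\<sigma> d) = d"
    and \<pi>_comult: "bilin sD sD F \<Longrightarrow> ev (\<Delta>C c) (\<lambda>(c1, c2). F (\<pi> c1) (\<pi> c2)) = ev (\<Delta>D (\<pi> c)) (\<lambda>(d1, d2). F d1 d2)"
    and kernel_comult: "bilin sC sC G \<Longrightarrow> \<pi> c = 0 \<Longrightarrow> (\<And>c1 c2. \<pi> c1 = 0 \<Longrightarrow> \<pi> c2 = 0 \<Longrightarrow> G c1 c2 = 0) \<Longrightarrow>
      ev (\<Delta>C c) (\<lambda>(c1, c2). G c1 c2) = 0"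
    and H_counital_D: "H_counital sD \<Delta>D"
    and projective_C: "projective_on UNIV actC"
begin

lemma \<pi>_diff: "\<pi> (c - c') = \<pi> c - \<pi> c'"
  by (rule additive_map_diff) (simp add: additive_map_def \<pi>_add)

lemma act_0_D [simp]: "actD b 0 = 0"
  using D.act_add_right[of b 0 0] by simp

text \<open>If letter \<open>j\<close> lies in the kernel, only its splittings into two kernel
  letters count; if it does not, the premise of \<open>v\<close> is vacuous and all splittings are
  covered. One condition on \<open>c1\<close> and \<open>c2\<close> thus handles both cases.\<close>

lemma comult_at_vanish:
  assumes j: "j < length cs" and f: "mlin sC (Suc (length cs)) f"
    and v: "\<And>c1 c2. (\<pi> (cs ! j) = 0 \<Longrightarrow> \<pi> c1 = 0 \<and> \<pi> c2 = 0) \<Longrightarrow> f (take j cs @ [c1, c2] @ drop (Suc j) cs) = 0"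
  shows "ev (comult_at \<Delta>C j cs) f = 0"
proof (cases "\<pi> (cs ! j) = 0")
  case True
  have "lfun sC (\<lambda>c1. f (take j cs @ c1 # c2 # drop (Suc j) cs))" for c2
    by (rule mlinD[OF f]) (use j in simp)
  moreover have "lfun sC (\<lambda>c2. f ((take j cs @ [c1]) @ c2 # drop (Suc j) cs))" for c1
    by (rule mlinD[OF f]) (use j in simp)
  ultimately have "bilin sC sC (\<lambda>c1 c2. f (take j cs @ [c1, c2] @ drop (Suc j) cs))"
    by (intro bilinI) simp_all
  from kernel_comult[OF this True] show ?thesis unfolding ev_comult_at using v by blast
next
  case False
  then have "f (take j cs @ [c1, c2] @ drop (Suc j) cs) = 0" for c1 c2 using v by blast
  then show ?thesis unfolding ev_comult_at by (simp add: case_prod_unfold)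
qed

lemma comult_at_\<pi>:
  assumes t: "t < length us" and G: "mlin sD (Suc (length us)) G"
  shows "ev (comult_at \<Delta>C t us) (\<lambda>vs. G (map \<pi> vs)) = ev (comult_at \<Delta>D t (map \<pi> us)) G"
proof -
  let ?u = "map \<pi> us"
  have "lfun sD (\<lambda>c1. G (take t ?u @ c1 # c2 # drop (Suc t) ?u))" for c2
    by (rule mlinD[OF G]) (use t in simp)
  moreover have "lfun sD (\<lambda>c2. G ((take t ?u @ [c1]) @ c2 # drop (Suc t) ?u))" for c1
    by (rule mlinD[OF G]) (use t in simp)
  ultimately have "bilin sD sD (\<lambda>c1 c2. G (take t ?u @ [c1, c2] @ drop (Suc t) ?u))"
    by (intro bilinI) simp_all
  from \<pi>_comult[OF this, of "us ! t"] show ?thesis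
    using t by (simp add: ev_comult_at take_map drop_map)
qed

text \<open>Functionals on words that factor through \<open>D\<close> on the \<open>a\<close> letters after the first \<open>lo\<close>, followed by \<open>r\<close> letters.
  Setting them to \<open>0\<close> on words of a different length makes them a module with honest equality of functions.\<close>

definition zone_funs :: "nat \<Rightarrow> nat \<Rightarrow> nat \<Rightarrow> ('c list \<Rightarrow> 'k) set" where
  "zone_funs lo r a = {f. mlin sC (lo + a + r) f \<and> (\<forall>cs. length cs \<noteq> lo + a + r \<longrightarrow> f cs = 0) \<and>
     (\<forall>cs t. length cs = lo + a + r \<longrightarrow> t < a \<longrightarrow> \<pi> (cs ! (lo + t)) = 0 \<longrightarrow> f cs = 0)}"

text \<open>The inverse of the antipode turns the right action on functionals into a left one, for which invariant functionals
  are linear in \<open>X\<close>.\<close>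

definition star :: "'b \<Rightarrow> ('c list \<Rightarrow> 'k) \<Rightarrow> ('c list \<Rightarrow> 'k)" where
  "star b f = (\<lambda>cs. C.la (T b) cs f)"

definition zdiff :: "nat \<Rightarrow> nat \<Rightarrow> nat \<Rightarrow> ('c list \<Rightarrow> 'k) \<Rightarrow> ('c list \<Rightarrow> 'k)" where
  "zdiff lo r a f = (\<lambda>cs. if length cs = lo + a + r then zone_diff \<Delta>C lo a f cs else 0)"

lemma zone_funsD:
  assumes "f \<in> zone_funs lo r a"
  shows "mlin sC (lo + a + r) f" "length cs \<noteq> lo + a + r \<Longrightarrow> f cs = 0"
    "length cs = lo + a + r \<Longrightarrow> t < a \<Longrightarrow> \<pi> (cs ! (lo + t)) = 0 \<Longrightarrow> f cs = 0"
  using assms by (auto simp: zone_funs_def)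

lemma zone_funsI:
  assumes "mlin sC (lo + a + r) f" "\<And>cs. length cs \<noteq> lo + a + r \<Longrightarrow> f cs = 0"
    "\<And>cs t. length cs = lo + a + r \<Longrightarrow> t < a \<Longrightarrow> \<pi> (cs ! (lo + t)) = 0 \<Longrightarrow> f cs = 0"
  shows "f \<in> zone_funs lo r a"
  using assms by (auto simp: zone_funs_def)

lemma la_wrong_length:
  "f \<in> zone_funs lo r a \<Longrightarrow> length cs \<noteq> lo + a + r \<Longrightarrow> C.la b cs f = 0"
  using lact_cong[of cs f "\<lambda>_. 0"] by (simp add: zone_funsD lact_zero)

lemma star_zone_funs:
  assumes f: "f \<in> zone_funs lo r a"
  shows "star b f \<in> zone_funs lo r a"
proof (rule zone_funsI)
  show "mlin sC (lo + a + r) (star b f)" unfolding star_def by (rule C.mlin_la[OF zone_funsD(1)[OF f]])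
  show "star b f cs = 0" if "length cs \<noteq> lo + a + r" for cs
    unfolding star_def by (rule la_wrong_length[OF f that])
  show "star b f cs = 0" if cs: "length cs = lo + a + r" "t < a" "\<pi> (cs ! (lo + t)) = 0" for cs t
  proof -
    have "C.la (T b) cs f = C.la (T b) cs (\<lambda>_. 0)"
    proof (rule lact_cong_act)
      fix ds assume l: "length ds = length cs" and ds: "\<And>p. p < length cs \<Longrightarrow> \<exists>b. ds ! p = actC b (cs ! p)"
      obtain b' where "ds ! (lo + t) = actC b' (cs ! (lo + t))" using ds[of "lo + t"] cs by auto
      then have "\<pi> (ds ! (lo + t)) = 0" using cs(3) by (simp add: \<pi>_act)
      then show "f ds = 0" using zone_funsD(3)[OF f] l cs by auto
    qed
    then show ?thesis by (simp add: star_def lact_zero)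
  qed
qed

lemma ring_module_zone_funs: "ring_module_on (zone_funs lo r a) star"
  unfolding ring_module_on_def
proof (intro conjI ballI allI)
  show "0 \<in> zone_funs lo r a" by (rule zone_funsI) (auto simp: mlin_zero zero_fun_def)
  fix f assume f: "f \<in> zone_funs lo r a"
  note fD = zone_funsD[OF f]
  have la: "C.la b cs f = 0" if "length cs \<noteq> lo + a + r" for b cs by (rule la_wrong_length[OF f that])
  have m: "mlin sC (length cs) f" if "length cs = lo + a + r" for cs :: "'c list" using fD(1) that by simp
  show "- f \<in> zone_funs lo r a"
    by (rule zone_funsI) (use fD mlin_scale[OF fD(1), of "-1"] in \<open>auto simp: fun_Compl_def\<close>)
  show "star b f \<in> zone_funs lo r a" for b by (rule star_zone_funs[OF f])
  show "star (b + c) f = star b f + star c f" for b c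
  proof
    fix cs show "star (b + c) f cs = (star b f + star c f) cs"
      by (cases "length cs = lo + a + r") (simp_all add: star_def T_add lfun_add[OF C.lfun_la[OF m]] la)
  qed
  show "star (b * c) f = star b (star c f)" for b c
  proof
    fix cs show "star (b * c) f cs = star b (star c f) cs"
    proof (cases "length cs = lo + a + r")
      case True
      then show ?thesis by (simp add: star_def T_mult C.la_mult[OF m])
    next
      case False
      then show ?thesis using la_wrong_length[OF star_zone_funs[OF f]] by (simp add: star_def la)
    qed
  qed
  show "star 1 f = f"
  proof
    fix cs show "star 1 f cs = f cs"
      by (cases "length cs = lo + a + r") (simp_all add: star_def T_one C.la_one[OF m] la fD(2))
  qed
  fix g assume g: "g \<in> zone_funs lo r a"
  show "f + g \<in> zone_funs lo r a"
    by (rule zone_funsI) (use fD zone_funsD[OF g] in \<open>auto simp: plus_fun_def intro: mlin_add\<close>)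
  show "star b (f + g) = star b f + star b g" for b
    by (simp add: star_def plus_fun_def lact_add)
qed

text \<open>A kernel letter of the zone survives a splitting inside the zone: it stays in place, is
  split into two kernel letters, or moves up by one, and the zone has become longer by one
  letter.\<close>

lemma zdiff_zone_funs:
  assumes f: "f \<in> zone_funs lo r (Suc a)"
  shows "zdiff lo r a f \<in> zone_funs lo r a"
proof (rule zone_funsI)
  note fD = zone_funsD[OF f]
  have m: "mlin sC (Suc (lo + a + r)) f" using fD(1) by simp
  show "mlin sC (lo + a + r) (zdiff lo r a f)"
    by (rule mlin_cong[OF C.mlin_zone_diff[OF m, of lo a]]) (simp_all add: zdiff_def)
  show "zdiff lo r a f cs = 0" if "length cs \<noteq> lo + a + r" for cs using that by (simp add: zdiff_def)
  show "zdiff lo r a f cs = 0" if cs: "length cs = lo + a + r" "t < a" "\<pi> (cs ! (lo + t)) = 0" for cs t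
  proof -
    have "ev (comult_at \<Delta>C (lo + s) cs) f = 0" if s: "s < a" for s
    proof (rule comult_at_vanish)
      fix c1 c2 assume c: "\<pi> (cs ! (lo + s)) = 0 \<Longrightarrow> \<pi> c1 = 0 \<and> \<pi> c2 = 0"
      let ?ds = "take (lo + s) cs @ [c1, c2] @ drop (Suc (lo + s)) cs"
      have l: "length ?ds = lo + Suc a + r" using s cs by simp
      consider "t < s" | "t = s" | k where "t = Suc (s + k)" using less_imp_Suc_add nat_neq_iff by metis
      then show "f ?ds = 0"
      proof cases
        case 1
        then have "\<pi> (?ds ! (lo + t)) = 0" using cs s by (simp add: nth_append)
        then show ?thesis by (rule fD(3)[OF l less_SucI[OF cs(2)]])
      next
        case 2
        then have "\<pi> (?ds ! (lo + t)) = 0" using c cs s by (simp add: nth_append)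
        then show ?thesis by (rule fD(3)[OF l less_SucI[OF cs(2)]])
      next
        case 3
        then have "?ds ! (lo + Suc t) = cs ! (lo + t)" using cs s by (simp add: nth_append add.assoc)
        then have "\<pi> (?ds ! (lo + Suc t)) = 0" using cs by simp
        then show ?thesis by (rule fD(3)[OF l Suc_mono[OF cs(2)]])
      qed
    qed (use s cs fD(1) in auto)
    then show ?thesis by (simp add: zdiff_def zone_diff_def)
  qed
qed

lemma zdiff_hom: "module_hom_on (zone_funs lo r (Suc a)) star (zone_funs lo r a) star (zdiff lo r a)"
  unfolding module_hom_on_def
proof (intro conjI ballI allI)
  show "zdiff lo r a ` zone_funs lo r (Suc a) \<subseteq> zone_funs lo r a" using zdiff_zone_funs by blast
  fix f assume f: "f \<in> zone_funs lo r (Suc a)"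
  show "zdiff lo r a (f + g) = zdiff lo r a f + zdiff lo r a g" for g
    by (auto simp: zdiff_def zone_diff_def plus_fun_def ev_fun_add alt_add sum.distrib fun_eq_iff)
  show "zdiff lo r a (star b f) = star b (zdiff lo r a f)" for b
  proof
    fix cs show "zdiff lo r a (star b f) cs = star b (zdiff lo r a f) cs"
    proof (cases "length cs = lo + a + r")
      case True
      have "star b (zdiff lo r a f) cs = C.la (T b) cs (\<lambda>ds. \<Sum>t<a. alt t (ev (comult_at \<Delta>C (lo + t) ds) f))"
        unfolding star_def by (rule lact_cong) (simp add: zdiff_def zone_diff_def True)
      also have "\<dots> = (\<Sum>t<a. alt t (ev (comult_at \<Delta>C (lo + t) cs) (\<lambda>es. C.la (T b) es f)))"
        unfolding lact_sum lact_alt using True zone_funsD(1)[OF f]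
        by (intro sum.cong refl arg_cong[where f = "alt _"] C.la_comult_at) auto
      finally show ?thesis using True by (simp add: zdiff_def zone_diff_def star_def)
    next
      case False
      then show ?thesis using la_wrong_length[OF zdiff_zone_funs[OF f]] by (simp add: zdiff_def star_def)
    qed
  qed
qed

lemma zdiff_zdiff:
  assumes f: "f \<in> zone_funs lo r (Suc (Suc a))"
  shows "zdiff lo r a (zdiff lo r (Suc a) f) = 0"
proof
  fix cs show "zdiff lo r a (zdiff lo r (Suc a) f) cs = 0 cs"
  proof (cases "length cs = lo + a + r")
    case True
    have "zdiff lo r a (zdiff lo r (Suc a) f) cs = zone_diff \<Delta>C lo a (zone_diff \<Delta>C lo (Suc a) f) cs"
      using True unfolding zone_diff_def[of _ _ a] zdiff_def[of _ _ a]
      by (auto simp: zdiff_def intro!: sum.cong arg_cong[where f = "alt _"] ev_comult_at_cong)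
    also have "\<dots> = 0" using zone_funsD(1)[OF f] True by (intro C.zone_diff_zone_diff) auto
    finally show ?thesis by simp
  qed (simp add: zdiff_def)
qed

text \<open>A letter and its image under \<open>\<sigma> \<circ> \<pi>\<close> differ by an element
  of the kernel, where the functional vanishes. So in the zone only the classes of the letters in D
  matter.\<close>

lemma zone_funs_\<sigma>_\<pi>:
  assumes f: "f \<in> zone_funs lo r a" and l: "length ms = lo" "length us = a" "length ns = r"
  shows "f (ms @ map \<sigma> (map \<pi> us) @ ns) = f (ms @ us @ ns)"
proof -
  let ?g = "\<lambda>j c. if lo \<le> j \<and> j < lo + a then \<sigma> (\<pi> c) else c"
  have "mapi ?g (ms @ us @ ns) = ms @ map \<sigma> (map \<pi> us) @ ns"
    using l by (intro nth_equalityI) (auto simp: nth_append)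
  moreover have "f (mapi ?g (ms @ us @ ns)) = f (ms @ us @ ns)"
  proof (rule mapi_mod[OF zone_funsD(1)[OF f]])
    fix j ds assume j: "j < lo + a + r" "length ds = lo + a + r"
      "ds ! j = (if lo \<le> j \<and> j < lo + a then \<sigma> (\<pi> ((ms @ us @ ns) ! j)) else (ms @ us @ ns) ! j) - (ms @ us @ ns) ! j"
    show "f ds = 0"
    proof (cases "lo \<le> j \<and> j < lo + a")
      case True
      then have "\<pi> (ds ! (lo + (j - lo))) = 0" using j by (simp add: \<pi>_diff)
      then show ?thesis using zone_funsD(3)[OF f j(2), of "j - lo"] True by auto
    next
      case False
      then show ?thesis using mlin_eq_0[OF zone_funsD(1)[OF f] j(2,1)] j(3) by auto
    qed
  qed (use l in simp)
  ultimately show ?thesis by simp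
qed

lemma map_\<sigma>_mlin: "mlin sC N f \<Longrightarrow> mlin sD N (\<lambda>ws. f (map \<sigma> ws))"
  unfolding map_eq_mapi by (rule mlin_mapi) (simp_all add: \<sigma>_add \<sigma>_scale)

lemma map_\<pi>_mlin: "mlin sD N f \<Longrightarrow> mlin sC N (\<lambda>ws. f (map \<pi> ws))"
  unfolding map_eq_mapi by (rule mlin_mapi) (simp_all add: \<pi>_add \<pi>_scale)

text \<open>In the zone, comultiplication in C may be replaced by that of D: the functional sees its
  zone letters only through \<open>\<pi>\<close>, which is a coalgebra map.\<close>

lemma zone_funs_comult_at:
  assumes f: "f \<in> zone_funs lo r (Suc a)" and l: "length ms = lo" "length us = a" "length ns = r" and t: "t < a"
  shows "ev (comult_at \<Delta>C (lo + t) (ms @ us @ ns)) f = ev (comult_at \<Delta>D t (map \<pi> us)) (\<lambda>ws. f (ms @ map \<sigma> ws @ ns))"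
proof -
  have m: "mlin sC (Suc a) (\<lambda>ws. f (ms @ ws @ ns))"
    using mlin_append2[OF mlin_append1[OF zone_funsD(1)[OF f], of ms "Suc a + r"], of "Suc a" ns] l by simp
  have "ev (comult_at \<Delta>C (lo + t) (ms @ us @ ns)) f = ev (comult_at \<Delta>C t us) (\<lambda>vs. f (ms @ vs @ ns))"
    using ev_comult_at_prefix[of \<Delta>C ms t "us @ ns" f] t l by (simp add: ev_comult_at_append)
  also have "\<dots> = ev (comult_at \<Delta>C t us) (\<lambda>vs. f (ms @ map \<sigma> (map \<pi> vs) @ ns))"
    using t l by (intro ev_comult_at_cong zone_funs_\<sigma>_\<pi>[OF f, symmetric]) auto
  also have "\<dots> = ev (comult_at \<Delta>D t (map \<pi> us)) (\<lambda>ws. f (ms @ map \<sigma> ws @ ns))"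
    using t l map_\<sigma>_mlin[OF m] by (intro comult_at_\<pi>) auto
  finally show ?thesis .
qed

text \<open>There is no condition on the lengths because elements of \<open>zone_funs\<close> are
  zero on words of the wrong length.\<close>

lemma zone_funs_mlin1: "f \<in> zone_funs lo r a \<Longrightarrow> mlin sC m (\<lambda>xs. f (xs @ ys))"
proof (cases "m + length ys = lo + a + r")
  case True
  assume f: "f \<in> zone_funs lo r a"
  show ?thesis by (rule mlin_append2[OF zone_funsD(1)[OF f]]) (use True in simp)
next
  case False
  assume f: "f \<in> zone_funs lo r a"
  show ?thesis by (rule mlin_cong[OF mlin_zero]) (use False zone_funsD(2)[OF f] in simp)
qed

lemma zone_funs_mlin2: "f \<in> zone_funs lo r a \<Longrightarrow> mlin sC m (\<lambda>ys. f (xs @ ys))"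
proof (cases "m + length xs = lo + a + r")
  case True
  assume f: "f \<in> zone_funs lo r a"
  show ?thesis by (rule mlin_append1[OF zone_funsD(1)[OF f]]) (use True in simp)
next
  case False
  assume f: "f \<in> zone_funs lo r a"
  show ?thesis by (rule mlin_cong[OF mlin_zero]) (use False zone_funsD(2)[OF f] in simp)
qed

text \<open>The homotopy \<open>h\<close> of D is applied to the images of the zone letters, the
  letters outside being parameters. As \<open>h\<close> is one fixed map for all functionals, the
  result stays multilinear in these parameters.\<close>

lemma zdiff_exact:
  assumes f: "f \<in> zone_funs lo r (Suc a)" and z: "zdiff lo r a f = 0"
  shows "\<exists>g\<in>zone_funs lo r (Suc (Suc a)). zdiff lo r (Suc a) g = f"
proof -
  obtain h :: "'d list \<Rightarrow> ('d list \<Rightarrow>\<^sub>0 'k)" where h: "\<forall>F. mlin sD (Suc a) F \<longrightarrow>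
    (\<forall>zs. length zs = a \<longrightarrow> zone_diff \<Delta>D 0 a F zs = 0) \<longrightarrow> mlin sD (Suc (Suc a)) (\<lambda>zs. ev (h zs) F) \<and>
    (\<forall>zs. length zs = Suc a \<longrightarrow> zone_diff \<Delta>D 0 (Suc a) (\<lambda>ws. ev (h ws) F) zs = F zs)"
    using D.H_counital_homotopy[OF H_counital_D] by blast
  have h1: "mlin sD (Suc (Suc a)) (\<lambda>zs. ev (h zs) F)"
    and h2: "length zs = Suc a \<Longrightarrow> zone_diff \<Delta>D 0 (Suc a) (\<lambda>ws. ev (h ws) F) zs = F zs"
    if "mlin sD (Suc a) F" "\<And>zs. length zs = a \<Longrightarrow> zone_diff \<Delta>D 0 a F zs = 0" for F zs
    using h that by blast+
  define F where "F ms ns ws = f (ms @ map \<sigma> ws @ ns)" for ms ns ws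
  have F_mlin: "mlin sD (Suc a) (F ms ns)" if "length ms = lo" "length ns = r" for ms ns
    using map_\<sigma>_mlin[OF mlin_append2[OF mlin_append1[OF zone_funsD(1)[OF f], of ms "Suc a + r"], of "Suc a" ns]] that
    by (simp add: F_def[abs_def])
  have F_cyc: "zone_diff \<Delta>D 0 a (F ms ns) zs = 0" if l: "length ms = lo" "length ns = r" "length zs = a" for ms ns zs
  proof -
    have "zone_diff \<Delta>D 0 a (F ms ns) zs = zone_diff \<Delta>C lo a f (ms @ map \<sigma> zs @ ns)"
      using l by (simp add: zone_diff_def zone_funs_comult_at[OF f] F_def[abs_def] o_def)
    also have "\<dots> = zdiff lo r a f (ms @ map \<sigma> zs @ ns)" using l by (simp add: zdiff_def)
    finally show ?thesis by (simp add: z)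
  qed
  note h1 = h1[OF F_mlin F_cyc] and h2 = h2[OF F_mlin F_cyc]
  define g0 where "g0 ms us ns = ev (h (map \<pi> us)) (F ms ns)" for ms us ns
  define g where "g cs = (if length cs = lo + Suc (Suc a) + r
    then g0 (take lo cs) (take (Suc (Suc a)) (drop lo cs)) (drop (Suc (Suc a)) (drop lo cs)) else 0)" for cs
  have g_app: "g (ms @ us @ ns) = g0 ms us ns" if "length ms = lo" "length us = Suc (Suc a)" "length ns = r" for ms us ns
    using that by (simp add: g_def)
  have g0_zone: "mlin sC (Suc (Suc a)) (\<lambda>us. g0 ms us ns)" if "length ms = lo" "length ns = r" for ms ns
    unfolding g0_def by (rule map_\<pi>_mlin[OF h1]) (use that in auto)
  have "mlin sC (lo + (Suc (Suc a) + r)) (\<lambda>cs. g0 (take lo cs) (take (Suc (Suc a)) (drop lo cs)) (drop (Suc (Suc a)) (drop lo cs)))"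
  proof (rule mlin_split[where F = "\<lambda>ms rest. g0 ms (take (Suc (Suc a)) rest) (drop (Suc (Suc a)) rest)"])
    fix ys :: "'c list"
    show "mlin sC lo (\<lambda>xs. g0 xs (take (Suc (Suc a)) ys) (drop (Suc (Suc a)) ys))"
      unfolding g0_def F_def by (intro mlin_ev zone_funs_mlin1[OF f])
  next
    fix ms :: "'c list" assume ms: "length ms = lo"
    show "mlin sC (Suc (Suc a) + r) (\<lambda>rest. g0 ms (take (Suc (Suc a)) rest) (drop (Suc (Suc a)) rest))"
    proof (rule mlin_split)
      show "mlin sC (Suc (Suc a)) (\<lambda>us. g0 ms us ns)" if "length ns = r" for ns using g0_zone[OF ms that] .
      show "mlin sC r (g0 ms us)" for us
        unfolding g0_def F_def append_assoc[symmetric] by (intro mlin_ev zone_funs_mlin2[OF f])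
    qed
  qed
  then have "mlin sC (lo + (Suc (Suc a) + r)) g" by (rule mlin_cong) (simp add: g_def)
  then have g_mlin: "mlin sC (lo + Suc (Suc a) + r) g" by (simp only: add.assoc)
  have "g \<in> zone_funs lo r (Suc (Suc a))"
  proof (rule zone_funsI[OF g_mlin])
    fix cs t assume l: "length cs = lo + Suc (Suc a) + r" and t: "t < Suc (Suc a)" "\<pi> (cs ! (lo + t)) = 0"
    let ?us = "take (Suc (Suc a)) (drop lo cs)"
    have "ev (h (map \<pi> ?us)) (F (take lo cs) (drop (Suc (Suc a)) (drop lo cs))) = 0"
      by (rule mlin_eq_0[OF h1, of _ _ _ t]) (use l t in auto)
    then show "g cs = 0" by (simp add: g_def g0_def)
  qed (simp add: g_def)
  moreover have "zdiff lo r (Suc a) g = f"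
  proof
    fix cs show "zdiff lo r (Suc a) g cs = f cs"
    proof (cases "length cs = lo + Suc a + r")
      case True
      define ms us ns where "ms = take lo cs" and "us = take (Suc a) (drop lo cs)" and "ns = drop (Suc a) (drop lo cs)"
      have cs: "cs = ms @ us @ ns" unfolding ms_def us_def ns_def append_take_drop_id ..
      have l: "length ms = lo" "length us = Suc a" "length ns = r" using True by (simp_all add: ms_def us_def ns_def)
      have "ev (comult_at \<Delta>C (lo + t) cs) g = ev (comult_at \<Delta>D t (map \<pi> us)) (\<lambda>ws. ev (h ws) (F ms ns))" if t: "t < Suc a" for t
      proof -
        have "ev (comult_at \<Delta>C (lo + t) cs) g = ev (comult_at \<Delta>C t us) (\<lambda>vs. g (ms @ vs @ ns))"
          using ev_comult_at_prefix[of \<Delta>C ms t "us @ ns" g] t l by (simp add: cs ev_comult_at_append)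
        also have "\<dots> = ev (comult_at \<Delta>C t us) (\<lambda>vs. ev (h (map \<pi> vs)) (F ms ns))"
          using t l by (intro ev_comult_at_cong) (auto simp: g_app g0_def)
        also have "\<dots> = ev (comult_at \<Delta>D t (map \<pi> us)) (\<lambda>ws. ev (h ws) (F ms ns))"
          using t l h1 by (intro comult_at_\<pi>) auto
        finally show ?thesis .
      qed
      then have "zdiff lo r (Suc a) g cs = zone_diff \<Delta>D 0 (Suc a) (\<lambda>ws. ev (h ws) (F ms ns)) (map \<pi> us)"
        using True by (simp add: zdiff_def zone_diff_def)
      also have "\<dots> = F ms ns (map \<pi> us)" by (rule h2) (use l in auto)
      also have "\<dots> = f cs" unfolding F_def cs by (rule zone_funs_\<sigma>_\<pi>[OF f l])
      finally show ?thesis .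
    qed (simp add: zdiff_def zone_funsD(2)[OF f])
  qed
  ultimately show ?thesis by blast
qed

lemma coresolution_zone_funs: "coresolution (zone_funs lo r) star (zdiff lo r)"
  by unfold_locales (simp_all add: ring_module_zone_funs zdiff_hom zdiff_zdiff zdiff_exact)

section \<open>Extending equivariant functionals from a submodule\<close>

lemma star_scalar:
  assumes f: "f \<in> zone_funs lo r a"
  shows "star (sB k 1) f cs = k * f cs"
proof (cases "length cs = lo + a + r")
  case True
  then have "mlin sC (length cs) f" using zone_funsD(1)[OF f] by simp
  then show ?thesis by (simp add: star_def T_scale T_one lfun_scale[OF C.lfun_la] C.la_one)
qed (simp add: star_def la_wrong_length[OF f] zone_funsD(2)[OF f])

lemma scalar_mult: "sB k 1 * b = sB k b" "b * sB k 1 = sB k b"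
  by (simp_all add: scale_mult_left scale_mult_right)

text \<open>\<open>P\<close> is a subset of its type, which carries no vector space structure of its
  own. The complement of \<open>K\<close> is therefore taken in the free module into which
  \<open>P\<close> embeds, where the field acts through the scalars \<open>sB k 1\<close>, and is
  carried back by the retraction.\<close>

lemma projective_k_projection:
  fixes actP :: "'b \<Rightarrow> 'p::ab_group_add \<Rightarrow> 'p"
  assumes P: "projective_on P actP" and K: "K \<subseteq> P" "ring_module_on K actP"
  obtains q where "\<And>x. x \<in> P \<Longrightarrow> q x \<in> K" "\<And>x. x \<in> K \<Longrightarrow> q x = x"
    "\<And>x y. x \<in> P \<Longrightarrow> y \<in> P \<Longrightarrow> q (x + y) = q x + q y"
    "\<And>k x. x \<in> P \<Longrightarrow> q (actP (sB k 1) x) = actP (sB k 1) (q x)"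
proof -
  obtain i :: "'p \<Rightarrow> ('p \<Rightarrow>\<^sub>0 'b)" and r where i: "module_hom_on P actP UNIV fscale i"
    and r: "module_hom_on UNIV fscale P actP r" and ri: "\<And>p. p \<in> P \<Longrightarrow> r (i p) = p"
    using P by (auto simp: projective_on_def)
  note iD = module_hom_onD[OF i] and rD = module_hom_onD[OF r] and KD = ring_module_onD[OF K(2)]
  define sF where "sF k u = fscale (sB k 1) u" for k and u :: "'p \<Rightarrow>\<^sub>0 'b"
  have vs: "vector_space sF"
    by unfold_locales
      (auto simp: sF_def lookup_fscale lookup_add scalar_mult distrib_right scale_right_distrib scale_left_distrib
        intro!: poly_mapping_eqI)
  interpret F: vector_space sF by fact
  interpret vp: vector_space_pair sF sF by unfold_locales
  have id: "Vector_Spaces.linear sF sF (\<lambda>u. u)" using F.linear_ident .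
  have "F.subspace (i ` K)"
  proof (rule F.subspaceI)
    have "i 0 = 0" using module_hom_on_0[OF i] KD(1) K(1) by auto
    then show "0 \<in> i ` K" using KD(1) by force
    fix x y assume "x \<in> i ` K" "y \<in> i ` K"
    then obtain u v where "u \<in> K" "x = i u" "v \<in> K" "y = i v" by blast
    then have "x + y = i (u + v)" "u + v \<in> K" using iD(2) K(1) KD(2) by (auto simp: subset_iff)
    then show "x + y \<in> i ` K" by blast
  next
    fix k x assume "x \<in> i ` K"
    then obtain u where "u \<in> K" "x = i u" by blast
    then have "sF k x = i (actP (sB k 1) u)" "actP (sB k 1) u \<in> K"
      using iD(3) K(1) KD(4) by (auto simp: subset_iff sF_def)
    then show "sF k x \<in> i ` K" by blast
  qed
  from vp.linear_exists_left_inverse_on[OF id this]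
  obtain p where p: "range p \<subseteq> i ` K" "Vector_Spaces.linear sF sF p" "\<forall>v\<in>i ` K. p v = v" by auto
  show thesis
  proof (rule that[of "\<lambda>x. r (p (i x))"])
    show "r (p (i x)) \<in> K" for x
    proof -
      obtain u where "u \<in> K" "p (i x) = i u" using p(1) by blast
      then show ?thesis using ri K(1) by auto
    qed
    show "r (p (i x)) = x" if "x \<in> K" for x using that p(3) ri K(1) by auto
    show "r (p (i (x + y))) = r (p (i x)) + r (p (i y))" if "x \<in> P" "y \<in> P" for x y
      using that by (simp add: iD(2) vp.linear_add[OF p(2)] rD(2))
    show "r (p (i (actP (sB k 1) x))) = actP (sB k 1) (r (p (i x)))" if "x \<in> P" for k x
      using that vp.linear_scale[OF p(2), of k "i x"] by (simp add: iD(3) rD(3) sF_def)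
  qed
qed

text \<open>A functional on \<open>K\<close> is first extended \<open>k\<close>-linearly to \<open>P\<close>; the last tensor factor, written in a dual basis of
  the projective module \<open>C\<close>, is then used to average the extension into a \<open>B\<close>-linear one.\<close>

lemma extends_from_zone_funs:
  fixes actP :: "'b \<Rightarrow> 'p::ab_group_add \<Rightarrow> 'p"
  assumes P: "projective_on P actP" and K: "K \<subseteq> P" "ring_module_on K actP"
  shows "coresolution.extends_from (zone_funs lo r) star K P actP"
proof -
  interpret coresolution "zone_funs lo r" star "zdiff lo r" by (rule coresolution_zone_funs)
  show ?thesis
    unfolding extends_from_def
  proof (intro allI impI)
    fix a \<phi> assume \<phi>: "module_hom_on K actP (zone_funs lo r (Suc a)) star \<phi>"
    define n where "n = lo + a + r"
    have N: "lo + Suc a + r = Suc n" by (simp add: n_def)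
    have Pm: "ring_module_on P actP" using P by (simp add: projective_on_def)
    note PD = ring_module_onD[OF Pm] and KD = ring_module_onD[OF K(2)] and \<phi>D = module_hom_onD[OF \<phi>]
    obtain q where qK: "\<And>x. x \<in> P \<Longrightarrow> q x \<in> K" and q_id: "\<And>x. x \<in> K \<Longrightarrow> q x = x"
      and q_add: "\<And>x y. x \<in> P \<Longrightarrow> y \<in> P \<Longrightarrow> q (x + y) = q x + q y"
      and q_scale: "\<And>k x. x \<in> P \<Longrightarrow> q (actP (sB k 1) x) = actP (sB k 1) (q x)"
      by (rule projective_k_projection[OF P K], rule that) blast+
    obtain iC :: "'c \<Rightarrow> ('c \<Rightarrow>\<^sub>0 'b)" and rC where iC: "module_hom_on UNIV actC UNIV fscale iC"
      and rC: "\<And>c. (\<Sum>e\<in>Poly_Mapping.keys (iC c). actC (Poly_Mapping.lookup (iC c) e) (rC e)) = c"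
      by (rule projective_onE[OF projective_C], rule that) simp_all
    have iC_add: "iC (c + c') = iC c + iC c'" and iC_act: "iC (actC b c) = fscale b (iC c)" for b c c'
      using module_hom_onD(2,3)[OF iC] by simp_all
    have iC_scale: "iC (sC k c) = fscale (sB k 1) (iC c)" for k c
      using iC_act[of "sB k 1" c] by (simp add: C.act_scale_left C.act_one)
    have \<phi>_mlin: "mlin sC (Suc n) (\<phi> y)" if "y \<in> K" for y
      using zone_funsD(1)[OF \<phi>D(1)[OF that]] by (simp add: N[symmetric])
    have \<phi>_init: "mlin sC n (\<lambda>xs. \<phi> y (xs @ [c]))" if "y \<in> K" for y c
      by (rule mlin_append2[OF \<phi>_mlin[OF that]]) simp
    have \<phi>_last: "lfun sC (\<lambda>c. \<phi> y (xs @ [c]))" if "y \<in> K" "length xs = n" for y xs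
      using mlinD[OF \<phi>_mlin[OF that(1)], of xs "[]"] that(2) by simp
    have \<phi>q: "lfun sB (\<lambda>b. \<phi> (q (actP (S b) x)) L)" if x: "x \<in> P" for x L
    proof (rule lfunI)
      show "\<phi> (q (actP (S (b + c)) x)) L = \<phi> (q (actP (S b) x)) L + \<phi> (q (actP (S c) x)) L" for b c
        using x by (simp add: antipode_add PD q_add qK \<phi>D(2))
      show "\<phi> (q (actP (S (sB k b)) x)) L = k * \<phi> (q (actP (S b) x)) L" for k b
      proof -
        have "actP (S (sB k b)) x = actP (sB k 1) (actP (S b) x)"
          using x by (simp add: antipode_scale scalar_mult flip: PD(7))
        then show ?thesis
          using x by (simp add: q_scale PD qK \<phi>D(3) star_scalar[OF \<phi>D(1)])
      qed
    qed
    \<comment> \<open>For an equivariant functional this formula is forced: \<open>b\<close> is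
      taken off the last letter \<open>rC e\<close> by letting it act diagonally, at the price of
      \<open>T b1\<close> on the other letters and \<open>S b2\<close> on \<open>x\<close>. Read as
      a definition it also makes sense for the extension along \<open>q\<close>, which is linear
      over the field only.\<close>
    define U where "U x xs b e = ev (\<Delta>B b) (\<lambda>(b1, b2). C.la (T b1) xs (\<lambda>ys. \<phi> (q (actP (S b2) x)) (ys @ [rC e])))" for x xs b e
    define \<psi>0 where "\<psi>0 x xs c = (\<Sum>e\<in>Poly_Mapping.keys (iC c). U x xs (Poly_Mapping.lookup (iC c) e) e)" for x xs c
    have U_lin: "lfun sB (\<lambda>b. U x xs b e)" if "x \<in> P" "length xs = n" for x xs e
      unfolding U_def
    proof (rule lfun_comult, rule bilinI)
      show "lfun sB (\<lambda>b1. C.la (T b1) xs (\<lambda>ys. \<phi> (q (actP (S b2) x)) (ys @ [rC e])))" for b2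
        by (rule lfun_T, rule C.lfun_la) (use that \<phi>_init PD qK in auto)
      show "lfun sB (\<lambda>b2. C.la (T b1) xs (\<lambda>ys. \<phi> (q (actP (S b2) x)) (ys @ [rC e])))" for b1
        by (intro lfun_lact_fun \<phi>q that)
    qed
    have U_xs: "mlin sC n (\<lambda>xs. U x xs b e)" if "x \<in> P" for x b e
      unfolding U_def case_prod_unfold using that by (intro mlin_ev C.mlin_la \<phi>_init qK PD)
    have U_x: "U (x + y) xs b e = U x xs b e + U y xs b e" if "x \<in> P" "y \<in> P" for x y xs b e
      using that by (simp add: U_def PD q_add qK \<phi>D(2) lact_add case_prod_unfold ev_fun_add)
    have \<psi>0_c: "lfun sC (\<psi>0 x xs)" if xn: "x \<in> P" "length xs = n" for x xs
    proof (rule lfunI)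
      note u = U_lin[OF xn]
      show "\<psi>0 x xs (c + c') = \<psi>0 x xs c + \<psi>0 x xs c'" for c c'
        unfolding \<psi>0_def iC_add by (rule coord_sum_add) (rule lfun_add[OF u])
      show "\<psi>0 x xs (sC k c) = k * \<psi>0 x xs c" for k c
        unfolding \<psi>0_def iC_scale
        by (subst coord_sum_scale) (simp_all add: lfun_0[OF u] scalar_mult lfun_scale[OF u] sum_distrib_left)
    qed
    have \<psi>0_xs: "mlin sC n (\<lambda>xs. \<psi>0 x xs c)" if "x \<in> P" for x c
      unfolding \<psi>0_def by (intro mlin_sum U_xs that)
    have \<psi>0_x: "\<psi>0 (x + y) xs c = \<psi>0 x xs c + \<psi>0 y xs c" if "x \<in> P" "y \<in> P" for x y xs c
      by (simp add: \<psi>0_def U_x[OF that] sum.distrib)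
    have \<psi>0_agree: "\<psi>0 x xs c = \<phi> x (xs @ [c])" if x: "x \<in> K" and xs: "length xs = n" for x xs c
    proof -
      \<comment> \<open>For \<open>x\<close> in \<open>K\<close> the functional is equivariant, so
        \<open>S b2\<close> can be moved back to the word; then \<open>p * T b1\<close> contracts to
        the counit.\<close>
      have U: "U x xs b e = \<phi> x (xs @ [actC b (rC e)])" for b e
      proof -
        define R where "R z p = C.la z xs (\<lambda>ys. \<phi> x (ys @ [actC p (rC e)]))" for z p
        have R1: "lfun sB (\<lambda>z. R z p)" for p
          unfolding R_def using \<phi>_init[OF x] xs by (intro C.lfun_la) simp
        have R2: "lfun sB (R z)" for z
          unfolding R_def by (intro lfun_lact_fun C.lfun_act_left[OF \<phi>_last[OF x]]) (simp add: xs)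
        have "U x xs b e = ev (\<Delta>B b) (\<lambda>(b1, b2). C.la (T b1) xs (\<lambda>ys. C.la b2 (ys @ [rC e]) (\<phi> x)))"
          unfolding U_def using q_id x by (simp add: KD(4) \<phi>D(3) star_def)
        also have "\<dots> = ev (\<Delta>B b) (\<lambda>(b1, b2). ev (\<Delta>B b2) (\<lambda>(p, t). R (p * T b1) t))"
        proof (rule ev_pair_cong)
          fix b1 b2
          have "C.la (T b1) xs (\<lambda>ys. C.la b2 (ys @ [rC e]) (\<phi> x)) =
            C.la (T b1) xs (\<lambda>ys. ev (\<Delta>B b2) (\<lambda>(p, t). C.la p ys (\<lambda>zs. \<phi> x (zs @ [actC t (rC e)]))))"
          proof (rule lact_cong)
            fix ys :: "'c list" assume ys: "length ys = length xs"
            have "C.la b2 (ys @ [rC e]) (\<phi> x) =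
                ev (\<Delta>B b2) (\<lambda>(p, t). C.la p ys (\<lambda>zs. C.la t [rC e] (\<lambda>us. \<phi> x (zs @ us))))"
              using \<phi>_mlin[OF x] ys xs by (intro C.la_append) simp
            also have "\<dots> = ev (\<Delta>B b2) (\<lambda>(p, t). C.la p ys (\<lambda>zs. \<phi> x (zs @ [actC t (rC e)])))"
              using ys xs by (intro ev_pair_cong lact_cong C.la_single \<phi>_last[OF x]) simp
            finally show "C.la b2 (ys @ [rC e]) (\<phi> x) =
              ev (\<Delta>B b2) (\<lambda>(p, t). C.la p ys (\<lambda>zs. \<phi> x (zs @ [actC t (rC e)])))" .
          qed
          also have "\<dots> = ev (\<Delta>B b2) (\<lambda>(p, t). R (p * T b1) t)"
            using \<phi>_init[OF x] xs by (simp add: lact_ev_pair R_def C.la_mult)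
          finally show "C.la (T b1) xs (\<lambda>ys. C.la b2 (ys @ [rC e]) (\<phi> x)) = ev (\<Delta>B b2) (\<lambda>(p, t). R (p * T b1) t)" .
        qed
        also have "\<dots> = ev (\<Delta>B b) (\<lambda>(m, t). ev (\<Delta>B m) (\<lambda>(b1, p). R (p * T b1) t))"
          by (rule coassoc_ev[symmetric])
            (intro trilinI R2 lfun_mult_right[OF R1] lfun_T[where G = "\<lambda>z. R (_ * z) _"] lfun_mult_left[OF R1])
        also have "\<dots> = ev (\<Delta>B b) (\<lambda>(m, t). \<epsilon> m * R 1 t)"
          by (simp add: T_right_ev[OF R1])
        also have "\<dots> = R 1 b" by (rule counit_left[OF R2])
        also have "\<dots> = \<phi> x (xs @ [actC b (rC e)])"
          using \<phi>_init[OF x] xs by (simp add: R_def C.la_one)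
        finally show ?thesis .
      qed
      have "\<psi>0 x xs c = \<phi> x (xs @ [(\<Sum>e\<in>Poly_Mapping.keys (iC c). actC (Poly_Mapping.lookup (iC c) e) (rC e))])"
        by (simp add: \<psi>0_def U lfun_sum[OF \<phi>_last[OF x xs]])
      then show ?thesis by (simp add: rC)
    qed
    define \<psi>1 where "\<psi>1 x L = \<psi>0 x (butlast L) (last L)" for x L
    have \<psi>1_mlin: "mlin sC (Suc n) (\<psi>1 x)" if x: "x \<in> P" for x
      unfolding mlin_def
    proof (intro allI impI)
      fix xs ys :: "'c list" assume l: "Suc (length xs + length ys) = Suc n"
      show "lfun sC (\<lambda>c. \<psi>1 x (xs @ c # ys))"
      proof (cases ys rule: rev_cases)
        case Nil
        then show ?thesis using \<psi>0_c[OF x, of xs] l by (simp add: \<psi>1_def)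
      next
        case (snoc us d)
        have "lfun sC (\<lambda>c. \<psi>0 x (xs @ c # us) d)" by (rule mlinD[OF \<psi>0_xs[OF x]]) (use l snoc in simp)
        then show ?thesis by (simp add: \<psi>1_def snoc butlast_append)
      qed
    qed
    \<comment> \<open>The last letter absorbs one part of the legs of \<open>T b\<close> into its
      coordinates, as \<open>t * \<beta>\<close>. In \<open>U\<close> this part returns to the other
      letters as \<open>T t1\<close> and contracts with \<open>p\<close>; what is left is
      \<open>S (T b) = b\<close> acting on \<open>x\<close>.\<close>
    have \<psi>1_act: "\<psi>1 (actP b x) L = C.la (T b) L (\<psi>1 x)" if x: "x \<in> P" and L: "length L = Suc n" for b x L
    proof -
      obtain xs c where L': "L = xs @ [c]" and xs: "length xs = n" using L by (cases L rule: rev_cases) auto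
      define R where "R e \<beta> z p = ev (\<Delta>B \<beta>) (\<lambda>(\<beta>1, \<beta>2). C.la z xs (\<lambda>ys. C.la (T \<beta>1) ys (\<lambda>zs. \<phi> (q (actP (S (p * \<beta>2)) x)) (zs @ [rC e]))))"
        for e \<beta> z p
      have m: "mlin sC n (\<lambda>zs. \<phi> (q (actP d x)) (zs @ [c]))" for d c
        by (rule \<phi>_init) (intro qK PD x)
      have m': "mlin sC n (\<lambda>zs. \<phi> (q (actP d (actP b x))) (zs @ [c]))" for d c
        by (rule \<phi>_init) (intro qK PD x)
      have R1: "lfun sB (\<lambda>z. R e \<beta> z p)" for e \<beta> p
        unfolding R_def using m xs by (intro lfun_ev_pair C.lfun_la C.mlin_la) simp
      have R2: "lfun sB (R e \<beta> z)" for e \<beta> z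
        unfolding R_def by (intro lfun_ev_pair lfun_lact_fun lfun_mult_right[where G = "\<lambda>b. \<phi> (q (actP (S b) x)) _"] \<phi>q x)
      have step: "C.la p xs (\<lambda>ys. U x ys (t * \<beta>) e) = ev (\<Delta>B t) (\<lambda>(t1, t2). R e \<beta> (T t1 * p) t2)" for p t \<beta> e
      proof -
        have "C.la p xs (\<lambda>ys. U x ys (t * \<beta>) e) = C.la p xs (\<lambda>ys. ev (\<Delta>B t) (\<lambda>(t1, t2). ev (\<Delta>B \<beta>) (\<lambda>(\<beta>1, \<beta>2).
          C.la (T t1) ys (\<lambda>us. C.la (T \<beta>1) us (\<lambda>zs. \<phi> (q (actP (S (t2 * \<beta>2)) x)) (zs @ [rC e]))))))"
        proof (rule lact_cong)
          fix ys :: "'c list" assume ys: "length ys = length xs"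
          have "U x ys (t * \<beta>) e = ev (\<Delta>B t) (\<lambda>(t1, t2). ev (\<Delta>B \<beta>) (\<lambda>(\<beta>1, \<beta>2).
            C.la (T (t1 * \<beta>1)) ys (\<lambda>zs. \<phi> (q (actP (S (t2 * \<beta>2)) x)) (zs @ [rC e]))))"
            unfolding U_def
          proof (rule comult_mult_ev, rule bilinI)
            show "lfun sB (\<lambda>b1. C.la (T b1) ys (\<lambda>zs. \<phi> (q (actP (S b2) x)) (zs @ [rC e])))" for b2
              by (rule lfun_T, rule C.lfun_la) (use m ys xs in simp)
            show "lfun sB (\<lambda>b2. C.la (T b1) ys (\<lambda>zs. \<phi> (q (actP (S b2) x)) (zs @ [rC e])))" for b1
              by (intro lfun_lact_fun \<phi>q x)
          qed
          then show "U x ys (t * \<beta>) e = ev (\<Delta>B t) (\<lambda>(t1, t2). ev (\<Delta>B \<beta>) (\<lambda>(\<beta>1, \<beta>2).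
            C.la (T t1) ys (\<lambda>us. C.la (T \<beta>1) us (\<lambda>zs. \<phi> (q (actP (S (t2 * \<beta>2)) x)) (zs @ [rC e])))))"
            using m ys xs by (simp add: T_mult C.la_mult)
        qed
        also have "\<dots> = ev (\<Delta>B t) (\<lambda>(t1, t2). R e \<beta> (T t1 * p) t2)"
        proof -
          have la2: "C.la p xs (\<lambda>ys. C.la (T t1) ys g) = C.la (T t1 * p) xs g" if "mlin sC n g" for t1 g
            using C.la_mult[of xs g "T t1" p] that xs by simp
          show ?thesis
            unfolding lact_ev_pair R_def by (intro ev_pair_cong la2 C.mlin_la m)
        qed
        finally show ?thesis .
      qed
      have sumR: "ev (\<Delta>B (T b)) (\<lambda>(p, t). ev (\<Delta>B t) (\<lambda>(t1, t2). R e \<beta> (T t1 * p) t2)) = U (actP b x) xs \<beta> e" for e \<beta>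
      proof -
        have "ev (\<Delta>B (T b)) (\<lambda>(p, t). ev (\<Delta>B t) (\<lambda>(t1, t2). R e \<beta> (T t1 * p) t2)) =
          ev (\<Delta>B (T b)) (\<lambda>(m, t). ev (\<Delta>B m) (\<lambda>(p, t1). R e \<beta> (T t1 * p) t))"
          by (rule coassoc_ev[symmetric])
            (intro trilinI R2 lfun_mult_left[OF R1] lfun_T[where G = "\<lambda>z. R _ _ (z * _) _"] lfun_mult_right[OF R1])
        also have "\<dots> = ev (\<Delta>B (T b)) (\<lambda>(m, t). \<epsilon> m * R e \<beta> 1 t)"
          by (simp add: T_left_ev[OF R1])
        also have "\<dots> = R e \<beta> 1 (T b)" by (rule counit_left[OF R2])
        also have "\<dots> = U (actP b x) xs \<beta> e"
          using x xs m' by (simp add: R_def U_def C.la_one C.mlin_la antipode_mult PD(7))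
        finally show ?thesis .
      qed
      have "C.la (T b) L (\<psi>1 x) = ev (\<Delta>B (T b)) (\<lambda>(p, t). C.la p xs (\<lambda>ys. C.la t [c] (\<lambda>us. \<psi>1 x (ys @ us))))"
        unfolding L' using \<psi>1_mlin[OF x] xs by (intro C.la_append) simp
      also have "\<dots> = ev (\<Delta>B (T b)) (\<lambda>(p, t). C.la p xs (\<lambda>ys. \<psi>0 x ys (actC t c)))"
      proof (intro ev_pair_cong lact_cong)
        fix p t and ys :: "'c list" assume "length ys = length xs"
        then have "lfun sC (\<lambda>d. \<psi>1 x (ys @ [d]))" using \<psi>0_c[OF x, of ys] xs by (simp add: \<psi>1_def)
        then have "C.la t [c] (\<lambda>us. \<psi>1 x (ys @ us)) = \<psi>1 x (ys @ [actC t c])" by (rule C.la_single)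
        then show "C.la t [c] (\<lambda>us. \<psi>1 x (ys @ us)) = \<psi>0 x ys (actC t c)" by (simp add: \<psi>1_def)
      qed
      also have "\<dots> = ev (\<Delta>B (T b)) (\<lambda>(p, t). \<Sum>e\<in>Poly_Mapping.keys (iC c).
          ev (\<Delta>B t) (\<lambda>(t1, t2). R e (Poly_Mapping.lookup (iC c) e) (T t1 * p) t2))"
      proof (rule ev_pair_cong)
        fix p t
        have "C.la p xs (\<lambda>ys. \<psi>0 x ys (actC t c)) =
          C.la p xs (\<lambda>ys. \<Sum>e\<in>Poly_Mapping.keys (iC c). U x ys (t * Poly_Mapping.lookup (iC c) e) e)"
        proof (rule lact_cong)
          fix ys :: "'c list" assume "length ys = length xs"
          then show "\<psi>0 x ys (actC t c) = (\<Sum>e\<in>Poly_Mapping.keys (iC c). U x ys (t * Poly_Mapping.lookup (iC c) e) e)"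
            unfolding \<psi>0_def iC_act using xs by (intro coord_sum_scale lfun_0[OF U_lin[OF x]]) simp
        qed
        then show "C.la p xs (\<lambda>ys. \<psi>0 x ys (actC t c)) = (\<Sum>e\<in>Poly_Mapping.keys (iC c).
          ev (\<Delta>B t) (\<lambda>(t1, t2). R e (Poly_Mapping.lookup (iC c) e) (T t1 * p) t2))"
          by (simp add: lact_sum step)
      qed
      also have "\<dots> = \<psi>0 (actP b x) xs c"
        unfolding case_prod_unfold ev_fun_sum \<psi>0_def sumR[unfolded case_prod_unfold] ..
      finally show ?thesis by (simp add: L' \<psi>1_def)
    qed
    \<comment> \<open>The extension built so far need not vanish on kernel letters in the zone.
      Composing with the equivariant map \<open>\<sigma> \<circ> \<pi>\<close> at these positions
      enforces it, without changing the values for \<open>x\<close> in \<open>K\<close>.\<close>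
    let ?g = "\<lambda>j c. if lo \<le> j \<and> j < lo + Suc a then \<sigma> (\<pi> c) else c"
    define \<psi> where "\<psi> x = (\<lambda>L. if length L = Suc n then \<psi>1 x (mapi ?g L) else 0)" for x
    have "module_hom_on P actP (zone_funs lo r (Suc a)) star \<psi>"
      unfolding module_hom_on_def
    proof (intro conjI ballI allI)
      show "\<psi> ` P \<subseteq> zone_funs lo r (Suc a)"
      proof (rule image_subsetI, rule zone_funsI)
        fix x assume x: "x \<in> P"
        have m: "mlin sC (Suc n) (\<lambda>L. \<psi>1 x (mapi ?g L))"
          by (rule mlin_mapi[OF \<psi>1_mlin[OF x]]) (auto simp: \<pi>_add \<sigma>_add \<pi>_scale \<sigma>_scale)
        show "mlin sC (lo + Suc a + r) (\<psi> x)"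
          unfolding N by (rule mlin_cong[OF m]) (simp add: \<psi>_def)
        show "\<psi> x cs = 0" if "length cs \<noteq> lo + Suc a + r" for cs using that by (simp add: \<psi>_def N[symmetric])
        show "\<psi> x cs = 0" if cs: "length cs = lo + Suc a + r" "t < Suc a" "\<pi> (cs ! (lo + t)) = 0" for cs t
        proof -
          have "\<sigma> 0 = 0" using additive_map_0[of \<sigma>] by (simp add: additive_map_def \<sigma>_add)
          then have "\<psi>1 x (mapi ?g cs) = 0"
            using cs N by (intro mlin_eq_0[OF \<psi>1_mlin[OF x], of _ "lo + t"]) auto
          then show ?thesis by (simp add: \<psi>_def)
        qed
      qed
      fix x assume x: "x \<in> P"
      show "\<psi> (x + y) = \<psi> x + \<psi> y" if "y \<in> P" for y
        by (rule ext) (simp add: \<psi>_def \<psi>1_def \<psi>0_x[OF x that])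
      show "\<psi> (actP b x) = star b (\<psi> x)" for b
      proof
        fix L show "\<psi> (actP b x) L = star b (\<psi> x) L"
        proof (cases "length L = Suc n")
          case True
          have "\<psi> (actP b x) L = C.la (T b) (mapi ?g L) (\<psi>1 x)" using True \<psi>1_act[OF x, of "mapi ?g L"] by (simp add: \<psi>_def)
          also have "\<dots> = C.la (T b) L (\<lambda>L. \<psi>1 x (mapi ?g L))"
            by (rule lact_mapi[symmetric]) (simp add: \<pi>_act \<sigma>_act)
          also have "\<dots> = star b (\<psi> x) L"
            unfolding star_def by (rule lact_cong) (simp add: \<psi>_def True)
          finally show ?thesis .
        next
          case False
          have "C.la (T b) L (\<psi> x) = C.la (T b) L (\<lambda>_. 0)" by (rule lact_cong) (simp add: \<psi>_def False)
          then show ?thesis using False by (simp add: \<psi>_def star_def lact_zero)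
        qed
      qed
    qed
    moreover have "\<psi> x = \<phi> x" if x: "x \<in> K" for x
    proof
      fix L show "\<psi> x L = \<phi> x L"
      proof (cases "length L = Suc n")
        case True
        then have "mapi ?g L \<noteq> []" by (auto simp flip: length_0_conv)
        then have "\<psi>1 x (mapi ?g L) = \<phi> x (mapi ?g L)"
          using True \<psi>0_agree[OF x, of "butlast (mapi ?g L)" "last (mapi ?g L)"] by (simp add: \<psi>1_def)
        also have "\<dots> = \<phi> x L"
        proof (rule mapi_mod[OF \<phi>_mlin[OF x] True])
          fix j ds assume j: "j < Suc n" "length ds = Suc n" "ds ! j = ?g j (L ! j) - L ! j"
          show "\<phi> x ds = 0"
          proof (cases "lo \<le> j \<and> j < lo + Suc a")
            case True
            then have "\<pi> (ds ! (lo + (j - lo))) = 0" using j by (simp add: \<pi>_diff)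
            then show ?thesis using zone_funsD(3)[OF \<phi>D(1)[OF x], of ds "j - lo"] True j N by auto
          next
            case False
            then have "ds ! j = 0" using j(3) by (auto split: if_splits)
            then show ?thesis using mlin_eq_0[OF \<phi>_mlin[OF x] j(2,1)] by simp
          qed
        qed
        finally show ?thesis using True by (simp add: \<psi>_def)
      next
        case False
        then show ?thesis using zone_funsD(2)[OF \<phi>D(1)[OF x], of L] N by (simp add: \<psi>_def)
      qed
    qed
    ultimately show "\<exists>\<psi>. module_hom_on P actP (zone_funs lo r (Suc a)) star \<psi> \<and> (\<forall>x\<in>K. \<psi> x = \<phi> x)" by blast
  qed
qed

lemma lifts_zone_funs:
  assumes "finite_projective_dimension TYPE('p::ab_group_add) actX"
  shows "coresolution.lifts (zone_funs lo r) star (zdiff lo r) UNIV actX"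
proof -
  interpret coresolution "zone_funs lo r" star "zdiff lo r" by (rule coresolution_zone_funs)
  show ?thesis by (rule lifts_finite_projective_dimension[OF assms extends_from_zone_funs])
qed

end

lemma alt_alt_add: "alt i (alt j x) = alt (i + j) x"
  by (simp add: alt_def)

lemma sum_zone:
  fixes f :: "nat \<Rightarrow> 'v::comm_monoid_add"
  assumes "i + a \<le> n" "\<And>j. j < n \<Longrightarrow> j < i \<or> i + a \<le> j \<Longrightarrow> f j = 0"
  shows "(\<Sum>j<n. f j) = (\<Sum>t<a. f (i + t))"
proof -
  have "(\<Sum>j<n. f j) = (\<Sum>j\<in>{i..<i + a}. f j)"
    by (rule sum.mono_neutral_right) (use assms in auto)
  also have "\<dots> = (\<Sum>t<a. f (i + t))"
    using sum.shift_bounds_nat_ivl[of f 0 i a] by (simp add: lessThan_atLeast0 add.commute)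
  finally show ?thesis .
qed

section \<open>Excision in the columns\<close>

context cyclic_coefficients
begin

text \<open>The transpose of the last coface, as the cyclic operator after coface 0.\<close>

definition wrap :: "('x \<Rightarrow> 'c list \<Rightarrow> 'k) \<Rightarrow> 'x \<Rightarrow> 'c list \<Rightarrow> 'k" where
  "wrap \<phi> x cs = split_at 0 (cshift \<phi>) x cs"

text \<open>Precomposition with the Hochschild (\<open>hoch\<close>) or the bar differential, see \<open>ev_column_diff\<close>.\<close>

definition codiff :: "bool \<Rightarrow> nat \<Rightarrow> ('x \<Rightarrow> 'c list \<Rightarrow> 'k) \<Rightarrow> 'x \<Rightarrow> 'c list \<Rightarrow> 'k" where
  "codiff hoch n \<phi> x cs = zone_diff \<Delta>C 0 (Suc n) (\<phi> x) cs + (if hoch then alt (Suc n) (wrap \<phi> x cs) else 0)"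

abbreviation column_diff :: "bool \<Rightarrow> nat \<Rightarrow> ('x \<times> 'c list \<Rightarrow>\<^sub>0 'k) \<Rightarrow> ('x \<times> 'c list \<Rightarrow>\<^sub>0 'k)" where
  "column_diff hoch n \<equiv> (if hoch then hoch_diff CMX n else bar_diff CMX n)"

lemma ev_bar_diff_CM:
  assumes "u \<in> chains CMX n"
  shows "ev (bar_diff CMX n u) (\<lambda>(x, cs). \<phi> x cs) = ev u (\<lambda>(x, cs). zone_diff \<Delta>C 0 (Suc n) (\<phi> x) cs)"
proof -
  have "ev (bar_diff CMX n u) (\<lambda>(x, cs). \<phi> x cs) = (\<Sum>j\<le>n. alt j (ev u (\<lambda>(x, cs). split_at j \<phi> x cs)))"
    unfolding bar_diff_def ev_sum ev_alt by (rule sum.cong) (simp_all add: ev_coface_CM[OF assms])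
  also have "\<dots> = ev u (\<lambda>(x, cs). zone_diff \<Delta>C 0 (Suc n) (\<phi> x) cs)"
    by (simp add: zone_diff_def split_at_def lessThan_Suc_atMost case_prod_unfold ev_fun_sum ev_fun_alt)
  finally show ?thesis .
qed

lemma ev_column_diff:
  assumes "u \<in> chains CMX n"
  shows "ev (column_diff hoch n u) (\<lambda>(x, cs). \<phi> x cs) = ev u (\<lambda>(x, cs). codiff hoch n \<phi> x cs)"
proof (cases hoch)
  case True
  have "ev (hoch_diff CMX n u) (\<lambda>(x, cs). \<phi> x cs) = ev (bar_diff CMX n u) (\<lambda>(x, cs). \<phi> x cs) +
      alt (Suc n) (ev (coface CMX n (Suc n) u) (\<lambda>(x, cs). \<phi> x cs))"
    by (simp add: hoch_diff_def bar_diff_def ev_add ev_alt)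
  then show ?thesis
    unfolding ev_bar_diff_CM[OF assms] ev_coface_last_CM[OF assms]
    by (simp add: True codiff_def wrap_def case_prod_unfold ev_fun_add ev_fun_alt)
qed (simp add: ev_bar_diff_CM[OF assms] codiff_def)

sublocale cocyc: cocyclic_object CMX by (rule cocyclic_object_CM)

lemma column_diff_chains: "u \<in> chains CMX n \<Longrightarrow> column_diff hoch n u \<in> chains CMX (Suc n)"
  by (simp add: cocyc.hoch_diff_chains cocyc.bar_diff_chains)

lemma column_diff_rels: "u \<in> rels CMX n \<Longrightarrow> column_diff hoch n u \<in> rels CMX (Suc n)"
  by (simp add: cocyc.hoch_diff_rels cocyc.bar_diff_rels)

lemma column_diff_column_diff:
  "u \<in> chains CMX n \<Longrightarrow> column_diff hoch (Suc n) (column_diff hoch n u) \<in> rels CMX (Suc (Suc n))"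
  by (simp add: cocyc.hoch_diff_hoch_diff cocyc.bar_diff_bar_diff)

lemma gen_chains: "length cs = Suc n \<Longrightarrow> gen (x, cs) \<in> chains CMX n"
  by (simp add: chains_CM_iff)

text \<open>Gives the closure of balanced functionals under sums and differentials without a return
  to the action.\<close>

lemma balanced_iff: "balanced (Suc n) \<phi> \<longleftrightarrow> (\<forall>u\<in>rels CMX n. ev u (\<lambda>(x, cs). \<phi> x cs) = 0)"
proof
  assume R: "\<forall>u\<in>rels CMX n. ev u (\<lambda>(x, cs). \<phi> x cs) = 0"
  show "balanced (Suc n) \<phi>"
    unfolding CM_rels_annihilator[symmetric] using R unfolding CM_def cocyclic.simps by (blast intro: fs.span_base)
qed (auto intro: rels_CM_ev)

lemma balanced_codiff: "balanced (Suc (Suc n)) \<phi> \<Longrightarrow> balanced (Suc n) (codiff hoch n \<phi>)"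
  unfolding balanced_iff
proof
  fix u assume \<phi>: "\<forall>u\<in>rels CMX (Suc n). ev u (\<lambda>(x, cs). \<phi> x cs) = 0" and u: "u \<in> rels CMX n"
  then have "u \<in> chains CMX n" using cocyc.rels_chains by blast
  from ev_column_diff[OF this, of hoch \<phi>] show "ev u (\<lambda>(x, cs). codiff hoch n \<phi> x cs) = 0"
    using \<phi> column_diff_rels[OF u, of hoch] by simp
qed

text \<open>The squared column differential of a generator is a relation, and balanced functionals
  annihilate relations.\<close>

lemma codiff_codiff:
  assumes "balanced (Suc (Suc (Suc n))) \<phi>" "length cs = Suc n"
  shows "codiff hoch n (codiff hoch (Suc n) \<phi>) x cs = 0"
proof -
  note u = gen_chains[OF assms(2), of x]
  have "ev (column_diff hoch (Suc n) (column_diff hoch n (gen (x, cs)))) (\<lambda>(x, cs). \<phi> x cs) = 0"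
    by (rule rels_CM_ev[OF column_diff_column_diff[OF u] assms(1)])
  then show ?thesis
    unfolding ev_column_diff[OF column_diff_chains[OF u]] ev_column_diff[OF u] by simp
qed

lemma balanced_diff: "balanced (Suc n) \<phi> \<Longrightarrow> balanced (Suc n) \<psi> \<Longrightarrow> balanced (Suc n) (\<lambda>x cs. \<phi> x cs - \<psi> x cs)"
  unfolding balanced_iff by (simp add: case_prod_unfold ev_fun_diff)

lemma balanced_add: "balanced (Suc n) \<phi> \<Longrightarrow> balanced (Suc n) \<psi> \<Longrightarrow> balanced (Suc n) (\<lambda>x cs. \<phi> x cs + \<psi> x cs)"
  unfolding balanced_iff by (simp add: case_prod_unfold ev_fun_add)

lemma wrap_eq: "cs \<noteq> [] \<Longrightarrow> wrap \<phi> x cs = ev (\<Delta>C (cs ! 0)) (\<lambda>(c1, c2). ev (\<rho> x) (\<lambda>(h, y). \<phi> y (c2 # tl cs @ [actC h c1])))"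
  by (cases cs) (simp_all add: wrap_def split_at_def cshift_def ev_comult_at_0)

lemma wrap_add: "wrap (\<lambda>x cs. \<phi> x cs + \<psi> x cs) x cs = wrap \<phi> x cs + wrap \<psi> x cs"
  by (simp add: wrap_def split_at_def ev_comult_at cshift_def case_prod_unfold ev_fun_add)

lemma codiff_add: "codiff hoch n (\<lambda>x cs. \<phi> x cs + \<psi> x cs) x cs = codiff hoch n \<phi> x cs + codiff hoch n \<psi> x cs"
  by (simp add: codiff_def zone_diff_def ev_fun_add alt_add sum.distrib wrap_add algebra_simps)

lemma wrap_diff: "wrap (\<lambda>x cs. \<phi> x cs - \<psi> x cs) x cs = wrap \<phi> x cs - wrap \<psi> x cs"
  by (simp add: wrap_def split_at_def ev_comult_at cshift_def case_prod_unfold ev_fun_diff)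

lemma codiff_diff: "codiff hoch n (\<lambda>x cs. \<phi> x cs - \<psi> x cs) x cs = codiff hoch n \<phi> x cs - codiff hoch n \<psi> x cs"
  by (simp add: codiff_def zone_diff_def ev_fun_diff alt_diff sum_subtractf wrap_diff algebra_simps)

end

section \<open>Correcting functionals by coboundaries, zone by zone\<close>

context excision
begin

abbreviation inK :: "'c \<Rightarrow> bool" where "inK c \<equiv> \<pi> c = 0"

text \<open>The B-linear projection of C onto the kernel of \<open>\<pi>\<close> along the image of
  \<open>\<sigma>\<close>.\<close>

definition toK :: "'c \<Rightarrow> 'c" where "toK c = c - \<sigma> (\<pi> c)"

lemma \<sigma>_0 [simp]: "\<sigma> 0 = 0"
  using additive_map_0[of \<sigma>] by (simp add: additive_map_def \<sigma>_add)

lemma inK_toK [simp]: "\<pi> (toK c) = 0" and toK_id: "\<pi> c = 0 \<Longrightarrow> toK c = c"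
  by (simp_all add: toK_def \<pi>_diff)

lemma toK_add: "toK (c + c') = toK c + toK c'" and toK_scale: "toK (sC a c) = sC a (toK c)"
  by (simp_all add: toK_def \<pi>_add \<sigma>_add \<pi>_scale \<sigma>_scale C.scale_right_diff_distrib)

lemma toK_act: "toK (actC b c) = actC b (toK c)"
  using additive_map_diff[of "actC b"] by (simp add: toK_def \<pi>_act \<sigma>_act additive_map_def C.act_add_right)

lemma balanced_mapi:
  assumes "balanced N \<phi>" "\<And>j c c'. g j (c + c') = g j c + g j c'" "\<And>j a c. g j (sC a c) = sC a (g j c)"
    "\<And>j b c. g j (actC b c) = actC b (g j c)"
  shows "balanced N (\<lambda>x cs. \<phi> x (mapi g cs))"
proof -
  have "C.la b cs (\<lambda>ds. f (mapi g ds)) = C.la b (mapi g cs) f" for b cs f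
    by (rule lact_mapi) (rule assms(4))
  then show ?thesis
    using assms(1) unfolding balanced_def multilinear_def
    by (auto intro!: mlin_mapi[where s' = sC] assms(2,3))
qed

text \<open>The counterpart of \<open>comult_at_vanish\<close> for the last coface. The halves of
  letter 0 end up at opposite ends of the word, and the one at the end is translated by the
  coaction, which does not lead out of the kernel.\<close>

lemma wrap_vanish:
  assumes m: "multilinear (Suc (length cs)) \<phi>" and cs: "cs \<noteq> []"
    and v: "\<And>c1 c2 h y. (inK (cs ! 0) \<Longrightarrow> inK c1 \<and> inK c2) \<Longrightarrow> \<phi> y (c2 # tl cs @ [actC h c1]) = 0"
  shows "wrap \<phi> x cs = 0"
proof (cases "inK (cs ! 0)")
  case True
  have "lfun sC (\<lambda>c1. \<phi> y ((c2 # tl cs) @ c1 # []))" for y c2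
    by (rule mlinD[OF multilinearD(2)[OF m]]) (use cs in simp)
  then have "lfun sC (\<lambda>c1. ev (\<rho> x) (\<lambda>(h, y). \<phi> y (c2 # tl cs @ [actC h c1])))" for c2
    by (intro lfun_ev_pair C.lfun_act_right) simp
  moreover have "lfun sC (\<lambda>c2. \<phi> y ([] @ c2 # tl cs @ [actC h c1]))" for y h c1
    by (rule mlinD[OF multilinearD(2)[OF m]]) (use cs in simp)
  then have "lfun sC (\<lambda>c2. ev (\<rho> x) (\<lambda>(h, y). \<phi> y (c2 # tl cs @ [actC h c1])))" for c1
    by (intro lfun_ev_pair) simp
  ultimately have "bilin sC sC (\<lambda>c1 c2. ev (\<rho> x) (\<lambda>(h, y). \<phi> y (c2 # tl cs @ [actC h c1])))"
    by (rule bilinI)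
  from kernel_comult[OF this True] show ?thesis
    unfolding wrap_eq[OF cs] using v by (simp add: case_prod_unfold)
next
  case False
  then have "\<phi> y (c2 # tl cs @ [actC h c1]) = 0" for c1 c2 h y using v by blast
  then show ?thesis unfolding wrap_eq[OF cs] by (simp add: case_prod_unfold)
qed

lemma codiff_vanish:
  assumes "balanced (Suc (Suc n)) \<phi>" "length cs = Suc n"
    and "\<And>j. j \<le> n \<Longrightarrow> ev (comult_at \<Delta>C j cs) (\<phi> x) = 0"
    and "\<And>c1 c2 h y. (inK (cs ! 0) \<Longrightarrow> inK c1 \<and> inK c2) \<Longrightarrow> \<phi> y (c2 # tl cs @ [actC h c1]) = 0"
  shows "codiff hoch n \<phi> x cs = 0"
proof -
  have "wrap \<phi> x cs = 0"
    using assms by (intro wrap_vanish) (auto simp: balanced_def)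
  then show ?thesis using assms(3) by (simp add: codiff_def zone_diff_def)
qed

lemma nth_insert2:
  assumes "j < length cs" "p \<le> length cs"
  shows "(take j cs @ [c1, c2] @ drop (Suc j) cs) ! p =
    (if p < j then cs ! p else if p = j then c1 else if p = Suc j then c2 else cs ! (p - 1))"
proof -
  consider "p < j" | "p = j" | "p = Suc j" | k where "p = Suc (Suc (j + k))"
  proof -
    have "p < j \<or> p = j \<or> p = Suc j \<or> Suc j < p" by linarith
    then show thesis using that less_imp_Suc_add[of "Suc j" p] by auto
  qed
  then show ?thesis using assms by cases (auto simp: nth_append)
qed

lemma nth_wrap:
  assumes "length cs = Suc n" "p \<le> Suc n"
  shows "(c2 # tl cs @ [c1]) ! p = (if p = 0 then c2 else if p \<le> n then cs ! p else c1)"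
  using assms by (cases cs; cases p) (auto simp: nth_append less_Suc_eq_le)

definition vanishes_on_K :: "nat \<Rightarrow> ('x \<Rightarrow> 'c list \<Rightarrow> 'k) \<Rightarrow> bool" where
  "vanishes_on_K n \<phi> \<longleftrightarrow> (\<forall>x cs. length cs = n \<longrightarrow> (\<forall>c\<in>set cs. inK c) \<longrightarrow> \<phi> x cs = 0)"

lemma vanishes_on_KD: "vanishes_on_K n \<phi> \<Longrightarrow> length cs = n \<Longrightarrow> (\<And>j. j < n \<Longrightarrow> inK (cs ! j)) \<Longrightarrow> \<phi> x cs = 0"
  unfolding vanishes_on_K_def by (metis in_set_conv_nth)

text \<open>One step of the excision argument: the functional \<open>\<phi>\<close>, already vanishing when the first \<open>i\<close> letters and one
  of the \<open>a + 1\<close> following ones lie in the kernel, is corrected by a coboundary so as to vanish when the first \<open>i\<close>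
  letters and letter \<open>i + a + 1\<close> (if there is one) lie in the kernel.  On such words, every term of the differential
  that is not part of the bar differential of \<open>D\<close> on the letters \<open>i, \<dots>, i + a\<close> vanishes.\<close>

lemma excision_step:
  assumes fpd: "finite_projective_dimension TYPE('p::ab_group_add) actX"
    and b: "balanced (Suc (Suc m)) \<phi>"
    and cyc: "\<And>x cs. length cs = Suc m \<Longrightarrow> (\<exists>j\<le>m. inK (cs ! j)) \<Longrightarrow> codiff hoch m \<phi> x cs = 0"
    and le: "i + Suc a \<le> Suc (Suc m)" and mixed: "0 < i \<or> i + a \<le> m"
    and Z: "\<And>x cs. length cs = Suc (Suc m) \<Longrightarrow> (\<And>j. j < i \<Longrightarrow> inK (cs ! j)) \<Longrightarrow> (\<exists>t\<le>a. inK (cs ! (i + t))) \<Longrightarrow> \<phi> x cs = 0"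
  obtains \<psi> where "balanced (Suc (Suc (Suc m))) \<psi>" "vanishes_on_K (Suc (Suc (Suc m))) \<psi>"
    "\<forall>x cs. length cs = Suc (Suc m) \<longrightarrow> (\<forall>j<i. inK (cs ! j)) \<longrightarrow>
      (\<exists>t\<le>a. inK (cs ! (i + t))) \<or> (i + a \<le> m \<longrightarrow> inK (cs ! (i + Suc a))) \<longrightarrow> codiff hoch (Suc m) \<psi> x cs = \<phi> x cs"
proof -
  define r where "r = Suc m - i - a"
  have r: "i + Suc a + r = Suc (Suc m)" "i + a + r = Suc m" "i + Suc (Suc a) + r = Suc (Suc (Suc m))"
    using le by (simp_all add: r_def)
  have m: "multilinear (Suc (Suc m)) \<phi>" using b by (simp add: balanced_def)
  \<comment> \<open>\<open>g k\<close> projects the first \<open>i\<close> letters and the letter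
    right behind a zone of length \<open>k\<close> to the kernel. Words whose letters at these
    places lie in the kernel are fixed by it; precomposing with it removes the condition on the
    letters outside the zone.\<close>
  define g where "g k j = (if j < i \<or> j = i + k then toK else id)" for k j
  have g_add: "g k j (c + c') = g k j c + g k j c'" and g_scale: "g k j (sC s c) = sC s (g k j c)"
    and g_act: "g k j (actC h c) = actC h (g k j c)" for k j c c' s h
    by (simp_all add: g_def toK_add toK_scale toK_act)
  have g_shift: "(\<lambda>p. if p \<le> i + t then g (Suc k) p else g (Suc k) (Suc p)) = g k" if "t < k" for t k
    using that by (auto simp: g_def fun_eq_iff)
  have comult_g: "ev (comult_at \<Delta>C (i + t) cs) (\<lambda>ds. f (mapi (g (Suc k)) ds)) = ev (comult_at \<Delta>C (i + t) (mapi (g k) cs)) f"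
    if "t < k" "i + t < length cs" for t k cs f
    using comult_at_mapi[of "i + t" cs "g (Suc k)" \<Delta>C f] that unfolding g_shift[OF that(1)] by (simp add: g_def)
  \<comment> \<open>The sign is needed because \<open>zdiff\<close> counts signs from the beginning
    of the zone and not of the word.\<close>
  define \<phi>' where "\<phi>' x = (\<lambda>cs. if length cs = Suc (Suc m) then alt i (\<phi> x (mapi (g (Suc a)) cs)) else 0)" for x
  have \<phi>'_zone: "\<phi>' x \<in> zone_funs i r (Suc a)" for x
  proof (rule zone_funsI)
    have "mlin sC (Suc (Suc m)) (\<lambda>cs. alt i (\<phi> x (mapi (g (Suc a)) cs)))"
      by (intro mlin_alt mlin_mapi[where s' = sC] multilinearD(2)[OF m] g_add g_scale)
    then show "mlin sC (i + Suc a + r) (\<phi>' x)" unfolding r by (rule mlin_cong) (simp add: \<phi>'_def)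
    show "\<phi>' x cs = 0" if "length cs \<noteq> i + Suc a + r" for cs using that by (simp add: \<phi>'_def r)
    show "\<phi>' x cs = 0" if cs: "length cs = i + Suc a + r" "t < Suc a" "inK (cs ! (i + t))" for cs t
    proof -
      have "\<phi> x (mapi (g (Suc a)) cs) = 0"
        using cs r by (intro Z) (auto simp: g_def intro!: exI[of _ t])
      then show ?thesis by (simp add: \<phi>'_def)
    qed
  qed
  \<comment> \<open>The cocycle condition is used at the projected word \<open>?w\<close>; by
    \<open>mixed\<close> it has a letter in the kernel. All terms of the differential other than
    splittings in the zone vanish by \<open>Z\<close>.\<close>
  have \<phi>'_cyc: "zdiff i r a (\<phi>' x) = 0" for x
  proof
    fix cs show "zdiff i r a (\<phi>' x) cs = 0 cs"
    proof (cases "length cs = Suc m")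
      case True
      let ?w = "mapi (g a) cs"
      have wl: "length ?w = Suc m" using True by simp
      have wi: "inK (?w ! j)" if "j < i" for j using that True le by (cases "j < Suc m") (auto simp: g_def)
      have wa: "inK (?w ! (i + a))" if "i + a \<le> m" using that True by (simp add: g_def)
      have "\<exists>j\<le>m. inK (?w ! j)"
      proof (cases "i + a \<le> m")
        case True
        then show ?thesis using wa by blast
      next
        case False
        then show ?thesis using mixed wi[of 0] by auto
      qed
      then have "codiff hoch m \<phi> x ?w = 0" by (rule cyc[OF wl])
      \<comment> \<open>If the zone reaches the end of the new word, its last letter is the
        translated half of letter 0, and this is in the kernel because then
        \<open>0 < i\<close>.\<close>
      moreover have "wrap \<phi> x ?w = 0"
      proof (rule wrap_vanish)
        show "multilinear (Suc (length ?w)) \<phi>" using m True by simp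
        show "?w \<noteq> []" using wl by force
        fix c1 c2 h y assume c: "inK (?w ! 0) \<Longrightarrow> inK c1 \<and> inK c2"
        note nw = nth_wrap[OF wl, of _ c2 "actC h c1"]
        show "\<phi> y (c2 # tl ?w @ [actC h c1]) = 0"
        proof (rule Z)
          show "length (c2 # tl ?w @ [actC h c1]) = Suc (Suc m)" using True by simp
          show "inK ((c2 # tl ?w @ [actC h c1]) ! j)" if "j < i" for j
            using that wi[of 0] wi[of j] c le by (subst nw) (auto simp: \<pi>_act)
          show "\<exists>t\<le>a. inK ((c2 # tl ?w @ [actC h c1]) ! (i + t))"
          proof (intro exI conjI)
            show "inK ((c2 # tl ?w @ [actC h c1]) ! (i + a))"
              using wa wi[of 0] c le mixed by (subst nw) (auto simp: \<pi>_act)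
          qed simp
        qed
      qed
      ultimately have "zone_diff \<Delta>C 0 (Suc m) (\<phi> x) ?w = 0" by (simp add: codiff_def split: if_splits)
      moreover have "zone_diff \<Delta>C 0 (Suc m) (\<phi> x) ?w = (\<Sum>t<a. alt (i + t) (ev (comult_at \<Delta>C (i + t) ?w) (\<phi> x)))"
        unfolding zone_diff_def add_0
      proof (rule sum_zone)
        fix j assume j: "j < Suc m" "j < i \<or> i + a \<le> j"
        have "ev (comult_at \<Delta>C j ?w) (\<phi> x) = 0"
        proof (rule comult_at_vanish)
          show "j < length ?w" using j True by simp
          show "mlin sC (Suc (length ?w)) (\<phi> x)" using multilinearD(2)[OF m] True by simp
          fix c1 c2 assume c: "inK (?w ! j) \<Longrightarrow> inK c1 \<and> inK c2"
          note ni = nth_insert2[of j ?w _ c1 c2]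
          show "\<phi> x (take j ?w @ [c1, c2] @ drop (Suc j) ?w) = 0"
          proof (rule Z)
            show "length (take j ?w @ [c1, c2] @ drop (Suc j) ?w) = Suc (Suc m)" using j True by simp
            show "inK ((take j ?w @ [c1, c2] @ drop (Suc j) ?w) ! p)" if "p < i" for p
              using that j wi[of p] wi[of "p - 1"] wi[of j] c True le by (subst ni) auto
            show "\<exists>t\<le>a. inK ((take j ?w @ [c1, c2] @ drop (Suc j) ?w) ! (i + t))"
            \<comment> \<open>A splitting in front of the zone pushes a kernel letter to place
              \<open>i\<close>, and one behind it keeps a kernel letter at place
              \<open>i + a\<close>.\<close>
            proof (cases "j < i")
              case True
              then show ?thesis
                using wi[of "i - 1"] wi[of j] c wl j le by (intro exI[of _ 0]) (subst ni, auto)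
            next
              case False
              then show ?thesis
                using wa c wl j le by (intro exI[of _ a]) (subst ni, auto)
            qed
          qed
        qed
        then show "alt j (ev (comult_at \<Delta>C j ?w) (\<phi> x)) = 0" by simp
      qed (use r in simp)
      ultimately have 0: "(\<Sum>t<a. alt (i + t) (ev (comult_at \<Delta>C (i + t) ?w) (\<phi> x))) = 0" by simp
      have "zdiff i r a (\<phi>' x) cs = (\<Sum>t<a. alt t (ev (comult_at \<Delta>C (i + t) cs) (\<phi>' x)))"
        using True r by (simp add: zdiff_def zone_diff_def)
      also have "\<dots> = (\<Sum>t<a. alt (i + t) (ev (comult_at \<Delta>C (i + t) ?w) (\<phi> x)))"
      proof (rule sum.cong)
        fix t assume "t \<in> {..<a}"
        then have t: "t < a" "i + t < length cs" using True r by auto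
        have "ev (comult_at \<Delta>C (i + t) cs) (\<phi>' x) = ev (comult_at \<Delta>C (i + t) cs) (\<lambda>ds. alt i (\<phi> x (mapi (g (Suc a)) ds)))"
          using t True by (intro ev_comult_at_cong) (simp_all add: \<phi>'_def)
        also have "\<dots> = alt i (ev (comult_at \<Delta>C (i + t) ?w) (\<phi> x))"
          unfolding ev_fun_alt comult_g[OF t] ..
        finally show "alt t (ev (comult_at \<Delta>C (i + t) cs) (\<phi>' x)) = alt (i + t) (ev (comult_at \<Delta>C (i + t) ?w) (\<phi> x))"
          by (simp add: alt_alt_add add.commute)
      qed simp
      finally show ?thesis using 0 by simp
    qed (use r in \<open>simp add: zdiff_def\<close>)
  qed
  have \<phi>'_hom: "module_hom_on UNIV actX (zone_funs i r (Suc a)) star \<phi>'"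
    unfolding module_hom_on_def
  proof (intro conjI ballI allI)
    show "\<phi>' ` UNIV \<subseteq> zone_funs i r (Suc a)" using \<phi>'_zone by blast
    show "\<phi>' (x + y) = \<phi>' x + \<phi>' y" for x y
      by (rule ext) (simp add: \<phi>'_def lfun_add[OF multilinearD(1)[OF m]] alt_add)
    show "\<phi>' (actX h x) = star h (\<phi>' x)" for h x
    proof
      fix cs show "\<phi>' (actX h x) cs = star h (\<phi>' x) cs"
      proof (cases "length cs = Suc (Suc m)")
        case True
        have "star h (\<phi>' x) cs = C.la (T h) cs (\<lambda>ds. alt i (\<phi> x (mapi (g (Suc a)) ds)))"
          unfolding star_def by (rule lact_cong) (simp add: \<phi>'_def True)
        also have "\<dots> = alt i (C.la (T h) (mapi (g (Suc a)) cs) (\<phi> x))"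
          unfolding lact_alt by (subst lact_mapi[where act' = actC]) (simp_all add: g_act)
        also have "\<dots> = \<phi>' (actX h x) cs"
          using b True by (simp add: balanced_def \<phi>'_def)
        finally show ?thesis ..
      qed (use la_wrong_length[OF \<phi>'_zone] r in \<open>simp add: \<phi>'_def star_def\<close>)
    qed
  qed
  interpret cr: coresolution "zone_funs i r" star "zdiff i r" by (rule coresolution_zone_funs)
  \<comment> \<open>Exactness of the zone complex, used equivariantly over X. That the lift is a
    module map from X is what makes it balanced.\<close>
  obtain \<psi>' where \<psi>'_hom: "module_hom_on UNIV actX (zone_funs i r (Suc (Suc a))) star \<psi>'"
    and \<psi>': "\<And>x. zdiff i r (Suc a) (\<psi>' x) = \<phi>' x"
    using cr.liftsE[OF lifts_zone_funs[OF fpd] \<phi>'_hom \<phi>'_cyc] by (metis UNIV_I)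
  have \<psi>'_zone: "\<psi>' x \<in> zone_funs i r (Suc (Suc a))" for x by (rule module_hom_onD(1)[OF \<psi>'_hom]) simp
  have \<psi>'_bal: "balanced (Suc (Suc (Suc m))) \<psi>'"
    unfolding balanced_def multilinear_def
  proof (intro conjI allI impI)
    show "lfun sX (\<lambda>x. \<psi>' x cs)" for cs
    proof (rule lfunI)
      show "\<psi>' (x + y) cs = \<psi>' x cs + \<psi>' y cs" for x y using module_hom_onD(2)[OF \<psi>'_hom, of x y] by simp
      show "\<psi>' (sX k x) cs = k * \<psi>' x cs" for k x
      proof -
        have "sX k x = actX (sB k 1) x" by (simp add: X.act_scale_left X.act_one)
        then show ?thesis using module_hom_onD(3)[OF \<psi>'_hom, of x "sB k 1"] star_scalar[OF \<psi>'_zone] by simp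
      qed
    qed
    show "mlin sC (Suc (Suc (Suc m))) (\<psi>' x)" for x using zone_funsD(1)[OF \<psi>'_zone, of x] by (simp add: r)
    show "C.la h cs (\<psi>' x) = \<psi>' (actX (S h) x) cs" for h x cs
      using module_hom_onD(3)[OF \<psi>'_hom, of x "S h"] by (simp add: star_def)
  qed
  define \<psi> where "\<psi> x cs = \<psi>' x (mapi (g (Suc (Suc a))) cs)" for x cs
  have \<psi>_bal: "balanced (Suc (Suc (Suc m))) \<psi>"
    unfolding \<psi>_def by (rule balanced_mapi[OF \<psi>'_bal g_add g_scale g_act])
  have \<psi>_zone: "\<psi> x cs = 0" if "length cs = Suc (Suc (Suc m))" "s \<le> Suc a" "inK (cs ! (i + s))" for x cs s
    unfolding \<psi>_def using that r by (intro zone_funsD(3)[OF \<psi>'_zone, of _ s]) (auto simp: g_def)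
  show thesis
  proof (rule that[OF \<psi>_bal])
    show "vanishes_on_K (Suc (Suc (Suc m))) \<psi>"
      unfolding vanishes_on_K_def
    proof (intro allI impI)
      fix x and cs :: "'c list" assume "length cs = Suc (Suc (Suc m))" "\<forall>c\<in>set cs. inK c"
      then show "\<psi> x cs = 0" using le by (intro \<psi>_zone[of _ 0]) simp_all
    qed
  next
    show "\<forall>x cs. length cs = Suc (Suc m) \<longrightarrow> (\<forall>j<i. inK (cs ! j)) \<longrightarrow>
      (\<exists>t\<le>a. inK (cs ! (i + t))) \<or> (i + a \<le> m \<longrightarrow> inK (cs ! (i + Suc a))) \<longrightarrow> codiff hoch (Suc m) \<psi> x cs = \<phi> x cs"
    proof (intro allI impI)
      fix x and cs :: "'c list"
      assume l: "length cs = Suc (Suc m)" and ci': "\<forall>j<i. inK (cs ! j)"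
        and alt: "(\<exists>t\<le>a. inK (cs ! (i + t))) \<or> (i + a \<le> m \<longrightarrow> inK (cs ! (i + Suc a)))"
      have ci: "inK (cs ! j)" if "j < i" for j using ci' that by blast
      have mlin_\<psi>: "mlin sC (Suc (length cs)) (\<psi> x)" using \<psi>_bal l by (simp add: balanced_def multilinear_def)
      \<comment> \<open>A splitting in front of the zone pushes a kernel letter to its first place,
        where \<open>\<psi>\<close> vanishes.\<close>
      have low: "ev (comult_at \<Delta>C j cs) (\<psi> x) = 0" if j: "j < i" for j
      proof (rule comult_at_vanish[OF _ mlin_\<psi>])
        fix c1 c2 assume c: "inK (cs ! j) \<Longrightarrow> inK c1 \<and> inK c2"
        have "inK ((take j cs @ [c1, c2] @ drop (Suc j) cs) ! i)"
          using j le l c ci[of j] ci[of "i - 1"] by (subst nth_insert2) auto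
        then show "\<psi> x (take j cs @ [c1, c2] @ drop (Suc j) cs) = 0"
          using l j le by (intro \<psi>_zone[of _ 0]) auto
      qed (use j le l in simp)
      show "codiff hoch (Suc m) \<psi> x cs = \<phi> x cs"
      \<comment> \<open>If one of the letters \<open>i, ..., i + a\<close> is in the kernel, both
        sides are zero. Otherwise the next letter is in the kernel or does not exist, and only the
        splittings in the zone contribute.\<close>
      proof (cases "\<exists>t\<le>a. inK (cs ! (i + t))")
        case True
        then obtain t where t: "t \<le> a" "inK (cs ! (i + t))" by blast
        have tm: "i + t \<le> Suc m" using t le by simp
        have "codiff hoch (Suc m) \<psi> x cs = 0"
        proof (rule codiff_vanish[OF \<psi>_bal l])
          fix j assume j: "j \<le> Suc m"
          show "ev (comult_at \<Delta>C j cs) (\<psi> x) = 0"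
          proof (rule comult_at_vanish[OF _ mlin_\<psi>])
            fix c1 c2 assume c: "inK (cs ! j) \<Longrightarrow> inK c1 \<and> inK c2"
            let ?ds = "take j cs @ [c1, c2] @ drop (Suc j) cs"
            have dl: "length ?ds = Suc (Suc (Suc m))" using j l by simp
            show "\<psi> x ?ds = 0"
            proof (cases "j < i + t")
              case True
              then have "inK (?ds ! (i + Suc t))" using t l j tm c by (subst nth_insert2) auto
              then show ?thesis using t by (intro \<psi>_zone[OF dl, of "Suc t"]) simp_all
            next
              case False
              then have "inK (?ds ! (i + t))" using t l j c by (subst nth_insert2) auto
              then show ?thesis using t by (intro \<psi>_zone[OF dl, of t]) simp_all
            qed
          qed (use j l in simp)
        next
          fix c1 c2 h y assume c: "inK (cs ! 0) \<Longrightarrow> inK c1 \<and> inK c2"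
          have "inK ((c2 # tl cs @ [actC h c1]) ! (i + t))"
            using t tm c by (subst nth_wrap[OF l]) auto
          then show "\<psi> y (c2 # tl cs @ [actC h c1]) = 0" using l t by (intro \<psi>_zone[of _ t]) auto
        qed
        then show ?thesis using Z[OF l ci] True by simp
      next
        case False
        then have ca: "inK (cs ! (i + Suc a))" if "i + a \<le> m" using alt that by blast
        have high: "ev (comult_at \<Delta>C j cs) (\<psi> x) = 0" if j: "i + Suc a \<le> j" "j \<le> Suc m" for j
        proof (rule comult_at_vanish[OF _ mlin_\<psi>])
          fix c1 c2 assume c: "inK (cs ! j) \<Longrightarrow> inK c1 \<and> inK c2"
          have "inK ((take j cs @ [c1, c2] @ drop (Suc j) cs) ! (i + Suc a))"
            using j l c ca by (subst nth_insert2) auto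
          then show "\<psi> x (take j cs @ [c1, c2] @ drop (Suc j) cs) = 0"
            using l j by (intro \<psi>_zone[of _ "Suc a"]) auto
        qed (use j l in simp)
        have "wrap \<psi> x cs = 0"
        proof (rule wrap_vanish)
          show "multilinear (Suc (length cs)) \<psi>" using \<psi>_bal l by (simp add: balanced_def)
          show "cs \<noteq> []" using l by force
          fix c1 c2 h y assume c: "inK (cs ! 0) \<Longrightarrow> inK c1 \<and> inK c2"
          have "inK ((c2 # tl cs @ [actC h c1]) ! (i + Suc a))"
            using ca ci[of 0] c mixed le by (subst nth_wrap[OF l]) (auto simp: \<pi>_act)
          then show "\<psi> y (c2 # tl cs @ [actC h c1]) = 0" using l by (intro \<psi>_zone[of _ "Suc a"]) auto
        qed
        then have "codiff hoch (Suc m) \<psi> x cs = (\<Sum>j<Suc (Suc m). alt j (ev (comult_at \<Delta>C j cs) (\<psi> x)))"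
          by (simp add: codiff_def zone_diff_def)
        also have "\<dots> = (\<Sum>t<Suc a. alt (i + t) (ev (comult_at \<Delta>C (i + t) cs) (\<psi> x)))"
          by (rule sum_zone) (use le low high in auto)
        also have "\<dots> = (\<Sum>t<Suc a. alt i (alt t (ev (comult_at \<Delta>C (i + t) cs) (\<psi>' x))))"
        proof (rule sum.cong)
          fix t assume "t \<in> {..<Suc a}"
          then have t: "t < Suc a" "i + t < length cs" using l le by auto
          \<comment> \<open>The letters to be projected already lie in the kernel, so the value
            obtained is that of the functional itself.\<close>
          have "mapi (g (Suc a)) cs = cs"
            by (rule nth_equalityI) (use ci ca l in \<open>auto simp: g_def toK_id\<close>)
          then show "alt (i + t) (ev (comult_at \<Delta>C (i + t) cs) (\<psi> x)) = alt i (alt t (ev (comult_at \<Delta>C (i + t) cs) (\<psi>' x)))"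
            unfolding \<psi>_def comult_g[OF t] by (simp add: alt_alt_add)
        qed simp
        also have "\<dots> = alt i (zdiff i r (Suc a) (\<psi>' x) cs)"
          using l r by (simp add: zdiff_def zone_diff_def alt_sum del: sum.lessThan_Suc)
        also have "\<dots> = \<phi> x (mapi (g (Suc a)) cs)"
          using l by (simp add: \<psi>' \<phi>'_def)
        also have "mapi (g (Suc a)) cs = cs"
          by (rule nth_equalityI) (use ci ca l in \<open>auto simp: g_def toK_id\<close>)
        finally show ?thesis .
      qed
    qed
  qed
qed

lemma balanced_zero: "balanced (Suc n) (\<lambda>x cs. 0)"
  unfolding balanced_iff by (simp add: case_prod_unfold)

lemma codiff_zero: "codiff hoch n (\<lambda>x cs. 0) x cs = 0"
  using codiff_diff[of hoch n "\<lambda>x cs. 0" "\<lambda>x cs. 0" x cs] by simp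

text \<open>The zone grows by one letter until it reaches the end of the word. At that point the
  functional vanishes as soon as the first \<open>i\<close> letters are in the kernel, which is the
  hypothesis for \<open>i - 1\<close> and a zone of a single letter, so the process restarts there.
  It stops when the zone is the whole word. The measure is lexicographic because the room behind the
  zone increases whenever \<open>i\<close> drops.\<close>

lemma excision_induct:
  assumes fpd: "finite_projective_dimension TYPE('p::ab_group_add) actX"
  shows "balanced (Suc (Suc m)) \<phi> \<Longrightarrow>
    (\<And>x cs. length cs = Suc m \<Longrightarrow> (\<exists>j\<le>m. inK (cs ! j)) \<Longrightarrow> codiff hoch m \<phi> x cs = 0) \<Longrightarrow> i + a \<le> Suc m \<Longrightarrow>
    (\<And>x cs. length cs = Suc (Suc m) \<Longrightarrow> (\<And>j. j < i \<Longrightarrow> inK (cs ! j)) \<Longrightarrow> (\<exists>t\<le>a. inK (cs ! (i + t))) \<Longrightarrow> \<phi> x cs = 0) \<Longrightarrow>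
    \<exists>\<psi>. balanced (Suc (Suc (Suc m))) \<psi> \<and> vanishes_on_K (Suc (Suc (Suc m))) \<psi> \<and>
      (\<forall>x cs. length cs = Suc (Suc m) \<longrightarrow> (\<exists>j\<le>Suc m. inK (cs ! j)) \<longrightarrow> codiff hoch (Suc m) \<psi> x cs = \<phi> x cs)"
proof (induction "(i, Suc m - i - a)" arbitrary: i a \<phi> rule: wf_induct_rule[OF wf_lex_prod[OF wf_less_than wf_less_than]])
  case (1 i a \<phi>)
  note b = 1(2) and cyc = 1(3) and le = 1(4) and Z = 1(5)
  show ?case
  proof (cases "0 < i \<or> i + a \<le> m")
    case False
    then have "i = 0" "a = Suc m" using le by auto
    then have "\<phi> x cs = 0" if "length cs = Suc (Suc m)" "\<exists>j\<le>Suc m. inK (cs ! j)" for x cs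
      using Z[of cs x] that by auto
    then show ?thesis
      by (intro exI[of _ "\<lambda>x cs. 0"]) (simp add: balanced_zero codiff_zero vanishes_on_K_def)
  next
    case True
    have le': "i + Suc a \<le> Suc (Suc m)" using le by simp
    obtain \<psi>1 where \<psi>1: "balanced (Suc (Suc (Suc m))) \<psi>1" and K1: "vanishes_on_K (Suc (Suc (Suc m))) \<psi>1"
      and E1: "\<forall>x cs. length cs = Suc (Suc m) \<longrightarrow> (\<forall>j<i. inK (cs ! j)) \<longrightarrow>
        (\<exists>t\<le>a. inK (cs ! (i + t))) \<or> (i + a \<le> m \<longrightarrow> inK (cs ! (i + Suc a))) \<longrightarrow> codiff hoch (Suc m) \<psi>1 x cs = \<phi> x cs"
    proof (rule excision_step[OF fpd b _ le' True])
      show "codiff hoch m \<phi> x cs = 0" if "length cs = Suc m" "\<exists>j\<le>m. inK (cs ! j)" for x cs by (rule cyc[OF that])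
      fix x and cs :: "'c list"
      assume l: "length cs = Suc (Suc m)" and c: "\<And>j. j < i \<Longrightarrow> inK (cs ! j)" and t: "\<exists>t\<le>a. inK (cs ! (i + t))"
      show "\<phi> x cs = 0" by (rule Z[OF l c t])
    qed (rule that)
    define \<phi>1 where "\<phi>1 x cs = \<phi> x cs - codiff hoch (Suc m) \<psi>1 x cs" for x cs
    have b1: "balanced (Suc (Suc m)) \<phi>1"
      unfolding \<phi>1_def by (rule balanced_diff[OF b balanced_codiff[OF \<psi>1]])
    have cyc1: "codiff hoch m \<phi>1 x cs = 0" if "length cs = Suc m" "\<exists>j\<le>m. inK (cs ! j)" for x cs
      unfolding \<phi>1_def codiff_diff codiff_codiff[OF \<psi>1 that(1)] by (simp add: cyc[OF that])
    have "\<exists>\<psi>. balanced (Suc (Suc (Suc m))) \<psi> \<and> vanishes_on_K (Suc (Suc (Suc m))) \<psi> \<and>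
      (\<forall>x cs. length cs = Suc (Suc m) \<longrightarrow> (\<exists>j\<le>Suc m. inK (cs ! j)) \<longrightarrow> codiff hoch (Suc m) \<psi> x cs = \<phi>1 x cs)"
    proof (cases "i + a \<le> m")
      case True
      have "((i, Suc m - i - Suc a), (i, Suc m - i - a)) \<in> less_than <*lex*> less_than"
        using True by (simp add: in_lex_prod)
      then show ?thesis
      proof (rule 1(1)[OF _ b1 cyc1])
        fix x and cs :: "'c list"
        assume l: "length cs = Suc (Suc m)" and c: "\<And>j. j < i \<Longrightarrow> inK (cs ! j)" and t: "\<exists>t\<le>Suc a. inK (cs ! (i + t))"
        have "(\<exists>t\<le>a. inK (cs ! (i + t))) \<or> (i + a \<le> m \<longrightarrow> inK (cs ! (i + Suc a)))"
          using t le_Suc_eq by blast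
        with E1 l c show "\<phi>1 x cs = 0" by (simp add: \<phi>1_def)
      qed (use True in simp_all)
    next
      case False
      then obtain i' where i': "i = Suc i'" using \<open>0 < i \<or> i + a \<le> m\<close> gr0_conv_Suc by blast
      have "((i', Suc m - i' - 0), (i, Suc m - i - a)) \<in> less_than <*lex*> less_than"
        by (simp add: i' in_lex_prod)
      then show ?thesis
      proof (rule 1(1)[OF _ b1 cyc1])
        fix x and cs :: "'c list"
        assume l: "length cs = Suc (Suc m)" and c: "\<And>j. j < i' \<Longrightarrow> inK (cs ! j)" and t: "\<exists>t\<le>0. inK (cs ! (i' + t))"
        have "inK (cs ! j)" if "j < i" for j using that c t by (cases "j = i'") (auto simp: i')
        with E1 l False show "\<phi>1 x cs = 0" by (simp add: \<phi>1_def)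
      qed (use le i' in simp_all)
    qed
    then obtain \<psi>2 where \<psi>2_all: "balanced (Suc (Suc (Suc m))) \<psi>2 \<and> vanishes_on_K (Suc (Suc (Suc m))) \<psi>2 \<and>
      (\<forall>x cs. length cs = Suc (Suc m) \<longrightarrow> (\<exists>j\<le>Suc m. inK (cs ! j)) \<longrightarrow> codiff hoch (Suc m) \<psi>2 x cs = \<phi>1 x cs)" ..
    note \<psi>2 = conjunct1[OF \<psi>2_all] conjunct1[OF conjunct2[OF \<psi>2_all]] conjunct2[OF conjunct2[OF \<psi>2_all]]
    show ?thesis
    proof (intro exI conjI allI impI)
      show "balanced (Suc (Suc (Suc m))) (\<lambda>x cs. \<psi>1 x cs + \<psi>2 x cs)" by (rule balanced_add[OF \<psi>1 \<psi>2(1)])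
      show "vanishes_on_K (Suc (Suc (Suc m))) (\<lambda>x cs. \<psi>1 x cs + \<psi>2 x cs)"
        unfolding vanishes_on_K_def
      proof (intro allI impI)
        fix x and cs :: "'c list" assume l: "length cs = Suc (Suc (Suc m))" and c: "\<forall>c\<in>set cs. inK c"
        with K1 \<psi>2(2) show "\<psi>1 x cs + \<psi>2 x cs = 0" unfolding vanishes_on_K_def by simp
      qed
      fix x and cs :: "'c list" assume "length cs = Suc (Suc m)" "\<exists>j\<le>Suc m. inK (cs ! j)"
      with \<psi>2(3) have "codiff hoch (Suc m) \<psi>2 x cs = \<phi>1 x cs" by blast
      then show "codiff hoch (Suc m) (\<lambda>x cs. \<psi>1 x cs + \<psi>2 x cs) x cs = \<phi> x cs"
        unfolding codiff_add by (simp add: \<phi>1_def)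
    qed
  qed
qed

text \<open>The induction starts with a zone consisting of the last letter, all others being in
  front of it: these are the words entirely in the kernel. In degree 0 every word with a kernel
  letter is of this kind, and \<open>\<psi> = 0\<close> suffices.\<close>

lemma excision_functional:
  assumes fpd: "finite_projective_dimension TYPE('p::ab_group_add) actX"
    and b: "balanced (Suc n) \<phi>" and K: "vanishes_on_K (Suc n) \<phi>"
    and cyc: "\<And>m x cs. n = Suc m \<Longrightarrow> length cs = Suc m \<Longrightarrow> \<exists>c\<in>set cs. inK c \<Longrightarrow> codiff hoch m \<phi> x cs = 0"
  obtains \<psi> where "balanced (Suc (Suc n)) \<psi>" "vanishes_on_K (Suc (Suc n)) \<psi>"
    "\<And>x cs. length cs = Suc n \<Longrightarrow> \<exists>c\<in>set cs. inK c \<Longrightarrow> codiff hoch n \<psi> x cs = \<phi> x cs"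
proof (cases n)
  case 0
  have "\<phi> x cs = 0" if "length cs = Suc n" "\<exists>c\<in>set cs. inK c" for x cs
    using vanishes_on_KD[OF K that(1)] that 0 by (cases cs) auto
  then show thesis
    by (intro that[of "\<lambda>x cs. 0"]) (simp_all add: balanced_zero codiff_zero vanishes_on_K_def)
next
  case (Suc m)
  have ex: "(\<exists>c\<in>set cs. inK c) \<longleftrightarrow> (\<exists>j\<le>k. inK (cs ! j))" if "length cs = Suc k" for k and cs :: "'c list"
    using that by (simp add: Bex_def in_set_conv_nth less_Suc_eq_le) blast
  have "\<exists>\<psi>. balanced (Suc (Suc (Suc m))) \<psi> \<and> vanishes_on_K (Suc (Suc (Suc m))) \<psi> \<and>
      (\<forall>x cs. length cs = Suc (Suc m) \<longrightarrow> (\<exists>j\<le>Suc m. inK (cs ! j)) \<longrightarrow> codiff hoch (Suc m) \<psi> x cs = \<phi> x cs)"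
  proof (rule excision_induct[OF fpd, where i = "Suc m" and a = 0])
    show "balanced (Suc (Suc m)) \<phi>" using b Suc by simp
    show "codiff hoch m \<phi> x cs = 0" if "length cs = Suc m" "\<exists>j\<le>m. inK (cs ! j)" for x cs
      using cyc[OF Suc that(1)] that(2) unfolding ex[OF that(1)] by blast
    fix x and cs :: "'c list"
    assume l: "length cs = Suc (Suc m)" and c: "\<And>j. j < Suc m \<Longrightarrow> inK (cs ! j)" and t: "\<exists>t\<le>0. inK (cs ! (Suc m + t))"
    show "\<phi> x cs = 0"
      using K l c t Suc by (intro vanishes_on_KD[of "Suc n"]) (auto simp: less_Suc_eq)
  qed simp
  then obtain \<psi> where \<psi>_all: "balanced (Suc (Suc (Suc m))) \<psi> \<and> vanishes_on_K (Suc (Suc (Suc m))) \<psi> \<and>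
      (\<forall>x cs. length cs = Suc (Suc m) \<longrightarrow> (\<exists>j\<le>Suc m. inK (cs ! j)) \<longrightarrow> codiff hoch (Suc m) \<psi> x cs = \<phi> x cs)" ..
  note \<psi> = conjunct1[OF \<psi>_all] conjunct1[OF conjunct2[OF \<psi>_all]] conjunct2[OF conjunct2[OF \<psi>_all]]
  show thesis
  proof (rule that)
    show "balanced (Suc (Suc n)) \<psi>" "vanishes_on_K (Suc (Suc n)) \<psi>" using \<psi>(1,2) Suc by simp_all
    show "codiff hoch n \<psi> x cs = \<phi> x cs" if "length cs = Suc n" "\<exists>c\<in>set cs. inK c" for x cs
      using \<psi>(3) that(1) that(2)[unfolded ex[OF that(1)[unfolded Suc]]] Suc by simp
  qed
qed

end

section \<open>The cofibration sequence\<close>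

lemma ev_CM_map: "ev (CM_map f u) (\<lambda>(x, ds). \<psi> x ds) = ev u (\<lambda>(x, cs). \<psi> x (map f cs))"
  by (simp add: CM_map_def ev_bind case_prod_unfold)

lemma CM_map_add: "CM_map f (u + v) = CM_map f u + CM_map f v"
  and CM_map_scale: "CM_map f (fscale a u) = fscale a (CM_map f u)"
  by (simp_all add: CM_map_def fbind_add fbind_scale)

lemma CM_map_gen: "CM_map f (gen (x, cs)) = gen (x, map f cs)"
  by (rule ev_eqI) (simp add: CM_map_def ev_bind)

lemma mlin_bilin:
  assumes "mlin s N f" "Suc (Suc (length xs + length ys)) = N"
  shows "bilin s s (\<lambda>c1 c2. f (xs @ [c1, c2] @ ys))"
proof (rule bilinI)
  show "lfun s (\<lambda>c1. f (xs @ [c1, c2] @ ys))" for c2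
    using mlinD[OF assms(1), of xs "c2 # ys"] assms(2) by simp
  show "lfun s (\<lambda>c2. f (xs @ [c1, c2] @ ys))" for c1
    using mlinD[OF assms(1), of "xs @ [c1]" ys] assms(2) by simp
qed

text \<open>No compatibility with the comultiplication is required. The section of
  \<open>\<pi>\<close> and the retraction of \<open>\<iota>\<close> are treated by this locale; they
  act on each degree and respect the relations, but are not claimed to commute with the
  cofaces.\<close>

locale coefficient_map =
  E: cyclic_coefficients sB \<Delta>B \<epsilon> S sX actX \<rho> sE actE \<Delta>E + F: cyclic_coefficients sB \<Delta>B \<epsilon> S sX actX \<rho> sF actF \<Delta>F
  for sB :: "'k::field \<Rightarrow> 'b::ring_1 \<Rightarrow> 'b" and \<Delta>B \<epsilon> S
    and sX :: "'k \<Rightarrow> 'x::ab_group_add \<Rightarrow> 'x" and actX \<rho>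
    and sE :: "'k \<Rightarrow> 'e::ab_group_add \<Rightarrow> 'e" and actE \<Delta>E
    and sF :: "'k \<Rightarrow> 'f::ab_group_add \<Rightarrow> 'f" and actF \<Delta>F +
  fixes f :: "'e \<Rightarrow> 'f"
  assumes f_add: "f (c + c') = f c + f c'" and f_scale: "f (sE a c) = sF a (f c)" and f_act: "f (actE b c) = actF b (f c)"
begin

lemma balanced_map:
  assumes b: "F.balanced N \<psi>"
  shows "E.balanced N (\<lambda>x cs. \<psi> x (map f cs))"
  unfolding E.balanced_def E.multilinear_def
proof (intro conjI allI impI)
  have m: "F.multilinear N \<psi>" using b by (simp add: F.balanced_def)
  show "lfun sX (\<lambda>x. \<psi> x (map f cs))" if "length cs = N" for cs
    by (rule F.multilinearD(1)[OF m]) (simp add: that)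
  show "mlin sE N (\<lambda>cs. \<psi> x (map f cs))" for x
    unfolding map_eq_mapi by (rule mlin_mapi[where g = "\<lambda>_. f", OF F.multilinearD(2)[OF m] f_add f_scale])
  show "E.C.la h cs (\<lambda>cs. \<psi> x (map f cs)) = \<psi> (actX (S h) x) (map f cs)" if "length cs = N" for h x cs
  proof -
    have "E.C.la h cs (\<lambda>cs. \<psi> x (mapi (\<lambda>_. f) cs)) = F.C.la h (mapi (\<lambda>_. f) cs) (\<psi> x)"
      by (rule lact_mapi) (rule f_act)
    then show ?thesis using b that by (simp add: map_eq_mapi F.balanced_def)
  qed
qed

lemma CM_map_chains:
  assumes "u \<in> chains E.CMX n"
  shows "CM_map f u \<in> chains F.CMX n"
  unfolding F.chains_CM_iff_ev
proof (intro allI impI)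
  fix G :: "'x \<times> 'f list \<Rightarrow> 'k" assume G: "\<forall>x cs. length cs = Suc n \<longrightarrow> G (x, cs) = 0"
  have "ev (CM_map f u) G = ev u (\<lambda>(x, cs). G (x, map f cs))"
    using ev_CM_map[of f u "\<lambda>x cs. G (x, cs)"] by (simp add: case_prod_unfold)
  also have "\<dots> = ev u (\<lambda>_. 0)"
    by (rule E.chains_CM_ev_cong[OF assms]) (simp add: G)
  finally show "ev (CM_map f u) G = 0" by simp
qed

lemma CM_map_rels: "u \<in> rels E.CMX n \<Longrightarrow> CM_map f u \<in> rels F.CMX n"
  by (rule F.rels_CM_I) (simp add: ev_CM_map E.rels_CM_ev balanced_map)

end

locale coalgebra_coefficient_map = coefficient_map +
  assumes f_comult: "bilin sF sF G \<Longrightarrow> ev (\<Delta>E c) (\<lambda>(c1, c2). G (f c1) (f c2)) = ev (\<Delta>F (f c)) (\<lambda>(d1, d2). G d1 d2)"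
begin

lemma split_at_map:
  assumes "F.multilinear (Suc (length cs)) \<psi>" "j < length cs"
  shows "E.split_at j (\<lambda>x cs. \<psi> x (map f cs)) x cs = F.split_at j \<psi> x (map f cs)"
proof -
  have "bilin sF sF (\<lambda>d1 d2. \<psi> x (take j (map f cs) @ [d1, d2] @ drop (Suc j) (map f cs)))"
    by (rule mlin_bilin[OF F.multilinearD(2)[OF assms(1)]]) (use assms(2) in simp)
  from f_comult[OF this, of "cs ! j"] show ?thesis
    using assms(2) by (simp add: E.split_at_def F.split_at_def ev_comult_at take_map drop_map)
qed

lemma cshift_map: "cs \<noteq> [] \<Longrightarrow> E.cshift (\<lambda>x cs. \<psi> x (map f cs)) x cs = F.cshift \<psi> x (map f cs)"
  by (simp add: E.cshift_def F.cshift_def f_act map_tl hd_map)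

lemma cocyclic_map: "cocyclic_map E.CMX F.CMX (CM_map f)"
proof
  fix u n assume u: "u \<in> chains E.CMX n"
  note fu = CM_map_chains[OF u]
  show "CM_map f u \<in> chains F.CMX n" by (rule fu)
  show "CM_map f (coface E.CMX n j u) \<approx>\<^bsub>rels F.CMX (Suc n)\<^esub> coface F.CMX n j (CM_map f u)" if j: "j \<le> Suc n" for j
  proof (rule F.rels_CM_I)
    fix \<psi> assume b: "F.balanced (Suc (Suc n)) \<psi>"
    then have m: "F.multilinear (Suc (Suc n)) \<psi>" by (simp add: F.balanced_def)
    have "ev (coface E.CMX n j u) (\<lambda>(x, cs). \<psi> x (map f cs)) = ev (coface F.CMX n j (CM_map f u)) (\<lambda>(x, cs). \<psi> x cs)"
    proof (cases "j \<le> n")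
      case True
      show ?thesis
        unfolding E.ev_coface_CM[OF u True] F.ev_coface_CM[OF fu True] ev_CM_map
        by (rule E.chains_CM_ev_cong[OF u]) (simp add: split_at_map m True less_Suc_eq_le)
    next
      case False
      then have j: "j = Suc n" using j by simp
      have "F.multilinear (Suc (Suc n)) (F.cshift \<psi>)"
        using F.balanced_cshift[OF b] by (simp add: F.balanced_def)
      then have "E.split_at 0 (E.cshift (\<lambda>x cs. \<psi> x (map f cs))) x cs = F.split_at 0 (F.cshift \<psi>) x (map f cs)"
        if "length cs = Suc n" for x cs
      proof -
        have "E.split_at 0 (E.cshift (\<lambda>x cs. \<psi> x (map f cs))) x cs = E.split_at 0 (\<lambda>x cs. F.cshift \<psi> x (map f cs)) x cs"
          unfolding E.split_at_def by (rule ev_comult_at_cong) (use that in \<open>auto intro!: cshift_map\<close>)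
        also have "\<dots> = F.split_at 0 (F.cshift \<psi>) x (map f cs)"
          using that \<open>F.multilinear (Suc (Suc n)) (F.cshift \<psi>)\<close> by (intro split_at_map) simp_all
        finally show ?thesis .
      qed
      then show ?thesis
        unfolding j E.ev_coface_last_CM[OF u] F.ev_coface_last_CM[OF fu] ev_CM_map
        by (intro E.chains_CM_ev_cong[OF u]) simp
    qed
    then show "ev (CM_map f (coface E.CMX n j u) - coface F.CMX n j (CM_map f u)) (\<lambda>(x, cs). \<psi> x cs) = 0"
      by (simp add: ev_diff ev_CM_map)
  qed
  show "CM_map f (cyc E.CMX n u) \<approx>\<^bsub>rels F.CMX n\<^esub> cyc F.CMX n (CM_map f u)"
  proof (rule F.rels_CM_I)
    fix \<psi> assume "F.balanced (Suc n) \<psi>"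
    have "ev (cyc E.CMX n u) (\<lambda>(x, cs). \<psi> x (map f cs)) = ev (cyc F.CMX n (CM_map f u)) (\<lambda>(x, cs). \<psi> x cs)"
      unfolding E.ev_cyc_CM F.ev_cyc_CM ev_CM_map
      by (rule E.chains_CM_ev_cong[OF u]) (auto intro!: cshift_map)
    then show "ev (CM_map f (cyc E.CMX n u) - cyc F.CMX n (CM_map f u)) (\<lambda>(x, cs). \<psi> x cs) = 0"
      by (simp add: ev_diff ev_CM_map)
  qed
qed (rule CM_map_add CM_map_scale CM_map_rels, assumption?)+

end

lemma (in cyclic_coefficients) column_diff_add: "column_diff hoch n (u + v) = column_diff hoch n u + column_diff hoch n v"
  by (simp add: additive_mapD[OF cocyc.additive_hoch_diff] additive_mapD[OF cocyc.additive_bar_diff])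

lemma (in cyclic_coefficients) column_diff_scale: "column_diff hoch n (fscale a u) = fscale a (column_diff hoch n u)"
proof -
  have "fscale a (alt j u) = alt j (fscale a u)" for j and u :: "'x \<times> 'c list \<Rightarrow>\<^sub>0 'k" by (simp add: alt_def)
  then show ?thesis
    by (simp add: hoch_diff_def bar_diff_def cocyc.coface_scale fs.scale_sum_right fs.scale_right_distrib)
qed

locale excision_sequence =
  excision sB \<Delta>B \<epsilon> S sX actX \<rho> sC actC \<Delta>C sD actD \<Delta>D \<pi> \<sigma> + K: module_coalgebra sB \<Delta>B \<epsilon> S sK actK \<Delta>K
  for sB :: "'k::field \<Rightarrow> 'b::ring_1 \<Rightarrow> 'b" and \<Delta>B \<epsilon> S
    and sX :: "'k \<Rightarrow> 'x::ab_group_add \<Rightarrow> 'x" and actX \<rho>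
    and sK :: "'k \<Rightarrow> 'l::ab_group_add \<Rightarrow> 'l" and actK \<Delta>K
    and sC :: "'k \<Rightarrow> 'c::ab_group_add \<Rightarrow> 'c" and actC \<Delta>C
    and sD :: "'k \<Rightarrow> 'd::ab_group_add \<Rightarrow> 'd" and actD \<Delta>D
    and \<iota> :: "'l \<Rightarrow> 'c" and \<pi> :: "'c \<Rightarrow> 'd" and \<sigma> :: "'d \<Rightarrow> 'c" +
  assumes \<iota>_add: "\<iota> (k + k') = \<iota> k + \<iota> k'" and \<iota>_scale: "\<iota> (sK a k) = sC a (\<iota> k)" and \<iota>_act: "\<iota> (actK b k) = actC b (\<iota> k)"
    and \<iota>_comult: "bilin sC sC F \<Longrightarrow> ev (\<Delta>K k) (\<lambda>(k1, k2). F (\<iota> k1) (\<iota> k2)) = ev (\<Delta>C (\<iota> k)) (\<lambda>(c1, c2). F c1 c2)"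
    and inj_\<iota>: "inj \<iota>" and range_\<iota>: "range \<iota> = {c. \<pi> c = 0}"
begin

text \<open>The equivariant retraction of \<open>\<iota>\<close> that corresponds to the section
  \<open>\<sigma>\<close> of \<open>\<pi>\<close>.\<close>

definition \<kappa> :: "'c \<Rightarrow> 'l" where "\<kappa> c = inv \<iota> (toK c)"

lemma \<iota>_\<kappa>: "\<iota> (\<kappa> c) = toK c"
  unfolding \<kappa>_def by (rule f_inv_into_f) (simp add: range_\<iota>)

lemma \<pi>_\<iota> [simp]: "\<pi> (\<iota> k) = 0"
  using range_\<iota> by blast

lemma \<kappa>_\<iota> [simp]: "\<kappa> (\<iota> k) = k"
  by (simp add: \<kappa>_def toK_id inv_f_f inj_\<iota>)

sublocale XK: cyclic_coefficients sB \<Delta>B \<epsilon> S sX actX \<rho> sK actK \<Delta>K ..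
sublocale XD: cyclic_coefficients sB \<Delta>B \<epsilon> S sX actX \<rho> sD actD \<Delta>D ..
sublocale Iota: coalgebra_coefficient_map sB \<Delta>B \<epsilon> S sX actX \<rho> sK actK \<Delta>K sC actC \<Delta>C \<iota>
  by unfold_locales (simp_all add: \<iota>_add \<iota>_scale \<iota>_act \<iota>_comult)
sublocale Pi: coalgebra_coefficient_map sB \<Delta>B \<epsilon> S sX actX \<rho> sC actC \<Delta>C sD actD \<Delta>D \<pi>
  by unfold_locales (simp_all add: \<pi>_add \<pi>_scale \<pi>_act \<pi>_comult)
sublocale Sigma: coefficient_map sB \<Delta>B \<epsilon> S sX actX \<rho> sD actD \<Delta>D sC actC \<Delta>C \<sigma>
  by unfold_locales (simp_all add: \<sigma>_add \<sigma>_scale \<sigma>_act)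
sublocale Kappa: coefficient_map sB \<Delta>B \<epsilon> S sX actX \<rho> sC actC \<Delta>C sK actK \<Delta>K \<kappa>
proof unfold_locales
  fix c c' a b
  show "\<kappa> (c + c') = \<kappa> c + \<kappa> c'" by (rule injD[OF inj_\<iota>]) (simp add: \<iota>_\<kappa> \<iota>_add toK_add)
  show "\<kappa> (sC a c) = sK a (\<kappa> c)" by (rule injD[OF inj_\<iota>]) (simp add: \<iota>_\<kappa> \<iota>_scale toK_scale)
  show "\<kappa> (actC b c) = actK b (\<kappa> c)" by (rule injD[OF inj_\<iota>]) (simp add: \<iota>_\<kappa> \<iota>_act toK_act)
qed

text \<open>Balanced functionals on words in K extend to words in C by pulling them back along the
  retraction, so no new relations arise in C.\<close>

lemma CM_map_\<iota>_inj:
  assumes "u \<in> chains XK.CMX n" "CM_map \<iota> u \<in> rels CMX n"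
  shows "u \<in> rels XK.CMX n"
proof (rule XK.rels_CM_I)
  fix \<phi> assume "XK.balanced (Suc n) \<phi>"
  then have "ev (CM_map \<iota> u) (\<lambda>(x, cs). \<phi> x (map \<kappa> cs)) = 0"
    by (rule rels_CM_ev[OF assms(2) Kappa.balanced_map])
  then show "ev u (\<lambda>(x, cs). \<phi> x cs) = 0" by (simp add: ev_CM_map o_def)
qed

lemma CM_map_\<pi>_surj: "w \<in> chains XD.CMX n \<Longrightarrow> \<exists>v\<in>chains CMX n. CM_map \<pi> v \<approx>\<^bsub>rels XD.CMX n\<^esub> w"
  by (rule bexI[of _ "CM_map \<sigma> w"])
    (auto intro!: XD.rels_CM_I Sigma.CM_map_chains simp: ev_diff ev_CM_map o_def)

lemma CM_map_\<pi>_vanish: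
  assumes v: "v \<in> chains CMX n" and K: "\<And>x cs. (x, cs) \<in> Poly_Mapping.keys v \<Longrightarrow> \<exists>c\<in>set cs. inK c"
  shows "CM_map \<pi> v \<in> rels XD.CMX n"
proof (rule XD.rels_CM_I)
  fix \<psi> assume b: "XD.balanced (Suc n) \<psi>"
  have "\<psi> x (map \<pi> cs) = 0" if k: "(x, cs) \<in> Poly_Mapping.keys v" for x cs
  proof -
    have "length cs = Suc n" using v k by (auto simp: chains_CM_iff)
    moreover obtain j where "j < length cs" "inK (cs ! j)" using K[OF k] by (auto simp: in_set_conv_nth)
    ultimately show ?thesis
      using b by (intro mlin_eq_0[of sD "Suc n" "\<psi> x" _ j]) (simp_all add: XD.balanced_def XD.multilinear_def)
  qed
  then show "ev (CM_map \<pi> v) (\<lambda>(x, cs). \<psi> x cs) = 0"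
    unfolding ev_CM_map by (intro ev_eq_0) auto
qed

lemma CM_map_\<pi>_\<iota>: assumes u: "u \<in> chains XK.CMX n" shows "CM_map \<pi> (CM_map \<iota> u) \<in> rels XD.CMX n"
proof (rule XD.rels_CM_I)
  fix \<psi> assume b: "XD.balanced (Suc n) \<psi>"
  have z: "\<psi> x (map \<pi> (map \<iota> ks)) = 0" if "length ks = Suc n" for x ks
    using b that by (intro mlin_eq_0[of sD "Suc n" "\<psi> x" _ 0]) (simp_all add: XD.balanced_def XD.multilinear_def)
  have "ev u (\<lambda>(x, ks). \<psi> x (map \<pi> (map \<iota> ks))) = ev u (\<lambda>_. 0)"
    by (rule XK.chains_CM_ev_cong[OF u]) (use z in simp)
  then show "ev (CM_map \<pi> (CM_map \<iota> u)) (\<lambda>(x, cs). \<psi> x cs) = 0" by (simp add: ev_CM_map)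
qed

text \<open>A functional vanishing on words with a letter in the kernel factors through \<open>\<pi>\<close>.\<close>

lemma ev_eq_0_factor:
  assumes v: "v \<in> chains CMX n" "CM_map \<pi> v \<in> rels XD.CMX n" and b: "balanced (Suc n) \<theta>"
    and K: "\<And>x cs. length cs = Suc n \<Longrightarrow> \<exists>c\<in>set cs. inK c \<Longrightarrow> \<theta> x cs = 0"
  shows "ev v (\<lambda>(x, cs). \<theta> x cs) = 0"
proof -
  have "\<theta> x (map \<sigma> (map \<pi> cs)) = \<theta> x cs" if l: "length cs = Suc n" for x cs
  proof -
    have "\<theta> x (mapi (\<lambda>_. \<sigma> \<circ> \<pi>) cs) = \<theta> x cs"
    proof (rule mapi_mod[of sC "Suc n"])
      show "mlin sC (Suc n) (\<theta> x)" using b by (simp add: balanced_def multilinear_def)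
      fix j and ds :: "'c list" assume "j < Suc n" "length ds = Suc n" "ds ! j = (\<sigma> \<circ> \<pi>) (cs ! j) - cs ! j"
      then have "inK (ds ! j)" by (simp add: \<pi>_diff)
      moreover have "ds ! j \<in> set ds" using \<open>j < Suc n\<close> \<open>length ds = Suc n\<close> by simp
      ultimately show "\<theta> x ds = 0" using K \<open>length ds = Suc n\<close> by blast
    qed (rule l)
    then show ?thesis by (simp add: map_eq_mapi[symmetric])
  qed
  then have "ev v (\<lambda>(x, cs). \<theta> x cs) = ev v (\<lambda>(x, cs). \<theta> x (map \<sigma> (map \<pi> cs)))"
    by (intro chains_CM_ev_cong[OF v(1)]) simp
  also have "\<dots> = ev (CM_map \<pi> v) (\<lambda>(x, ds). \<theta> x (map \<sigma> ds))" by (simp add: ev_CM_map)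
  also have "\<dots> = 0" by (rule XD.rels_CM_ev[OF v(2) Sigma.balanced_map[OF b]])
  finally show ?thesis .
qed

text \<open>The assumption \<open>cyc\<close>, used for words with a kernel letter, makes
  \<open>\<phi>\<close> a cocycle on them, so there it is the coboundary of some
  \<open>\<psi>\<close> that vanishes on words in K. The difference of \<open>\<phi>\<close> and
  this coboundary factors through D and kills \<open>v\<close>; the coboundary itself takes at
  \<open>v\<close> the value of \<open>\<psi>\<close> at the differential of \<open>v\<close>, which
  comes from K.\<close>

lemma column_functional:
  assumes fpd: "finite_projective_dimension TYPE('p::ab_group_add) actX"
    and v: "v \<in> chains CMX n" "CM_map \<pi> v \<in> rels XD.CMX n"
    and u: "u \<in> chains XK.CMX (Suc n)" "column_diff hoch n v \<approx>\<^bsub>rels CMX (Suc n)\<^esub> CM_map \<iota> u"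
    and b: "balanced (Suc n) \<phi>" and K: "vanishes_on_K (Suc n) \<phi>"
    and cyc: "\<And>m v'. n = Suc m \<Longrightarrow> v' \<in> chains CMX m \<Longrightarrow> CM_map \<pi> v' \<in> rels XD.CMX m \<Longrightarrow>
      ev (column_diff hoch m v') (\<lambda>(x, cs). \<phi> x cs) = 0"
  shows "ev v (\<lambda>(x, cs). \<phi> x cs) = 0"
proof -
  have "codiff hoch m \<phi> x cs = 0" if n: "n = Suc m" and l: "length cs = Suc m" and k: "\<exists>c\<in>set cs. inK c" for m x cs
  proof -
    note g = gen_chains[OF l, of x]
    have "CM_map \<pi> (gen (x, cs)) \<in> rels XD.CMX m" by (rule CM_map_\<pi>_vanish[OF g]) (use k in auto)
    from cyc[OF n g this] show ?thesis unfolding ev_column_diff[OF g] by simp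
  qed
  then obtain \<psi> where \<psi>: "balanced (Suc (Suc n)) \<psi>" "vanishes_on_K (Suc (Suc n)) \<psi>"
    "\<And>x cs. length cs = Suc n \<Longrightarrow> \<exists>c\<in>set cs. inK c \<Longrightarrow> codiff hoch n \<psi> x cs = \<phi> x cs"
    by (rule excision_functional[OF fpd b K]) (assumption | rule that)+
  have "ev v (\<lambda>(x, cs). codiff hoch n \<psi> x cs) = ev (column_diff hoch n v) (\<lambda>(x, cs). \<psi> x cs)"
    by (rule ev_column_diff[OF v(1), symmetric])
  also have "\<dots> = ev (CM_map \<iota> u) (\<lambda>(x, cs). \<psi> x cs)"
    using rels_CM_ev[OF u(2) \<psi>(1)] by (simp add: ev_diff)
  also have "\<dots> = ev u (\<lambda>(x, ks). \<psi> x (map \<iota> ks))" by (rule ev_CM_map)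
  also have "\<dots> = ev u (\<lambda>_. 0)"
    by (rule XK.chains_CM_ev_cong[OF u(1)]) (use \<psi>(2) in \<open>simp add: vanishes_on_K_def\<close>)
  finally have 0: "ev v (\<lambda>(x, cs). codiff hoch n \<psi> x cs) = 0" by simp
  have "ev v (\<lambda>(x, cs). \<phi> x cs - codiff hoch n \<psi> x cs) = 0"
    by (rule ev_eq_0_factor[OF v balanced_diff[OF b balanced_codiff[OF \<psi>(1)]]]) (use \<psi>(3) in simp)
  then show ?thesis using 0 by (simp add: case_prod_unfold ev_fun_diff)
qed

text \<open>By \<open>column_functional\<close>, a functional that annihilates the relations, the
  image of K and the coboundaries of elements dying in D also annihilates \<open>v\<close>. By
  separation \<open>v\<close> lies in the sum of these three subspaces.\<close>

lemma column_exact: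
  assumes fpd: "finite_projective_dimension TYPE('p::ab_group_add) actX"
    and v: "v \<in> chains CMX n" "CM_map \<pi> v \<in> rels XD.CMX n"
    and u: "u \<in> chains XK.CMX (Suc n)" "column_diff hoch n v \<approx>\<^bsub>rels CMX (Suc n)\<^esub> CM_map \<iota> u"
  shows "\<exists>l\<in>chains XK.CMX n. \<exists>y. v - CM_map \<iota> l - y \<in> rels CMX n \<and>
    (case n of 0 \<Rightarrow> y = 0 | Suc m \<Rightarrow> \<exists>v'\<in>chains CMX m. CM_map \<pi> v' \<in> rels XD.CMX m \<and> y = column_diff hoch m v')"
proof -
  let ?A = "CM_map \<iota> ` chains XK.CMX n"
  let ?V = "\<lambda>m. {v' \<in> chains CMX m. CM_map \<pi> v' \<in> rels XD.CMX m}"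
  define Y where "Y = (case n of 0 \<Rightarrow> {0} | Suc m \<Rightarrow> column_diff hoch m ` ?V m)"
  have lin: "fs.subspace (g ` W)" if "fs.subspace W" "\<And>u v. g (u + v) = g u + g v" "\<And>a u. g (fscale a u) = fscale a (g u)"
    for g :: "('i \<Rightarrow>\<^sub>0 'k) \<Rightarrow> ('j \<Rightarrow>\<^sub>0 'k)" and W
    by (rule module_hom.subspace_image[OF _ that(1)])
      (unfold_locales, simp_all add: that)
  have A: "fs.subspace ?A" by (rule lin[OF XK.fs_subspace_chains_CM CM_map_add CM_map_scale])
  have "CM_map \<pi> (0 :: 'x \<times> 'c list \<Rightarrow>\<^sub>0 'k) = 0"
    by (rule additive_map_0) (simp add: additive_map_def CM_map_add)
  then have "fs.subspace (?V m)" for m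
    by (intro fs.subspaceI)
      (auto simp: CM_map_add CM_map_scale intro: XD.cocyc.rels_0 XD.cocyc.rels_add XD.cocyc.rels_scale
        cocyc.chains_0 cocyc.chains_add cocyc.chains_scale)
  then have Y: "fs.subspace Y"
    by (cases n) (simp_all only: Y_def nat.case fs.subspace_single_0 lin column_diff_add column_diff_scale)
  have "v \<in> fspan (rels CMX n \<union> (?A \<union> Y))"
  proof (rule in_fspanI)
    fix F assume F: "\<And>r. r \<in> rels CMX n \<union> (?A \<union> Y) \<Longrightarrow> ev r F = 0"
    have eq: "(\<lambda>(x, cs). F (x, cs)) = F" by auto
    have "ev v (\<lambda>(x, cs). F (x, cs)) = 0"
    proof (rule column_functional[OF fpd v u])
      show "balanced (Suc n) (\<lambda>x cs. F (x, cs))" unfolding balanced_iff eq using F by blast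
      show "vanishes_on_K (Suc n) (\<lambda>x cs. F (x, cs))"
        unfolding vanishes_on_K_def
      proof (intro allI impI)
        fix x and cs :: "'c list" assume l: "length cs = Suc n" and k: "\<forall>c\<in>set cs. inK c"
        have "map \<iota> (map \<kappa> cs) = cs" using k by (auto simp: \<iota>_\<kappa> toK_id intro: map_idI)
        moreover have "CM_map \<iota> (gen (x, map \<kappa> cs)) \<in> ?A" using l by (intro imageI XK.gen_chains) simp
        ultimately have "gen (x, cs) \<in> ?A" by (simp add: CM_map_gen)
        then show "F (x, cs) = 0" using F[of "gen (x, cs)"] by simp
      qed
      fix m v' assume "n = Suc m" "v' \<in> chains CMX m" "CM_map \<pi> v' \<in> rels XD.CMX m"
      then have "column_diff hoch m v' \<in> Y" by (auto simp: Y_def)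
      then show "ev (column_diff hoch m v') (\<lambda>(x, cs). F (x, cs)) = 0" unfolding eq using F by blast
    qed
    then show "ev v F = 0" unfolding eq .
  qed
  also have "\<dots> = {r + (a + y) | r a y. r \<in> rels CMX n \<and> a \<in> ?A \<and> y \<in> Y}"
    unfolding fs.span_Un fs.span_eq_iff[THEN iffD2, OF A] fs.span_eq_iff[THEN iffD2, OF Y]
      fs.span_eq_iff[THEN iffD2, OF cocyc.subspace_rels] by blast
  finally obtain r l y where "r \<in> rels CMX n" "l \<in> chains XK.CMX n" "y \<in> Y" "v = r + (CM_map \<iota> l + y)" by blast
  then show ?thesis
    by (intro bexI[of _ l] exI[of _ y]) (auto simp: Y_def split: nat.splits)
qed

lemma cocyclic_sequence:
  assumes fpd: "finite_projective_dimension TYPE('p::ab_group_add) actX"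
  shows "cocyclic_sequence XK.CMX CMX XD.CMX (CM_map \<iota>) (CM_map \<pi>)"
proof (intro cocyclic_sequence.intro cocyclic_sequence_axioms.intro Iota.cocyclic_map Pi.cocyclic_map
    CM_map_\<iota>_inj CM_map_\<pi>_surj CM_map_\<pi>_\<iota>)
  fix v q u p
  assume v: "v \<in> chains CMX q" "CM_map \<pi> v \<in> rels XD.CMX q" and u: "u \<in> chains XK.CMX (Suc q)"
    and vu: "vert CMX p q v \<approx>\<^bsub>rels CMX (Suc q)\<^esub> CM_map \<iota> u"
  have am: "additive_map (CM_map f)" for f :: "'h \<Rightarrow> 'i" by (simp add: additive_map_def CM_map_add)
  show "\<exists>l\<in>chains XK.CMX q. \<exists>y. v - CM_map \<iota> l - y \<in> rels CMX q \<and>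
      (case q of 0 \<Rightarrow> y = 0 | Suc m \<Rightarrow> \<exists>v'\<in>chains CMX m. CM_map \<pi> v' \<in> rels XD.CMX m \<and> y = vert CMX p m v')"
  proof (cases "even p")
    case True
    have "column_diff True q v \<approx>\<^bsub>rels CMX (Suc q)\<^esub> CM_map \<iota> u" using vu True by (simp add: vert_def)
    from column_exact[OF fpd v u this] True show ?thesis
      by (simp add: vert_def cong: nat.case_cong)
  next
    \<comment> \<open>The odd columns carry the negative bar differential; the sign is moved to
      \<open>u\<close> and to the cochain whose coboundary is taken.\<close>
    case False
    have "column_diff False q v \<approx>\<^bsub>rels CMX (Suc q)\<^esub> CM_map \<iota> (- u)"
      using cocyc.rels_minus[OF vu] False by (simp add: vert_def additive_map_minus[OF am] add.commute)
    from column_exact[OF fpd v XK.cocyc.chains_minus[OF u] this]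
    obtain l y where l: "l \<in> chains XK.CMX q" "v - CM_map \<iota> l - y \<in> rels CMX q"
      and y: "case q of 0 \<Rightarrow> y = 0 | Suc m \<Rightarrow> \<exists>v'\<in>chains CMX m. CM_map \<pi> v' \<in> rels XD.CMX m \<and> y = column_diff False m v'"
      by blast
    have "case q of 0 \<Rightarrow> y = 0 | Suc m \<Rightarrow> \<exists>v'\<in>chains CMX m. CM_map \<pi> v' \<in> rels XD.CMX m \<and> y = vert CMX p m v'"
    proof (cases q)
      case (Suc m)
      then obtain v' where v': "v' \<in> chains CMX m" "CM_map \<pi> v' \<in> rels XD.CMX m" "y = bar_diff CMX m v'" using y by auto
      then have "- v' \<in> chains CMX m" "CM_map \<pi> (- v') \<in> rels XD.CMX m" "y = vert CMX p m (- v')"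
        using False by (simp_all add: vert_def cocyc.chains_minus additive_map_minus[OF am] XD.cocyc.rels_minus
          additive_map_minus[OF cocyc.additive_bar_diff])
      then show ?thesis using Suc by auto
    qed (use y in simp)
    then show ?thesis using l by blast
  qed
qed

end

text \<open>Preimages under \<open>f\<close> of the elements of a dual basis are chosen and extended
  by means of the coordinates.\<close>

lemma projective_split:
  fixes act :: "'b::ring_1 \<Rightarrow> 'q::ab_group_add \<Rightarrow> 'q" and act' :: "'b \<Rightarrow> 'p::ab_group_add \<Rightarrow> 'p"
  assumes P: "projective_on UNIV act'" and Q: "ring_module_on UNIV act"
    and f: "module_hom_on UNIV act UNIV act' f" and surj: "surj f"
  obtains s where "module_hom_on UNIV act' UNIV act s" "\<And>p. f (s p) = p"
proof -
  obtain i :: "'p \<Rightarrow> ('p \<Rightarrow>\<^sub>0 'b)" and r :: "'p \<Rightarrow> 'p"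
    where i: "module_hom_on UNIV act' UNIV fscale i"
    and ir: "\<And>p. (\<Sum>e\<in>Poly_Mapping.keys (i p). act' (Poly_Mapping.lookup (i p) e) (r e)) = p"
    by (rule projective_onE[OF P], rule that) simp_all
  let ?s = "\<lambda>p. \<Sum>e\<in>Poly_Mapping.keys (i p). act (Poly_Mapping.lookup (i p) e) (inv f (r e))"
  show thesis
  proof (rule that[of ?s])
    show "module_hom_on UNIV act' UNIV act ?s" by (rule projective_extend[OF P Q i]) simp
    show "f (?s p) = p" for p
      by (subst module_hom_on_sum[OF f Q]) (simp_all add: module_hom_onD(3)[OF f] surj_f_inv_f[OF surj] ir)
  qed
qed

lemma (in alg_module) ring_module_on_UNIV: "ring_module_on UNIV act"
  unfolding ring_module_on_def
  by (simp add: act_add_right act_add_left act_mult act_one)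

lemma module_coalgebra_homD:
  assumes "module_coalgebra_hom sC actC \<Delta>C sD actD \<Delta>D f"
  shows "f (c + c') = f c + f c'" "f (sC a c) = sD a (f c)" "f (actC b c) = actD b (f c)"
    and "bilin sD sD G \<Longrightarrow> ev (\<Delta>C c) (\<lambda>(c1, c2). G (f c1) (f c2)) = ev (\<Delta>D (f c)) (\<lambda>(d1, d2). G d1 d2)"
proof -
  interpret l: Vector_Spaces.linear sC sD f using assms by (simp add: module_coalgebra_hom_def)
  show "f (c + c') = f c + f c'" by (rule l.add)
  show "f (sC a c) = sD a (f c)" by (rule l.scale)
  show "f (actC b c) = actD b (f c)" using assms by (simp add: module_coalgebra_hom_def)
  assume G: "bilin sD sD G"
  have "(\<Delta>C c \<bind> (\<lambda>(c1, c2). gen (f c1, f c2))) \<approx>\<^bsub>tensor2 sD sD\<^esub> \<Delta>D (f c)"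
    using assms by (simp add: module_coalgebra_hom_def)
  from tensor2_ev[OF this G]
  show "ev (\<Delta>C c) (\<lambda>(c1, c2). G (f c1) (f c2)) = ev (\<Delta>D (f c)) (\<lambda>(d1, d2). G d1 d2)"
    by (simp add: ev_bind case_prod_unfold)
qed

theorem theorem4p11:
  fixes sB :: "'k::field \<Rightarrow> 'b::ring_1 \<Rightarrow> 'b"
    and \<Delta>B :: "'b \<Rightarrow> ('b \<times> 'b \<Rightarrow>\<^sub>0 'k)" and \<epsilon> :: "'b \<Rightarrow> 'k" and S :: "'b \<Rightarrow> 'b"
    and sX :: "'k \<Rightarrow> 'x::ab_group_add \<Rightarrow> 'x"
    and actX :: "'b \<Rightarrow> 'x \<Rightarrow> 'x" and \<rho> :: "'x \<Rightarrow> ('b \<times> 'x \<Rightarrow>\<^sub>0 'k)"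
    and sK :: "'k \<Rightarrow> 'l::ab_group_add \<Rightarrow> 'l"
    and actK :: "'b \<Rightarrow> 'l \<Rightarrow> 'l" and \<Delta>K :: "'l \<Rightarrow> ('l \<times> 'l \<Rightarrow>\<^sub>0 'k)"
    and sC :: "'k \<Rightarrow> 'c::ab_group_add \<Rightarrow> 'c"
    and actC :: "'b \<Rightarrow> 'c \<Rightarrow> 'c" and \<Delta>C :: "'c \<Rightarrow> ('c \<times> 'c \<Rightarrow>\<^sub>0 'k)"
    and sD :: "'k \<Rightarrow> 'd::ab_group_add \<Rightarrow> 'd"
    and actD :: "'b \<Rightarrow> 'd \<Rightarrow> 'd" and \<Delta>D :: "'d \<Rightarrow> ('d \<times> 'd \<Rightarrow>\<^sub>0 'k)"
    and \<iota> :: "'l \<Rightarrow> 'c" and \<pi> :: "'c \<Rightarrow> 'd"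
  assumes "hopf_algebra sB \<Delta>B \<epsilon> S"
    and "bij S"
    and "sayd_module sB \<Delta>B \<epsilon> S sX actX \<rho>"
    and "module_coalgebra sB \<Delta>B \<epsilon> S sC actC \<Delta>C"
    and "counital sC \<Delta>C"
    and "module_coalgebra sB \<Delta>B \<epsilon> S sK actK \<Delta>K"
    and "module_coalgebra sB \<Delta>B \<epsilon> S sD actD \<Delta>D"
    and "short_exact_module_coalgebras sK actK \<Delta>K sC actC \<Delta>C sD actD \<Delta>D \<iota> \<pi>"
    and "H_counital sK \<Delta>K" and "H_counital sC \<Delta>C" and "H_counital sD \<Delta>D"
    and "projective_on UNIV actC"
    and "projective_on UNIV actD"
    and "finite_projective_dimension TYPE('p::ab_group_add) actX"
  shows "homotopy_cofibration
      (CM \<Delta>B \<epsilon> sK actK \<Delta>K sX actX \<rho>)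
      (CM \<Delta>B \<epsilon> sC actC \<Delta>C sX actX \<rho>)
      (CM \<Delta>B \<epsilon> sD actD \<Delta>D sX actX \<rho>)
      (CM_map \<iota>) (CM_map \<pi>)"
proof -
  interpret B: hopf_algebra sB \<Delta>B \<epsilon> S by fact
  interpret X: sayd_module sB \<Delta>B \<epsilon> S sX actX \<rho> by fact
  interpret C: module_coalgebra sB \<Delta>B \<epsilon> S sC actC \<Delta>C by fact
  interpret K: module_coalgebra sB \<Delta>B \<epsilon> S sK actK \<Delta>K by fact
  interpret D: module_coalgebra sB \<Delta>B \<epsilon> S sD actD \<Delta>D by fact
  note ex = \<open>short_exact_module_coalgebras sK actK \<Delta>K sC actC \<Delta>C sD actD \<Delta>D \<iota> \<pi>\<close>[unfolded short_exact_module_coalgebras_def]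
  have hom_\<iota>: "module_coalgebra_hom sK actK \<Delta>K sC actC \<Delta>C \<iota>" and hom_\<pi>: "module_coalgebra_hom sC actC \<Delta>C sD actD \<Delta>D \<pi>"
    and inj: "inj \<iota>" and range: "range \<iota> = {c. \<pi> c = 0}" and surj: "surj \<pi>"
    using ex by simp_all
  note \<iota> = module_coalgebra_homD[OF hom_\<iota>] and \<pi> = module_coalgebra_homD[OF hom_\<pi>]
  have "module_hom_on UNIV actC UNIV actD \<pi>" by (simp add: module_hom_on_def \<pi>)
  then obtain \<sigma> where \<sigma>: "module_hom_on UNIV actD UNIV actC \<sigma>" and \<pi>\<sigma>: "\<And>d. \<pi> (\<sigma> d) = d"
    using projective_split[OF \<open>projective_on UNIV actD\<close> C.ring_module_on_UNIV _ surj] by blast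
  \<comment> \<open>The field acts through B, so that maps linear over B are linear over the field
    as well.\<close>
  have scale: "sC a c = actC (sB a 1) c" "sD a d = actD (sB a 1) d" for a c d
    by (simp_all add: C.act_scale_left C.act_one D.act_scale_left D.act_one)
  interpret excision_sequence sB \<Delta>B \<epsilon> S sX actX \<rho> sK actK \<Delta>K sC actC \<Delta>C sD actD \<Delta>D \<iota> \<pi> \<sigma>
  proof unfold_locales
    fix G c assume G: "bilin sC sC G" and c: "\<pi> c = 0" and v: "\<And>c1 c2. \<pi> c1 = 0 \<Longrightarrow> \<pi> c2 = 0 \<Longrightarrow> G c1 c2 = 0"
    obtain k where k: "c = \<iota> k" using c range by blast
    have "\<pi> (\<iota> k) = 0" for k using range by blast
    then show "ev (\<Delta>C c) (\<lambda>(c1, c2). G c1 c2) = 0"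
      unfolding k \<iota>(4)[OF G, symmetric] using v by (simp add: case_prod_unfold)
  next
    show "\<sigma> (sD a d) = sC a (\<sigma> d)" for a d
      using module_hom_onD(3)[OF \<sigma>, of d "sB a 1"] by (simp add: scale)
  qed (use assms \<iota>(1-3) \<pi>(1-3) \<pi>\<sigma> module_hom_onD(2,3)[OF \<sigma>] inj range in \<open>simp_all add: \<iota>(4) \<pi>(4)\<close>)
  interpret cocyclic_sequence "CM \<Delta>B \<epsilon> sK actK \<Delta>K sX actX \<rho>" "CM \<Delta>B \<epsilon> sC actC \<Delta>C sX actX \<rho>"
    "CM \<Delta>B \<epsilon> sD actD \<Delta>D sX actX \<rho>" "CM_map \<iota>" "CM_map \<pi>"
    by (rule cocyclic_sequence) fact
  show ?thesis by (rule homotopy_cofibration)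
qed

end
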